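(* Let $\mathfrak{o}$ be a compact discrete valuation ring with finite residue field of characteristic $2$, and let $\ell\ge 1$ be an integer with $2\ell\ge \mathbf{R}_{\mathfrak{o}}$, where $\mathbf{R}_{\mathfrak{o}}=4e$ if $\mathrm{char}(\mathfrak{o})=0$ with ramification index $e$, and $\mathbf{R}_{\mathfrak{o}}=2$ if $\mathrm{char}(\mathfrak{o})=2$. Put $r=2\ell$. Let $A=\begin{bmatrix}0&a^{-1}\alpha\\ a&\beta\end{bmatrix}\in M_2(\mathfrak{o}_\ell)$ with $a\in\mathfrak{o}_\ell^\times$ be a cyclic matrix, and let $\mathbb{M}_A=C_{\mathrm{SL}_2(\mathfrak{o}_{2\ell})}(\psi_A)\,\mathbb{E}_{\tilde A}$. Then $\mathbb{M}_A$ is a group and: 1. The one-dimensional representation $\psi_{[A]}$ of $K^\ell$ extends to $\mathbb{M}_A$. 2. The group $\mathbb{M}_A/K^\ell$ is either abelian or a semidirect product of an abelian group with a group of order two. Hence every $\rho\in\mathrm{Irr}(\mathbb{M}_A\mid\psi_{[A]})$ has dimension one or two. 3. The map $\rho\mapsto \mathrm{Ind}_{\mathbb{M}_A}^{\mathrm{SL}_2(\mathfrak{o}_{2\ell})}(\rho)$ induces a bijection from the set of orbits of $\mathrm{Irr}(\mathbb{M}_A\mid\psi_{[A]})$ under the conjugation action of $C_{\mathrm{SL}_2(\mathfrak{o}_{2\ell})}(\psi_{[A]})$ onto $\mathrm{Irr}(\mathrm{SL}_2(\mathfrak{o}_{2\ell})\mid\psi_{[A]})$.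
   Context: Notation: $\pi$ is a uniformizer of $\mathfrak{o}$, $\mathfrak{p}=\pi\mathfrak{o}$, $\mathfrak{o}_m=\mathfrak{o}/\mathfrak{p}^m$; if $\mathrm{char}(\mathfrak{o})=0$, the ramification index $e$ is defined by $2\mathfrak{o}=\pi^e\mathfrak{o}$. Here $r=2\ell$. $M^\ell=\ker(\mathrm{GL}_2(\mathfrak{o}_r)\to\mathrm{GL}_2(\mathfrak{o}_\ell))$ and $K^\ell=M^\ell\cap\mathrm{SL}_2(\mathfrak{o}_r)$. Fix an additive character $\psi:\mathfrak{o}_r\to\mathbb{C}^\times$ with $\psi(\pi^{r-1})\ne1$; when $\mathrm{char}(\mathfrak{o})=2$, so that each $v\in\mathfrak{o}_r$ is uniquely $v=\sum_{i=0}^{r-1}(v)_i\pi^i$ with $(v)_i\in\mathbb{F}_q=\mathfrak{o}/\mathfrak{p}$, $\psi$ is taken of the form $\psi(v)=\boldsymbol{\psi}((v)_{r-1})$ for a fixed additive character $\boldsymbol\psi$ of $\mathbb{F}_q$ with $\boldsymbol\psi(1)\neq 1$. A matrix $A\in M_2(\mathfrak{o}_m)$ is cyclic if some $v$ makes $\{v,Av\}$ an $\mathfrak{o}_m$-basis of $\mathfrak{o}_m^2$; every cyclic matrix is $\mathrm{SL}_2(\mathfrak{o}_m)$-conjugate to one of the displayed form (with $a$ a unit), and every matrix of that form is cyclic. Fix a lift $\tilde A=\begin{bmatrix}0&\tilde a^{-1}\tilde\alpha\\ \tilde a&\tilde\beta\end{bmatrix}\in M_2(\mathfrak{o}_r)$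 of $A$, where $\tilde a,\tilde\alpha,\tilde\beta$ lift $a,\alpha,\beta$. $\psi_A$ is the character $I+\pi^\ell B\mapsto\psi(\pi^\ell\,\mathrm{trace}(\tilde A B))$ of $M^\ell$, and $\psi_{[A]}=\psi_A|_{K^\ell}$. For a group $G$ acting by conjugation on the representations of a normal (or normalized) subgroup, $C_G(\phi)=\{g\in G\mid\phi^g\cong\phi\}$. For $H\le G$ and $\phi\in\mathrm{Irr}(H)$, $\mathrm{Irr}(G\mid\phi)$ is the set of irreducible representations $\rho$ of $G$ (up to equivalence) with $\langle\rho|_H,\phi\rangle\ne0$. Set $C_S^\ell(\tilde A)=\big(C_{\mathrm{GL}_2(\mathfrak{o}_r)}(\tilde A)M^\ell\big)\cap\mathrm{SL}_2(\mathfrak{o}_r)$, $\mathrm{h}^\ell_{\tilde A}=\{x\in\mathfrak{o}_r\mid 2x=0 \bmod \pi^\ell,\ x(x+\tilde\beta)=0\bmod\pi^\ell\}$, $e_\lambda=\begin{bmatrix}1&\tilde a^{-1}\lambda\\0&1\end{bmatrix}$ for $\lambda\in\mathfrak{o}_r$, $\mathrm{H}^\ell_{\tilde A}=\{e_x\mid x\in\mathrm{h}^\ell_{\tilde A}\}$ (an abelian group), and $\mathbb{E}_{\tilde A}=\{e_\lambda\in\mathrm{H}^\ell_{\tilde A}\mid \psi_{[A]}\text{ extends to a one-dimensional representation of } C_S^\ell(\tilde A)\langle e_\lambda\rangle\}$. *)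

theory Defs
  imports
    "HOL-Analysis.Determinants"
    "HOL-Analysis.Abstract_Topology"
    "HOL-Algebra.Generated_Groups"
    "Jordan_Normal_Form.VS_Connect"
begin

text \<open>
  Matrices over the ring are of type \<open>'r^2^2\<close> (\<open>HOL-Analysis\<close>); representations take values in the
  dimension-indexed matrices \<open>complex mat\<close> of \<open>Jordan_Normal_Form\<close>.
\<close>

hide_const (open) Matrix.vec Matrix.mat Matrix.row Determinant.det
no_notation Matrix.vec_index (infixl "$" 100)
no_notation Matrix.scalar_prod (infix "\<bullet>" 70)

section \<open>Compact discrete valuation rings and their quotients\<close>

definition dvr_uniformizer :: "'o::idom \<Rightarrow> bool" where
  "dvr_uniformizer \<pi> \<longleftrightarrow> \<pi> \<noteq> 0 \<and> \<not> \<pi> dvd 1 \<and>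
     (\<forall>x. x \<noteq> 0 \<longrightarrow> (\<exists>n u. u dvd 1 \<and> x = u * \<pi> ^ n))"

definition adic_topology :: "'o::comm_ring_1 \<Rightarrow> 'o topology" where
  "adic_topology \<pi> = topology_generated_by {{y. \<pi> ^ n dvd y - x} | n x. True}"

definition finite_residue_ring :: "'o::comm_ring_1 \<Rightarrow> bool" where
  "finite_residue_ring \<pi> \<longleftrightarrow> finite (UNIV // {(x, y). \<pi> dvd x - y})"

definition ramification_index :: "'o::comm_ring_1 \<Rightarrow> nat" where
  "ramification_index \<pi> = (THE e. range ((*) 2) = range ((*) (\<pi> ^ e)))"

definition R_o :: "'o::comm_ring_1 \<Rightarrow> nat" where
  "R_o \<pi> = (if CHAR('o) = 0 then 4 * ramification_index \<pi> else 2)"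

text \<open>
  A quotient ring cannot be a type depending on \<open>m\<close>, so \<open>\<oo>/\<pi>\<^sup>m\<oo>\<close> is presented as a
  type \<open>'r\<close> together with a surjective ring homomorphism \<open>\<oo> \<rightarrow> 'r\<close> with kernel \<open>\<pi>\<^sup>m\<oo>\<close>.
\<close>
definition quotient_map_mod :: "'o::comm_ring_1 \<Rightarrow> nat \<Rightarrow> ('o \<Rightarrow> 'r::comm_ring_1) \<Rightarrow> bool" where
  "quotient_map_mod \<pi> m q \<longleftrightarrow> comm_ring_hom q \<and> surj q \<and> (\<forall>x. q x = 0 \<longleftrightarrow> \<pi> ^ m dvd x)"

definition unit_inverse :: "'r::comm_ring_1 \<Rightarrow> 'r" where
  "unit_inverse a = (THE b. a * b = 1)"

section \<open>The additive character\<close>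

definition additive_character :: "'r::ab_group_add set \<Rightarrow> ('r \<Rightarrow> complex) \<Rightarrow> bool" where
  "additive_character F \<psi> \<longleftrightarrow> \<psi> 0 = 1 \<and> (\<forall>x\<in>F. \<forall>y\<in>F. \<psi> (x + y) = \<psi> x * \<psi> y)"

text \<open>
  A copy in \<open>\<oo>/\<pi>\<^sup>r\<oo>\<close> of the residue field; in characteristic 2 it exists and is unique,
  since \<open>\<oo>\<close> is a power series ring over its (finite, hence perfect) residue field.
\<close>
definition coefficient_field :: "'r::comm_ring_1 \<Rightarrow> 'r set \<Rightarrow> bool" where
  "coefficient_field p F \<longleftrightarrow> 1 \<in> F \<and> (\<forall>x\<in>F. \<forall>y\<in>F. x - y \<in> F \<and> x * y \<in> F) \<and>
     (\<forall>x. \<exists>!c. c \<in> F \<and> p dvd x - c)"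

definition top_digit_character :: "nat \<Rightarrow> 'r::comm_ring_1 \<Rightarrow> ('r \<Rightarrow> complex) \<Rightarrow> bool" where
  "top_digit_character r p \<psi> \<longleftrightarrow>
     (\<exists>F \<psi>0. coefficient_field p F \<and> additive_character F \<psi>0 \<and> \<psi>0 1 \<noteq> 1 \<and>
       (\<forall>c. (\<forall>i<r. c i \<in> F) \<longrightarrow> \<psi> (\<Sum>i<r. c i * p ^ i) = \<psi>0 (c (r - 1))))"

section \<open>Complex matrix representations\<close>

text \<open>Subgroups \<open>H\<close> of \<open>G\<close> are sets; \<open>G\<lparr>carrier := H\<rparr>\<close> is \<open>H\<close> viewed as a group.\<close>

definition rep_degree :: "('g, 'm) monoid_scheme \<Rightarrow> ('g \<Rightarrow> complex mat) \<Rightarrow> nat" where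
  "rep_degree G \<rho> = dim_row (\<rho> \<one>\<^bsub>G\<^esub>)"

definition is_rep :: "('g, 'm) monoid_scheme \<Rightarrow> ('g \<Rightarrow> complex mat) \<Rightarrow> bool" where
  "is_rep G \<rho> \<longleftrightarrow>
     (\<forall>g\<in>carrier G. \<rho> g \<in> carrier_mat (rep_degree G \<rho>) (rep_degree G \<rho>)) \<and>
     \<rho> \<one>\<^bsub>G\<^esub> = 1\<^sub>m (rep_degree G \<rho>) \<and>
     (\<forall>g\<in>carrier G. \<forall>h\<in>carrier G. \<rho> (g \<otimes>\<^bsub>G\<^esub> h) = \<rho> g * \<rho> h)"

definition rep_equiv ::
  "('g, 'm) monoid_scheme \<Rightarrow> ('g \<Rightarrow> complex mat) \<Rightarrow> ('g \<Rightarrow> complex mat) \<Rightarrow> bool" where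
  "rep_equiv G \<rho> \<sigma> \<longleftrightarrow> is_rep G \<rho> \<and> is_rep G \<sigma> \<and> rep_degree G \<rho> = rep_degree G \<sigma> \<and>
     (\<exists>P \<in> carrier_mat (rep_degree G \<rho>) (rep_degree G \<rho>). invertible_mat P \<and>
        (\<forall>g\<in>carrier G. P * \<rho> g = \<sigma> g * P))"

definition irreducible_rep :: "('g, 'm) monoid_scheme \<Rightarrow> ('g \<Rightarrow> complex mat) \<Rightarrow> bool" where
  "irreducible_rep G \<rho> \<longleftrightarrow> is_rep G \<rho> \<and> rep_degree G \<rho> > 0 \<and>
     (\<forall>W. VectorSpace.subspace class_ring W (module_vec TYPE(complex) (rep_degree G \<rho>)) \<and>
          (\<forall>g\<in>carrier G. \<forall>w\<in>W. \<rho> g *\<^sub>v w \<in> W) \<longrightarrow>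
        W = {0\<^sub>v (rep_degree G \<rho>)} \<or> W = carrier_vec (rep_degree G \<rho>))"

text \<open>A complex-valued function as a family of \<open>1 \<times> 1\<close> matrices.\<close>
definition lin_rep :: "('g \<Rightarrow> complex) \<Rightarrow> 'g \<Rightarrow> complex mat" where
  "lin_rep f g = Matrix.mat 1 1 (\<lambda>_. f g)"

definition extends_one_dim ::
  "('g, 'm) monoid_scheme \<Rightarrow> 'g set \<Rightarrow> 'g set \<Rightarrow> ('g \<Rightarrow> complex mat) \<Rightarrow> bool" where
  "extends_one_dim G K H \<phi> \<longleftrightarrow>
     (\<exists>\<rho>. is_rep (G\<lparr>carrier := H\<rparr>) \<rho> \<and> rep_degree (G\<lparr>carrier := H\<rparr>) \<rho> = 1 \<and>
        (\<forall>k\<in>K. \<rho> k = \<phi> k))"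

definition rep_character :: "('g, 'm) monoid_scheme \<Rightarrow> ('g \<Rightarrow> complex mat) \<Rightarrow> 'g \<Rightarrow> complex" where
  "rep_character G \<rho> g = (\<Sum>i<rep_degree G \<rho>. \<rho> g $$ (i, i))"

definition rep_inner ::
  "('g, 'm) monoid_scheme \<Rightarrow> ('g \<Rightarrow> complex mat) \<Rightarrow> ('g \<Rightarrow> complex mat) \<Rightarrow> complex" where
  "rep_inner G \<rho> \<phi> =
     (\<Sum>g\<in>carrier G. rep_character G \<rho> g * cnj (rep_character G \<phi> g)) / of_nat (card (carrier G))"

text \<open>Elements of \<open>Irr G\<close> are whole equivalence classes of irreducible representations.\<close>
definition Irr :: "('g, 'm) monoid_scheme \<Rightarrow> ('g \<Rightarrow> complex mat) set set" where
  "Irr G = {\<rho>. irreducible_rep G \<rho>} // {(\<rho>, \<sigma>). rep_equiv G \<rho> \<sigma>}"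

definition Irr_over ::
  "('g, 'm) monoid_scheme \<Rightarrow> 'g set \<Rightarrow> ('g \<Rightarrow> complex mat) \<Rightarrow> ('g \<Rightarrow> complex mat) set set" where
  "Irr_over G H \<phi> = {c \<in> Irr G. \<exists>\<rho>\<in>c. rep_inner (G\<lparr>carrier := H\<rparr>) \<rho> \<phi> \<noteq> 0}"

definition conj_rep ::
  "('g, 'm) monoid_scheme \<Rightarrow> 'g \<Rightarrow> ('g \<Rightarrow> complex mat) \<Rightarrow> 'g \<Rightarrow> complex mat" where
  "conj_rep G g \<rho> x = \<rho> (g \<otimes>\<^bsub>G\<^esub> x \<otimes>\<^bsub>G\<^esub> inv\<^bsub>G\<^esub> g)"

definition rep_stabilizer ::
  "('g, 'm) monoid_scheme \<Rightarrow> 'g set \<Rightarrow> 'g set \<Rightarrow> ('g \<Rightarrow> complex mat) \<Rightarrow> 'g set" where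
  "rep_stabilizer G S N \<phi> = {g \<in> S. rep_equiv (G\<lparr>carrier := N\<rparr>) (conj_rep G g \<phi>) \<phi>}"

definition conj_orbits ::
  "('g, 'm) monoid_scheme \<Rightarrow> 'g set \<Rightarrow> ('g \<Rightarrow> complex mat) set set
     \<Rightarrow> ('g \<Rightarrow> complex mat) set set set" where
  "conj_orbits G C X = X // {(c, d). c \<in> X \<and> d \<in> X \<and> (\<exists>g\<in>C. \<exists>\<rho>\<in>c. conj_rep G g \<rho> \<in> d)}"

definition left_transversal :: "('g, 'm) monoid_scheme \<Rightarrow> 'g set \<Rightarrow> 'g list \<Rightarrow> bool" where
  "left_transversal G H ts \<longleftrightarrow> set ts \<subseteq> carrier G \<and>
     (\<forall>g\<in>carrier G. \<exists>!i. i < length ts \<and> inv\<^bsub>G\<^esub> (ts ! i) \<otimes>\<^bsub>G\<^esub> g \<in> H)"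

text \<open>
  The induced representation as a block matrix: for coset representatives \<open>t\<^sub>0, t\<^sub>1, \<dots>\<close> of \<open>G/H\<close>,
  the block of \<open>Ind \<rho> g\<close> in position \<open>(a, b)\<close> is \<open>\<rho> (t\<^sub>a\<inverse> g t\<^sub>b)\<close> if \<open>t\<^sub>a\<inverse> g t\<^sub>b \<in> H\<close> and
  \<open>0\<close> otherwise. Another choice of representatives gives an equivalent representation.
\<close>
definition Ind ::
  "('g, 'm) monoid_scheme \<Rightarrow> 'g set \<Rightarrow> ('g \<Rightarrow> complex mat) \<Rightarrow> 'g \<Rightarrow> complex mat" where
  "Ind G H \<rho> g =
     (let ts = (SOME ts. left_transversal G H ts);
          n = rep_degree (G\<lparr>carrier := H\<rparr>) \<rho>
      in Matrix.mat (length ts * n) (length ts * n)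
           (\<lambda>(i, j). let h = inv\<^bsub>G\<^esub> (ts ! (i div n)) \<otimes>\<^bsub>G\<^esub> g \<otimes>\<^bsub>G\<^esub> (ts ! (j div n))
                    in if h \<in> H then \<rho> h $$ (i mod n, j mod n) else 0))"

text \<open>
  Induction on a set \<open>Q\<close> of equivalence classes of representations of \<open>H\<close>. The value is a single
  equivalence class precisely if all members of all classes in \<open>Q\<close> have equivalent inductions, so
  that a value in \<open>Irr G\<close> includes well-definedness on \<open>Q\<close>.
\<close>
definition Ind_orbit ::
  "('g, 'm) monoid_scheme \<Rightarrow> 'g set \<Rightarrow> ('g \<Rightarrow> complex mat) set set \<Rightarrow> ('g \<Rightarrow> complex mat) set" where
  "Ind_orbit G H Q = {\<sigma>. \<exists>c\<in>Q. \<exists>\<rho>\<in>c. rep_equiv G (Ind G H \<rho>) \<sigma>}"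

definition abelian_semidirect_order_two :: "('g, 'm) monoid_scheme \<Rightarrow> bool" where
  "abelian_semidirect_order_two G \<longleftrightarrow>
     (\<exists>N T. N \<lhd> G \<and> comm_group (G\<lparr>carrier := N\<rparr>) \<and> subgroup T G \<and> card T = 2 \<and>
        N \<inter> T = {\<one>\<^bsub>G\<^esub>} \<and> N <#>\<^bsub>G\<^esub> T = carrier G)"

section \<open>Groups of two by two matrices\<close>

definition mat2 :: "'r::zero \<Rightarrow> 'r \<Rightarrow> 'r \<Rightarrow> 'r \<Rightarrow> 'r^2^2" where
  "mat2 a b c d = vector [vector [a, b], vector [c, d]]"

definition cyclic_matrix :: "'r::comm_ring_1^2^2 \<Rightarrow> bool" where
  "cyclic_matrix A \<longleftrightarrow> (\<exists>v. \<forall>w. \<exists>!(c, d). w = c *s v + d *s (A *v v))"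

definition GL2 :: "('r::comm_ring_1^2^2) monoid" where
  "GL2 = \<lparr>carrier = {g. invertible g}, monoid.mult = (**), one = mat 1\<rparr>"

definition SL2 :: "('r::comm_ring_1^2^2) monoid" where
  "SL2 = GL2\<lparr>carrier := {g \<in> carrier GL2. det g = 1}\<rparr>"

definition M_grp :: "('r::comm_ring_1 \<Rightarrow> 'l::comm_ring_1) \<Rightarrow> ('r^2^2) set" where
  "M_grp red = kernel GL2 GL2 (\<lambda>g. \<chi> i j. red (g $ i $ j))"

definition K_grp :: "('r::comm_ring_1 \<Rightarrow> 'l::comm_ring_1) \<Rightarrow> ('r^2^2) set" where
  "K_grp red = M_grp red \<inter> carrier SL2"

text \<open>
  This is \<open>I + \<pi>\<^sup>\<ell>B \<mapsto> \<psi>(\<pi>\<^sup>\<ell> trace(\<tilde>AB))\<close>, written without choosing \<open>B\<close>; see \<open>psi_A_eq\<close>.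
\<close>
definition psi_A :: "('r::comm_ring_1 \<Rightarrow> complex) \<Rightarrow> 'r^2^2 \<Rightarrow> 'r^2^2 \<Rightarrow> complex" where
  "psi_A \<psi> At g = \<psi> (trace (At ** (g - mat 1)))"

lemma psi_A_eq: "psi_A \<psi> At (mat 1 + (\<chi> i j. c * B $ i $ j)) = \<psi> (c * trace (At ** B))"
  by (simp add: psi_A_def trace_def matrix_matrix_mult_def sum_2 algebra_simps)

section \<open>The group \<open>M\<^sub>A\<close>\<close>

text \<open>
  Below \<open>p\<close> is the image of the uniformizer in \<open>\<oo>/\<pi>\<^sup>r\<oo>\<close>, \<open>red\<close> is the reduction map
  \<open>\<oo>/\<pi>\<^sup>r\<oo> \<rightarrow> \<oo>/\<pi>\<^sup>\<ell>\<oo>\<close>, and \<open>a, \<alpha>, \<beta>\<close> are elements of \<open>\<oo>/\<pi>\<^sup>r\<oo>\<close>.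
\<close>

definition comp_mat :: "'r::comm_ring_1 \<Rightarrow> 'r \<Rightarrow> 'r \<Rightarrow> 'r^2^2" where
  "comp_mat a \<alpha> \<beta> = mat2 0 (unit_inverse a * \<alpha>) a \<beta>"

definition C_S :: "('r::comm_ring_1 \<Rightarrow> 'l::comm_ring_1) \<Rightarrow> 'r^2^2 \<Rightarrow> ('r^2^2) set" where
  "C_S red At =
     ({g \<in> carrier GL2. g ** At = At ** g} <#>\<^bsub>GL2\<^esub> M_grp red) \<inter> carrier SL2"

definition h_set :: "'r::comm_ring_1 \<Rightarrow> nat \<Rightarrow> 'r \<Rightarrow> 'r set" where
  "h_set p l \<beta> = {x. p ^ l dvd 2 * x \<and> p ^ l dvd x * (x + \<beta>)}"

definition e_mat :: "'r::comm_ring_1 \<Rightarrow> 'r \<Rightarrow> 'r^2^2" where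
  "e_mat a x = mat2 1 (unit_inverse a * x) 0 1"

definition H_grp :: "'r::comm_ring_1 \<Rightarrow> nat \<Rightarrow> 'r \<Rightarrow> 'r \<Rightarrow> ('r^2^2) set" where
  "H_grp p l a \<beta> = e_mat a ` h_set p l \<beta>"

definition E_set ::
  "'r::comm_ring_1 \<Rightarrow> nat \<Rightarrow> ('r \<Rightarrow> 'l::comm_ring_1) \<Rightarrow> ('r \<Rightarrow> complex) \<Rightarrow> 'r \<Rightarrow> 'r \<Rightarrow> 'r
     \<Rightarrow> ('r^2^2) set" where
  "E_set p l red \<psi> a \<alpha> \<beta> =
     {g \<in> H_grp p l a \<beta>.
        extends_one_dim SL2 (K_grp red)
          (C_S red (comp_mat a \<alpha> \<beta>) <#>\<^bsub>SL2\<^esub> generate SL2 {g})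
          (lin_rep (psi_A \<psi> (comp_mat a \<alpha> \<beta>)))}"

definition M_A ::
  "'r::comm_ring_1 \<Rightarrow> nat \<Rightarrow> ('r \<Rightarrow> 'l::comm_ring_1) \<Rightarrow> ('r \<Rightarrow> complex) \<Rightarrow> 'r \<Rightarrow> 'r \<Rightarrow> 'r
     \<Rightarrow> ('r^2^2) set" where
  "M_A p l red \<psi> a \<alpha> \<beta> =
     rep_stabilizer GL2 (carrier SL2) (M_grp red) (lin_rep (psi_A \<psi> (comp_mat a \<alpha> \<beta>)))
       <#>\<^bsub>SL2\<^esub> E_set p l red \<psi> a \<alpha> \<beta>"

end

theory Submission
  imports Defs "Jordan_Normal_Form.Spectral_Radius" "HOL-Algebra.Multiplicative_Group"
begin

text \<open>
  Write \<open>S\<close> for the stabilizer of \<open>\<psi>\<^sub>A\<close> in \<open>SL\<^sub>2\<close> and \<open>C\<close> for that of its restriction to \<open>K\<close>.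
  Commutators of elements of \<open>S\<close> lie in \<open>K\<close> and are killed by \<open>\<psi>\<^sub>A\<close>, so the character of \<open>K\<close>
  extends to \<open>S\<close>, and \<open>C\<close> is the product of \<open>S\<close> with the transvections \<open>e\<^sub>\<zeta>\<close>, \<open>\<zeta> \<in> h\<close>, which have
  order at most two modulo \<open>K\<close>. Extendibility to \<open>S\<langle>e\<^sub>\<zeta>\<rangle>\<close> means that some extension to \<open>S\<close> is
  \<open>e\<^sub>\<zeta>\<close>-invariant, and then \<open>\<psi>\<^sub>A\<close> is trivial on every commutator of \<open>e\<^sub>\<zeta>\<close> with \<open>S\<close> that lies
  in \<open>K\<close>. Evaluating these commutators gives a dichotomy: either all such \<open>e\<^sub>\<zeta>\<close> commute with
  \<open>S\<close> modulo \<open>K\<close>, or they form at most one nontrivial class modulo \<open>K\<close>. In the first case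
  \<open>M\<^sub>A/K\<close> is abelian, in the second \<open>S/K\<close> has index at most two in it.

  The stabilizer in \<open>C\<close> of any extension to \<open>S\<close> is contained in \<open>M\<^sub>A\<close>. This makes induction from
  \<open>M\<^sub>A\<close> preserve irreducibility, and two induced representations are equivalent exactly if the
  inducing ones are \<open>C\<close>-conjugate.
\<close>

hide_const (open) Matrix.vec Matrix.mat Matrix.row Determinant.det
no_notation Matrix.vec_index (infixl "$" 100)
no_notation Matrix.scalar_prod (infix "\<bullet>" 70)

notation Matrix.vec_index (infixl "$v" 100)

section \<open>Linear algebra over the complex numbers\<close>

text \<open>The obstacle is closure under products: two elements of the extendibility set may fix
  different extensions of \<open>psi_A\<close>, and no general principle makes one extension serve
  for both. So the group law of \<open>M_A\<close> is a matter of arithmetic. Elements of S with x =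
  1 + p^n t make the value of \<open>psi_A\<close> on a commutator a linear plus a quadratic
  expression in t. Unless the leading valuations are exceptional, t can be chosen so that the
  quadratic term vanishes and the linear one is p^(2l-1), which generates the smallest nonzero ideal
  and at which \<open>\<psi>\<close> is nontrivial. The exceptional cases pin down the class of
  \<zeta>. In mixed characteristic the test elements are scalar modulo p^l: x = 1 + p^(l-e) t
  satisfies x^2 = 1 modulo p^l as soon as 2 e <= l, and this is the bound 2 l >= 4 e. In
  characteristic two they interpolate between the identity and a given element of S.\<close>

definition lin_subspace :: "nat \<Rightarrow> complex Matrix.vec set \<Rightarrow> bool" where
  "lin_subspace n W \<longleftrightarrow> W \<subseteq> carrier_vec n \<and> 0\<^sub>v n \<in> W \<and> (\<forall>v\<in>W. \<forall>w\<in>W. v + w \<in> W) \<and>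
     (\<forall>c. \<forall>v\<in>W. c \<cdot>\<^sub>v v \<in> W)"

text \<open>\<open>irreducible_rep\<close> quantifies over subspaces in the sense of modules; the
  invariance arguments below work with the bare closure conditions.\<close>

lemma subspace_iff_lin_subspace:
  "VectorSpace.subspace class_ring W (module_vec TYPE(complex) n) \<longleftrightarrow> lin_subspace n W"
proof -
  interpret vec_space "TYPE(complex)" n .
  show ?thesis
  proof
    assume "VectorSpace.subspace class_ring W (module_vec TYPE(complex) n)"
    then have s: "LinearCombinations.submodule class_ring W (module_vec TYPE(complex) n)"
      by (auto simp: VectorSpace.subspace_def)
    then show "lin_subspace n W"
      unfolding LinearCombinations.submodule_def lin_subspace_def
      by (auto simp: module_vec_simps class_ring_simps)
  next
    assume "lin_subspace n W"
    then show "VectorSpace.subspace class_ring W (module_vec TYPE(complex) n)"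
      unfolding VectorSpace.subspace_def LinearCombinations.submodule_def lin_subspace_def
      using vec_module vec_vs by (auto simp: module_vec_simps class_ring_simps)
  qed
qed

lemma mat_eq_by_vec:
  fixes A B :: "complex mat"
  assumes "A \<in> carrier_mat n m" "B \<in> carrier_mat n m"
    and "\<And>v. v \<in> carrier_vec m \<Longrightarrow> A *\<^sub>v v = B *\<^sub>v v"
  shows "A = B"
proof (rule eq_matI)
  fix i j assume ij: "i < dim_row B" "j < dim_col B"
  have "(A *\<^sub>v unit_vec m j) $v i = (B *\<^sub>v unit_vec m j) $v i" using assms(3) by simp
  then show "A $$ (i, j) = B $$ (i, j)" using ij assms(1,2) by simp
qed (use assms in auto)

text \<open>Intertwiners are built below as functions on vectors, by evaluation or by averaging,
  while \<open>rep_schur\<close> takes a matrix. Its columns are the values of \<open>F\<close> at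
  the unit vectors.\<close>

lemma linear_map_mat:
  fixes F :: "complex Matrix.vec \<Rightarrow> complex Matrix.vec"
  assumes cl: "\<And>v. v \<in> carrier_vec m \<Longrightarrow> F v \<in> carrier_vec n"
    and add: "\<And>v w. v \<in> carrier_vec m \<Longrightarrow> w \<in> carrier_vec m \<Longrightarrow> F (v + w) = F v + F w"
    and sm: "\<And>c v. v \<in> carrier_vec m \<Longrightarrow> F (c \<cdot>\<^sub>v v) = c \<cdot>\<^sub>v F v"
  shows "\<exists>M \<in> carrier_mat n m. \<forall>v \<in> carrier_vec m. M *\<^sub>v v = F v"
proof -
  define M where "M = Matrix.mat n m (\<lambda>(i, j). F (unit_vec m j) $v i)"
  have M: "M \<in> carrier_mat n m" by (simp add: M_def)
  have "M *\<^sub>v v = F v" if v: "v \<in> carrier_vec m" for v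
  proof -
    \<comment> \<open>Cutting \<open>v\<close> off after k coordinates lets additivity be used for
      one coordinate at a time.\<close>
    define t where "t k = Matrix.vec m (\<lambda>i. if i < k then v $v i else 0)" for k
    have tc: "t k \<in> carrier_vec m" for k by (simp add: t_def)
    have "k \<le> m \<Longrightarrow> M *\<^sub>v t k = F (t k)" for k
    proof (induction k)
      case 0
      have t0: "t 0 = 0 \<cdot>\<^sub>v 0\<^sub>v m" by (auto simp: t_def)
      have "F (t 0) = 0 \<cdot>\<^sub>v F (0\<^sub>v m)" unfolding t0 by (rule sm) simp
      also have "\<dots> = 0\<^sub>v n" using cl[of "0\<^sub>v m"] by (intro eq_vecI) auto
      also have "\<dots> = M *\<^sub>v t 0" unfolding t0 using M by (intro eq_vecI) auto
      finally show ?case by simp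
    next
      case (Suc k)
      have ts: "t (Suc k) = t k + v $v k \<cdot>\<^sub>v unit_vec m k"
        using v Suc.prems by (intro eq_vecI) (auto simp: t_def less_Suc_eq)
      have "M *\<^sub>v unit_vec m k = F (unit_vec m k)"
        using cl[of "unit_vec m k"] Suc.prems by (intro eq_vecI) (auto simp: M_def)
      then show ?case
        unfolding ts using Suc tc M
        by (simp add: add sm mult_add_distrib_mat_vec[OF M] mult_mat_vec[OF M])
    qed
    moreover have "t m = v" using v by (intro eq_vecI) (auto simp: t_def)
    ultimately show ?thesis by fastforce
  qed
  with M show ?thesis by blast
qed

text \<open>If d < m, padding both factors with zeros to m by m matrices keeps
  \<open>R' * Q'\<close> equal to 1, hence also \<open>Q' * R'\<close>; but row d of
  \<open>Q'\<close> is zero.\<close>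

lemma left_inverse_dim_le:
  fixes Q R :: "complex mat"
  assumes Q: "Q \<in> carrier_mat d m" and R: "R \<in> carrier_mat m d" and RQ: "R * Q = 1\<^sub>m m"
  shows "m \<le> d"
proof (rule ccontr)
  assume "\<not> m \<le> d"
  then have dm: "d < m" by simp
  define Q' where "Q' = Matrix.mat m m (\<lambda>(i, j). if i < d then Q $$ (i, j) else 0)"
  define R' where "R' = Matrix.mat m m (\<lambda>(i, j). if j < d then R $$ (i, j) else 0)"
  have Q': "Q' \<in> carrier_mat m m" and R': "R' \<in> carrier_mat m m" by (auto simp: Q'_def R'_def)
  have "R' * Q' = 1\<^sub>m m"
  proof (rule eq_matI)
    fix i j assume ij: "i < dim_row (1\<^sub>m m)" "j < dim_col (1\<^sub>m m)"
    have "(R' * Q') $$ (i, j) = (\<Sum>k\<in>{0..<m}. if k < d then R $$ (i, k) * Q $$ (k, j) else 0)"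
      using ij by (auto simp: R'_def Q'_def scalar_prod_def intro!: sum.cong)
    also have "\<dots> = (\<Sum>k\<in>{0..<d}. R $$ (i, k) * Q $$ (k, j))"
      using dm by (intro sum.mono_neutral_cong_right) auto
    also have "\<dots> = (R * Q) $$ (i, j)"
      using ij Q R by (auto simp: scalar_prod_def intro!: sum.cong)
    finally show "(R' * Q') $$ (i, j) = 1\<^sub>m m $$ (i, j)" by (simp add: RQ)
  qed (auto simp: R'_def Q'_def)
  then have QR: "Q' * R' = 1\<^sub>m m" by (rule mat_mult_left_right_inverse[OF R' Q'])
  have "(Q' * R') $$ (d, d) = 0" using dm by (auto simp: Q'_def R'_def scalar_prod_def intro!: sum.neutral)
  with QR dm show False by simp
qed

text \<open>This plays the role of a basis: the columns of \<open>Q\<close> form one of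
  \<open>Y\<close>, and \<open>R\<close> reads off coordinates. The largest possible m works,
  because a vector of \<open>Y\<close> outside the image of \<open>Q\<close> would give one more
  column together with a row dual to it.\<close>

lemma lin_subspace_retract:
  assumes Y: "lin_subspace d Y"
  shows "\<exists>m Q R. Q \<in> carrier_mat d m \<and> R \<in> carrier_mat m d \<and> R * Q = 1\<^sub>m m \<and>
     (\<forall>v\<in>carrier_vec m. Q *\<^sub>v v \<in> Y) \<and> (\<forall>y\<in>Y. Q *\<^sub>v (R *\<^sub>v y) = y) \<and>
     (Y \<noteq> {0\<^sub>v d} \<longrightarrow> m > 0) \<and> (Y \<noteq> carrier_vec d \<longrightarrow> m < d)"
proof -
  define P where "P m \<longleftrightarrow> (\<exists>Q R. Q \<in> carrier_mat d m \<and> R \<in> carrier_mat m d \<and> R * Q = 1\<^sub>m m \<and>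
     (\<forall>v\<in>carrier_vec m. Q *\<^sub>v v \<in> Y))" for m
  have P0: "P 0" unfolding P_def
  proof (intro exI conjI ballI)
    show "0\<^sub>m d 0 \<in> carrier_mat d 0" "0\<^sub>m 0 d \<in> carrier_mat 0 d" by auto
    show "0\<^sub>m 0 d * 0\<^sub>m d 0 = (1\<^sub>m 0 :: complex mat)" by (intro eq_matI) auto
    fix v :: "complex Matrix.vec" assume "v \<in> carrier_vec 0"
    then have "0\<^sub>m d 0 *\<^sub>v v = 0\<^sub>v d" by (intro eq_vecI) (auto simp: scalar_prod_def)
    then show "0\<^sub>m d 0 *\<^sub>v v \<in> Y" using Y by (simp add: lin_subspace_def)
  qed
  have Pb: "P m \<Longrightarrow> m \<le> d" for m unfolding P_def using left_inverse_dim_le by blast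
  define m where "m = Max {m. P m}"
  have fin: "finite {m. P m}" using Pb by (rule_tac finite_subset[of _ "{..d}"]) auto
  have Pm: "P m" unfolding m_def using Max_in[OF fin] P0 by blast
  have mx: "\<not> P (Suc m)" using Max_ge[OF fin, of "Suc m"] unfolding m_def by auto
  from Pm obtain Q R where Q: "Q \<in> carrier_mat d m" and R: "R \<in> carrier_mat m d"
    and RQ: "R * Q = 1\<^sub>m m" and QY: "\<forall>v\<in>carrier_vec m. Q *\<^sub>v v \<in> Y" unfolding P_def by blast
  have RQv: "R *\<^sub>v (Q *\<^sub>v v) = v" if "v \<in> carrier_vec m" for v
    using that Q R RQ by (simp add: assoc_mult_mat_vec[OF R Q, symmetric])
  have id: "Q *\<^sub>v (R *\<^sub>v y) = y" if y: "y \<in> Y" for y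
  proof (rule ccontr)
    assume ne: "Q *\<^sub>v (R *\<^sub>v y) \<noteq> y"
    have yc: "y \<in> carrier_vec d" using Y y by (auto simp: lin_subspace_def)
    have Ryc: "R *\<^sub>v y \<in> carrier_vec m" using R yc by simp
    \<comment> \<open>The part of y that \<open>R\<close> does not see; it becomes the new
      column.\<close>
    define z where "z = y + (-1) \<cdot>\<^sub>v (Q *\<^sub>v (R *\<^sub>v y))"
    have zc: "z \<in> carrier_vec d" using yc Ryc Q by (simp add: z_def)
    have zY: "z \<in> Y" using Y y QY Ryc unfolding z_def lin_subspace_def by blast
    have Rz: "R *\<^sub>v z = 0\<^sub>v m"
    proof -
      have "R *\<^sub>v z = R *\<^sub>v y + (-1) \<cdot>\<^sub>v (R *\<^sub>v (Q *\<^sub>v (R *\<^sub>v y)))"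
        unfolding z_def using R Q yc Ryc by (simp add: mult_add_distrib_mat_vec[OF R] mult_mat_vec[OF R])
      also have "\<dots> = 0\<^sub>v m" using RQv[OF Ryc] Ryc R by (intro eq_vecI) auto
      finally show ?thesis .
    qed
    have "z \<noteq> 0\<^sub>v d"
    proof
      assume z0: "z = 0\<^sub>v d"
      have "Q *\<^sub>v (R *\<^sub>v y) = y"
      proof (rule eq_vecI)
        fix i assume i: "i < dim_vec y"
        then have "z $v i = 0" using z0 yc by auto
        then show "(Q *\<^sub>v (R *\<^sub>v y)) $v i = y $v i" using i yc Q by (simp add: z_def)
      qed (use Q yc in auto)
      with ne show False by simp
    qed
    then obtain i0 where i0: "i0 < d" "z $v i0 \<noteq> 0"
      using zc eq_vecI[of z "0\<^sub>v d"] by auto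
    \<comment> \<open>A functional with value 1 at z. Subtracting \<open>s0 * (Q * R)\<close> makes
      it vanish on the old columns and, as \<open>R\<close> kills z, keeps the value at z.\<close>
    define s0 where "s0 = Matrix.mat 1 d (\<lambda>(i, j). if j = i0 then inverse (z $v i0) else 0)"
    have s0c: "s0 \<in> carrier_mat 1 d" by (simp add: s0_def)
    define s where "s = s0 - s0 * (Q * R)"
    have sc: "s \<in> carrier_mat 1 d" unfolding s_def by (rule minus_carrier_mat[OF mult_carrier_mat[OF s0c mult_carrier_mat[OF Q R]]])
    have sQ: "s * Q = 0\<^sub>m 1 m"
    proof -
      have "s * Q = s0 * Q - s0 * (Q * R) * Q"
        unfolding s_def using s0c Q R by (intro minus_mult_distrib_mat) auto
      also have "s0 * (Q * R) * Q = s0 * Q"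
        using s0c Q R RQ
        by (simp add: assoc_mult_mat[of s0 1 d "Q * R" d Q m] assoc_mult_mat[of Q d m R d Q m])
      finally show ?thesis using s0c Q by auto
    qed
    have sz: "(s *\<^sub>v z) $v 0 = 1"
    proof -
      have "s *\<^sub>v z = s0 *\<^sub>v z - s0 * (Q * R) *\<^sub>v z"
        unfolding s_def using s0c Q R zc by (intro minus_mult_distrib_mat_vec) auto
      also have "s0 * (Q * R) *\<^sub>v z = 0\<^sub>v 1"
      proof -
        have "s0 * (Q * R) *\<^sub>v z = s0 *\<^sub>v (Q *\<^sub>v (R *\<^sub>v z))"
          using s0c Q R zc
          by (simp add: assoc_mult_mat_vec[of s0 1 d "Q * R" d z] assoc_mult_mat_vec[of Q d m R d z])
        then show ?thesis unfolding Rz using s0c Q by (auto simp: scalar_prod_def intro!: eq_vecI)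
      qed
      finally have "(s *\<^sub>v z) $v 0 = (s0 *\<^sub>v z) $v 0" using s0c by auto
      also have "\<dots> = (\<Sum>j\<in>{0..<d}. (if j = i0 then inverse (z $v i0) else 0) * z $v j)"
        using zc by (auto simp: s0_def scalar_prod_def intro!: sum.cong)
      also have "\<dots> = (\<Sum>j\<in>{0..<d}. if j = i0 then 1 else 0)"
        using i0 by (intro sum.cong) auto
      also have "\<dots> = 1" using i0 by simp
      finally show ?thesis .
    qed
    define Q' where "Q' = Matrix.mat d (Suc m) (\<lambda>(i, j). if j < m then Q $$ (i, j) else z $v i)"
    define R' where "R' = Matrix.mat (Suc m) d (\<lambda>(i, j). if i < m then R $$ (i, j) else s $$ (0, j))"
    have Q': "Q' \<in> carrier_mat d (Suc m)" and R': "R' \<in> carrier_mat (Suc m) d"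
      by (auto simp: Q'_def R'_def)
    have "R' * Q' = 1\<^sub>m (Suc m)"
    proof (rule eq_matI)
      fix i j assume "i < dim_row (1\<^sub>m (Suc m))" "j < dim_col (1\<^sub>m (Suc m))"
      then have ij: "i < Suc m" "j < Suc m" by auto
      have "(R' * Q') $$ (i, j) = (\<Sum>k\<in>{0..<d}. R' $$ (i, k) * Q' $$ (k, j))"
        using ij Q' R' by (auto simp: scalar_prod_def)
      also have "\<dots> = (if i = j then 1 else 0)"
      proof (cases "i < m")
        case True
        show ?thesis
        proof (cases "j < m")
          case jm: True
          have "(\<Sum>k\<in>{0..<d}. R' $$ (i, k) * Q' $$ (k, j)) = (R * Q) $$ (i, j)"
            using True jm Q R by (auto simp: scalar_prod_def R'_def Q'_def intro!: sum.cong)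
          then show ?thesis using RQ True jm by simp
        next
          case False
          have "(\<Sum>k\<in>{0..<d}. R' $$ (i, k) * Q' $$ (k, j)) = (R *\<^sub>v z) $v i"
            using True False ij R zc by (auto simp: scalar_prod_def R'_def Q'_def intro!: sum.cong)
          then show ?thesis using Rz True False by simp
        qed
      next
        case im: False
        show ?thesis
        proof (cases "j < m")
          case jm: True
          have "(\<Sum>k\<in>{0..<d}. R' $$ (i, k) * Q' $$ (k, j)) = (s * Q) $$ (0, j)"
            using im ij jm Q sc by (auto simp: scalar_prod_def R'_def Q'_def intro!: sum.cong)
          then show ?thesis using sQ im jm by simp
        next
          case False
          have "(\<Sum>k\<in>{0..<d}. R' $$ (i, k) * Q' $$ (k, j)) = (s *\<^sub>v z) $v 0"
            using im False ij sc zc by (auto simp: scalar_prod_def R'_def Q'_def intro!: sum.cong)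
          then show ?thesis using sz im False ij by simp
        qed
      qed
      finally show "(R' * Q') $$ (i, j) = 1\<^sub>m (Suc m) $$ (i, j)" using ij by simp
    qed (auto simp: R'_def Q'_def)
    moreover have "Q' *\<^sub>v v \<in> Y" if v: "v \<in> carrier_vec (Suc m)" for v
    proof -
      define v0 where "v0 = Matrix.vec m (\<lambda>i. v $v i)"
      have v0: "v0 \<in> carrier_vec m" by (simp add: v0_def)
      have "Q' *\<^sub>v v = Q *\<^sub>v v0 + v $v m \<cdot>\<^sub>v z"
        using v Q zc by (intro eq_vecI) (auto simp: Q'_def v0_def scalar_prod_def intro!: sum.cong)
      then show ?thesis using QY v0 zY Y unfolding lin_subspace_def by auto
    qed
    ultimately have "P (Suc m)" unfolding P_def using Q' R' by blast
    with mx show False by simp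
  qed
  have "m > 0" if "Y \<noteq> {0\<^sub>v d}"
  proof (rule ccontr)
    assume "\<not> m > 0"
    then have m0: "m = 0" by simp
    from that Y obtain y where y: "y \<in> Y" "y \<noteq> 0\<^sub>v d" unfolding lin_subspace_def by blast
    have yc: "y \<in> carrier_vec d" using Y y by (auto simp: lin_subspace_def)
    have "Q *\<^sub>v (R *\<^sub>v y) = 0\<^sub>v d" using Q R m0 by (intro eq_vecI) (auto simp: scalar_prod_def)
    with id[OF y(1)] y show False by simp
  qed
  moreover have "m < d" if "Y \<noteq> carrier_vec d"
  proof (rule ccontr)
    assume "\<not> m < d"
    then have md: "m = d" using Pb[OF Pm] by simp
    have "Q * R = 1\<^sub>m d" using mat_mult_left_right_inverse[of R d Q] Q R RQ md by simp
    have "v \<in> Y" if v: "v \<in> carrier_vec d" for v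
    proof -
      have "Q *\<^sub>v (R *\<^sub>v v) = v"
        using v \<open>Q * R = 1\<^sub>m d\<close> by (simp add: assoc_mult_mat_vec[OF Q R v, symmetric])
      then show ?thesis using QY R v by (metis mult_mat_vec_carrier)
    qed
    then have "Y = carrier_vec d" using Y by (auto simp: lin_subspace_def)
    with that show False by simp
  qed
  ultimately show ?thesis using Q R RQ QY id by blast
qed

lemma trace_mult_comm:
  fixes A B :: "complex mat"
  assumes "A \<in> carrier_mat n m" "B \<in> carrier_mat m n"
  shows "(\<Sum>i<n. (A * B) $$ (i, i)) = (\<Sum>i<m. (B * A) $$ (i, i))"
proof -
  have "(\<Sum>i<n. (A * B) $$ (i, i)) = (\<Sum>i<n. \<Sum>k<m. A $$ (i, k) * B $$ (k, i))"
    using assms by (auto simp: scalar_prod_def lessThan_atLeast0 intro!: sum.cong)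
  also have "\<dots> = (\<Sum>k<m. \<Sum>i<n. B $$ (k, i) * A $$ (i, k))"
    by (subst sum.swap) (simp add: mult.commute)
  also have "\<dots> = (\<Sum>i<m. (B * A) $$ (i, i))"
    using assms by (auto simp: scalar_prod_def lessThan_atLeast0 intro!: sum.cong)
  finally show ?thesis .
qed

text \<open>With the columns of \<open>Q\<close> a basis of the fixed space, P = Q (R P) and (R P) Q
  = 1. So the trace is the dimension of that space, and in characteristic zero it vanishes only with
  the dimension.\<close>

lemma idempotent_trace_eq_0:
  fixes P :: "complex mat"
  assumes P: "P \<in> carrier_mat n n" and PP: "P * P = P" and tr: "(\<Sum>i<n. P $$ (i, i)) = 0"
  shows "P = 0\<^sub>m n n"
proof -
  define Y where "Y = {y \<in> carrier_vec n. P *\<^sub>v y = y}"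
  have "lin_subspace n Y"
    using P by (auto simp: Y_def lin_subspace_def mult_add_distrib_mat_vec[OF P] mult_mat_vec[OF P])
  from lin_subspace_retract[OF this] obtain m Q R where Q: "Q \<in> carrier_mat n m"
    and R: "R \<in> carrier_mat m n" and RQ: "R * Q = 1\<^sub>m m" and QY: "\<forall>v\<in>carrier_vec m. Q *\<^sub>v v \<in> Y"
    and id: "\<forall>y\<in>Y. Q *\<^sub>v (R *\<^sub>v y) = y" by blast
  have PQ: "P * Q = Q"
    by (rule mat_eq_by_vec[of _ n m])
      (use P Q QY in \<open>auto simp: Y_def assoc_mult_mat_vec[OF P Q]\<close>)
  have PvY: "P *\<^sub>v v \<in> Y" if "v \<in> carrier_vec n" for v
    using that P PP by (auto simp: Y_def assoc_mult_mat_vec[OF P P, symmetric])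
  have QRP: "Q * (R * P) = P"
  proof (rule mat_eq_by_vec[of _ n n])
    fix v :: "complex Matrix.vec" assume v: "v \<in> carrier_vec n"
    have "(Q * (R * P)) *\<^sub>v v = Q *\<^sub>v (R *\<^sub>v (P *\<^sub>v v))"
      using Q R P v
      by (simp add: assoc_mult_mat_vec[of Q n m "R * P" n v] assoc_mult_mat_vec[of R m n P n v])
    then show "(Q * (R * P)) *\<^sub>v v = P *\<^sub>v v" using id PvY[OF v] by simp
  qed (use Q R P in auto)
  have RPQ: "(R * P) * Q = 1\<^sub>m m" using R P Q RQ PQ by (simp add: assoc_mult_mat[OF R P Q])
  have "(\<Sum>i<n. P $$ (i, i)) = (\<Sum>i<m. ((R * P) * Q) $$ (i, i))"
    using trace_mult_comm[of Q n m "R * P"] Q R P QRP by simp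
  also have "\<dots> = of_nat m" by (simp add: RPQ)
  finally have "m = 0" using tr by simp
  have "P = Q * (R * P)" by (simp add: QRP)
  also have "\<dots> = 0\<^sub>m n n" using Q R P \<open>m = 0\<close> by (intro eq_matI) (auto simp: scalar_prod_def)
  finally show ?thesis .
qed

section \<open>Irreducible matrix representations\<close>

lemma is_rep_mat:
  "is_rep G \<rho> \<Longrightarrow> g \<in> carrier G \<Longrightarrow> \<rho> g \<in> carrier_mat (rep_degree G \<rho>) (rep_degree G \<rho>)"
  by (simp add: is_rep_def)

lemma is_rep_mult:
  "is_rep G \<rho> \<Longrightarrow> g \<in> carrier G \<Longrightarrow> h \<in> carrier G \<Longrightarrow> \<rho> (g \<otimes>\<^bsub>G\<^esub> h) = \<rho> g * \<rho> h"
  by (simp add: is_rep_def)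

lemma is_rep_one: "is_rep G \<rho> \<Longrightarrow> \<rho> \<one>\<^bsub>G\<^esub> = 1\<^sub>m (rep_degree G \<rho>)"
  by (simp add: is_rep_def)

lemma is_rep_mult_vec:
  assumes "is_rep G \<rho>" "g \<in> carrier G" "h \<in> carrier G" "v \<in> carrier_vec (rep_degree G \<rho>)"
  shows "\<rho> (g \<otimes>\<^bsub>G\<^esub> h) *\<^sub>v v = \<rho> g *\<^sub>v (\<rho> h *\<^sub>v v)"
  unfolding is_rep_mult[OF assms(1-3)]
  by (rule assoc_mult_mat_vec[OF is_rep_mat[OF assms(1,2)] is_rep_mat[OF assms(1,3)] assms(4)])

lemma mult_mat_zero_vec: "A \<in> carrier_mat n m \<Longrightarrow> A *\<^sub>v 0\<^sub>v m = (0\<^sub>v n :: complex Matrix.vec)"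
  by (intro eq_vecI) (auto simp: scalar_prod_def)

lemma is_rep_one_vec:
  "is_rep G \<rho> \<Longrightarrow> v \<in> carrier_vec (rep_degree G \<rho>) \<Longrightarrow> \<rho> \<one>\<^bsub>G\<^esub> *\<^sub>v v = v"
  by (simp add: is_rep_one)

lemma irreducible_rep_alt:
  "irreducible_rep G \<rho> \<longleftrightarrow> is_rep G \<rho> \<and> rep_degree G \<rho> > 0 \<and>
     (\<forall>W. lin_subspace (rep_degree G \<rho>) W \<and> (\<forall>g\<in>carrier G. \<forall>w\<in>W. \<rho> g *\<^sub>v w \<in> W) \<longrightarrow>
        W = {0\<^sub>v (rep_degree G \<rho>)} \<or> W = carrier_vec (rep_degree G \<rho>))"
  unfolding irreducible_rep_def subspace_iff_lin_subspace ..

lemma irreducible_rep_full: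
  assumes "irreducible_rep G \<rho>" "lin_subspace (rep_degree G \<rho>) W"
    and "\<And>g w. g \<in> carrier G \<Longrightarrow> w \<in> W \<Longrightarrow> \<rho> g *\<^sub>v w \<in> W"
    and "w \<in> W" "w \<noteq> 0\<^sub>v (rep_degree G \<rho>)"
  shows "W = carrier_vec (rep_degree G \<rho>)"
  using assms unfolding irreducible_rep_alt by blast

lemma left_inverse_cancel_vec:
  fixes Q R :: "complex mat"
  assumes "R \<in> carrier_mat m n" "Q \<in> carrier_mat n m" "R * Q = 1\<^sub>m m" "v \<in> carrier_vec m"
  shows "R *\<^sub>v (Q *\<^sub>v v) = v"
  using assms by (simp add: assoc_mult_mat_vec[of R m n Q m v, symmetric])

lemma irreducible_rep_imp_is_rep: "irreducible_rep G \<rho> \<Longrightarrow> is_rep G \<rho>"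
  by (simp add: irreducible_rep_def)

text \<open>Among the nonzero stable subspaces of \<open>Y\<close>, each given by a retract, one of
  least dimension is irreducible: a proper invariant subspace of it, pushed through
  \<open>Q\<close>, would be a smaller one. The equivariant map is \<open>Q\<close>; its left
  inverse \<open>R\<close> is only linear.\<close>

lemma exists_irreducible_subrep:
  assumes rep: "is_rep G \<sigma>" and n: "n = rep_degree G \<sigma>" and Y: "lin_subspace n Y"
    and st: "\<And>g v. g \<in> carrier G \<Longrightarrow> v \<in> Y \<Longrightarrow> \<sigma> g *\<^sub>v v \<in> Y"
    and y0: "y0 \<in> Y" "y0 \<noteq> 0\<^sub>v n"
    and one: "\<one>\<^bsub>G\<^esub> \<in> carrier G" and clo: "\<And>g h. g \<in> carrier G \<Longrightarrow> h \<in> carrier G \<Longrightarrow> g \<otimes>\<^bsub>G\<^esub> h \<in> carrier G"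
  shows "\<exists>\<rho> d Q R. irreducible_rep G \<rho> \<and> rep_degree G \<rho> = d \<and> Q \<in> carrier_mat n d \<and>
     R \<in> carrier_mat d n \<and> R * Q = 1\<^sub>m d \<and> (\<forall>v\<in>carrier_vec d. Q *\<^sub>v v \<in> Y) \<and>
     (\<forall>g\<in>carrier G. \<sigma> g * Q = Q * \<rho> g)"
proof -
  \<comment> \<open>The last conjunct says that the image of \<open>Q\<close> is stable, since
    \<open>Q * R\<close> fixes exactly the vectors of that image.\<close>
  define S where "S d \<longleftrightarrow> d > 0 \<and> (\<exists>Q R. Q \<in> carrier_mat n d \<and> R \<in> carrier_mat d n \<and> R * Q = 1\<^sub>m d \<and>
    (\<forall>v\<in>carrier_vec d. Q *\<^sub>v v \<in> Y) \<and> (\<forall>g\<in>carrier G. \<sigma> g * Q = Q * (R * (\<sigma> g * Q))))" for d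
  have sm: "\<sigma> g \<in> carrier_mat n n" if "g \<in> carrier G" for g using is_rep_mat[OF rep that] n by simp
  have Yc: "v \<in> carrier_vec n" if "v \<in> Y" for v using Y that by (auto simp: lin_subspace_def)
  have ex: "\<exists>d. S d"
  proof -
    obtain m Q R where Q: "Q \<in> carrier_mat n m" and R: "R \<in> carrier_mat m n" and RQ: "R * Q = 1\<^sub>m m"
      and QY: "\<forall>v\<in>carrier_vec m. Q *\<^sub>v v \<in> Y" and id: "\<forall>y\<in>Y. Q *\<^sub>v (R *\<^sub>v y) = y" and m0: "Y \<noteq> {0\<^sub>v n} \<longrightarrow> m > 0"
      using lin_subspace_retract[OF Y] by blast
    have "\<sigma> g * Q = Q * (R * (\<sigma> g * Q))" if g: "g \<in> carrier G" for g
    proof (rule mat_eq_by_vec[of _ n m])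
      fix v :: "complex Matrix.vec" assume v: "v \<in> carrier_vec m"
      have "Q *\<^sub>v (R *\<^sub>v (\<sigma> g *\<^sub>v (Q *\<^sub>v v))) = \<sigma> g *\<^sub>v (Q *\<^sub>v v)"
        using id st g QY v by blast
      then show "(\<sigma> g * Q) *\<^sub>v v = (Q * (R * (\<sigma> g * Q))) *\<^sub>v v"
        using sm[OF g] Q R v
        by (simp add: assoc_mult_mat_vec[of Q n m "R * (\<sigma> g * Q)" m v]
            assoc_mult_mat_vec[of R m n "\<sigma> g * Q" m v] assoc_mult_mat_vec[of "\<sigma> g" n n Q m v])
    qed (use sm[OF g] Q R in auto)
    moreover have "m > 0" using m0 y0 by blast
    ultimately show ?thesis unfolding S_def using Q R RQ QY by blast
  qed
  define d where "d = (LEAST d. S d)"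
  have "S d" unfolding d_def using ex by (rule LeastI_ex)
  then obtain Q R where d0: "d > 0" and Q: "Q \<in> carrier_mat n d" and R: "R \<in> carrier_mat d n"
    and RQ: "R * Q = 1\<^sub>m d" and QY: "\<forall>v\<in>carrier_vec d. Q *\<^sub>v v \<in> Y"
    and inv: "\<forall>g\<in>carrier G. \<sigma> g * Q = Q * (R * (\<sigma> g * Q))" unfolding S_def by blast
  define \<rho> where "\<rho> g = R * (\<sigma> g * Q)" for g
  have rc: "\<rho> g \<in> carrier_mat d d" if "g \<in> carrier G" for g
    using sm[OF that] Q R by (simp add: \<rho>_def)
  have int: "\<sigma> g * Q = Q * \<rho> g" if "g \<in> carrier G" for g using inv that by (simp add: \<rho>_def)
  have \<rho>1: "\<rho> \<one>\<^bsub>G\<^esub> = 1\<^sub>m d" using is_rep_one[OF rep] n Q RQ by (simp add: \<rho>_def)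
  have deg: "rep_degree G \<rho> = d" by (simp add: rep_degree_def \<rho>1)
  have rep\<rho>: "is_rep G \<rho>" unfolding is_rep_def deg
  proof (intro conjI ballI)
    fix g h assume g: "g \<in> carrier G" and h: "h \<in> carrier G"
    have "\<rho> (g \<otimes>\<^bsub>G\<^esub> h) = R * (\<sigma> g * (\<sigma> h * Q))"
      using sm[OF g] sm[OF h] Q by (simp add: \<rho>_def is_rep_mult[OF rep g h])
    also have "\<dots> = R * (\<sigma> g * (Q * \<rho> h))" using int[OF h] by simp
    also have "\<sigma> g * (Q * \<rho> h) = (\<sigma> g * Q) * \<rho> h" using sm[OF g] Q rc[OF h] by simp
    also have "R * ((\<sigma> g * Q) * \<rho> h) = R * (\<sigma> g * Q) * \<rho> h"
      using sm[OF g] Q rc[OF h] R by (simp add: assoc_mult_mat[of R d n "\<sigma> g * Q" d "\<rho> h" d])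
    finally show "\<rho> (g \<otimes>\<^bsub>G\<^esub> h) = \<rho> g * \<rho> h" by (simp add: \<rho>_def)
  qed (use rc \<rho>1 in auto)
  have "irreducible_rep G \<rho>"
    unfolding irreducible_rep_alt deg
  proof (intro conjI allI impI)
    fix W assume W: "lin_subspace d W \<and> (\<forall>g\<in>carrier G. \<forall>w\<in>W. \<rho> g *\<^sub>v w \<in> W)"
    show "W = {0\<^sub>v d} \<or> W = carrier_vec d"
    proof (rule ccontr)
      assume con: "\<not> (W = {0\<^sub>v d} \<or> W = carrier_vec d)"
      from W have Ws: "lin_subspace d W" by simp
      obtain m Q' R' where Q': "Q' \<in> carrier_mat d m" and R': "R' \<in> carrier_mat m d" and RQ': "R' * Q' = 1\<^sub>m m"
        and QY': "\<forall>v\<in>carrier_vec m. Q' *\<^sub>v v \<in> W" and id: "\<forall>y\<in>W. Q' *\<^sub>v (R' *\<^sub>v y) = y"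
        and m0: "W \<noteq> {0\<^sub>v d} \<longrightarrow> m > 0" and md: "W \<noteq> carrier_vec d \<longrightarrow> m < d"
        using lin_subspace_retract[OF Ws] by blast
      define QQ where "QQ = Q * Q'"
      define RR where "RR = R' * R"
      have QQ: "QQ \<in> carrier_mat n m" and RR: "RR \<in> carrier_mat m n" using Q Q' R R' by (auto simp: QQ_def RR_def)
      have "RR * QQ = R' * (R * (Q * Q'))" unfolding RR_def QQ_def
        using Q Q' R R' by (intro assoc_mult_mat) auto
      also have "R * (Q * Q') = Q'" using Q Q' R RQ by (simp add: assoc_mult_mat[of R d n Q d Q' m, symmetric])
      finally have RRQQ: "RR * QQ = 1\<^sub>m m" using RQ' by simp
      have range: "\<forall>v\<in>carrier_vec m. QQ *\<^sub>v v \<in> Y"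
        using QY Q Q' by (auto simp: QQ_def assoc_mult_mat_vec[OF Q Q'])
      have "\<sigma> g * QQ = QQ * (RR * (\<sigma> g * QQ))" if g: "g \<in> carrier G" for g
      proof (rule mat_eq_by_vec[of _ n m])
        fix v :: "complex Matrix.vec" assume v: "v \<in> carrier_vec m"
        let ?w = "\<rho> g *\<^sub>v (Q' *\<^sub>v v)"
        have w: "?w \<in> W" using W QY' g v by blast
        have wc: "?w \<in> carrier_vec d" using w Ws by (auto simp: lin_subspace_def)
        have 1: "(\<sigma> g * QQ) *\<^sub>v v = Q *\<^sub>v ?w"
        proof -
          have "(\<sigma> g * QQ) *\<^sub>v v = \<sigma> g *\<^sub>v (Q *\<^sub>v (Q' *\<^sub>v v))"
            using sm[OF g] Q Q' QQ v by (simp add: assoc_mult_mat_vec[of "\<sigma> g" n n QQ m v]) (simp add: QQ_def)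
          also have "\<dots> = (\<sigma> g * Q) *\<^sub>v (Q' *\<^sub>v v)" using sm[OF g] Q Q' v by simp
          also have "\<dots> = Q *\<^sub>v ?w" using int[OF g] Q Q' rc[OF g] v by simp
          finally show ?thesis .
        qed
        have "(QQ * (RR * (\<sigma> g * QQ))) *\<^sub>v v = QQ *\<^sub>v (RR *\<^sub>v ((\<sigma> g * QQ) *\<^sub>v v))"
          using sm[OF g] QQ RR v by (simp add: assoc_mult_mat_vec[of QQ n m "RR * (\<sigma> g * QQ)" m v]
            assoc_mult_mat_vec[of RR m n "\<sigma> g * QQ" m v])
        also have "\<dots> = QQ *\<^sub>v (R' *\<^sub>v (R *\<^sub>v (Q *\<^sub>v ?w)))"
          unfolding 1 RR_def using R R' Q wc by simp
        also have "\<dots> = QQ *\<^sub>v (R' *\<^sub>v ?w)" using left_inverse_cancel_vec[OF R Q RQ wc] by simp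
        also have "\<dots> = Q *\<^sub>v (Q' *\<^sub>v (R' *\<^sub>v ?w))" unfolding QQ_def using Q Q' R' wc by simp
        also have "\<dots> = Q *\<^sub>v ?w" using id w by simp
        finally show "(\<sigma> g * QQ) *\<^sub>v v = (QQ * (RR * (\<sigma> g * QQ))) *\<^sub>v v" using 1 by simp
      qed (use sm[OF g] QQ RR in auto)
      then have "S m" unfolding S_def using QQ RR RRQQ range m0 con by blast
      then have "d \<le> m" unfolding d_def by (rule Least_le)
      with md con show False by auto
    qed
  qed (use rep\<rho> d0 in auto)
  then show ?thesis using deg Q R RQ QY int by blast
qed

text \<open>Kernel and image of \<open>L\<close> are invariant; a vector that \<open>L\<close> does
  not kill makes the first zero and the second everything.\<close>

lemma rep_schur:
  assumes \<rho>: "irreducible_rep G \<rho>" and \<sigma>: "irreducible_rep G \<sigma>"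
    and L: "L \<in> carrier_mat (rep_degree G \<sigma>) (rep_degree G \<rho>)"
    and w: "w \<in> carrier_vec (rep_degree G \<rho>)" "L *\<^sub>v w \<noteq> 0\<^sub>v (rep_degree G \<sigma>)"
    and int: "\<And>g v. g \<in> carrier G \<Longrightarrow> v \<in> carrier_vec (rep_degree G \<rho>) \<Longrightarrow> \<sigma> g *\<^sub>v (L *\<^sub>v v) = L *\<^sub>v (\<rho> g *\<^sub>v v)"
  shows "rep_equiv G \<rho> \<sigma>"
proof -
  define d where "d = rep_degree G \<rho>"
  define n where "n = rep_degree G \<sigma>"
  have L: "L \<in> carrier_mat n d" using L by (simp add: d_def n_def)
  have rm: "\<rho> g \<in> carrier_mat d d" if "g \<in> carrier G" for g
    using is_rep_mat[OF _ that] \<rho> by (simp add: d_def irreducible_rep_def)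
  have sm: "\<sigma> g \<in> carrier_mat n n" if "g \<in> carrier G" for g
    using is_rep_mat[OF _ that] \<sigma> by (simp add: n_def irreducible_rep_def)
  define Ker where "Ker = {v \<in> carrier_vec d. L *\<^sub>v v = 0\<^sub>v n}"
  have "lin_subspace d Ker" using L
    by (auto simp: Ker_def lin_subspace_def mult_add_distrib_mat_vec[OF L] mult_mat_vec[OF L])
  moreover have "\<rho> g *\<^sub>v v \<in> Ker" if g: "g \<in> carrier G" and v: "v \<in> Ker" for g v
    using int[OF g, of v] v rm[OF g] mult_mat_zero_vec[OF sm[OF g]]
    by (auto simp: Ker_def d_def[symmetric])
  moreover have "w \<notin> Ker" using w by (simp add: Ker_def n_def)
  ultimately have K0: "Ker = {0\<^sub>v d}" using \<rho> w(1) unfolding irreducible_rep_alt d_def by blast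
  define Im where "Im = {L *\<^sub>v v | v. v \<in> carrier_vec d}"
  have "lin_subspace n Im"
    unfolding lin_subspace_def
  proof (intro conjI ballI allI)
    show "Im \<subseteq> carrier_vec n" using L by (auto simp: Im_def)
    show "0\<^sub>v n \<in> Im" unfolding Im_def using mult_mat_zero_vec[OF L] zero_carrier_vec[of d] by (auto intro!: exI[of _ "0\<^sub>v d"])
    fix x assume x: "x \<in> Im" then obtain v where v: "v \<in> carrier_vec d" "x = L *\<^sub>v v" by (auto simp: Im_def)
    show "c \<cdot>\<^sub>v x \<in> Im" for c unfolding Im_def using v L by (auto intro!: exI[of _ "c \<cdot>\<^sub>v v"] simp: mult_mat_vec[OF L])
    fix y assume "y \<in> Im" then obtain u where u: "u \<in> carrier_vec d" "y = L *\<^sub>v u" by (auto simp: Im_def)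
    show "x + y \<in> Im" unfolding Im_def
      using u v L by (auto intro!: exI[of _ "v + u"] simp: mult_add_distrib_mat_vec[OF L])
  qed
  moreover have "\<sigma> g *\<^sub>v v \<in> Im" if g: "g \<in> carrier G" and v: "v \<in> Im" for g v
    using int[OF g] v rm[OF g] unfolding Im_def d_def[symmetric] by force
  moreover have "L *\<^sub>v w \<in> Im" using w(1) by (auto simp: Im_def d_def)
  ultimately have I: "Im = carrier_vec n" using \<sigma> w(2) unfolding irreducible_rep_alt n_def by blast
  have "\<exists>x. x \<in> carrier_vec d \<and> L *\<^sub>v x = unit_vec n i" for i
  proof -
    have "unit_vec n i \<in> Im" unfolding I by simp
    then show ?thesis by (auto simp: Im_def)
  qed
  then obtain x where x: "\<And>i. x i \<in> carrier_vec d" "\<And>i. L *\<^sub>v x i = unit_vec n i" by metis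
  \<comment> \<open>Preimages of the unit vectors are the columns of a right inverse; injectivity of
    \<open>L\<close> makes it two-sided.\<close>
  define X where "X = Matrix.mat d n (\<lambda>(i, j). x j $v i)"
  have X: "X \<in> carrier_mat d n" by (simp add: X_def)
  have LX: "L * X = 1\<^sub>m n"
  proof (rule eq_matI)
    fix i j assume ij: "i < dim_row (1\<^sub>m n)" "j < dim_col (1\<^sub>m n)"
    have "(L * X) $$ (i, j) = (L *\<^sub>v x j) $v i"
      using ij L x(1)[of j] by (auto simp: X_def scalar_prod_def intro!: sum.cong)
    then show "(L * X) $$ (i, j) = 1\<^sub>m n $$ (i, j)" using ij x(2)[of j] by auto
  qed (use L X in auto)
  have XL: "X * L = 1\<^sub>m d"
  proof (rule mat_eq_by_vec[of _ d d])
    fix v :: "complex Matrix.vec" assume v: "v \<in> carrier_vec d"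
    have "L *\<^sub>v (X *\<^sub>v (L *\<^sub>v v)) = L *\<^sub>v v"
      using v L X LX by (simp add: assoc_mult_mat_vec[of L n d X n "L *\<^sub>v v", symmetric])
    then have "X *\<^sub>v (L *\<^sub>v v) - v \<in> Ker"
      using v L X by (simp add: Ker_def mult_minus_distrib_mat_vec[OF L])
    then have 0: "X *\<^sub>v (L *\<^sub>v v) - v = 0\<^sub>v d" using K0 by simp
    have "X *\<^sub>v (L *\<^sub>v v) = v"
    proof (rule eq_vecI)
      fix i assume i: "i < dim_vec v"
      have "(X *\<^sub>v (L *\<^sub>v v) - v) $v i = 0" using 0 i v by simp
      then show "(X *\<^sub>v (L *\<^sub>v v)) $v i = v $v i" using i v X by simp
    qed (use X v in auto)
    then show "(X * L) *\<^sub>v v = 1\<^sub>m d *\<^sub>v v" using v L X by simp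
  qed (use X L in auto)
  have dn: "d = n" using left_inverse_dim_le[OF L X XL] left_inverse_dim_le[OF X L LX] by simp
  have invL: "invertible_mat L" unfolding invertible_mat_def inverts_mat_def
    using L X LX XL dn by auto
  have "L * \<rho> g = \<sigma> g * L" if g: "g \<in> carrier G" for g
    using int[OF g] L rm[OF g] sm[OF g] by (intro mat_eq_by_vec[of _ n d]) (auto simp: d_def)
  then show ?thesis unfolding rep_equiv_def
    using \<rho> \<sigma> dn L invL by (auto simp: irreducible_rep_def d_def n_def)
qed

text \<open>An eigenspace of one operator is invariant under all of them. So every operator is a
  scalar, and every line is invariant.\<close>

lemma irreducible_commuting_degree_1:
  assumes \<rho>: "irreducible_rep G \<rho>"
    and comm: "\<And>g h. g \<in> carrier G \<Longrightarrow> h \<in> carrier G \<Longrightarrow> \<rho> g * \<rho> h = \<rho> h * \<rho> g"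
  shows "rep_degree G \<rho> = 1"
proof -
  define d where "d = rep_degree G \<rho>"
  have d0: "d > 0" using \<rho> by (simp add: irreducible_rep_def d_def)
  have rm: "\<rho> g \<in> carrier_mat d d" if "g \<in> carrier G" for g
    using is_rep_mat[OF _ that] \<rho> by (simp add: d_def irreducible_rep_def)
  have scal: "\<exists>c. \<forall>v\<in>carrier_vec d. \<rho> g *\<^sub>v v = c \<cdot>\<^sub>v v" if g: "g \<in> carrier G" for g
  proof -
    from spectrum_non_empty[OF rm[OF g] d0] obtain c where "c \<in> spectrum (\<rho> g)" by auto
    then have "eigenvalue (\<rho> g) c" by (simp add: spectrum_def)
    then obtain v where v: "v \<in> carrier_vec d" "v \<noteq> 0\<^sub>v d" "\<rho> g *\<^sub>v v = c \<cdot>\<^sub>v v"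
      using rm[OF g] unfolding eigenvalue_def eigenvector_def by auto
    define W where "W = {v \<in> carrier_vec d. \<rho> g *\<^sub>v v = c \<cdot>\<^sub>v v}"
    have "lin_subspace d W" using rm[OF g]
      by (auto simp: W_def lin_subspace_def mult_add_distrib_mat_vec[OF rm[OF g]] mult_mat_vec[OF rm[OF g]]
          smult_add_distrib_vec smult_smult_assoc mult.commute)
    moreover have "\<rho> h *\<^sub>v w \<in> W" if h: "h \<in> carrier G" and w: "w \<in> W" for h w
    proof -
      have wc: "w \<in> carrier_vec d" using w by (simp add: W_def)
      have "\<rho> g *\<^sub>v (\<rho> h *\<^sub>v w) = (\<rho> g * \<rho> h) *\<^sub>v w" using rm[OF g] rm[OF h] wc by simp
      also have "\<dots> = \<rho> h *\<^sub>v (\<rho> g *\<^sub>v w)" using comm[OF g h] rm[OF g] rm[OF h] wc by simp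
      also have "\<dots> = c \<cdot>\<^sub>v (\<rho> h *\<^sub>v w)" using w wc by (simp add: W_def mult_mat_vec[OF rm[OF h]])
      finally show ?thesis using rm[OF h] wc by (simp add: W_def)
    qed
    moreover have "v \<in> W" using v by (simp add: W_def)
    ultimately have "W = carrier_vec d"
      using irreducible_rep_full[OF \<rho>, of W v] v(2) by (simp add: d_def)
    then show ?thesis by (auto simp: W_def)
  qed
  define W where "W = {c \<cdot>\<^sub>v unit_vec d 0 | c :: complex. True}"
  have Wc: "W \<subseteq> carrier_vec d" by (auto simp: W_def)
  have "lin_subspace d W"
    unfolding lin_subspace_def
  proof (intro conjI ballI allI)
    have "0\<^sub>v d = (0::complex) \<cdot>\<^sub>v unit_vec d 0" by (intro eq_vecI) auto
    then show "0\<^sub>v d \<in> W" unfolding W_def by blast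
    fix v assume "v \<in> W" then obtain a where a: "v = a \<cdot>\<^sub>v unit_vec d 0" by (auto simp: W_def)
    show "c \<cdot>\<^sub>v v \<in> W" for c unfolding W_def a by (auto simp: smult_smult_assoc)
    fix w assume "w \<in> W" then obtain b where b: "w = b \<cdot>\<^sub>v unit_vec d 0" by (auto simp: W_def)
    have "v + w = (a + b) \<cdot>\<^sub>v unit_vec d 0" unfolding a b by (simp add: add_smult_distrib_vec)
    then show "v + w \<in> W" unfolding W_def by blast
  qed (rule Wc)
  moreover have "\<rho> g *\<^sub>v w \<in> W" if "g \<in> carrier G" "w \<in> W" for g w
  proof -
    from scal[OF that(1)] obtain c where c: "\<forall>v\<in>carrier_vec d. \<rho> g *\<^sub>v v = c \<cdot>\<^sub>v v" by blast
    then have "\<rho> g *\<^sub>v w = c \<cdot>\<^sub>v w" using that(2) Wc by blast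
    then show ?thesis using that(2) by (auto simp: W_def smult_smult_assoc)
  qed
  moreover have "unit_vec d 0 \<in> W" unfolding W_def by (auto intro!: exI[of _ 1])
  moreover have "unit_vec d 0 \<noteq> (0\<^sub>v d :: complex Matrix.vec)"
  proof
    assume "unit_vec d 0 = (0\<^sub>v d :: complex Matrix.vec)"
    then have "unit_vec d 0 $v 0 = (0\<^sub>v d :: complex Matrix.vec) $v 0" by simp
    then show False using d0 by simp
  qed
  ultimately have full: "W = carrier_vec d"
    using irreducible_rep_full[OF \<rho>, of W "unit_vec d 0"] by (simp add: d_def)
  have "\<not> d > 1"
  proof
    assume d1: "d > 1"
    have "unit_vec d 1 \<in> W" using full by simp
    then obtain c :: complex where c: "unit_vec d 1 = c \<cdot>\<^sub>v unit_vec d 0" by (auto simp: W_def)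
    have "unit_vec d 1 $v 1 = (c \<cdot>\<^sub>v unit_vec d 0) $v 1" by (simp only: c)
    then show False using d1 by simp
  qed
  then show ?thesis using d0 by (simp add: d_def)
qed

section \<open>Equivalence of matrix representations\<close>

lemma rep_equiv_vec:
  assumes "rep_equiv G \<rho> \<sigma>"
  obtains P R where "P \<in> carrier_mat (rep_degree G \<rho>) (rep_degree G \<rho>)" "R \<in> carrier_mat (rep_degree G \<rho>) (rep_degree G \<rho>)"
    "P * R = 1\<^sub>m (rep_degree G \<rho>)" "R * P = 1\<^sub>m (rep_degree G \<rho>)" "\<forall>g\<in>carrier G. P * \<rho> g = \<sigma> g * P"
    "is_rep G \<rho>" "is_rep G \<sigma>" "rep_degree G \<sigma> = rep_degree G \<rho>"
proof -
  have r: "is_rep G \<rho>" "is_rep G \<sigma>" "rep_degree G \<sigma> = rep_degree G \<rho>"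
    using assms by (simp_all add: rep_equiv_def)
  from assms obtain P where P: "P \<in> carrier_mat (rep_degree G \<rho>) (rep_degree G \<rho>)" "invertible_mat P"
    "\<forall>g\<in>carrier G. P * \<rho> g = \<sigma> g * P" unfolding rep_equiv_def by blast
  from P(1,2) obtain R where R: "P * R = 1\<^sub>m (rep_degree G \<rho>)" "R * P = 1\<^sub>m (dim_row R)"
    unfolding invertible_mat_def inverts_mat_def by auto
  \<comment> \<open>\<open>inverts_mat\<close> leaves the size of \<open>R\<close> open; comparing
    dimensions in the two products determines it.\<close>
  have "dim_row R = rep_degree G \<rho>" using arg_cong[OF R(2), of dim_col] P(1) by simp
  moreover have "dim_col R = rep_degree G \<rho>" using arg_cong[OF R(1), of dim_col] by simp
  ultimately have Rc: "R \<in> carrier_mat (rep_degree G \<rho>) (rep_degree G \<rho>)" by auto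
  show thesis
    using that[OF P(1) Rc R(1) _ P(3) r] R(2) Rc by simp
qed

lemma rep_equivI:
  assumes "is_rep G \<rho>" "is_rep G \<sigma>" "rep_degree G \<sigma> = rep_degree G \<rho>"
    "P \<in> carrier_mat (rep_degree G \<rho>) (rep_degree G \<rho>)" "R \<in> carrier_mat (rep_degree G \<rho>) (rep_degree G \<rho>)"
    "P * R = 1\<^sub>m (rep_degree G \<rho>)" "R * P = 1\<^sub>m (rep_degree G \<rho>)" "\<And>g. g \<in> carrier G \<Longrightarrow> P * \<rho> g = \<sigma> g * P"
  shows "rep_equiv G \<rho> \<sigma>"
  unfolding rep_equiv_def invertible_mat_def inverts_mat_def using assms by (auto intro!: bexI[of _ P] exI[of _ R])

lemma rep_equiv_refl: assumes "is_rep G \<rho>" shows "rep_equiv G \<rho> \<rho>"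
proof (rule rep_equivI[of G \<rho> \<rho> "1\<^sub>m (rep_degree G \<rho>)" "1\<^sub>m (rep_degree G \<rho>)"])
  fix g assume "g \<in> carrier G"
  from is_rep_mat[OF assms this] show "1\<^sub>m (rep_degree G \<rho>) * \<rho> g = \<rho> g * 1\<^sub>m (rep_degree G \<rho>)"
    by simp
qed (use assms in auto)

lemma rep_equiv_sym: assumes "rep_equiv G \<rho> \<sigma>" shows "rep_equiv G \<sigma> \<rho>"
proof -
  obtain P R where *: "P \<in> carrier_mat (rep_degree G \<rho>) (rep_degree G \<rho>)" "R \<in> carrier_mat (rep_degree G \<rho>) (rep_degree G \<rho>)"
    "P * R = 1\<^sub>m (rep_degree G \<rho>)" "R * P = 1\<^sub>m (rep_degree G \<rho>)" "\<forall>g\<in>carrier G. P * \<rho> g = \<sigma> g * P"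
    "is_rep G \<rho>" "is_rep G \<sigma>" "rep_degree G \<sigma> = rep_degree G \<rho>" using rep_equiv_vec[OF assms] by blast
  let ?d = "rep_degree G \<rho>"
  have "R * \<sigma> g = \<rho> g * R" if g: "g \<in> carrier G" for g
  proof -
    have r: "\<rho> g \<in> carrier_mat ?d ?d" "\<sigma> g \<in> carrier_mat ?d ?d" using is_rep_mat[OF _ g] * by metis+
    have "R * \<sigma> g = R * \<sigma> g * (P * R)" using r * by simp
    also have "\<dots> = R * (\<sigma> g * P) * R" using r *(1,2)
      by (simp add: assoc_mult_mat[of _ ?d ?d _ ?d _ ?d])
    also have "\<dots> = R * (P * \<rho> g) * R" using bspec[OF *(5) g] by simp
    also have "\<dots> = (R * P) * (\<rho> g * R)" using r *(1,2)
      by (simp add: assoc_mult_mat[of _ ?d ?d _ ?d _ ?d])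
    finally show ?thesis using r * by simp
  qed
  then show ?thesis using * by (intro rep_equivI[of G \<sigma> \<rho> R P]) auto
qed

lemma rep_equiv_trans: assumes "rep_equiv G \<rho> \<sigma>" "rep_equiv G \<sigma> \<tau>" shows "rep_equiv G \<rho> \<tau>"
proof -
  obtain P R where *: "P \<in> carrier_mat (rep_degree G \<rho>) (rep_degree G \<rho>)" "R \<in> carrier_mat (rep_degree G \<rho>) (rep_degree G \<rho>)"
    "P * R = 1\<^sub>m (rep_degree G \<rho>)" "R * P = 1\<^sub>m (rep_degree G \<rho>)" "\<forall>g\<in>carrier G. P * \<rho> g = \<sigma> g * P"
    "is_rep G \<rho>" "is_rep G \<sigma>" "rep_degree G \<sigma> = rep_degree G \<rho>" using rep_equiv_vec[OF assms(1)] by blast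
  obtain P' R' where **: "P' \<in> carrier_mat (rep_degree G \<sigma>) (rep_degree G \<sigma>)" "R' \<in> carrier_mat (rep_degree G \<sigma>) (rep_degree G \<sigma>)"
    "P' * R' = 1\<^sub>m (rep_degree G \<sigma>)" "R' * P' = 1\<^sub>m (rep_degree G \<sigma>)" "\<forall>g\<in>carrier G. P' * \<sigma> g = \<tau> g * P'"
    "is_rep G \<sigma>" "is_rep G \<tau>" "rep_degree G \<tau> = rep_degree G \<sigma>" using rep_equiv_vec[OF assms(2)] by blast
  let ?d = "rep_degree G \<rho>"
  note as = assoc_mult_mat[of _ ?d ?d _ ?d _ ?d]
  have c: "P' \<in> carrier_mat ?d ?d" "R' \<in> carrier_mat ?d ?d" using ** * by auto
  show ?thesis
  proof (rule rep_equivI[of G \<rho> \<tau> "P' * P" "R * R'"])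
    have "P' * P * (R * R') = P' * ((P * R) * R')" using c *(1,2) by (simp add: as)
    also have "\<dots> = 1\<^sub>m ?d" using c * **(3) by simp
    finally show "P' * P * (R * R') = 1\<^sub>m ?d" .
    have "R * R' * (P' * P) = R * ((R' * P') * P)" using c *(1,2) by (simp add: as)
    also have "\<dots> = 1\<^sub>m ?d" using c * **(4) by simp
    finally show "R * R' * (P' * P) = 1\<^sub>m ?d" .
    fix g assume g: "g \<in> carrier G"
    have r: "\<rho> g \<in> carrier_mat ?d ?d" "\<sigma> g \<in> carrier_mat ?d ?d" "\<tau> g \<in> carrier_mat ?d ?d"
      using is_rep_mat[OF _ g] * ** by metis+
    have "P' * P * \<rho> g = P' * (P * \<rho> g)" using c r * by (simp add: as)
    also have "\<dots> = (P' * \<sigma> g) * P" using c r *(1,2) bspec[OF *(5) g] by (simp add: as)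
    also have "\<dots> = \<tau> g * (P' * P)" using c r * bspec[OF **(5) g] by (simp add: as)
    finally show "P' * P * \<rho> g = \<tau> g * (P' * P)" .
  qed (use * ** c in auto)
qed

lemma rep_equiv_irreducible:
  assumes eq: "rep_equiv G \<rho> \<sigma>" and irr: "irreducible_rep G \<rho>"
  shows "irreducible_rep G \<sigma>"
proof -
  obtain P R where *: "P \<in> carrier_mat (rep_degree G \<rho>) (rep_degree G \<rho>)" "R \<in> carrier_mat (rep_degree G \<rho>) (rep_degree G \<rho>)"
    "P * R = 1\<^sub>m (rep_degree G \<rho>)" "R * P = 1\<^sub>m (rep_degree G \<rho>)" "\<forall>g\<in>carrier G. P * \<rho> g = \<sigma> g * P"
    "is_rep G \<rho>" "is_rep G \<sigma>" "rep_degree G \<sigma> = rep_degree G \<rho>" using rep_equiv_vec[OF eq] by blast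
  define d where "d = rep_degree G \<rho>"
  have P: "P \<in> carrier_mat d d" and R: "R \<in> carrier_mat d d" and PR: "P * R = 1\<^sub>m d" using * by (auto simp: d_def)
  have ds: "rep_degree G \<sigma> = d" using * by (simp add: d_def)
  have PRv: "P *\<^sub>v (R *\<^sub>v w) = w" if "w \<in> carrier_vec d" for w
    using left_inverse_cancel_vec[OF P R PR that] .
  show ?thesis unfolding irreducible_rep_alt ds
  proof (intro conjI allI impI)
    fix W assume W: "lin_subspace d W \<and> (\<forall>g\<in>carrier G. \<forall>w\<in>W. \<sigma> g *\<^sub>v w \<in> W)"
    define V where "V = {v \<in> carrier_vec d. P *\<^sub>v v \<in> W}"
    have "lin_subspace d V" using W P
      by (auto simp: V_def lin_subspace_def mult_add_distrib_mat_vec[OF P] mult_mat_vec[OF P] mult_mat_zero_vec[OF P])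
    moreover have "\<rho> g *\<^sub>v v \<in> V" if g: "g \<in> carrier G" and v: "v \<in> V" for g v
    proof -
      have rg: "\<rho> g \<in> carrier_mat d d" and sg: "\<sigma> g \<in> carrier_mat d d"
        using is_rep_mat[OF *(6) g] is_rep_mat[OF *(7) g] ds by (auto simp: d_def)
      have vc: "v \<in> carrier_vec d" using v by (simp add: V_def)
      have "P *\<^sub>v (\<rho> g *\<^sub>v v) = (P * \<rho> g) *\<^sub>v v" using P rg vc by simp
      also have "\<dots> = \<sigma> g *\<^sub>v (P *\<^sub>v v)" using P sg vc bspec[OF *(5) g] by simp
      finally show ?thesis using W v g rg vc by (simp add: V_def)
    qed
    ultimately have "V = {0\<^sub>v d} \<or> V = carrier_vec d"
      using irr unfolding irreducible_rep_alt d_def by blast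
    then show "W = {0\<^sub>v d} \<or> W = carrier_vec d"
    proof
      assume V0: "V = {0\<^sub>v d}"
      have "w = 0\<^sub>v d" if w: "w \<in> W" for w
      proof -
        have wc: "w \<in> carrier_vec d" using w W by (auto simp: lin_subspace_def)
        then have "R *\<^sub>v w \<in> V" using PRv w R by (simp add: V_def)
        then show ?thesis using V0 PRv[OF wc] mult_mat_zero_vec[OF P] by simp
      qed
      then show ?thesis using W by (auto simp: lin_subspace_def)
    next
      assume V: "V = carrier_vec d"
      have "w \<in> W" if w: "w \<in> carrier_vec d" for w
      proof -
        have "R *\<^sub>v w \<in> V" using V R w by simp
        then show ?thesis using PRv[OF w] by (simp add: V_def)
      qed
      then show ?thesis using W by (auto simp: lin_subspace_def)
    qed
  qed (use irr * ds d_def in \<open>auto simp: irreducible_rep_def\<close>)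
qed

lemma (in group) mult_inv_cancel [simp]:
  assumes "x \<in> carrier G" "y \<in> carrier G"
  shows "x \<otimes> (inv x \<otimes> y) = y" "inv x \<otimes> (x \<otimes> y) = y"
  using assms by (simp_all add: m_assoc[symmetric])

section \<open>Averaging over a finite group\<close>

text \<open>The dimension is an argument so that the empty sum is the zero vector of the right
  length.\<close>

definition vsum :: "nat \<Rightarrow> 'i set \<Rightarrow> ('i \<Rightarrow> complex Matrix.vec) \<Rightarrow> complex Matrix.vec" where
  "vsum n S F = Matrix.vec n (\<lambda>i. \<Sum>s\<in>S. F s $v i)"

lemma vsum_carrier [simp]: "vsum n S F \<in> carrier_vec n"
  by (simp add: vsum_def)

lemma vsum_index [simp]: "i < n \<Longrightarrow> vsum n S F $v i = (\<Sum>s\<in>S. F s $v i)"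
  by (simp add: vsum_def)

lemma mult_mat_vsum:
  assumes A: "A \<in> carrier_mat m n" and F: "\<And>s. s \<in> S \<Longrightarrow> F s \<in> carrier_vec n"
  shows "A *\<^sub>v vsum n S F = vsum m S (\<lambda>s. A *\<^sub>v F s)"
proof (rule eq_vecI)
  fix i assume i: "i < dim_vec (vsum m S (\<lambda>s. A *\<^sub>v F s))"
  then have i: "i < m" by (simp add: vsum_def)
  have "(A *\<^sub>v vsum n S F) $v i = (\<Sum>j\<in>{0..<n}. \<Sum>s\<in>S. A $$ (i, j) * F s $v j)"
    using A i by (auto simp: scalar_prod_def vsum_def sum_distrib_left intro!: sum.cong)
  also have "\<dots> = (\<Sum>s\<in>S. \<Sum>j\<in>{0..<n}. A $$ (i, j) * F s $v j)" by (rule sum.swap)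
  also have "\<dots> = (\<Sum>s\<in>S. (A *\<^sub>v F s) $v i)"
  proof (rule sum.cong[OF refl])
    fix s assume "s \<in> S"
    from F[OF this] show "(\<Sum>j\<in>{0..<n}. A $$ (i, j) * F s $v j) = (A *\<^sub>v F s) $v i"
      using A i by (auto simp: scalar_prod_def)
  qed
  finally show "(A *\<^sub>v vsum n S F) $v i = vsum m S (\<lambda>s. A *\<^sub>v F s) $v i" using i by simp
qed (use A in \<open>auto simp: vsum_def\<close>)

lemma smult_vsum:
  assumes "\<And>s. s \<in> S \<Longrightarrow> F s \<in> carrier_vec n"
  shows "c \<cdot>\<^sub>v vsum n S F = vsum n S (\<lambda>s. c \<cdot>\<^sub>v F s)"
  using carrier_vecD[OF assms] by (intro eq_vecI) (auto simp: vsum_def sum_distrib_left intro!: sum.cong)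

lemma vsum_cong: "(\<And>s. s \<in> S \<Longrightarrow> F s = F' s) \<Longrightarrow> vsum n S F = vsum n S F'"
  by (auto simp: vsum_def intro!: eq_vecI sum.cong)

lemma vsum_reindex:
  assumes "bij_betw h S T"
  shows "vsum n T F = vsum n S (\<lambda>s. F (h s))"
  by (simp add: vsum_def sum.reindex_bij_betw[OF assms, symmetric])

lemma vsum_const:
  assumes "\<And>s. s \<in> S \<Longrightarrow> F s = c s \<cdot>\<^sub>v w" "w \<in> carrier_vec n"
  shows "vsum n S F = (\<Sum>s\<in>S. c s) \<cdot>\<^sub>v w"
  using assms by (intro eq_vecI) (auto simp: vsum_def sum_distrib_right)

lemma vsum_mem:
  assumes "lin_subspace n W" "finite S" "\<And>s. s \<in> S \<Longrightarrow> F s \<in> W"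
  shows "vsum n S F \<in> W"
  using assms(2,3)
proof (induction S)
  case empty
  have "vsum n {} F = 0\<^sub>v n" by (auto simp: vsum_def)
  then show ?case using assms(1) by (simp add: lin_subspace_def)
next
  case (insert x S)
  have "F x \<in> carrier_vec n" using insert.prems assms(1) by (auto simp: lin_subspace_def)
  then have "vsum n (insert x S) F = F x + vsum n S F"
    using insert.hyps by (intro eq_vecI) (auto simp: vsum_def)
  then show ?case using insert assms(1) by (simp add: lin_subspace_def)
qed

section \<open>Linear characters and the projections attached to them\<close>

definition lin_char :: "('g, 'm) monoid_scheme \<Rightarrow> ('g \<Rightarrow> complex) \<Rightarrow> bool" where
  "lin_char G \<theta> \<longleftrightarrow> \<theta> \<one>\<^bsub>G\<^esub> = 1 \<and> (\<forall>x\<in>carrier G. \<forall>y\<in>carrier G. \<theta> (x \<otimes>\<^bsub>G\<^esub> y) = \<theta> x * \<theta> y)"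

lemma lin_char_inv:
  fixes G (structure)
  assumes "group G" "lin_char G \<theta>" "x \<in> carrier G"
  shows "\<theta> (inv\<^bsub>G\<^esub> x) * \<theta> x = 1" "\<theta> x \<noteq> 0"
proof -
  interpret group G by fact
  have "\<theta> (inv x \<otimes> x) = \<theta> (inv x) * \<theta> x"
    using assms(2,3) inv_closed[OF assms(3)] unfolding lin_char_def by blast
  then show 1: "\<theta> (inv x) * \<theta> x = 1"
    using assms(2) l_inv[OF assms(3)] by (simp add: lin_char_def)
  then show "\<theta> x \<noteq> 0" by auto
qed

text \<open>On a finite group the values are roots of unity, so conjugation is inversion. This
  rewrites the complex conjugate in \<open>rep_inner\<close> as the weight of an averaging
  operator.\<close>

lemma lin_char_cnj:
  fixes G (structure)
  assumes "group G" "finite (carrier G)" "lin_char G \<theta>" "x \<in> carrier G"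
  shows "cnj (\<theta> x) = \<theta> (inv\<^bsub>G\<^esub> x)"
proof -
  interpret group G by fact
  have "\<theta> (x [^] n) = \<theta> x ^ n" for n :: nat
    by (induction n) (use assms in \<open>auto simp: lin_char_def\<close>)
  then have "\<theta> x ^ Coset.order G = 1"
    using pow_order_eq_1[OF assms(4)] assms(3) by (metis lin_char_def)
  moreover have "Coset.order G > 0" using assms(2) order_gt_0_iff_finite by blast
  ultimately have "norm (\<theta> x) = 1"
    using power_eq_1_iff[of "\<theta> x" "Coset.order G"] by simp
  then have "cnj (\<theta> x) * \<theta> x = 1" by (simp add: complex_norm_square[symmetric] mult.commute)
  then show ?thesis using lin_char_inv[OF assms(1,3,4)] by (metis mult_right_cancel)
qed

text \<open>Translation by x permutes the group and multiplies the sum by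
  \<open>\<theta> x\<close>.\<close>

lemma sum_nontrivial_lin_char:
  fixes G (structure)
  assumes "group G" "lin_char G \<theta>" "x \<in> carrier G" "\<theta> x \<noteq> 1"
  shows "(\<Sum>g\<in>carrier G. \<theta> g) = 0"
proof -
  interpret group G by fact
  have b: "bij_betw (\<lambda>g. x \<otimes> g) (carrier G) (carrier G)"
    by (rule bij_betwI[of _ _ _ "\<lambda>g. inv x \<otimes> g"]) (use assms(3) in \<open>auto simp: m_assoc[symmetric]\<close>)
  have "(\<Sum>g\<in>carrier G. \<theta> g) = (\<Sum>g\<in>carrier G. \<theta> (x \<otimes> g))"
    by (rule sum.reindex_bij_betw[OF b, symmetric])
  also have "\<dots> = \<theta> x * (\<Sum>g\<in>carrier G. \<theta> g)"
    using assms by (simp add: lin_char_def sum_distrib_left)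
  finally show ?thesis using assms(4) by simp
qed

text \<open>Up to the factor \<open>card (carrier G)\<close>, this is the projection onto the
  \<theta>-eigenvectors.\<close>

definition char_avg :: "('g, 'm) monoid_scheme \<Rightarrow> ('g \<Rightarrow> complex mat) \<Rightarrow> ('g \<Rightarrow> complex) \<Rightarrow> complex Matrix.vec \<Rightarrow> complex Matrix.vec" where
  "char_avg G \<rho> \<theta> v = vsum (rep_degree G \<rho>) (carrier G) (\<lambda>x. \<theta> (inv\<^bsub>G\<^esub> x) \<cdot>\<^sub>v (\<rho> x *\<^sub>v v))"

lemma char_avg_eigen:
  fixes G (structure)
  assumes gr: "group G" and rep: "is_rep G \<rho>" and ch: "lin_char G \<theta>"
    and v: "v \<in> carrier_vec (rep_degree G \<rho>)" and h: "h \<in> carrier G"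
  shows "\<rho> h *\<^sub>v char_avg G \<rho> \<theta> v = \<theta> h \<cdot>\<^sub>v char_avg G \<rho> \<theta> v"
proof -
  interpret group G by fact
  let ?n = "rep_degree G \<rho>"
  note rm = is_rep_mat[OF rep]
  have rv: "\<rho> x *\<^sub>v v \<in> carrier_vec ?n" if "x \<in> carrier G" for x
    using rm[OF that] v by (rule mult_mat_vec_carrier)
  have b: "bij_betw (\<lambda>g. h \<otimes> g) (carrier G) (carrier G)"
    by (rule bij_betwI[of _ _ _ "\<lambda>g. inv h \<otimes> g"]) (use h in \<open>auto simp: m_assoc[symmetric]\<close>)
  have "\<rho> h *\<^sub>v char_avg G \<rho> \<theta> v = vsum ?n (carrier G) (\<lambda>x. \<rho> h *\<^sub>v (\<theta> (inv x) \<cdot>\<^sub>v (\<rho> x *\<^sub>v v)))"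
    unfolding char_avg_def using rv by (intro mult_mat_vsum[OF rm[OF h]]) auto
  also have "\<dots> = vsum ?n (carrier G) (\<lambda>x. \<theta> h \<cdot>\<^sub>v (\<theta> (inv (h \<otimes> x)) \<cdot>\<^sub>v (\<rho> (h \<otimes> x) *\<^sub>v v)))"
  proof (rule vsum_cong)
    fix x assume x: "x \<in> carrier G"
    have "\<theta> (inv (h \<otimes> x)) * \<theta> h = \<theta> (inv x)"
    proof -
      have "\<theta> (inv (h \<otimes> x)) * \<theta> h = \<theta> (inv (h \<otimes> x) \<otimes> h)" using ch h x by (simp add: lin_char_def)
      also have "inv (h \<otimes> x) \<otimes> h = inv x" using h x by (simp add: inv_mult_group m_assoc)
      finally show ?thesis .
    qed
    then have e: "\<theta> (inv x) = \<theta> h * \<theta> (inv (h \<otimes> x))" by (simp add: mult.commute)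
    show "\<rho> h *\<^sub>v (\<theta> (inv x) \<cdot>\<^sub>v (\<rho> x *\<^sub>v v)) = \<theta> h \<cdot>\<^sub>v (\<theta> (inv (h \<otimes> x)) \<cdot>\<^sub>v (\<rho> (h \<otimes> x) *\<^sub>v v))"
      unfolding is_rep_mult_vec[OF rep h x v] smult_smult_assoc e
      by (rule mult_mat_vec[OF rm[OF h] rv[OF x]])
  qed
  also have "\<dots> = \<theta> h \<cdot>\<^sub>v vsum ?n (carrier G) (\<lambda>x. \<theta> (inv (h \<otimes> x)) \<cdot>\<^sub>v (\<rho> (h \<otimes> x) *\<^sub>v v))"
    using rv h by (intro smult_vsum[symmetric]) auto
  also have "vsum ?n (carrier G) (\<lambda>x. \<theta> (inv (h \<otimes> x)) \<cdot>\<^sub>v (\<rho> (h \<otimes> x) *\<^sub>v v)) = char_avg G \<rho> \<theta> v"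
    unfolding char_avg_def by (rule vsum_reindex[OF b, symmetric])
  finally show ?thesis .
qed

lemma char_avg_of_eigen:
  fixes G (structure)
  assumes gr: "group G" and ch: "lin_char G \<theta>" and v: "v \<in> carrier_vec (rep_degree G \<rho>)"
    and ev: "\<And>x. x \<in> carrier G \<Longrightarrow> \<rho> x *\<^sub>v v = \<theta> x \<cdot>\<^sub>v v"
  shows "char_avg G \<rho> \<theta> v = of_nat (card (carrier G)) \<cdot>\<^sub>v v"
proof -
  have "char_avg G \<rho> \<theta> v = (\<Sum>x\<in>carrier G. 1) \<cdot>\<^sub>v v"
    unfolding char_avg_def
    by (rule vsum_const) (use ev lin_char_inv[OF gr ch] v in \<open>auto simp: smult_smult_assoc\<close>)
  then show ?thesis by simp
qed

text \<open>\<open>rep_inner\<close> is an average of traces, so the projection is needed as a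
  matrix as well.\<close>

lemma char_avg_mat:
  fixes G (structure)
  assumes rep: "is_rep G \<rho>" and v: "v \<in> carrier_vec (rep_degree G \<rho>)"
  shows "Matrix.mat (rep_degree G \<rho>) (rep_degree G \<rho>) (\<lambda>(i, j). \<Sum>x\<in>carrier G. \<theta> (inv x) * \<rho> x $$ (i, j)) *\<^sub>v v
    = char_avg G \<rho> \<theta> v"
    (is "?P *\<^sub>v v = _")
proof (rule eq_vecI)
  let ?n = "rep_degree G \<rho>"
  note rm = is_rep_mat[OF rep]
  fix i assume "i < dim_vec (char_avg G \<rho> \<theta> v)"
  then have i: "i < ?n" by (simp add: char_avg_def vsum_def)
  have "(?P *\<^sub>v v) $v i = (\<Sum>j\<in>{0..<?n}. \<Sum>x\<in>carrier G. \<theta> (inv x) * (\<rho> x $$ (i, j) * v $v j))"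
    using v i by (auto simp: scalar_prod_def sum_distrib_right mult.assoc intro!: sum.cong)
  also have "\<dots> = (\<Sum>x\<in>carrier G. \<Sum>j\<in>{0..<?n}. \<theta> (inv x) * (\<rho> x $$ (i, j) * v $v j))"
    by (rule sum.swap)
  also have "\<dots> = (\<Sum>x\<in>carrier G. (\<theta> (inv x) \<cdot>\<^sub>v (\<rho> x *\<^sub>v v)) $v i)"
  proof (rule sum.cong[OF refl])
    fix x assume x: "x \<in> carrier G"
    have "(\<rho> x *\<^sub>v v) $v i = (\<Sum>j\<in>{0..<?n}. \<rho> x $$ (i, j) * v $v j)"
      using rm[OF x] v i by (auto simp: scalar_prod_def)
    then show "(\<Sum>j\<in>{0..<?n}. \<theta> (inv x) * (\<rho> x $$ (i, j) * v $v j)) = (\<theta> (inv x) \<cdot>\<^sub>v (\<rho> x *\<^sub>v v)) $v i"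
      using rm[OF x] i by (simp add: sum_distrib_left)
  qed
  finally show "(?P *\<^sub>v v) $v i = char_avg G \<rho> \<theta> v $v i" using i by (simp add: char_avg_def vsum_def)
qed (simp add: char_avg_def vsum_def)

text \<open>The inner product with a linear character is the trace of the projection
  \<open>P\<close> onto its eigenvectors, and an idempotent of trace zero is zero. This turns the
  numerical condition in \<open>Irr_over\<close> into the existence of an eigenvector.\<close>

lemma rep_inner_lin_rep_iff:
  fixes G (structure)
  assumes gr: "group G" and fin: "finite (carrier G)" and rep: "is_rep G \<rho>" and ch: "lin_char G \<theta>"
  shows "rep_inner G \<rho> (lin_rep \<theta>) \<noteq> 0 \<longleftrightarrow>
    (\<exists>v\<in>carrier_vec (rep_degree G \<rho>). v \<noteq> 0\<^sub>v (rep_degree G \<rho>) \<and> (\<forall>g\<in>carrier G. \<rho> g *\<^sub>v v = \<theta> g \<cdot>\<^sub>v v))"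
proof -
  interpret group G by fact
  let ?n = "rep_degree G \<rho>"
  let ?c = "of_nat (card (carrier G)) :: complex"
  have c0: "?c \<noteq> 0" using fin by auto
  note rm = is_rep_mat[OF rep]
  define P0 where "P0 = Matrix.mat ?n ?n (\<lambda>(i, j). \<Sum>x\<in>carrier G. \<theta> (inv x) * \<rho> x $$ (i, j))"
  define P where "P = (1 / ?c) \<cdot>\<^sub>m P0"
  have P0: "P0 \<in> carrier_mat ?n ?n" by (simp add: P0_def)
  then have P: "P \<in> carrier_mat ?n ?n" by (simp add: P_def)
  have Pv: "P *\<^sub>v v = (1 / ?c) \<cdot>\<^sub>v char_avg G \<rho> \<theta> v" if v: "v \<in> carrier_vec ?n" for v
  proof -
    have "P *\<^sub>v v = (1 / ?c) \<cdot>\<^sub>v (P0 *\<^sub>v v)"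
      using P0 v by (intro eq_vecI) (auto simp: P_def)
    then show ?thesis using char_avg_mat[OF rep v] by (simp add: P0_def)
  qed
  have avgc: "char_avg G \<rho> \<theta> v \<in> carrier_vec ?n" for v by (simp add: char_avg_def)
  have Peig: "\<rho> g *\<^sub>v (P *\<^sub>v v) = \<theta> g \<cdot>\<^sub>v (P *\<^sub>v v)" if "v \<in> carrier_vec ?n" "g \<in> carrier G" for v g
    unfolding Pv[OF that(1)] mult_mat_vec[OF rm[OF that(2)] avgc]
      char_avg_eigen[OF gr rep ch that] smult_smult_assoc by (simp add: mult.commute)
  have Pfix: "P *\<^sub>v v = v" if "v \<in> carrier_vec ?n" "\<And>g. g \<in> carrier G \<Longrightarrow> \<rho> g *\<^sub>v v = \<theta> g \<cdot>\<^sub>v v" for v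
    using char_avg_of_eigen[OF gr ch, of v \<rho>] that c0 by (simp add: Pv smult_smult_assoc)
  have PP: "P * P = P"
  proof (rule mat_eq_by_vec[of _ ?n ?n])
    fix v :: "complex Matrix.vec" assume v: "v \<in> carrier_vec ?n"
    show "(P * P) *\<^sub>v v = P *\<^sub>v v" using Pfix[of "P *\<^sub>v v"] Peig[OF v] P v by simp
  qed (use P in auto)
  have "rep_inner G \<rho> (lin_rep \<theta>) = (\<Sum>i<?n. P $$ (i, i))"
  proof -
    have cc: "rep_character G (lin_rep \<theta>) g = \<theta> g" for g
      by (simp add: rep_character_def lin_rep_def rep_degree_def)
    have "rep_inner G \<rho> (lin_rep \<theta>) = (\<Sum>x\<in>carrier G. \<Sum>i<?n. \<theta> (inv x) * \<rho> x $$ (i, i)) / ?c"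
      unfolding rep_inner_def cc unfolding rep_character_def sum_distrib_right
      by (intro arg_cong2[where f = "(/)"] sum.cong refl) (simp add: lin_char_cnj[OF gr fin ch])
    also have "\<dots> = (\<Sum>i<?n. (\<Sum>x\<in>carrier G. \<theta> (inv x) * \<rho> x $$ (i, i)) / ?c)"
      by (subst sum.swap) (simp add: sum_divide_distrib)
    finally show ?thesis by (simp add: P_def P0_def)
  qed
  moreover have "(\<Sum>i<?n. P $$ (i, i)) = 0 \<longleftrightarrow> P = 0\<^sub>m ?n ?n"
    using idempotent_trace_eq_0[OF P PP] by (auto intro!: sum.neutral)
  moreover have "P \<noteq> 0\<^sub>m ?n ?n \<longleftrightarrow> (\<exists>v\<in>carrier_vec ?n. v \<noteq> 0\<^sub>v ?n \<and> (\<forall>g\<in>carrier G. \<rho> g *\<^sub>v v = \<theta> g \<cdot>\<^sub>v v))"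
  proof
    assume "P \<noteq> 0\<^sub>m ?n ?n"
    then obtain v where v: "v \<in> carrier_vec ?n" "P *\<^sub>v v \<noteq> 0\<^sub>m ?n ?n *\<^sub>v v"
      using mat_eq_by_vec[OF P, of "0\<^sub>m ?n ?n"] by auto
    moreover have "0\<^sub>m ?n ?n *\<^sub>v v = 0\<^sub>v ?n" using v(1) by (intro eq_vecI) auto
    ultimately show "\<exists>v\<in>carrier_vec ?n. v \<noteq> 0\<^sub>v ?n \<and> (\<forall>g\<in>carrier G. \<rho> g *\<^sub>v v = \<theta> g \<cdot>\<^sub>v v)"
      using Peig[OF v(1)] P by (intro bexI[of _ "P *\<^sub>v v"]) auto
  next
    assume "\<exists>v\<in>carrier_vec ?n. v \<noteq> 0\<^sub>v ?n \<and> (\<forall>g\<in>carrier G. \<rho> g *\<^sub>v v = \<theta> g \<cdot>\<^sub>v v)"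
    then obtain v where v: "v \<in> carrier_vec ?n" "v \<noteq> 0\<^sub>v ?n" "\<And>g. g \<in> carrier G \<Longrightarrow> \<rho> g *\<^sub>v v = \<theta> g \<cdot>\<^sub>v v" by blast
    show "P \<noteq> 0\<^sub>m ?n ?n"
    proof
      assume "P = 0\<^sub>m ?n ?n"
      then have "P *\<^sub>v v = 0\<^sub>v ?n" using v(1) by (intro eq_vecI) auto
      with Pfix[OF v(1,3)] v(2) show False by simp
    qed
  qed
  ultimately show ?thesis by auto
qed

section \<open>Induced representations\<close>

text \<open>\<open>r\<close> chooses from a predicate that depends on g only through its coset, so
  its values are representatives without repetition.\<close>

lemma (in group) exists_left_transversal:
  assumes fin: "finite (carrier G)" and H: "subgroup H G"
  shows "\<exists>ts. left_transversal G H ts"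
proof -
  interpret H: subgroup H G by fact
  define r where "r g = (SOME x. x \<in> carrier G \<and> inv x \<otimes> g \<in> H)" for g
  have r: "r g \<in> carrier G" "inv (r g) \<otimes> g \<in> H" if "g \<in> carrier G" for g
    using someI[of "\<lambda>x. x \<in> carrier G \<and> inv x \<otimes> g \<in> H" g] that by (auto simp: r_def)
  have eq: "r g = r g'" if g: "g \<in> carrier G" "g' \<in> carrier G" and m: "inv g \<otimes> g' \<in> H" for g g'
  proof -
    have "inv x \<otimes> g \<in> H \<longleftrightarrow> inv x \<otimes> g' \<in> H" if x: "x \<in> carrier G" for x
    proof
      assume "inv x \<otimes> g \<in> H"
      then have "(inv x \<otimes> g) \<otimes> (inv g \<otimes> g') \<in> H" using m by simp
      then show "inv x \<otimes> g' \<in> H" using g x by (simp add: m_assoc)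
    next
      assume "inv x \<otimes> g' \<in> H"
      then have "(inv x \<otimes> g') \<otimes> inv (inv g \<otimes> g') \<in> H" using m by simp
      then show "inv x \<otimes> g \<in> H" using g x by (simp add: m_assoc inv_mult_group)
    qed
    then have "(\<lambda>x. x \<in> carrier G \<and> inv x \<otimes> g \<in> H) = (\<lambda>x. x \<in> carrier G \<and> inv x \<otimes> g' \<in> H)" by auto
    then show ?thesis unfolding r_def by simp
  qed
  obtain ts where ts: "set ts = r ` carrier G" "distinct ts"
    using finite_distinct_list[of "r ` carrier G"] fin by auto
  have "left_transversal G H ts"
    unfolding left_transversal_def
  proof (intro conjI ballI)
    show "set ts \<subseteq> carrier G" using ts r by auto
    fix g assume g: "g \<in> carrier G"
    have "r g \<in> set ts" using ts g by auto
    then obtain i where i: "i < length ts" "ts ! i = r g" by (auto simp: in_set_conv_nth)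
    show "\<exists>!i. i < length ts \<and> inv (ts ! i) \<otimes> g \<in> H"
    proof (rule ex1I[of _ i])
      show "i < length ts \<and> inv (ts ! i) \<otimes> g \<in> H" using i r[OF g] by simp
      fix j assume j: "j < length ts \<and> inv (ts ! j) \<otimes> g \<in> H"
      then have "ts ! j \<in> r ` carrier G" using ts(1) nth_mem by blast
      then obtain g' where g': "g' \<in> carrier G" "ts ! j = r g'" by auto
      have "inv (inv (r g') \<otimes> g') \<otimes> (inv (r g') \<otimes> g) \<in> H" using r[OF g'(1)] j g'(2) by simp
      then have "inv g' \<otimes> g \<in> H"
        using g g'(1) r(1)[OF g'(1)] by (simp add: inv_mult_group m_assoc)
      then have "r g' = r g" by (rule eq[OF g'(1) g])
      then have "ts ! j = ts ! i" using g' i by simp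
      then show "j = i" using nth_eq_iff_index_eq[OF ts(2)] i j by blast
    qed
  qed
  then show ?thesis ..
qed

text \<open>
  A vector of the induced representation is handled as the function \<open>f\<close> on \<open>G\<close> with
  \<open>f (g h) = \<rho> (h\<inverse>) (f g)\<close> for \<open>h \<in> H\<close> whose values at the coset representatives are the blocks;
  \<open>G\<close> then acts by left translation.
\<close>

locale induced_rep = group G for G (structure) +
  fixes H :: "'a set" and \<rho> :: "'a \<Rightarrow> complex mat"
  assumes fin: "finite (carrier G)" and H: "subgroup H G" and rep: "is_rep (G\<lparr>carrier := H\<rparr>) \<rho>"
begin

definition n where "n = rep_degree (G\<lparr>carrier := H\<rparr>) \<rho>"
text \<open>The same choice as inside \<open>Ind\<close>, so that block a of a vector is the value
  at \<open>ts ! a\<close>.\<close>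

definition ts where "ts = (SOME ts. left_transversal G H ts)"
definition idx where "idx g = (THE i. i < length ts \<and> inv (ts ! i) \<otimes> g \<in> H)"
definition N where "N = length ts * n"

definition fn :: "complex Matrix.vec \<Rightarrow> 'a \<Rightarrow> complex Matrix.vec" where
  "fn v g = \<rho> (inv g \<otimes> ts ! idx g) *\<^sub>v Matrix.vec n (\<lambda>i. v $v (idx g * n + i))"

lemma ts: "left_transversal G H ts"
  unfolding ts_def using someI_ex[OF exists_left_transversal[OF fin H]] .

lemma ts_carrier: "i < length ts \<Longrightarrow> ts ! i \<in> carrier G"
  using ts nth_mem unfolding left_transversal_def by blast

lemma idx: "g \<in> carrier G \<Longrightarrow> idx g < length ts \<and> inv (ts ! idx g) \<otimes> g \<in> H"
  using ts unfolding left_transversal_def idx_def by (metis (mono_tags, lifting) theI')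

lemma idx_unique: "g \<in> carrier G \<Longrightarrow> i < length ts \<Longrightarrow> inv (ts ! i) \<otimes> g \<in> H \<Longrightarrow> i = idx g"
  using ts idx[of g] unfolding left_transversal_def by blast

lemma H_sub: "h \<in> H \<Longrightarrow> h \<in> carrier G"
  using H subgroup.mem_carrier by metis

lemma H_closed: "h \<in> H \<Longrightarrow> k \<in> H \<Longrightarrow> h \<otimes> k \<in> H" "h \<in> H \<Longrightarrow> inv h \<in> H" "\<one> \<in> H"
  using H by (auto simp: subgroup.m_closed subgroup.m_inv_closed subgroup.one_closed)

lemma rho_mat: "h \<in> H \<Longrightarrow> \<rho> h \<in> carrier_mat n n"
  using is_rep_mat[OF rep] by (simp add: n_def)

lemma rho_vec: "h \<in> H \<Longrightarrow> v \<in> carrier_vec n \<Longrightarrow> \<rho> h *\<^sub>v v \<in> carrier_vec n"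
  by (rule mult_mat_vec_carrier[OF rho_mat])

lemma rho_mult: "h \<in> H \<Longrightarrow> k \<in> H \<Longrightarrow> v \<in> carrier_vec n \<Longrightarrow> \<rho> (h \<otimes> k) *\<^sub>v v = \<rho> h *\<^sub>v (\<rho> k *\<^sub>v v)"
  using is_rep_mult_vec[OF rep, of h k v] by (simp add: n_def)

lemma rho_one: "v \<in> carrier_vec n \<Longrightarrow> \<rho> \<one> *\<^sub>v v = v"
  using is_rep_one_vec[OF rep, of v] by (simp add: n_def)

lemma inv_idx: "g \<in> carrier G \<Longrightarrow> inv g \<otimes> ts ! idx g \<in> H"
  using idx[of g] H_closed(2)[of "inv (ts ! idx g) \<otimes> g"] ts_carrier by (simp add: inv_mult_group)

lemma fn_carrier [simp]: "g \<in> carrier G \<Longrightarrow> fn v g \<in> carrier_vec n"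
  unfolding fn_def by (rule rho_vec) (auto intro: inv_idx)

lemma fn_dim [simp]: "g \<in> carrier G \<Longrightarrow> dim_vec (fn v g) = n"
  by (rule carrier_vecD) simp

lemma idx_mult: "g \<in> carrier G \<Longrightarrow> h \<in> H \<Longrightarrow> idx (g \<otimes> h) = idx g"
  by (rule idx_unique[symmetric])
    (use idx[of g] ts_carrier H_sub H_closed(1)[of "inv (ts ! idx g) \<otimes> g" h] in \<open>auto simp: m_assoc\<close>)

lemma fn_mult: "g \<in> carrier G \<Longrightarrow> h \<in> H \<Longrightarrow> fn v (g \<otimes> h) = \<rho> (inv h) *\<^sub>v fn v g"
  using rho_mult[of "inv h" "inv g \<otimes> ts ! idx g" "Matrix.vec n (\<lambda>i. v $v (idx g * n + i))"]
    idx[of g] ts_carrier[of "idx g"] H_sub[of h] inv_idx[of g] H_closed(2)[of h]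
  by (simp add: fn_def idx_mult inv_mult_group m_assoc)

lemma idx_ts: "i < length ts \<Longrightarrow> idx (ts ! i) = i"
  by (rule idx_unique[symmetric]) (use ts_carrier H_closed in auto)

lemma fn_ts: "i < length ts \<Longrightarrow> fn v (ts ! i) = Matrix.vec n (\<lambda>j. v $v (i * n + j))"
  by (simp add: fn_def idx_ts ts_carrier rho_one)

lemma block_index: "i < length ts \<Longrightarrow> j < n \<Longrightarrow> i * n + j < N"
proof -
  assume "i < length ts" "j < n"
  then have "i * n + j < Suc i * n" by simp
  also have "\<dots> \<le> length ts * n" using \<open>i < length ts\<close> by (intro mult_le_mono1) simp
  finally show ?thesis by (simp add: N_def)
qed

lemma fn_eqI:
  assumes "v \<in> carrier_vec N" "w \<in> carrier_vec N" "\<And>g. g \<in> carrier G \<Longrightarrow> fn v g = fn w g"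
  shows "v = w"
proof (rule eq_vecI)
  fix k assume "k < dim_vec w"
  then have k: "k < length ts * n" using assms(2) by (simp add: N_def)
  then have n0: "n > 0" by (cases n) auto
  have q: "k div n < length ts" using k n0 by (simp add: less_mult_imp_div_less)
  have "fn v (ts ! (k div n)) $v (k mod n) = fn w (ts ! (k div n)) $v (k mod n)"
    using assms(3)[OF ts_carrier[OF q]] by simp
  then show "v $v k = w $v k" using q n0 by (simp add: fn_ts)
qed (use assms in auto)

text \<open>An equivariant function is determined by its values at the coset representatives, and
  these can be stacked freely into a vector. Together with \<open>fn_eqI\<close> this identifies
  vectors with equivariant functions.\<close>

lemma fn_surj:
  assumes c: "\<And>g. g \<in> carrier G \<Longrightarrow> \<phi> g \<in> carrier_vec n"
    and e: "\<And>g h. g \<in> carrier G \<Longrightarrow> h \<in> H \<Longrightarrow> \<phi> (g \<otimes> h) = \<rho> (inv h) *\<^sub>v \<phi> g"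
  shows "\<exists>v\<in>carrier_vec N. \<forall>g\<in>carrier G. fn v g = \<phi> g"
proof -
  define v where "v = Matrix.vec N (\<lambda>k. \<phi> (ts ! (k div n)) $v (k mod n))"
  have "fn v g = \<phi> g" if g: "g \<in> carrier G" for g
  proof -
    note i = idx[OF g] and t = ts_carrier[of "idx g"]
    have "fn v (ts ! idx g) = \<phi> (ts ! idx g)"
      unfolding fn_ts[OF conjunct1[OF i]]
      using c[OF t] i block_index[of "idx g"] by (intro eq_vecI) (auto simp: v_def)
    moreover have "g = ts ! idx g \<otimes> (inv (ts ! idx g) \<otimes> g)" using g t i by simp
    ultimately show ?thesis using fn_mult[of "ts ! idx g" "inv (ts ! idx g) \<otimes> g" v] e[of "ts ! idx g" "inv (ts ! idx g) \<otimes> g"] t i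
      by metis
  qed
  moreover have "v \<in> carrier_vec N" by (simp add: v_def)
  ultimately show ?thesis by blast
qed

lemma fn_add:
  assumes "v \<in> carrier_vec N" "w \<in> carrier_vec N" "g \<in> carrier G"
  shows "fn (v + w) g = fn v g + fn w g"
proof -
  note i = idx[OF assms(3)]
  have "Matrix.vec n (\<lambda>i. (v + w) $v (idx g * n + i)) = Matrix.vec n (\<lambda>i. v $v (idx g * n + i)) + Matrix.vec n (\<lambda>i. w $v (idx g * n + i))"
    using assms block_index[of "idx g"] i by (intro eq_vecI) auto
  then show ?thesis unfolding fn_def
    by (simp add: mult_add_distrib_mat_vec[OF rho_mat[OF inv_idx[OF assms(3)]]])
qed

lemma fn_smult:
  assumes "v \<in> carrier_vec N" "g \<in> carrier G"
  shows "fn (c \<cdot>\<^sub>v v) g = c \<cdot>\<^sub>v fn v g"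
proof -
  note i = idx[OF assms(2)]
  have "Matrix.vec n (\<lambda>i. (c \<cdot>\<^sub>v v) $v (idx g * n + i)) = c \<cdot>\<^sub>v Matrix.vec n (\<lambda>i. v $v (idx g * n + i))"
    using assms block_index[of "idx g"] i by (intro eq_vecI) auto
  then show ?thesis unfolding fn_def
    by (simp add: mult_mat_vec[OF rho_mat[OF inv_idx[OF assms(2)]]])
qed

lemma fn_vsum:
  assumes "\<And>s. s \<in> S \<Longrightarrow> F s \<in> carrier_vec N" "g \<in> carrier G"
  shows "fn (vsum N S F) g = vsum n S (\<lambda>s. fn (F s) g)"
proof -
  note i = idx[OF assms(2)]
  have "Matrix.vec n (\<lambda>i. (vsum N S F) $v (idx g * n + i)) = vsum n S (\<lambda>s. Matrix.vec n (\<lambda>i. F s $v (idx g * n + i)))"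
    using block_index[of "idx g"] i by (intro eq_vecI) (auto simp: vsum_def)
  then show ?thesis unfolding fn_def
    by (simp add: mult_mat_vsum[OF rho_mat[OF inv_idx[OF assms(2)]]])
qed

lemma fn_zero: "g \<in> carrier G \<Longrightarrow> fn (0\<^sub>v N) g = 0\<^sub>v n"
  using fn_vsum[of "{}" "\<lambda>_. 0\<^sub>v N" g] by (simp add: vsum_def zero_vec_def)

lemma Ind_mat: "Ind G H \<rho> x \<in> carrier_mat N N"
  by (simp add: Ind_def Let_def N_def n_def ts_def)

lemma Ind_vec: "v \<in> carrier_vec N \<Longrightarrow> Ind G H \<rho> x *\<^sub>v v \<in> carrier_vec N"
  using Ind_mat mult_mat_vec_carrier by blast

text \<open>In block row a of \<open>Ind G H \<rho> x\<close> the only nonzero block stands at the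
  representative t_b of the coset of x^-1 t_a, and it is the matrix by which equivariance carries
  the value at t_b to x^-1 t_a. Other points g follow by equivariance.\<close>

lemma fn_Ind:
  assumes x: "x \<in> carrier G" and v: "v \<in> carrier_vec N" and g: "g \<in> carrier G"
  shows "fn (Ind G H \<rho> x *\<^sub>v v) g = fn v (inv x \<otimes> g)"
proof -
  have ts_case: "fn (Ind G H \<rho> x *\<^sub>v v) (ts ! a) = fn v (inv x \<otimes> ts ! a)" if a: "a < length ts" for a
  proof (rule eq_vecI)
    note ta = ts_carrier[OF a]
    define b where "b = idx (inv x \<otimes> ts ! a)"
    have b: "b < length ts" "inv (ts ! b) \<otimes> (inv x \<otimes> ts ! a) \<in> H"
      using idx[of "inv x \<otimes> ts ! a"] x ta by (auto simp: b_def)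
    note tb = ts_carrier[OF b(1)]
    have inH: "inv (ts ! a) \<otimes> x \<otimes> ts ! c \<in> H \<longleftrightarrow> c = b" if c: "c < length ts" for c
    proof -
      note tc = ts_carrier[OF c]
      have e: "inv (inv (ts ! a) \<otimes> x \<otimes> ts ! c) = inv (ts ! c) \<otimes> (inv x \<otimes> ts ! a)"
        using x ta tc by (simp add: inv_mult_group m_assoc)
      have "inv (ts ! a) \<otimes> x \<otimes> ts ! c \<in> H \<longleftrightarrow> inv (ts ! c) \<otimes> (inv x \<otimes> ts ! a) \<in> H"
        using e H_closed(2) x ta tc by (metis inv_inv m_closed inv_closed)
      also have "\<dots> \<longleftrightarrow> c = b" using idx_unique[of "inv x \<otimes> ts ! a" c] b c x ta by (auto simp: b_def)
      finally show ?thesis .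
    qed
    have hb: "inv (ts ! a) \<otimes> x \<otimes> ts ! b \<in> H" using inH[OF b(1)] by simp
    fix i assume "i < dim_vec (fn v (inv x \<otimes> ts ! a))"
    then have i: "i < n" using x ta by simp
    let ?B = "\<lambda>c j. if inv (ts ! a) \<otimes> x \<otimes> ts ! c \<in> H then \<rho> (inv (ts ! a) \<otimes> x \<otimes> ts ! c) $$ (i, j) else 0"
    have "fn (Ind G H \<rho> x *\<^sub>v v) (ts ! a) $v i = (Ind G H \<rho> x *\<^sub>v v) $v (a * n + i)"
      using i by (simp add: fn_ts a)
    also have "\<dots> = (\<Sum>k\<in>{0..<length ts * n}. ?B (k div n) (k mod n) * v $v k)"
      using block_index[OF a i] v i
      by (auto simp: Ind_def Let_def N_def n_def[symmetric] ts_def[symmetric] scalar_prod_def intro!: sum.cong)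
    \<comment> \<open>Columns are regrouped by blocks, with k = c n + j.\<close>
    also have "\<dots> = (\<Sum>c<length ts. \<Sum>j<n. ?B c j * v $v (c * n + j))"
    proof -
      have "(\<Sum>k\<in>{0..<length ts * n}. ?B (k div n) (k mod n) * v $v k)
        = (\<Sum>k<length ts * n. ?B (k div n) (k mod n) * v $v k)" by (simp add: lessThan_atLeast0)
      also have "\<dots> = (\<Sum>c<length ts. \<Sum>j\<in>{c * n..<c * n + n}. ?B (j div n) (j mod n) * v $v j)"
        by (rule sum.nat_group[symmetric])
      also have "\<dots> = (\<Sum>c<length ts. \<Sum>j<n. ?B c j * v $v (c * n + j))"
      proof (rule sum.cong[OF refl])
        fix c
        have "(\<Sum>j\<in>{c * n..<c * n + n}. ?B (j div n) (j mod n) * v $v j) = (\<Sum>j\<in>{0 + c * n..<n + c * n}. ?B (j div n) (j mod n) * v $v j)"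
          by (simp add: add.commute)
        also have "\<dots> = (\<Sum>j\<in>{0..<n}. ?B ((j + c * n) div n) ((j + c * n) mod n) * v $v (j + c * n))"
          by (rule sum.shift_bounds_nat_ivl)
        also have "\<dots> = (\<Sum>j<n. ?B c j * v $v (c * n + j))"
          by (auto simp: lessThan_atLeast0 add.commute intro!: sum.cong)
        finally show "(\<Sum>j\<in>{c * n..<c * n + n}. ?B (j div n) (j mod n) * v $v j) = (\<Sum>j<n. ?B c j * v $v (c * n + j))" .
      qed
      finally show ?thesis .
    qed
    also have "\<dots> = (\<Sum>c<length ts. if c = b then (\<Sum>j<n. \<rho> (inv (ts ! a) \<otimes> x \<otimes> ts ! b) $$ (i, j) * v $v (b * n + j)) else 0)"
      by (rule sum.cong[OF refl]) (use inH in auto)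
    also have "\<dots> = (\<Sum>j<n. \<rho> (inv (ts ! a) \<otimes> x \<otimes> ts ! b) $$ (i, j) * v $v (b * n + j))"
      using b(1) by simp
    also have "\<dots> = (\<rho> (inv (ts ! a) \<otimes> x \<otimes> ts ! b) *\<^sub>v Matrix.vec n (\<lambda>j. v $v (b * n + j))) $v i"
      using rho_mat[OF hb] i by (auto simp: scalar_prod_def lessThan_atLeast0 intro!: sum.cong)
    also have "\<dots> = fn v (inv x \<otimes> ts ! a) $v i"
      using x ta tb by (simp add: fn_def b_def[symmetric] inv_mult_group)
    finally show "fn (Ind G H \<rho> x *\<^sub>v v) (ts ! a) $v i = fn v (inv x \<otimes> ts ! a) $v i" .
  next
    show "dim_vec (fn (Ind G H \<rho> x *\<^sub>v v) (ts ! a)) = dim_vec (fn v (inv x \<otimes> ts ! a))"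
      using ts_carrier[OF a] x by simp
  qed
  define h where "h = inv (ts ! idx g) \<otimes> g"
  have i: "idx g < length ts" "h \<in> H" using idx[OF g] by (auto simp: h_def)
  have t: "ts ! idx g \<in> carrier G" using i ts_carrier by simp
  have e: "g = ts ! idx g \<otimes> h" using g t by (simp add: h_def)
  have "fn (Ind G H \<rho> x *\<^sub>v v) (ts ! idx g \<otimes> h) = \<rho> (inv h) *\<^sub>v fn v (inv x \<otimes> ts ! idx g)"
    using fn_mult[OF t i(2)] ts_case[OF i(1)] by simp
  also have "\<dots> = fn v (inv x \<otimes> ts ! idx g \<otimes> h)" using fn_mult[of "inv x \<otimes> ts ! idx g" h v] x t i by simp
  also have "\<dots> = fn v (inv x \<otimes> (ts ! idx g \<otimes> h))" using x t i H_sub by (simp add: m_assoc)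
  finally show ?thesis using e by simp
qed

lemma Ind_degree: "rep_degree G (Ind G H \<rho>) = N"
  using carrier_matD(1)[OF Ind_mat] by (simp add: rep_degree_def)

lemma Ind_is_rep: "is_rep G (Ind G H \<rho>)"
  unfolding is_rep_def Ind_degree
proof (intro conjI ballI)
  show "Ind G H \<rho> g \<in> carrier_mat N N" for g by (rule Ind_mat)
  show "Ind G H \<rho> \<one> = 1\<^sub>m N"
  proof (rule mat_eq_by_vec[OF Ind_mat])
    fix v :: "complex Matrix.vec" assume v: "v \<in> carrier_vec N"
    have "Ind G H \<rho> \<one> *\<^sub>v v = v"
      by (rule fn_eqI) (use v in \<open>auto simp: fn_Ind Ind_vec\<close>)
    then show "Ind G H \<rho> \<one> *\<^sub>v v = 1\<^sub>m N *\<^sub>v v" using v by simp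
  qed simp
  fix x y assume x: "x \<in> carrier G" and y: "y \<in> carrier G"
  show "Ind G H \<rho> (x \<otimes> y) = Ind G H \<rho> x * Ind G H \<rho> y"
  proof (rule mat_eq_by_vec[OF Ind_mat])
    show "Ind G H \<rho> x * Ind G H \<rho> y \<in> carrier_mat N N" using Ind_mat by (rule mult_carrier_mat) (rule Ind_mat)
    fix v :: "complex Matrix.vec" assume v: "v \<in> carrier_vec N"
    have "Ind G H \<rho> (x \<otimes> y) *\<^sub>v v = Ind G H \<rho> x *\<^sub>v (Ind G H \<rho> y *\<^sub>v v)"
      by (rule fn_eqI) (use v x y in \<open>auto simp: fn_Ind Ind_vec inv_mult_group m_assoc\<close>)
    then show "Ind G H \<rho> (x \<otimes> y) *\<^sub>v v = (Ind G H \<rho> x * Ind G H \<rho> y) *\<^sub>v v"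
      by (simp add: assoc_mult_mat_vec[OF Ind_mat Ind_mat v])
  qed
qed

text \<open>The functions supported on \<open>H\<close> form a copy of \<open>\<rho>\<close> inside
  the induced representation; evaluation at 1 identifies the two.\<close>

lemma exists_supported:
  assumes w: "w \<in> carrier_vec n"
  shows "\<exists>v\<in>carrier_vec N. fn v \<one> = w \<and> (\<forall>g\<in>carrier G - H. fn v g = 0\<^sub>v n)"
proof -
  define \<phi> where "\<phi> g = (if g \<in> H then \<rho> (inv g) *\<^sub>v w else 0\<^sub>v n)" for g
  have "\<exists>v\<in>carrier_vec N. \<forall>g\<in>carrier G. fn v g = \<phi> g"
  proof (rule fn_surj)
    show "\<phi> g \<in> carrier_vec n" for g using rho_vec H_closed w by (auto simp: \<phi>_def)
    fix g h assume g: "g \<in> carrier G" and h: "h \<in> H"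
    have gh: "g \<otimes> h \<in> H \<longleftrightarrow> g \<in> H"
    proof
      assume "g \<otimes> h \<in> H"
      then have "(g \<otimes> h) \<otimes> inv h \<in> H" using H_closed h by blast
      then show "g \<in> H" using g H_sub[OF h] by (simp add: m_assoc)
    qed (use H_closed h in auto)
    show "\<phi> (g \<otimes> h) = \<rho> (inv h) *\<^sub>v \<phi> g"
    proof (cases "g \<in> H")
      case True
      then show ?thesis using gh g h H_sub[OF h] rho_mult[of "inv h" "inv g" w] H_closed(2) w
        by (simp add: \<phi>_def inv_mult_group)
    next
      case False
      then show ?thesis using gh mult_mat_zero_vec[OF rho_mat[OF H_closed(2)[OF h]]] by (simp add: \<phi>_def)
    qed
  qed
  then obtain v where v: "v \<in> carrier_vec N" "\<forall>g\<in>carrier G. fn v g = \<phi> g" by blast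
  have "fn v \<one> = w" using v(2) H_closed(3) rho_one[OF w] by (simp add: \<phi>_def)
  moreover have "\<forall>g\<in>carrier G - H. fn v g = 0\<^sub>v n" using v(2) by (simp add: \<phi>_def)
  ultimately show ?thesis using v(1) by blast
qed

lemma supported_unique:
  assumes "v \<in> carrier_vec N" "v' \<in> carrier_vec N" "fn v \<one> = fn v' \<one>"
    "\<And>g. g \<in> carrier G - H \<Longrightarrow> fn v g = 0\<^sub>v n" "\<And>g. g \<in> carrier G - H \<Longrightarrow> fn v' g = 0\<^sub>v n"
  shows "v = v'"
proof (rule fn_eqI[OF assms(1,2)])
  fix g assume g: "g \<in> carrier G"
  show "fn v g = fn v' g"
  proof (cases "g \<in> H")
    case True
    then show ?thesis using fn_mult[of \<one> g v] fn_mult[of \<one> g v'] assms(3) g by simp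
  next
    case False
    then show ?thesis using assms(4,5) g by simp
  qed
qed

lemma fn_one_Ind:
  assumes h: "h \<in> H" and v: "v \<in> carrier_vec N"
  shows "fn (Ind G H \<rho> h *\<^sub>v v) \<one> = \<rho> h *\<^sub>v fn v \<one>"
  using fn_Ind[OF H_sub[OF h] v one_closed] fn_mult[of \<one> "inv h" v] H_closed(2)[OF h] H_sub[OF h] by simp

lemma Ind_supported:
  assumes h: "h \<in> H" and v: "v \<in> carrier_vec N" and g: "g \<in> carrier G - H"
    and s: "\<And>g. g \<in> carrier G - H \<Longrightarrow> fn v g = 0\<^sub>v n"
  shows "fn (Ind G H \<rho> h *\<^sub>v v) g = 0\<^sub>v n"
proof -
  have "inv h \<otimes> g \<notin> H"
  proof
    assume "inv h \<otimes> g \<in> H"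
    then have "h \<otimes> (inv h \<otimes> g) \<in> H" using H_closed h by blast
    then show False using g H_sub[OF h] by simp
  qed
  then show ?thesis using fn_Ind[OF H_sub[OF h] v, of g] s[of "inv h \<otimes> g"] g H_sub[OF h] by simp
qed

definition emb :: "complex Matrix.vec \<Rightarrow> complex Matrix.vec" where
  "emb w = (SOME v. v \<in> carrier_vec N \<and> fn v \<one> = w \<and> (\<forall>g\<in>carrier G - H. fn v g = 0\<^sub>v n))"

lemma emb:
  assumes "w \<in> carrier_vec n"
  shows "emb w \<in> carrier_vec N" "fn (emb w) \<one> = w" "\<And>g. g \<in> carrier G - H \<Longrightarrow> fn (emb w) g = 0\<^sub>v n"
proof -
  have "emb w \<in> carrier_vec N \<and> fn (emb w) \<one> = w \<and> (\<forall>g\<in>carrier G - H. fn (emb w) g = 0\<^sub>v n)"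
    unfolding emb_def by (rule someI_ex) (use exists_supported[OF assms] in blast)
  then show "emb w \<in> carrier_vec N" "fn (emb w) \<one> = w" "\<And>g. g \<in> carrier G - H \<Longrightarrow> fn (emb w) g = 0\<^sub>v n"
    by blast+
qed

lemma emb_add: "v \<in> carrier_vec n \<Longrightarrow> w \<in> carrier_vec n \<Longrightarrow> emb (v + w) = emb v + emb w"
  by (rule supported_unique) (auto simp: emb fn_add)

lemma emb_smult: "w \<in> carrier_vec n \<Longrightarrow> emb (c \<cdot>\<^sub>v w) = c \<cdot>\<^sub>v emb w"
  by (rule supported_unique) (auto simp: emb fn_smult)

lemma emb_Ind: "h \<in> H \<Longrightarrow> w \<in> carrier_vec n \<Longrightarrow> Ind G H \<rho> h *\<^sub>v emb w = emb (\<rho> h *\<^sub>v w)"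
  by (rule supported_unique) (use Ind_supported[OF _ emb(1) _ emb(3)] in \<open>auto simp: emb Ind_vec rho_vec fn_one_Ind\<close>)

lemma emb_nonzero: "w \<in> carrier_vec n \<Longrightarrow> w \<noteq> 0\<^sub>v n \<Longrightarrow> emb w \<noteq> 0\<^sub>v N"
  using fn_zero[of \<one>] emb(2)[of w] by auto

text \<open>Frobenius reciprocity, in the form that a nonzero \<open>H\<close>-map \<open>\<rho> \<rightarrow> \<sigma>\<close> yields a nonzero \<open>G\<close>-map \<open>Ind \<rho> \<rightarrow> \<sigma>\<close>.\<close>
lemma Ind_equiv_if_intertwiner:
  assumes irr: "irreducible_rep G (Ind G H \<rho>)" and \<sigma>: "irreducible_rep G \<sigma>"
    and Lc: "\<And>w. w \<in> carrier_vec n \<Longrightarrow> L w \<in> carrier_vec (rep_degree G \<sigma>)"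
    and Ladd: "\<And>v w. v \<in> carrier_vec n \<Longrightarrow> w \<in> carrier_vec n \<Longrightarrow> L (v + w) = L v + L w"
    and Lsm: "\<And>c w. w \<in> carrier_vec n \<Longrightarrow> L (c \<cdot>\<^sub>v w) = c \<cdot>\<^sub>v L w"
    and int: "\<And>h w. h \<in> H \<Longrightarrow> w \<in> carrier_vec n \<Longrightarrow> L (\<rho> h *\<^sub>v w) = \<sigma> h *\<^sub>v L w"
    and w: "w \<in> carrier_vec n" "L w \<noteq> 0\<^sub>v (rep_degree G \<sigma>)"
  shows "rep_equiv G (Ind G H \<rho>) \<sigma>"
proof -
  define m where "m = rep_degree G \<sigma>"
  have rs: "is_rep G \<sigma>" using \<sigma> by (simp add: irreducible_rep_def)
  have sm: "\<sigma> g \<in> carrier_mat m m" if "g \<in> carrier G" for g using is_rep_mat[OF rs that] by (simp add: m_def)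
  note Lc = Lc[folded m_def]
  \<comment> \<open>Summing over all of G instead of coset representatives makes equivariance a mere
    reindexing; the price is the factor \<open>card H\<close> below.\<close>
  define T where "T v = vsum m (carrier G) (\<lambda>g. \<sigma> g *\<^sub>v L (fn v g))" for v
  have term_c: "\<sigma> g *\<^sub>v L (fn v g) \<in> carrier_vec m" if "g \<in> carrier G" for g v
    using mult_mat_vec_carrier[OF sm[OF that] Lc] that by simp
  have "\<exists>M\<in>carrier_mat m N. \<forall>v\<in>carrier_vec N. M *\<^sub>v v = T v"
  proof (rule linear_map_mat)
    show "T v \<in> carrier_vec m" for v by (simp add: T_def)
    fix v :: "complex Matrix.vec" assume v: "v \<in> carrier_vec N"
    have "T (c \<cdot>\<^sub>v v) = vsum m (carrier G) (\<lambda>g. c \<cdot>\<^sub>v (\<sigma> g *\<^sub>v L (fn v g)))" for c :: complex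
      unfolding T_def by (rule vsum_cong) (simp add: fn_smult[OF v] Lsm mult_mat_vec[OF sm Lc])
    then show "T (c \<cdot>\<^sub>v v) = c \<cdot>\<^sub>v T v" for c :: complex unfolding T_def using smult_vsum[of "carrier G"] term_c by simp
    fix u :: "complex Matrix.vec" assume u: "u \<in> carrier_vec N"
    have "T (v + u) = vsum m (carrier G) (\<lambda>g. \<sigma> g *\<^sub>v L (fn v g) + \<sigma> g *\<^sub>v L (fn u g))"
      unfolding T_def by (rule vsum_cong) (simp add: fn_add[OF v u] Ladd mult_add_distrib_mat_vec[OF sm Lc Lc])
    also have "\<dots> = T v + T u"
    proof (rule eq_vecI)
      fix i assume i: "i < dim_vec (T v + T u)"
      then have i: "i < m" by (simp add: T_def vsum_def)
      have d: "dim_vec (\<sigma> g *\<^sub>v L (fn v g)) = m" if "g \<in> carrier G" for v g using term_c[OF that, of v] by (rule carrier_vecD)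
      have "(\<Sum>g\<in>carrier G. (\<sigma> g *\<^sub>v L (fn v g) + \<sigma> g *\<^sub>v L (fn u g)) $v i)
        = (\<Sum>g\<in>carrier G. (\<sigma> g *\<^sub>v L (fn v g)) $v i + (\<sigma> g *\<^sub>v L (fn u g)) $v i)"
        by (rule sum.cong[OF refl], rule index_add_vec(1)) (use d i in simp)
      then show "vsum m (carrier G) (\<lambda>g. \<sigma> g *\<^sub>v L (fn v g) + \<sigma> g *\<^sub>v L (fn u g)) $v i = (T v + T u) $v i"
        using i by (simp add: T_def vsum_def sum.distrib del: index_mult_mat_vec)
    qed (simp add: T_def vsum_def)
    finally show "T (v + u) = T v + T u" .
  qed
  then obtain M where M: "M \<in> carrier_mat m N" and MT: "\<And>v. v \<in> carrier_vec N \<Longrightarrow> M *\<^sub>v v = T v" by blast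
  have Tint: "\<sigma> x *\<^sub>v T v = T (Ind G H \<rho> x *\<^sub>v v)" if x: "x \<in> carrier G" and v: "v \<in> carrier_vec N" for x v
  proof -
    have b: "bij_betw (\<lambda>g. x \<otimes> g) (carrier G) (carrier G)"
      by (rule bij_betwI[of _ _ _ "\<lambda>g. inv x \<otimes> g"]) (use x in auto)
    have "T (Ind G H \<rho> x *\<^sub>v v) = vsum m (carrier G) (\<lambda>g. \<sigma> (x \<otimes> g) *\<^sub>v L (fn (Ind G H \<rho> x *\<^sub>v v) (x \<otimes> g)))"
      unfolding T_def by (rule vsum_reindex[OF b])
    also have "\<dots> = vsum m (carrier G) (\<lambda>g. \<sigma> x *\<^sub>v (\<sigma> g *\<^sub>v L (fn v g)))"
    proof (rule vsum_cong)
      fix g assume g: "g \<in> carrier G"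
      have "fn (Ind G H \<rho> x *\<^sub>v v) (x \<otimes> g) = fn v g" using fn_Ind[OF x v, of "x \<otimes> g"] x g by simp
      then show "\<sigma> (x \<otimes> g) *\<^sub>v L (fn (Ind G H \<rho> x *\<^sub>v v) (x \<otimes> g)) = \<sigma> x *\<^sub>v (\<sigma> g *\<^sub>v L (fn v g))"
        using is_rep_mult_vec[OF rs x g, of "L (fn v g)"] Lc[of "fn v g"] g by (simp add: m_def)
    qed
    also have "\<dots> = \<sigma> x *\<^sub>v T v" unfolding T_def using term_c by (intro mult_mat_vsum[OF sm[OF x], symmetric]) auto
    finally show ?thesis by simp
  qed
  obtain v where v: "v \<in> carrier_vec N" "fn v \<one> = w" and supp: "\<And>g. g \<in> carrier G - H \<Longrightarrow> fn v g = 0\<^sub>v n"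
    using exists_supported[OF w(1)] by blast
  have L0: "L (0\<^sub>v n) = 0\<^sub>v m"
  proof -
    have "L (0 \<cdot>\<^sub>v 0\<^sub>v n) = 0 \<cdot>\<^sub>v L (0\<^sub>v n)" by (rule Lsm) simp
    moreover have "0 \<cdot>\<^sub>v 0\<^sub>v n = (0\<^sub>v n :: complex Matrix.vec)" by (intro eq_vecI) auto
    moreover have "0 \<cdot>\<^sub>v L (0\<^sub>v n) = 0\<^sub>v m" using Lc[of "0\<^sub>v n"] by (intro eq_vecI) auto
    ultimately show ?thesis by simp
  qed
  \<comment> \<open>On the copy of \<open>\<rho>\<close> supported on \<open>H\<close> each summand
    over \<open>H\<close> equals \<open>L w\<close> and the others vanish, so the result is a
    nonzero multiple of \<open>L w\<close>.\<close>
  have "T v = (\<Sum>g\<in>carrier G. if g \<in> H then 1 else 0) \<cdot>\<^sub>v L w"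
    unfolding T_def
  proof (rule vsum_const)
    fix g assume g: "g \<in> carrier G"
    show "\<sigma> g *\<^sub>v L (fn v g) = (if g \<in> H then 1 else 0) \<cdot>\<^sub>v L w"
    proof (cases "g \<in> H")
      case True
      have "fn v g = \<rho> (inv g) *\<^sub>v w" using fn_mult[of \<one> g v] True g v by simp
      then have "\<sigma> g *\<^sub>v L (fn v g) = \<sigma> g *\<^sub>v (\<sigma> (inv g) *\<^sub>v L w)" using int[of "inv g" w] H_closed(2)[OF True] w by simp
      also have "\<dots> = \<sigma> \<one> *\<^sub>v L w" using is_rep_mult_vec[OF rs g inv_closed[OF g], of "L w"] g Lc[OF w(1)] by (simp add: m_def)
      also have "\<dots> = L w" using is_rep_one_vec[OF rs] Lc[OF w(1)] by (simp add: m_def)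
      finally show ?thesis using True by simp
    next
      case False
      then show ?thesis using supp[of g] g mult_mat_zero_vec[OF sm[OF g]] L0 Lc[OF w(1)] by (auto intro!: eq_vecI)
    qed
  qed (rule Lc[OF w(1)])
  also have "(\<Sum>g\<in>carrier G. if g \<in> H then 1 else 0 :: complex) = of_nat (card H)"
    using fin H_sub by (simp add: sum.If_cases Int_absorb1 subsetI Collect_conj_eq)
  finally have Tv: "T v = of_nat (card H) \<cdot>\<^sub>v L w" .
  have cH: "card H > 0" using H_closed(3) fin H_sub by (metis card_gt_0_iff empty_iff finite_subset subsetI)
  have "T v \<noteq> 0\<^sub>v m"
  proof
    assume "T v = 0\<^sub>v m"
    then have "inverse (of_nat (card H)) \<cdot>\<^sub>v (of_nat (card H) \<cdot>\<^sub>v L w) = inverse (of_nat (card H)) \<cdot>\<^sub>v 0\<^sub>v m" using Tv by simp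
    then have "L w = inverse (of_nat (card H)) \<cdot>\<^sub>v 0\<^sub>v m" using cH by (simp add: smult_smult_assoc)
    then show False using w(2) by (auto simp: m_def)
  qed
  then show ?thesis
    using rep_schur[OF irr \<sigma>, of M v] M v MT Tint Ind_degree by (auto simp: m_def Ind_vec)
qed

end

section \<open>Clifford theory for a linear character of a normal subgroup\<close>

lemma is_rep_subset:
  assumes "is_rep (G\<lparr>carrier := M\<rparr>) \<rho>" "A \<subseteq> M"
  shows "is_rep (G\<lparr>carrier := A\<rparr>) \<rho>" "rep_degree (G\<lparr>carrier := A\<rparr>) \<rho> = rep_degree (G\<lparr>carrier := M\<rparr>) \<rho>"
  using assms by (auto simp: is_rep_def rep_degree_def)

lemma is_rep_restrict:
  assumes "is_rep G \<rho>" "A \<subseteq> carrier G"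
  shows "is_rep (G\<lparr>carrier := A\<rparr>) \<rho>" "rep_degree (G\<lparr>carrier := A\<rparr>) \<rho> = rep_degree G \<rho>"
  using assms by (auto simp: is_rep_def rep_degree_def)

lemma zero_smult_vec: "v \<in> carrier_vec n \<Longrightarrow> (0::complex) \<cdot>\<^sub>v v = 0\<^sub>v n"
  by (intro eq_vecI) auto

text \<open>To be applied with \<open>A\<close> the group S and \<open>M\<close> the group
  \<open>M_A\<close>. By \<open>commut\<close>, the representations of \<open>A\<close> over
  \<open>f\<close> are built from characters that extend \<open>f\<close>; by \<open>stab\<close>,
  whatever fixes \<open>f\<close> and one of these characters lies in \<open>M\<close>. The two
  conditions stand in for the usual assumption that \<open>M\<close> is the whole stabilizer of
  \<open>f\<close>.\<close>

locale clifford = group G for G (structure) +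
  fixes K A M :: "'a set" and f :: "'a \<Rightarrow> complex"
  assumes fin: "finite (carrier G)"
    and K: "subgroup K G" and A: "subgroup A G" and M: "subgroup M G"
    and KA: "K \<subseteq> A" and AM: "A \<subseteq> M"
    and K_norm: "\<And>g k. g \<in> carrier G \<Longrightarrow> k \<in> K \<Longrightarrow> g \<otimes> k \<otimes> inv g \<in> K"
    and f: "lin_char (G\<lparr>carrier := K\<rparr>) f"
    and f_M: "\<And>m k. m \<in> M \<Longrightarrow> k \<in> K \<Longrightarrow> f (m \<otimes> k \<otimes> inv m) = f k"
    and A_norm: "\<And>g x. g \<in> carrier G \<Longrightarrow> \<forall>k\<in>K. f (g \<otimes> k \<otimes> inv g) = f k \<Longrightarrow> x \<in> A \<Longrightarrow> g \<otimes> x \<otimes> inv g \<in> A"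
    and M_norm: "\<And>g x. g \<in> carrier G \<Longrightarrow> \<forall>k\<in>K. f (g \<otimes> k \<otimes> inv g) = f k \<Longrightarrow> x \<in> M \<Longrightarrow> g \<otimes> x \<otimes> inv g \<in> M"
    and commut: "\<And>x y. x \<in> A \<Longrightarrow> y \<in> A \<Longrightarrow> x \<otimes> y \<otimes> inv x \<otimes> inv y \<in> K \<and> f (x \<otimes> y \<otimes> inv x \<otimes> inv y) = 1"
    and stab: "\<And>\<theta> g. lin_char (G\<lparr>carrier := A\<rparr>) \<theta> \<Longrightarrow> \<forall>k\<in>K. \<theta> k = f k \<Longrightarrow> g \<in> carrier G \<Longrightarrow>
      \<forall>k\<in>K. f (g \<otimes> k \<otimes> inv g) = f k \<Longrightarrow> \<forall>x\<in>A. \<theta> (g \<otimes> x \<otimes> inv g) = \<theta> x \<Longrightarrow> g \<in> M"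
begin

definition C where "C = {g \<in> carrier G. \<forall>k\<in>K. f (g \<otimes> k \<otimes> inv g) = f k}"

abbreviation "GM \<equiv> G\<lparr>carrier := M\<rparr>"
abbreviation "GA \<equiv> G\<lparr>carrier := A\<rparr>"
abbreviation "GK \<equiv> G\<lparr>carrier := K\<rparr>"
abbreviation "dgr \<equiv> rep_degree GM"

text \<open>Here \<open>K\<close> acts by scalars on the whole space, not only on one vector: since
  \<open>M\<close> fixes \<open>f\<close>, a single eigenvector already forces this, see
  \<open>overI\<close>.\<close>

definition over :: "('a \<Rightarrow> complex mat) \<Rightarrow> bool" where
  "over \<rho> \<longleftrightarrow> irreducible_rep GM \<rho> \<and> (\<forall>k\<in>K. \<forall>v\<in>carrier_vec (dgr \<rho>). \<rho> k *\<^sub>v v = f k \<cdot>\<^sub>v v)"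

text \<open>A single eigenvector is asked for, because G may move \<open>f\<close>, and then the
  conjugates of \<open>f\<close> occur as well.\<close>

definition overG :: "('a \<Rightarrow> complex mat) \<Rightarrow> bool" where
  "overG \<sigma> \<longleftrightarrow> irreducible_rep G \<sigma> \<and> (\<exists>v\<in>carrier_vec (rep_degree G \<sigma>). v \<noteq> 0\<^sub>v (rep_degree G \<sigma>) \<and>
     (\<forall>k\<in>K. \<sigma> k *\<^sub>v v = f k \<cdot>\<^sub>v v))"

lemma sub: "m \<in> M \<Longrightarrow> m \<in> carrier G" "a \<in> A \<Longrightarrow> a \<in> carrier G" "k \<in> K \<Longrightarrow> k \<in> carrier G"
  using K A M subgroup.mem_carrier by metis+

lemma sub': "a \<in> A \<Longrightarrow> a \<in> M" "k \<in> K \<Longrightarrow> k \<in> A" "k \<in> K \<Longrightarrow> k \<in> M"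
  using KA AM by auto

lemma groups: "group GM" "group GA" "group GK"
  using K A M subgroup.subgroup_is_group is_group by blast+

lemma clo: "m \<in> M \<Longrightarrow> m' \<in> M \<Longrightarrow> m \<otimes> m' \<in> M" "m \<in> M \<Longrightarrow> inv m \<in> M" "\<one> \<in> M"
  "a \<in> A \<Longrightarrow> a' \<in> A \<Longrightarrow> a \<otimes> a' \<in> A" "a \<in> A \<Longrightarrow> inv a \<in> A" "\<one> \<in> A"
  "k \<in> K \<Longrightarrow> k' \<in> K \<Longrightarrow> k \<otimes> k' \<in> K" "k \<in> K \<Longrightarrow> inv k \<in> K" "\<one> \<in> K"
  using K A M by (auto simp: subgroup.m_closed subgroup.m_inv_closed subgroup.one_closed)

lemma MC: "m \<in> M \<Longrightarrow> m \<in> C"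
  using f_M sub by (auto simp: C_def)

lemma C_carrier: "g \<in> C \<Longrightarrow> g \<in> carrier G" by (simp add: C_def)

lemma f_C: "g \<in> C \<Longrightarrow> k \<in> K \<Longrightarrow> f (g \<otimes> k \<otimes> inv g) = f k" by (simp add: C_def)

lemma K_norm': "g \<in> carrier G \<Longrightarrow> k \<in> K \<Longrightarrow> inv g \<otimes> k \<otimes> g \<in> K"
  using K_norm[of "inv g" k] by simp

lemma C_inv: "g \<in> C \<Longrightarrow> inv g \<in> C"
proof -
  assume g: "g \<in> C"
  note gc = C_carrier[OF g]
  have "f (inv g \<otimes> k \<otimes> g) = f k" if k: "k \<in> K" for k
  proof -
    have "f (g \<otimes> (inv g \<otimes> k \<otimes> g) \<otimes> inv g) = f (inv g \<otimes> k \<otimes> g)"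
      by (rule f_C[OF g K_norm'[OF gc k]])
    moreover have "g \<otimes> (inv g \<otimes> k \<otimes> g) \<otimes> inv g = k" using gc sub(3)[OF k] by (simp add: m_assoc)
    ultimately show ?thesis by simp
  qed
  then show "inv g \<in> C" using gc by (simp add: C_def)
qed

lemma C_mult: "g \<in> C \<Longrightarrow> h \<in> C \<Longrightarrow> g \<otimes> h \<in> C"
proof -
  assume g: "g \<in> C" and h: "h \<in> C"
  note c = C_carrier[OF g] C_carrier[OF h]
  have "f (g \<otimes> h \<otimes> k \<otimes> inv (g \<otimes> h)) = f k" if k: "k \<in> K" for k
  proof -
    have "g \<otimes> h \<otimes> k \<otimes> inv (g \<otimes> h) = g \<otimes> (h \<otimes> k \<otimes> inv h) \<otimes> inv g"
      using c sub(3)[OF k] by (simp add: m_assoc inv_mult_group)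
    then show ?thesis using f_C[OF g K_norm[OF c(2) k]] f_C[OF h k] by simp
  qed
  then show ?thesis using c by (simp add: C_def)
qed

lemma A_conj: "g \<in> C \<Longrightarrow> a \<in> A \<Longrightarrow> g \<otimes> a \<otimes> inv g \<in> A"
  using A_norm unfolding C_def by blast

lemma A_conj': "g \<in> C \<Longrightarrow> a \<in> A \<Longrightarrow> inv g \<otimes> a \<otimes> g \<in> A"
  using A_conj[OF C_inv, of g a] C_carrier by simp

lemma M_conj: "g \<in> C \<Longrightarrow> a \<in> M \<Longrightarrow> g \<otimes> a \<otimes> inv g \<in> M"
  using M_norm unfolding C_def by blast

lemma M_conj': "g \<in> C \<Longrightarrow> a \<in> M \<Longrightarrow> inv g \<otimes> a \<otimes> g \<in> M"
  using M_conj[OF C_inv, of g a] C_carrier by simp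

lemma induced: "is_rep GM \<rho> \<Longrightarrow> induced_rep G M \<rho>"
  unfolding induced_rep_def induced_rep_axioms_def using fin M is_group by blast

lemma rep_GM_vec: "is_rep GM \<rho> \<Longrightarrow> m \<in> M \<Longrightarrow> v \<in> carrier_vec (dgr \<rho>) \<Longrightarrow> \<rho> m *\<^sub>v v \<in> carrier_vec (dgr \<rho>)"
  using is_rep_mat[of GM \<rho> m] mult_mat_vec_carrier by fastforce

lemma rep_GM_mult: "is_rep GM \<rho> \<Longrightarrow> m \<in> M \<Longrightarrow> m' \<in> M \<Longrightarrow> v \<in> carrier_vec (dgr \<rho>) \<Longrightarrow>
    \<rho> (m \<otimes> m') *\<^sub>v v = \<rho> m *\<^sub>v (\<rho> m' *\<^sub>v v)"
  using is_rep_mult_vec[of GM \<rho> m m' v] by simp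

lemma rep_GM_mat: "is_rep GM \<rho> \<Longrightarrow> m \<in> M \<Longrightarrow> \<rho> m \<in> carrier_mat (dgr \<rho>) (dgr \<rho>)"
  using is_rep_mat[of GM \<rho> m] by simp

lemma rep_GM_one: "is_rep GM \<rho> \<Longrightarrow> v \<in> carrier_vec (dgr \<rho>) \<Longrightarrow> \<rho> \<one> *\<^sub>v v = v"
  using is_rep_one_vec[of GM \<rho> v] by simp

lemma eigenspace_subspace:
  assumes "\<And>k. k \<in> S \<Longrightarrow> \<rho> k \<in> carrier_mat n n"
  shows "lin_subspace n {v \<in> carrier_vec n. \<forall>k\<in>S. \<rho> k *\<^sub>v v = c k \<cdot>\<^sub>v v}"
  unfolding lin_subspace_def
proof (intro conjI ballI allI)
  show "0\<^sub>v n \<in> {v \<in> carrier_vec n. \<forall>k\<in>S. \<rho> k *\<^sub>v v = c k \<cdot>\<^sub>v v}"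
    using mult_mat_zero_vec[OF assms] by auto
  fix v assume v: "v \<in> {v \<in> carrier_vec n. \<forall>k\<in>S. \<rho> k *\<^sub>v v = c k \<cdot>\<^sub>v v}"
  then show "a \<cdot>\<^sub>v v \<in> {v \<in> carrier_vec n. \<forall>k\<in>S. \<rho> k *\<^sub>v v = c k \<cdot>\<^sub>v v}" for a
    using mult_mat_vec[OF assms] by (auto simp: smult_smult_assoc mult.commute)
  fix w assume w: "w \<in> {v \<in> carrier_vec n. \<forall>k\<in>S. \<rho> k *\<^sub>v v = c k \<cdot>\<^sub>v v}"
  show "v + w \<in> {v \<in> carrier_vec n. \<forall>k\<in>S. \<rho> k *\<^sub>v v = c k \<cdot>\<^sub>v v}"
    using v w mult_add_distrib_mat_vec[OF assms] by (auto simp: smult_add_distrib_vec[of v n w])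
qed auto

text \<open>Conjugation by \<open>M\<close> fixes \<open>f\<close>, so the
  \<open>f\<close>-eigenspace of \<open>K\<close> is stable under \<open>M\<close>, and
  irreducibility makes it everything.\<close>

lemma overI:
  assumes irr: "irreducible_rep GM \<rho>"
    and v0: "v0 \<in> carrier_vec (dgr \<rho>)" "v0 \<noteq> 0\<^sub>v (dgr \<rho>)" "\<And>k. k \<in> K \<Longrightarrow> \<rho> k *\<^sub>v v0 = f k \<cdot>\<^sub>v v0"
  shows "over \<rho>"
proof -
  have rep: "is_rep GM \<rho>" using irr by (simp add: irreducible_rep_def)
  let ?n = "dgr \<rho>"
  let ?W = "{v \<in> carrier_vec ?n. \<forall>k\<in>K. \<rho> k *\<^sub>v v = f k \<cdot>\<^sub>v v}"
  have "?W = carrier_vec ?n"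
  proof (rule irreducible_rep_full[OF irr])
    show "lin_subspace ?n ?W" by (rule eigenspace_subspace) (use rep_GM_mat[OF rep] sub' in blast)
    fix m w assume m': "m \<in> carrier GM" and w: "w \<in> ?W"
    have m: "m \<in> M" using m' by simp
    have "\<rho> k *\<^sub>v (\<rho> m *\<^sub>v w) = f k \<cdot>\<^sub>v (\<rho> m *\<^sub>v w)" if k: "k \<in> K" for k
    proof -
      have k': "inv m \<otimes> k \<otimes> m \<in> K" using K_norm' m k sub by blast
      have fk: "f (inv m \<otimes> k \<otimes> m) = f k" using f_C[OF C_inv[OF MC[OF m]] k] sub(1)[OF m] by simp
      have "\<rho> k *\<^sub>v (\<rho> m *\<^sub>v w) = \<rho> (k \<otimes> m) *\<^sub>v w" using rep_GM_mult[OF rep, of k m w] m k w sub' by simp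
      also have "k \<otimes> m = m \<otimes> (inv m \<otimes> k \<otimes> m)" using m k sub by (simp add: m_assoc)
      also have "\<rho> (m \<otimes> (inv m \<otimes> k \<otimes> m)) *\<^sub>v w = \<rho> m *\<^sub>v (\<rho> (inv m \<otimes> k \<otimes> m) *\<^sub>v w)"
        using rep_GM_mult[OF rep m sub'(3)[OF k']] w by simp
      also have "\<dots> = \<rho> m *\<^sub>v (f k \<cdot>\<^sub>v w)" using w k' fk by auto
      also have "\<dots> = f k \<cdot>\<^sub>v (\<rho> m *\<^sub>v w)" using mult_mat_vec[OF rep_GM_mat[OF rep m]] w by simp
      finally show ?thesis .
    qed
    then show "\<rho> m *\<^sub>v w \<in> ?W" using rep_GM_vec[OF rep m] w by auto
  qed (use v0 in auto)
  then show ?thesis using irr unfolding over_def by blast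
qed

text \<open>Commutators of \<open>A\<close> lie in \<open>K\<close> and act by the scalar 1. So an
  irreducible subrepresentation of the restriction to \<open>A\<close> consists of commuting
  matrices and has degree 1.\<close>

lemma exists_A_eigenvector:
  assumes ov: "over \<rho>"
  shows "\<exists>w \<theta>. w \<in> carrier_vec (dgr \<rho>) \<and> w \<noteq> 0\<^sub>v (dgr \<rho>) \<and> lin_char GA \<theta> \<and> (\<forall>k\<in>K. \<theta> k = f k) \<and>
     (\<forall>a\<in>A. \<rho> a *\<^sub>v w = \<theta> a \<cdot>\<^sub>v w)"
proof -
  let ?n = "dgr \<rho>"
  have irr: "irreducible_rep GM \<rho>" and sc: "\<And>k v. k \<in> K \<Longrightarrow> v \<in> carrier_vec ?n \<Longrightarrow> \<rho> k *\<^sub>v v = f k \<cdot>\<^sub>v v"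
    using ov by (auto simp: over_def)
  have rep: "is_rep GM \<rho>" and n0: "?n > 0" using irr by (auto simp: irreducible_rep_def)
  note repA = is_rep_subset[OF rep AM]
  interpret GA: group GA by (rule groups)
  have uv: "unit_vec ?n 0 \<noteq> (0\<^sub>v ?n :: complex Matrix.vec)"
  proof
    assume "unit_vec ?n 0 = (0\<^sub>v ?n :: complex Matrix.vec)"
    then have "unit_vec ?n 0 $v 0 = (0\<^sub>v ?n :: complex Matrix.vec) $v 0" by simp
    then show False using n0 by simp
  qed
  have st: "\<And>g v. g \<in> carrier GA \<Longrightarrow> v \<in> carrier_vec ?n \<Longrightarrow> \<rho> g *\<^sub>v v \<in> carrier_vec ?n"
    using rep_GM_vec[OF rep] sub'(1) by simp
  have full: "lin_subspace ?n (carrier_vec ?n)" by (auto simp: lin_subspace_def)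
  obtain \<tau> d Q R where \<tau>: "irreducible_rep GA \<tau>" "rep_degree GA \<tau> = d" and Q: "Q \<in> carrier_mat ?n d"
    and R: "R \<in> carrier_mat d ?n" and RQ: "R * Q = 1\<^sub>m d" and int: "\<forall>a\<in>carrier GA. \<rho> a * Q = Q * \<tau> a"
    using exists_irreducible_subrep[OF repA(1) repA(2)[symmetric] full st unit_vec_carrier uv GA.one_closed GA.m_closed]
    by blast
  have rt: "is_rep GA \<tau>" using \<tau>(1) by (simp add: irreducible_rep_def)
  have tm: "\<tau> a \<in> carrier_mat d d" if "a \<in> A" for a using is_rep_mat[OF rt, of a] that \<tau>(2) by simp
  have tt: "\<tau> (a \<otimes> b) = \<tau> a * \<tau> b" if "a \<in> A" "b \<in> A" for a b using is_rep_mult[OF rt, of a b] that by simp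
  have intv: "\<rho> a *\<^sub>v (Q *\<^sub>v v) = Q *\<^sub>v (\<tau> a *\<^sub>v v)" if a: "a \<in> A" and v: "v \<in> carrier_vec d" for a v
  proof -
    have "\<rho> a *\<^sub>v (Q *\<^sub>v v) = (\<rho> a * Q) *\<^sub>v v" using assoc_mult_mat_vec[OF rep_GM_mat[OF rep sub'(1)[OF a]] Q v] by simp
    also have "\<dots> = (Q * \<tau> a) *\<^sub>v v" using int a by simp
    also have "\<dots> = Q *\<^sub>v (\<tau> a *\<^sub>v v)" by (rule assoc_mult_mat_vec[OF Q tm[OF a] v])
    finally show ?thesis .
  qed
  have tk: "\<tau> k = f k \<cdot>\<^sub>m 1\<^sub>m d" if k: "k \<in> K" for k
  proof (rule mat_eq_by_vec[OF tm[OF sub'(2)[OF k]]])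
    fix v :: "complex Matrix.vec" assume v: "v \<in> carrier_vec d"
    have tv: "\<tau> k *\<^sub>v v \<in> carrier_vec d" using tm[OF sub'(2)[OF k]] v by simp
    have "\<tau> k *\<^sub>v v = R *\<^sub>v (Q *\<^sub>v (\<tau> k *\<^sub>v v))" using left_inverse_cancel_vec[OF R Q RQ tv] by simp
    also have "\<dots> = R *\<^sub>v (f k \<cdot>\<^sub>v (Q *\<^sub>v v))" using intv[OF sub'(2)[OF k] v] sc[OF k] Q v by simp
    also have "\<dots> = f k \<cdot>\<^sub>v v" using mult_mat_vec[OF R, of "Q *\<^sub>v v"] Q v left_inverse_cancel_vec[OF R Q RQ v] by simp
    also have "\<dots> = (f k \<cdot>\<^sub>m 1\<^sub>m d) *\<^sub>v v" using v by (intro eq_vecI) auto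
    finally show "\<tau> k *\<^sub>v v = (f k \<cdot>\<^sub>m 1\<^sub>m d) *\<^sub>v v" .
  qed simp
  have "\<tau> a * \<tau> b = \<tau> b * \<tau> a" if a: "a \<in> A" and b: "b \<in> A" for a b
  proof -
    let ?c = "a \<otimes> b \<otimes> inv a \<otimes> inv b"
    have c: "?c \<in> K" "f ?c = 1" using commut[OF a b] by auto
    have "a \<otimes> b = ?c \<otimes> (b \<otimes> a)" using sub(2)[OF a] sub(2)[OF b] by (simp add: m_assoc)
    then have "\<tau> (a \<otimes> b) = \<tau> ?c * \<tau> (b \<otimes> a)" using tt[OF sub'(2)[OF c(1)] clo(4)[OF b a]] by simp
    also have "\<tau> ?c = 1\<^sub>m d" using tk[OF c(1)] c(2) by (intro eq_matI) auto
    also have "1\<^sub>m d * \<tau> (b \<otimes> a) = \<tau> (b \<otimes> a)" by (rule left_mult_one_mat[OF tm[OF clo(4)[OF b a]]])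
    finally show ?thesis using tt[OF a b] tt[OF b a] by simp
  qed
  then have d1: "d = 1" using irreducible_commuting_degree_1[OF \<tau>(1)] \<tau>(2) by simp
  define \<theta> where "\<theta> a = \<tau> a $$ (0, 0)" for a
  define w where "w = Q *\<^sub>v unit_vec d 0"
  have wc: "w \<in> carrier_vec ?n" using Q by (simp add: w_def)
  have w0: "w \<noteq> 0\<^sub>v ?n"
  proof
    assume "w = 0\<^sub>v ?n"
    then have "0\<^sub>v d = (unit_vec d 0 :: complex Matrix.vec)"
      using left_inverse_cancel_vec[OF R Q RQ, of "unit_vec d 0"] mult_mat_zero_vec[OF R] by (simp add: w_def)
    then have "(0\<^sub>v d :: complex Matrix.vec) $v 0 = unit_vec d 0 $v 0" by simp
    then show False using d1 by simp
  qed
  have ev: "\<rho> a *\<^sub>v w = \<theta> a \<cdot>\<^sub>v w" if a: "a \<in> A" for a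
  proof -
    have "\<tau> a *\<^sub>v unit_vec d 0 = \<theta> a \<cdot>\<^sub>v unit_vec d 0"
      using tm[OF a] d1 by (intro eq_vecI) (auto simp: \<theta>_def)
    then show ?thesis using intv[OF a, of "unit_vec d 0"] mult_mat_vec[OF Q, of "unit_vec d 0"] by (simp add: w_def)
  qed
  have "lin_char GA \<theta>"
    unfolding lin_char_def
  proof (intro conjI ballI)
    show "\<theta> \<one>\<^bsub>GA\<^esub> = 1" using is_rep_one[OF rt] \<tau>(2) d1 by (simp add: \<theta>_def)
    fix a b assume "a \<in> carrier GA" "b \<in> carrier GA"
    then show "\<theta> (a \<otimes>\<^bsub>GA\<^esub> b) = \<theta> a * \<theta> b"
      using tt[of a b] tm[of a] tm[of b] d1 by (simp add: \<theta>_def scalar_prod_def)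
  qed
  moreover have "\<forall>k\<in>K. \<theta> k = f k" using tk d1 by (simp add: \<theta>_def)
  ultimately show ?thesis using wc w0 ev by blast
qed

text \<open>
  \<open>\<rho>\<close> is spanned by the \<open>M\<close>-translates of \<open>w\<close>, so averaging against a character that is not
  \<open>M\<close>-conjugate to that of \<open>w\<close> kills \<open>\<rho>\<close>.
\<close>
lemma A_characters_conjugate:
  assumes ov: "over \<rho>"
    and w: "w \<in> carrier_vec (dgr \<rho>)" "w \<noteq> 0\<^sub>v (dgr \<rho>)" and \<theta>: "lin_char GA \<theta>"
    and ev: "\<And>a. a \<in> A \<Longrightarrow> \<rho> a *\<^sub>v w = \<theta> a \<cdot>\<^sub>v w"
    and w': "w' \<in> carrier_vec (dgr \<rho>)" "w' \<noteq> 0\<^sub>v (dgr \<rho>)" and \<theta>': "lin_char GA \<theta>'"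
    and ev': "\<And>a. a \<in> A \<Longrightarrow> \<rho> a *\<^sub>v w' = \<theta>' a \<cdot>\<^sub>v w'"
  shows "\<exists>m\<in>M. \<forall>a\<in>A. \<theta>' a = \<theta> (inv m \<otimes> a \<otimes> m)"
proof (rule ccontr)
  assume con: "\<not> ?thesis"
  let ?n = "dgr \<rho>"
  have irr: "irreducible_rep GM \<rho>" using ov by (auto simp: over_def)
  have rep: "is_rep GM \<rho>" using irr by (auto simp: irreducible_rep_def)
  note repA = is_rep_subset[OF rep AM]
  have finA: "finite A" using fin sub by (meson finite_subset subsetI)
  define P where "P = Matrix.mat ?n ?n (\<lambda>(i, j). \<Sum>x\<in>A. \<theta>' (inv\<^bsub>GA\<^esub> x) * \<rho> x $$ (i, j))"
  have P: "P \<in> carrier_mat ?n ?n" by (simp add: P_def)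
  have Pv: "P *\<^sub>v v = char_avg GA \<rho> \<theta>' v" if "v \<in> carrier_vec ?n" for v
    using char_avg_mat[OF repA(1), of v \<theta>'] that by (simp add: P_def repA(2))
  have kill: "P *\<^sub>v (\<rho> m *\<^sub>v w) = 0\<^sub>v ?n" if m: "m \<in> M" for m
  proof -
    have mc: "m \<in> carrier G" using sub m by blast
    have rmw: "\<rho> m *\<^sub>v w \<in> carrier_vec ?n" by (rule rep_GM_vec[OF rep m w(1)])
    \<comment> \<open>The quotient of a conjugate of \<theta> by \<theta>'. By assumption it is a
      nontrivial character, so it sums to zero.\<close>
    define \<eta> where "\<eta> x = \<theta>' (inv\<^bsub>GA\<^esub> x) * \<theta> (inv m \<otimes> x \<otimes> m)" for x
    have iA: "inv\<^bsub>GA\<^esub> x = inv x" if "x \<in> A" for x using m_inv_consistent[OF A that] .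
    have cj: "inv m \<otimes> x \<otimes> m \<in> A" if "x \<in> A" for x using A_conj'[OF MC[OF m] that] .
    have "char_avg GA \<rho> \<theta>' (\<rho> m *\<^sub>v w) = vsum ?n A (\<lambda>x. \<theta>' (inv\<^bsub>GA\<^esub> x) \<cdot>\<^sub>v (\<rho> x *\<^sub>v (\<rho> m *\<^sub>v w)))"
      by (simp add: char_avg_def repA(2))
    also have "\<dots> = (\<Sum>x\<in>A. \<eta> x) \<cdot>\<^sub>v (\<rho> m *\<^sub>v w)"
    proof (rule vsum_const)
      fix x assume x: "x \<in> A"
      have xc: "x \<in> carrier G" using sub x by blast
      have "\<rho> x *\<^sub>v (\<rho> m *\<^sub>v w) = \<rho> (m \<otimes> (inv m \<otimes> x \<otimes> m)) *\<^sub>v w"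
        using rep_GM_mult[OF rep sub'(1)[OF x] m w(1)] mc xc by (simp add: m_assoc)
      also have "\<dots> = \<rho> m *\<^sub>v (\<rho> (inv m \<otimes> x \<otimes> m) *\<^sub>v w)" by (rule rep_GM_mult[OF rep m sub'(1)[OF cj[OF x]] w(1)])
      also have "\<dots> = \<theta> (inv m \<otimes> x \<otimes> m) \<cdot>\<^sub>v (\<rho> m *\<^sub>v w)"
        using ev[OF cj[OF x]] mult_mat_vec[OF rep_GM_mat[OF rep m] w(1)] by simp
      finally show "\<theta>' (inv\<^bsub>GA\<^esub> x) \<cdot>\<^sub>v (\<rho> x *\<^sub>v (\<rho> m *\<^sub>v w)) = \<eta> x \<cdot>\<^sub>v (\<rho> m *\<^sub>v w)"
        by (simp add: \<eta>_def smult_smult_assoc)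
    qed (rule rmw)
    finally have e: "char_avg GA \<rho> \<theta>' (\<rho> m *\<^sub>v w) = (\<Sum>x\<in>A. \<eta> x) \<cdot>\<^sub>v (\<rho> m *\<^sub>v w)" .
    have lc: "lin_char GA \<eta>"
      unfolding lin_char_def
    proof (intro conjI ballI)
      show "\<eta> \<one>\<^bsub>GA\<^esub> = 1" using iA[OF clo(6)] \<theta> \<theta>' mc by (simp add: \<eta>_def lin_char_def)
      fix x y assume "x \<in> carrier GA" "y \<in> carrier GA"
      then have x: "x \<in> A" and y: "y \<in> A" by auto
      note c = sub(2)[OF x] sub(2)[OF y]
      have 1: "\<theta>' (inv (x \<otimes> y)) = \<theta>' (inv x) * \<theta>' (inv y)"
      proof -
        have "\<theta>' (inv (x \<otimes> y)) = \<theta>' (inv y \<otimes> inv x)" using c by (simp add: inv_mult_group)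
        then show ?thesis using \<theta>' clo(5)[OF x] clo(5)[OF y] by (simp add: lin_char_def)
      qed
      have "inv m \<otimes> (x \<otimes> y) \<otimes> m = (inv m \<otimes> x \<otimes> m) \<otimes> (inv m \<otimes> y \<otimes> m)" using c mc by (simp add: m_assoc)
      then have "\<theta> (inv m \<otimes> (x \<otimes> y) \<otimes> m) = \<theta> (inv m \<otimes> x \<otimes> m) * \<theta> (inv m \<otimes> y \<otimes> m)"
        using \<theta> cj[OF x] cj[OF y] by (simp add: lin_char_def)
      then show "\<eta> (x \<otimes>\<^bsub>GA\<^esub> y) = \<eta> x * \<eta> y"
        using 1 iA x y clo(4)[OF x y] by (simp add: \<eta>_def)
    qed
    obtain a where a: "a \<in> A" "\<theta>' a \<noteq> \<theta> (inv m \<otimes> a \<otimes> m)" using con m by blast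
    have "\<eta> a \<noteq> 1"
    proof
      assume "\<eta> a = 1"
      then have "\<theta>' (inv\<^bsub>GA\<^esub> a) * \<theta> (inv m \<otimes> a \<otimes> m) = \<theta>' (inv\<^bsub>GA\<^esub> a) * \<theta>' a"
        using lin_char_inv(1)[OF groups(2) \<theta>', of a] a by (simp add: \<eta>_def)
      moreover have "\<theta>' (inv\<^bsub>GA\<^esub> a) \<noteq> 0"
        using lin_char_inv(1)[OF groups(2) \<theta>', of a] a by auto
      ultimately show False using a(2) by simp
    qed
    then have "(\<Sum>x\<in>A. \<eta> x) = 0" using sum_nontrivial_lin_char[OF groups(2) lc, of a] a by simp
    then show ?thesis using Pv[OF rmw] e zero_smult_vec[OF rmw] by simp
  qed
  \<comment> \<open>Asking this for all translates at once makes the space invariant under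
    \<open>M\<close>.\<close>
  define Y where "Y = {v \<in> carrier_vec ?n. \<forall>m\<in>M. P *\<^sub>v (\<rho> m *\<^sub>v v) = 0\<^sub>v ?n}"
  have "Y = carrier_vec ?n"
  proof (rule irreducible_rep_full[OF irr])
    have zero: "(0::complex) \<cdot>\<^sub>v 0\<^sub>v ?n = 0\<^sub>v ?n" "c \<cdot>\<^sub>v 0\<^sub>v ?n = (0\<^sub>v ?n :: complex Matrix.vec)" for c by auto
    show "lin_subspace ?n Y" unfolding lin_subspace_def
    proof (intro conjI ballI allI)
      show "0\<^sub>v ?n \<in> Y" using mult_mat_zero_vec[OF rep_GM_mat[OF rep]] mult_mat_zero_vec[OF P] by (simp add: Y_def)
      fix v assume v: "v \<in> Y"
      show "c \<cdot>\<^sub>v v \<in> Y" for c using v mult_mat_vec[OF rep_GM_mat[OF rep]] mult_mat_vec[OF P] rep_GM_vec[OF rep]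
        by (simp add: Y_def zero)
      fix u assume u: "u \<in> Y"
      show "v + u \<in> Y" using v u mult_add_distrib_mat_vec[OF rep_GM_mat[OF rep]] mult_add_distrib_mat_vec[OF P] rep_GM_vec[OF rep]
        by (simp add: Y_def)
    qed (auto simp: Y_def)
    fix m v assume m': "m \<in> carrier GM" and v: "v \<in> Y"
    have m: "m \<in> M" using m' by simp
    have "P *\<^sub>v (\<rho> m' *\<^sub>v (\<rho> m *\<^sub>v v)) = 0\<^sub>v ?n" if "m' \<in> M" for m'
      using rep_GM_mult[OF rep that m, of v, symmetric] v clo(1)[OF that m] by (simp add: Y_def)
    then show "\<rho> m *\<^sub>v v \<in> Y" using rep_GM_vec[OF rep m] v by (simp add: Y_def)
  qed (use w kill in \<open>auto simp: Y_def\<close>)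
  then have "w' \<in> Y" using w' by simp
  then have "P *\<^sub>v (\<rho> \<one> *\<^sub>v w') = 0\<^sub>v ?n" using clo(3) unfolding Y_def by blast
  then have 0: "P *\<^sub>v w' = 0\<^sub>v ?n" using rep_GM_one[OF rep w'(1)] by simp
  have "char_avg GA \<rho> \<theta>' w' = of_nat (card A) \<cdot>\<^sub>v w'"
    using char_avg_of_eigen[OF groups(2) \<theta>', of w' \<rho>] w' ev' by (simp add: repA(2))
  then have e0: "of_nat (card A) \<cdot>\<^sub>v w' = 0\<^sub>v ?n" using 0 Pv[OF w'(1)] by simp
  have "card A > 0" using finA clo(6) by (auto simp: card_gt_0_iff)
  then have "w' = (1 / of_nat (card A)) \<cdot>\<^sub>v (of_nat (card A) \<cdot>\<^sub>v w')" by (simp add: smult_smult_assoc)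
  also have "\<dots> = 0\<^sub>v ?n" unfolding e0 by auto
  finally show False using w'(2) by simp
qed

end

section \<open>Irreducibility of the induced representation\<close>

context clifford
begin

lemma over_is_rep: "over \<rho> \<Longrightarrow> is_rep GM \<rho>"
  by (simp add: over_def irreducible_rep_def)

lemma over_K: "over \<rho> \<Longrightarrow> k \<in> K \<Longrightarrow> v \<in> carrier_vec (dgr \<rho>) \<Longrightarrow> \<rho> k *\<^sub>v v = f k \<cdot>\<^sub>v v"
  by (simp add: over_def)

lemma eigenvalue_unique:
  fixes v :: "complex Matrix.vec"
  assumes "v \<in> carrier_vec n" "v \<noteq> 0\<^sub>v n" "a \<cdot>\<^sub>v v = b \<cdot>\<^sub>v v"
  shows "a = b"
proof -
  obtain i where i: "i < n" "v $v i \<noteq> 0" using assms(1,2) eq_vecI[of v "0\<^sub>v n"] by auto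
  have "(a \<cdot>\<^sub>v v) $v i = (b \<cdot>\<^sub>v v) $v i" using assms(3) by simp
  then show ?thesis using i assms(1) by simp
qed

text \<open>As \<open>K\<close> acts on \<open>\<rho>\<close> by scalars, k acts on the value at x
  through \<open>f\<close> at x^-1 k x. Where the value is nonzero this must agree with
  \<open>f\<close> at k.\<close>

lemma fn_support_C:
  assumes ov: "over \<rho>" and v: "v \<in> carrier_vec (induced_rep.N G M \<rho>)"
    and ev: "\<And>k. k \<in> K \<Longrightarrow> Ind G M \<rho> k *\<^sub>v v = f k \<cdot>\<^sub>v v"
    and x: "x \<in> carrier G" "induced_rep.fn G M \<rho> v x \<noteq> 0\<^sub>v (dgr \<rho>)"
  shows "x \<in> C"
proof -
  interpret I: induced_rep G M \<rho> by (rule induced[OF over_is_rep[OF ov]])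
  have fc: "I.fn v x \<in> carrier_vec (dgr \<rho>)" using I.fn_carrier[OF x(1)] by (simp add: I.n_def)
  have eq: "f (inv x \<otimes> k \<otimes> x) = f k" if k: "k \<in> K" for k
  proof -
    have kc: "k \<in> carrier G" using sub k by blast
    have h: "inv x \<otimes> k \<otimes> x \<in> K" by (rule K_norm'[OF x(1) k])
    have "f k \<cdot>\<^sub>v I.fn v x = I.fn (Ind G M \<rho> k *\<^sub>v v) x" using ev[OF k] I.fn_smult[OF v x(1)] by simp
    also have "\<dots> = I.fn v (inv k \<otimes> x)" by (rule I.fn_Ind[OF kc v x(1)])
    also have "inv k \<otimes> x = x \<otimes> inv (inv x \<otimes> k \<otimes> x)" using kc x(1) by (simp add: inv_mult_group m_assoc)
    also have "I.fn v \<dots> = \<rho> (inv x \<otimes> k \<otimes> x) *\<^sub>v I.fn v x"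
      using I.fn_mult[OF x(1), of "inv (inv x \<otimes> k \<otimes> x)" v] clo(2)[OF sub'(3)[OF h]] sub(3)[OF h] by simp
    also have "\<dots> = f (inv x \<otimes> k \<otimes> x) \<cdot>\<^sub>v I.fn v x" by (rule over_K[OF ov h fc])
    finally show ?thesis using eigenvalue_unique[OF fc x(2)] by metis
  qed
  have "inv x \<in> C" unfolding C_def using x(1) eq by simp
  then show ?thesis using C_inv[of "inv x"] x(1) by simp
qed

lemma supported_K_eigen:
  assumes ov: "over \<rho>" and w: "w \<in> carrier_vec (dgr \<rho>)" and k: "k \<in> K"
  shows "Ind G M \<rho> k *\<^sub>v induced_rep.emb G M \<rho> w = f k \<cdot>\<^sub>v induced_rep.emb G M \<rho> w"
proof -
  interpret I: induced_rep G M \<rho> by (rule induced[OF over_is_rep[OF ov]])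
  show ?thesis using I.emb_Ind[of k w] I.emb_smult[of w "f k"] over_K[OF ov k w] sub'(3)[OF k] w by (simp add: I.n_def)
qed

text \<open>It suffices to find in a nonzero invariant \<open>U\<close> a nonzero function supported
  on \<open>M\<close>: then \<open>U\<close> contains the copy of \<open>\<rho>\<close> there, whose
  translates span. Projecting onto an eigencharacter \<theta> of \<open>A\<close> produces one. Its
  support consists of x that carry \<theta> to an \<open>M\<close>-conjugate of itself, and
  \<open>stab\<close> puts such x into \<open>M\<close>.\<close>

lemma Ind_irreducible:
  assumes ov: "over \<rho>"
  shows "irreducible_rep G (Ind G M \<rho>)"
proof -
  have rep: "is_rep GM \<rho>" and irr: "irreducible_rep GM \<rho>" using ov by (auto simp: over_def irreducible_rep_def)
  interpret I: induced_rep G M \<rho> by (rule induced[OF rep])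
  let ?I = "Ind G M \<rho>"
  let ?n = "dgr \<rho>"
  have nn: "I.n = ?n" by (simp add: I.n_def)
  have n0: "?n > 0" using irr by (simp add: irreducible_rep_def)
  obtain w0 \<theta> where w0: "w0 \<in> carrier_vec ?n" "w0 \<noteq> 0\<^sub>v ?n" and \<theta>: "lin_char GA \<theta>" "\<forall>k\<in>K. \<theta> k = f k"
    and ev: "\<forall>a\<in>A. \<rho> a *\<^sub>v w0 = \<theta> a \<cdot>\<^sub>v w0" using exists_A_eigenvector[OF ov] by blast
  have I1: "\<rho> \<one> *\<^sub>v v = v" if "v \<in> carrier_vec ?n" for v by (rule rep_GM_one[OF rep that])
  have "U = {0\<^sub>v I.N} \<or> U = carrier_vec I.N"
    if U: "lin_subspace I.N U" and st: "\<forall>g\<in>carrier G. \<forall>w\<in>U. ?I g *\<^sub>v w \<in> U" for U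
  proof (cases "U = {0\<^sub>v I.N}")
    case False
    have Uc: "v \<in> carrier_vec I.N" if "v \<in> U" for v using U that by (auto simp: lin_subspace_def)
    have "0\<^sub>v I.N \<in> U" using U by (simp add: lin_subspace_def)
    with False obtain u where u: "u \<in> U" "u \<noteq> 0\<^sub>v I.N" by blast
    obtain g where g: "g \<in> carrier G" "I.fn u g \<noteq> 0\<^sub>v ?n"
    proof -
      have "\<exists>g\<in>carrier G. I.fn u g \<noteq> 0\<^sub>v ?n"
      proof (rule ccontr)
        assume "\<not> ?thesis"
        then have "u = 0\<^sub>v I.N" by (rule_tac I.fn_eqI[OF Uc[OF u(1)] zero_carrier_vec]) (simp add: I.fn_zero nn)
        with u(2) show False by simp
      qed
      then show ?thesis using that by blast
    qed
    \<comment> \<open>Translating u by \<open>inv g\<close> shows that this space is nonzero; it is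
      \<open>M\<close>-stable, hence everything.\<close>
    define Y where "Y = {I.fn v \<one> | v. v \<in> U}"
    have Yfull: "Y = carrier_vec ?n"
    proof (rule irreducible_rep_full[OF irr])
      show "lin_subspace ?n Y" unfolding lin_subspace_def
      proof (intro conjI ballI allI)
        show "Y \<subseteq> carrier_vec ?n" using I.fn_carrier[OF one_closed] by (auto simp: Y_def nn)
        show "0\<^sub>v ?n \<in> Y" using U I.fn_zero[OF one_closed] unfolding Y_def lin_subspace_def nn by (metis (mono_tags, lifting) mem_Collect_eq)
        fix x assume "x \<in> Y" then obtain v where v: "v \<in> U" "x = I.fn v \<one>" by (auto simp: Y_def)
        have "c \<cdot>\<^sub>v x = I.fn (c \<cdot>\<^sub>v v) \<one>" for c using v I.fn_smult[OF Uc[OF v(1)] one_closed] by simp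
        then show "c \<cdot>\<^sub>v x \<in> Y" for c using U v(1) unfolding Y_def lin_subspace_def by blast
        fix y assume "y \<in> Y" then obtain v' where v': "v' \<in> U" "y = I.fn v' \<one>" by (auto simp: Y_def)
        have "x + y = I.fn (v + v') \<one>" using v v' I.fn_add[OF Uc[OF v(1)] Uc[OF v'(1)] one_closed] by simp
        then show "x + y \<in> Y" using U v(1) v'(1) unfolding Y_def lin_subspace_def by blast
      qed
      fix m y assume m: "m \<in> carrier GM" and "y \<in> Y"
      then obtain v where v: "v \<in> U" "y = I.fn v \<one>" by (auto simp: Y_def)
      have "\<rho> m *\<^sub>v y = I.fn (?I m *\<^sub>v v) \<one>" using I.fn_one_Ind[of m v] m v Uc by simp
      moreover have "?I m *\<^sub>v v \<in> U" using st m v sub by simp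
      ultimately show "\<rho> m *\<^sub>v y \<in> Y" unfolding Y_def by blast
    next
      have "I.fn (?I (inv g) *\<^sub>v u) \<one> = I.fn u g" using I.fn_Ind[OF inv_closed[OF g(1)] Uc[OF u(1)] one_closed] g by simp
      moreover have "?I (inv g) *\<^sub>v u \<in> U" using st g u by simp
      ultimately show "I.fn u g \<in> Y" unfolding Y_def mem_Collect_eq by metis
    qed (rule g(2))
    from w0(1) have "w0 \<in> Y" unfolding Yfull .
    then obtain u1 where u1: "u1 \<in> U" and u1': "w0 = I.fn u1 \<one>" unfolding Y_def by blast
    have rIA: "is_rep GA ?I" "rep_degree GA ?I = I.N"
      using is_rep_restrict[OF I.Ind_is_rep, of A] I.Ind_degree sub by auto
    \<comment> \<open>The projection to \<theta>-eigenvectors of \<open>A\<close> stays inside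
      \<open>U\<close> and multiplies the value \<open>w0\<close> at 1 by
      \<open>card A\<close>.\<close>
    define u2 where "u2 = char_avg GA ?I \<theta> u1"
    have iA: "inv\<^bsub>GA\<^esub> x = inv x" if "x \<in> A" for x using m_inv_consistent[OF A that] .
    have finA: "finite A" using fin sub by (meson finite_subset subsetI)
    have u2U: "u2 \<in> U" unfolding u2_def char_avg_def rIA(2)
    proof (rule vsum_mem[OF U])
      fix s assume "s \<in> carrier GA"
      then have "?I s *\<^sub>v u1 \<in> U" using st sub u1 by simp
      then show "\<theta> (inv\<^bsub>GA\<^esub> s) \<cdot>\<^sub>v (?I s *\<^sub>v u1) \<in> U" using U by (simp add: lin_subspace_def)
    qed (use finA in simp)
    have u2e: "?I a *\<^sub>v u2 = \<theta> a \<cdot>\<^sub>v u2" if "a \<in> A" for a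
      using char_avg_eigen[OF groups(2) rIA(1) \<theta>(1), of u1 a] Uc[OF u1] that by (simp add: u2_def rIA(2))
    have u2_1: "I.fn u2 \<one> = of_nat (card A) \<cdot>\<^sub>v w0"
    proof -
      have "I.fn u2 \<one> = vsum ?n A (\<lambda>s. I.fn (\<theta> (inv\<^bsub>GA\<^esub> s) \<cdot>\<^sub>v (?I s *\<^sub>v u1)) \<one>)"
        unfolding u2_def char_avg_def rIA(2) using I.fn_vsum[of A "\<lambda>s. \<theta> (inv\<^bsub>GA\<^esub> s) \<cdot>\<^sub>v (?I s *\<^sub>v u1)" \<one>] I.Ind_vec[OF Uc[OF u1]]
        by (simp add: nn)
      also have "\<dots> = (\<Sum>s\<in>A. 1) \<cdot>\<^sub>v w0"
      proof (rule vsum_const[OF _ w0(1)])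
        fix s assume s: "s \<in> A"
        have "I.fn (\<theta> (inv\<^bsub>GA\<^esub> s) \<cdot>\<^sub>v (?I s *\<^sub>v u1)) \<one> = \<theta> (inv\<^bsub>GA\<^esub> s) \<cdot>\<^sub>v (\<rho> s *\<^sub>v w0)"
          using I.fn_smult[OF I.Ind_vec[OF Uc[OF u1]] one_closed] I.fn_one_Ind[OF sub'(1)[OF s] Uc[OF u1]] u1'[symmetric] by simp
        also have "\<dots> = (\<theta> (inv\<^bsub>GA\<^esub> s) * \<theta> s) \<cdot>\<^sub>v w0" using ev s by (simp add: smult_smult_assoc)
        also have "\<theta> (inv\<^bsub>GA\<^esub> s) * \<theta> s = 1" using lin_char_inv(1)[OF groups(2) \<theta>(1), of s] s by simp
        finally show "I.fn (\<theta> (inv\<^bsub>GA\<^esub> s) \<cdot>\<^sub>v (?I s *\<^sub>v u1)) \<one> = 1 \<cdot>\<^sub>v w0" .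
      qed
      finally show ?thesis by simp
    qed
    \<comment> \<open>A nonzero value at x is an eigenvector for \<theta> conjugated by x. The
      characters of \<open>A\<close> in \<open>\<rho>\<close> are \<open>M\<close>-conjugate, so x m
      fixes \<theta> for some m in \<open>M\<close>, which puts x m, and then x, into
      \<open>M\<close>.\<close>
    have supp: "I.fn u2 x = 0\<^sub>v ?n" if x: "x \<in> carrier G - M" for x
    proof (rule ccontr)
      assume ne: "I.fn u2 x \<noteq> 0\<^sub>v ?n"
      have xc: "x \<in> carrier G" using x by simp
      have xC: "x \<in> C" using fn_support_C[OF ov Uc[OF u2U] _ xc ne] u2e sub'(2) \<theta>(2) by simp
      let ?w = "I.fn u2 x"
      have wc: "?w \<in> carrier_vec ?n" using I.fn_carrier[OF xc] nn by simp
      define \<theta>' where "\<theta>' a = \<theta> (x \<otimes> a \<otimes> inv x)" for a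
      have "lin_char GA \<theta>'" unfolding lin_char_def
      proof (intro conjI ballI)
        show "\<theta>' \<one>\<^bsub>GA\<^esub> = 1" using \<theta>(1) xc by (simp add: \<theta>'_def lin_char_def)
        fix a b assume "a \<in> carrier GA" "b \<in> carrier GA"
        then have a: "a \<in> A" "b \<in> A" by auto
        have "x \<otimes> (a \<otimes> b) \<otimes> inv x = (x \<otimes> a \<otimes> inv x) \<otimes> (x \<otimes> b \<otimes> inv x)"
          using xc sub(2)[OF a(1)] sub(2)[OF a(2)] by (simp add: m_assoc)
        then show "\<theta>' (a \<otimes>\<^bsub>GA\<^esub> b) = \<theta>' a * \<theta>' b"
          using \<theta>(1) A_conj[OF xC a(1)] A_conj[OF xC a(2)] by (simp add: \<theta>'_def lin_char_def)
      qed
      moreover have "\<rho> a *\<^sub>v ?w = \<theta>' a \<cdot>\<^sub>v ?w" if a: "a \<in> A" for a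
      proof -
        let ?b = "x \<otimes> a \<otimes> inv x"
        have b: "?b \<in> A" by (rule A_conj[OF xC a])
        have "\<theta>' a \<cdot>\<^sub>v ?w = I.fn (?I ?b *\<^sub>v u2) x" using u2e[OF b] I.fn_smult[OF Uc[OF u2U] xc] by (simp add: \<theta>'_def)
        also have "\<dots> = I.fn u2 (inv ?b \<otimes> x)" by (rule I.fn_Ind[OF sub(2)[OF b] Uc[OF u2U] xc])
        also have "inv ?b \<otimes> x = x \<otimes> inv a" using xc sub(2)[OF a] by (simp add: inv_mult_group m_assoc)
        also have "I.fn u2 (x \<otimes> inv a) = \<rho> a *\<^sub>v ?w"
          using I.fn_mult[OF xc clo(2)[OF sub'(1)[OF a]]] sub(2)[OF a] by simp
        finally show ?thesis by simp
      qed
      ultimately obtain m where m: "m \<in> M" "\<forall>a\<in>A. \<theta>' a = \<theta> (inv m \<otimes> a \<otimes> m)"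
        using A_characters_conjugate[OF ov w0 \<theta>(1) _ wc ne] ev by blast
      have mc: "m \<in> carrier G" using m sub by blast
      have xm: "x \<otimes> m \<in> C" by (rule C_mult[OF xC MC[OF m(1)]])
      have "\<theta> (x \<otimes> m \<otimes> a \<otimes> inv (x \<otimes> m)) = \<theta> a" if a: "a \<in> A" for a
      proof -
        have c: "m \<otimes> a \<otimes> inv m \<in> A" by (rule A_conj[OF MC[OF m(1)] a])
        have "x \<otimes> m \<otimes> a \<otimes> inv (x \<otimes> m) = x \<otimes> (m \<otimes> a \<otimes> inv m) \<otimes> inv x"
          using xc mc sub(2)[OF a] by (simp add: m_assoc inv_mult_group)
        then have "\<theta> (x \<otimes> m \<otimes> a \<otimes> inv (x \<otimes> m)) = \<theta> (inv m \<otimes> (m \<otimes> a \<otimes> inv m) \<otimes> m)"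
          using bspec[OF m(2) c] by (simp add: \<theta>'_def)
        also have "inv m \<otimes> (m \<otimes> a \<otimes> inv m) \<otimes> m = a" using mc sub(2)[OF a] by (simp add: m_assoc)
        finally show ?thesis .
      qed
      then have "x \<otimes> m \<in> M" using stab[OF \<theta>, of "x \<otimes> m"] xm by (auto simp: C_def)
      then have "x \<otimes> m \<otimes> inv m \<in> M" using clo m(1) by blast
      then show False using x xc mc by (simp add: m_assoc)
    qed
    \<comment> \<open>The argument for \<open>Y\<close> again, restricted to functions supported on
      \<open>M\<close>; now \<open>u2\<close> shows that the space is nonzero.\<close>
    define Z where "Z = {I.fn v \<one> | v. v \<in> U \<and> (\<forall>x\<in>carrier G - M. I.fn v x = 0\<^sub>v ?n)}"
    have ZI: "I.fn v \<one> \<in> Z" if "v \<in> U" "\<forall>x\<in>carrier G - M. I.fn v x = 0\<^sub>v ?n" for v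
      using that unfolding Z_def by blast
    have ZE: "\<exists>v. v \<in> U \<and> y = I.fn v \<one> \<and> (\<forall>x\<in>carrier G - M. I.fn v x = 0\<^sub>v ?n)" if "y \<in> Z" for y
      using that unfolding Z_def by blast
    have Zfull: "Z = carrier_vec ?n"
    proof (rule irreducible_rep_full[OF irr])
      show "lin_subspace ?n Z" unfolding lin_subspace_def
      proof (intro conjI ballI allI)
        show "Z \<subseteq> carrier_vec ?n" using I.fn_carrier[OF one_closed] ZE by (auto simp: nn)
        have "\<forall>x\<in>carrier G - M. I.fn (0\<^sub>v I.N) x = 0\<^sub>v ?n" using I.fn_zero by (simp add: nn)
        moreover have "0\<^sub>v I.N \<in> U" using U by (simp add: lin_subspace_def)
        moreover have "I.fn (0\<^sub>v I.N) \<one> = 0\<^sub>v ?n" using I.fn_zero by (simp add: nn)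
        ultimately show "0\<^sub>v ?n \<in> Z" using ZI[of "0\<^sub>v I.N"] by simp
        fix x assume "x \<in> Z"
        then obtain v where v: "v \<in> U" "x = I.fn v \<one>" "\<forall>x\<in>carrier G - M. I.fn v x = 0\<^sub>v ?n" using ZE by blast
        have "c \<cdot>\<^sub>v x = I.fn (c \<cdot>\<^sub>v v) \<one>" for c using v I.fn_smult[OF Uc[OF v(1)] one_closed] by simp
        moreover have "\<forall>x\<in>carrier G - M. I.fn (c \<cdot>\<^sub>v v) x = 0\<^sub>v ?n" for c
          using v(3) I.fn_smult[OF Uc[OF v(1)]] by auto
        moreover have "c \<cdot>\<^sub>v v \<in> U" for c using U v(1) by (simp add: lin_subspace_def)
        ultimately show "c \<cdot>\<^sub>v x \<in> Z" for c using ZI[of "c \<cdot>\<^sub>v v"] by simp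
        fix y assume "y \<in> Z"
        then obtain v' where v': "v' \<in> U" "y = I.fn v' \<one>" "\<forall>x\<in>carrier G - M. I.fn v' x = 0\<^sub>v ?n" using ZE by blast
        have "x + y = I.fn (v + v') \<one>" using v v' I.fn_add[OF Uc[OF v(1)] Uc[OF v'(1)] one_closed] by simp
        moreover have "\<forall>x\<in>carrier G - M. I.fn (v + v') x = 0\<^sub>v ?n"
          using v(3) v'(3) I.fn_add[OF Uc[OF v(1)] Uc[OF v'(1)]] by auto
        moreover have "v + v' \<in> U" using U v(1) v'(1) by (simp add: lin_subspace_def)
        ultimately show "x + y \<in> Z" using ZI[of "v + v'"] by simp
      qed
      fix m y assume m': "m \<in> carrier GM" and "y \<in> Z"
      then obtain v where v: "v \<in> U" "y = I.fn v \<one>" "\<forall>x\<in>carrier G - M. I.fn v x = 0\<^sub>v ?n" using ZE by blast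
      have m: "m \<in> M" using m' by simp
      have "\<rho> m *\<^sub>v y = I.fn (?I m *\<^sub>v v) \<one>" using I.fn_one_Ind[of m v] m v Uc by simp
      moreover have "?I m *\<^sub>v v \<in> U" using st m v sub by simp
      moreover have "\<forall>x\<in>carrier G - M. I.fn (?I m *\<^sub>v v) x = 0\<^sub>v ?n"
        using I.Ind_supported[OF m Uc[OF v(1)]] v(3) by (simp add: nn)
      ultimately show "\<rho> m *\<^sub>v y \<in> Z" using ZI[of "?I m *\<^sub>v v"] by simp
    next
      show "of_nat (card A) \<cdot>\<^sub>v w0 \<in> Z" using ZI[OF u2U] u2_1 supp by simp
      have "card A > 0" using finA clo(6) by (auto simp: card_gt_0_iff)
      then show "of_nat (card A) \<cdot>\<^sub>v w0 \<noteq> 0\<^sub>v ?n"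
        using eigenvalue_unique[OF w0, of "of_nat (card A)" 0] zero_smult_vec[OF w0(1)] by auto
    qed
    have "v \<in> U" if v: "v \<in> carrier_vec I.N" for v
    proof -
      have "\<forall>y\<in>carrier_vec ?n. \<exists>u. u \<in> U \<and> (\<forall>x\<in>carrier G - M. I.fn u x = 0\<^sub>v ?n) \<and> I.fn u \<one> = y"
        using ZE unfolding Zfull by metis
      then obtain s where s: "\<And>y. y \<in> carrier_vec ?n \<Longrightarrow> s y \<in> U \<and> (\<forall>x\<in>carrier G - M. I.fn (s y) x = 0\<^sub>v ?n) \<and> I.fn (s y) \<one> = y"
        by metis
      \<comment> \<open>The element of \<open>U\<close> that agrees with v on the coset of
        \<open>I.ts ! a\<close> and vanishes elsewhere; their sum over a is v.\<close>
      define t where "t a = ?I (I.ts ! a) *\<^sub>v s (I.fn v (I.ts ! a))" for a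
      have fc: "I.fn v (I.ts ! a) \<in> carrier_vec ?n" if "a < length I.ts" for a
        using I.fn_carrier[OF I.ts_carrier[OF that]] nn by simp
      have tU: "t a \<in> U" if "a < length I.ts" for a
        using st s[OF fc[OF that]] I.ts_carrier[OF that] by (simp add: t_def)
      have "v = vsum I.N {..<length I.ts} t"
      proof (rule I.fn_eqI[OF v vsum_carrier])
        fix g assume g: "g \<in> carrier G"
        define a where "a = I.idx g"
        have a: "a < length I.ts" "inv (I.ts ! a) \<otimes> g \<in> M" using I.idx[OF g] by (auto simp: a_def)
        have "I.fn (vsum I.N {..<length I.ts} t) g = vsum ?n {..<length I.ts} (\<lambda>b. I.fn (t b) g)"
          using I.fn_vsum[of "{..<length I.ts}" t g] Uc tU g by (simp add: nn)
        also have "\<dots> = (\<Sum>b<length I.ts. if b = a then 1 else 0) \<cdot>\<^sub>v I.fn v g"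
        proof (rule vsum_const)
          fix b assume "b \<in> {..<length I.ts}"
          then have b: "b < length I.ts" by simp
          note tb = I.ts_carrier[OF b] and sb = s[OF fc[OF b]]
          have e: "I.fn (t b) g = I.fn (s (I.fn v (I.ts ! b))) (inv (I.ts ! b) \<otimes> g)"
            unfolding t_def by (rule I.fn_Ind[OF tb _ g]) (use sb Uc in blast)
          show "I.fn (t b) g = (if b = a then 1 else 0) \<cdot>\<^sub>v I.fn v g"
          proof (cases "b = a")
            case True
            let ?h = "inv (I.ts ! a) \<otimes> g"
            have ta: "I.ts ! a \<in> carrier G" using tb True by simp
            have "I.fn (t b) g = \<rho> (inv ?h) *\<^sub>v I.fn v (I.ts ! a)"
              using e I.fn_mult[OF one_closed a(2), of "s (I.fn v (I.ts ! b))"] sub(1)[OF a(2)] sb True by simp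
            also have "\<dots> = I.fn v (I.ts ! a \<otimes> ?h)" using I.fn_mult[OF ta a(2), of v] by simp
            also have "I.ts ! a \<otimes> ?h = g" using g ta by simp
            finally show ?thesis using True by simp
          next
            case False
            have "inv (I.ts ! b) \<otimes> g \<notin> M" using I.idx_unique[OF g b] False by (auto simp: a_def)
            then have "I.fn (t b) g = 0\<^sub>v ?n" using e sb g tb by simp
            then show ?thesis using False zero_smult_vec[OF I.fn_carrier[OF g]] by (simp add: nn)
          qed
        qed (use I.fn_carrier[OF g] nn in simp)
        also have "\<dots> = I.fn v g" using a(1) by simp
        finally show "I.fn v g = I.fn (vsum I.N {..<length I.ts} t) g" by simp
      qed
      also have "\<dots> \<in> U" by (rule vsum_mem[OF U]) (use tU in auto)
      finally show ?thesis .
    qed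
    then have "U = carrier_vec I.N" using Uc by blast
    then show ?thesis by simp
  qed simp
  moreover have "I.N > 0"
  proof -
    have "I.emb w0 \<in> carrier_vec I.N" "I.emb w0 \<noteq> 0\<^sub>v I.N"
      using I.emb(1) I.emb_nonzero w0 nn by simp_all
    then show ?thesis by (cases "I.N") (auto intro: eq_vecI)
  qed
  ultimately show ?thesis unfolding irreducible_rep_alt I.Ind_degree using I.Ind_is_rep by blast
qed

end

section \<open>The Clifford correspondence\<close>

context clifford
begin

lemma conj_rep_over:
  assumes ov: "over \<rho>" and g: "g \<in> C"
  shows "over (conj_rep G g \<rho>)" "dgr (conj_rep G g \<rho>) = dgr \<rho>"
proof -
  have rep: "is_rep GM \<rho>" and irr: "irreducible_rep GM \<rho>" using ov by (auto simp: over_def irreducible_rep_def)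
  have gc: "g \<in> carrier G" by (rule C_carrier[OF g])
  show dg: "dgr (conj_rep G g \<rho>) = dgr \<rho>" using gc by (simp add: rep_degree_def conj_rep_def)
  have rc: "is_rep GM (conj_rep G g \<rho>)" unfolding is_rep_def dg
  proof (intro conjI ballI)
    fix m assume m: "m \<in> carrier GM"
    then show "conj_rep G g \<rho> m \<in> carrier_mat (dgr \<rho>) (dgr \<rho>)"
      using rep_GM_mat[OF rep M_conj[OF g]] by (simp add: conj_rep_def)
    fix m' assume m': "m' \<in> carrier GM"
    have e: "g \<otimes> (m \<otimes> m') \<otimes> inv g = (g \<otimes> m \<otimes> inv g) \<otimes> (g \<otimes> m' \<otimes> inv g)"
      using gc m m' sub by (simp add: m_assoc)
    show "conj_rep G g \<rho> (m \<otimes>\<^bsub>GM\<^esub> m') = conj_rep G g \<rho> m * conj_rep G g \<rho> m'"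
      using is_rep_mult[OF rep, of "g \<otimes> m \<otimes> inv g" "g \<otimes> m' \<otimes> inv g"] M_conj[OF g, of m] M_conj[OF g, of m'] m m' e
      by (simp add: conj_rep_def)
  qed (use is_rep_one[OF rep] gc in \<open>simp add: conj_rep_def\<close>)
  have "irreducible_rep GM (conj_rep G g \<rho>)"
    unfolding irreducible_rep_alt dg
  proof (intro conjI allI impI)
    fix W assume W: "lin_subspace (dgr \<rho>) W \<and> (\<forall>m\<in>carrier GM. \<forall>w\<in>W. conj_rep G g \<rho> m *\<^sub>v w \<in> W)"
    have "\<rho> m *\<^sub>v w \<in> W" if m: "m \<in> M" and w: "w \<in> W" for m w
    proof -
      have "conj_rep G g \<rho> (inv g \<otimes> m \<otimes> g) *\<^sub>v w \<in> W" using W M_conj'[OF g m] w by simp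
      moreover have "g \<otimes> (inv g \<otimes> m \<otimes> g) \<otimes> inv g = m" using gc sub(1)[OF m] by (simp add: m_assoc)
      ultimately show ?thesis by (simp add: conj_rep_def)
    qed
    then show "W = {0\<^sub>v (dgr \<rho>)} \<or> W = carrier_vec (dgr \<rho>)"
      using W irr unfolding irreducible_rep_alt by auto
  qed (use irr rc in \<open>auto simp: irreducible_rep_def\<close>)
  moreover have "conj_rep G g \<rho> k *\<^sub>v v = f k \<cdot>\<^sub>v v" if "k \<in> K" "v \<in> carrier_vec (dgr \<rho>)" for k v
    using over_K[OF ov K_norm[OF gc that(1)] that(2)] f_C[OF g that(1)] by (simp add: conj_rep_def)
  ultimately show "over (conj_rep G g \<rho>)" by (simp add: over_def dg)
qed

lemma over_equiv:
  assumes "over \<rho>" "rep_equiv GM \<rho> \<sigma>"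
  shows "over \<sigma>"
proof (rule ccontr)
  have irr: "irreducible_rep GM \<sigma>" using rep_equiv_irreducible assms by (auto simp: over_def)
  have dg: "dgr \<sigma> = dgr \<rho>" using assms(2) by (simp add: rep_equiv_def)
  obtain P R where PRs: "P \<in> carrier_mat (rep_degree GM \<rho>) (rep_degree GM \<rho>)" "R \<in> carrier_mat (rep_degree GM \<rho>) (rep_degree GM \<rho>)"
    "P * R = 1\<^sub>m (rep_degree GM \<rho>)" "R * P = 1\<^sub>m (rep_degree GM \<rho>)" "\<forall>g\<in>carrier GM. P * \<rho> g = \<sigma> g * P"
    "is_rep GM (\<rho>)" "is_rep GM (\<sigma>)" "rep_degree GM (\<sigma>) = rep_degree GM \<rho>"
    using rep_equiv_vec[OF assms(2)] by blast
  note P = PRs(1) and R = PRs(2) and PR = PRs(3) and int = PRs(5) and rs = PRs(7)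
  have "\<sigma> k *\<^sub>v v = f k \<cdot>\<^sub>v v" if k: "k \<in> K" and v: "v \<in> carrier_vec (dgr \<rho>)" for k v
  proof -
    have km: "k \<in> M" by (rule sub'(3)[OF k])
    have Rv: "R *\<^sub>v v \<in> carrier_vec (dgr \<rho>)" using R v by simp
    have sk: "\<sigma> k \<in> carrier_mat (dgr \<rho>) (dgr \<rho>)" using rep_GM_mat[OF rs km] dg by simp
    have "\<sigma> k *\<^sub>v v = \<sigma> k *\<^sub>v (P *\<^sub>v (R *\<^sub>v v))" using left_inverse_cancel_vec[OF P R PR v] by simp
    also have "\<dots> = (P * \<rho> k) *\<^sub>v (R *\<^sub>v v)" using int km by (simp add: assoc_mult_mat_vec[OF sk P Rv])
    also have "\<dots> = P *\<^sub>v (f k \<cdot>\<^sub>v (R *\<^sub>v v))"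
      using over_K[OF assms(1) k Rv] assoc_mult_mat_vec[OF P rep_GM_mat[OF over_is_rep[OF assms(1)] km] Rv] by simp
    also have "\<dots> = f k \<cdot>\<^sub>v v" using mult_mat_vec[OF P Rv] left_inverse_cancel_vec[OF P R PR v] by simp
    finally show ?thesis .
  qed
  moreover assume "\<not> over \<sigma>"
  ultimately show False using irr by (simp add: over_def dg)
qed

lemma Ind_overG:
  assumes ov: "over \<rho>"
  shows "overG (Ind G M \<rho>)"
proof -
  have rep: "is_rep GM \<rho>" and n0: "dgr \<rho> > 0" using ov by (auto simp: over_def irreducible_rep_def)
  interpret I: induced_rep G M \<rho> by (rule induced[OF rep])
  have u: "unit_vec (dgr \<rho>) 0 \<noteq> (0\<^sub>v (dgr \<rho>) :: complex Matrix.vec)"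
  proof
    assume "unit_vec (dgr \<rho>) 0 = (0\<^sub>v (dgr \<rho>) :: complex Matrix.vec)"
    then have "unit_vec (dgr \<rho>) 0 $v 0 = (0\<^sub>v (dgr \<rho>) :: complex Matrix.vec) $v 0" by simp
    then show False using n0 by simp
  qed
  show ?thesis unfolding overG_def I.Ind_degree
    using Ind_irreducible[OF ov] I.emb(1)[of "unit_vec (dgr \<rho>) 0"] I.emb_nonzero[of "unit_vec (dgr \<rho>) 0"]
      supported_K_eigen[OF ov unit_vec_carrier] u
    by (auto simp: I.n_def intro!: bexI[of _ "I.emb (unit_vec (dgr \<rho>) 0)"])
qed

text \<open>Translating by g the copy of \<open>\<rho>'\<close> supported on \<open>M\<close> yields
  a copy of \<open>\<rho>\<close> in the representation induced from \<open>\<rho>'\<close>;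
  Frobenius reciprocity does the rest.\<close>

lemma Ind_equiv_of_conj:
  assumes ov: "over \<rho>" and ov': "over \<rho>'" and g: "g \<in> C" and eq: "rep_equiv GM (conj_rep G g \<rho>) \<rho>'"
  shows "rep_equiv G (Ind G M \<rho>) (Ind G M \<rho>')"
proof -
  have rep: "is_rep GM \<rho>" and rep': "is_rep GM \<rho>'" and n0: "dgr \<rho> > 0"
    using ov ov' by (auto simp: over_def irreducible_rep_def)
  have gc: "g \<in> carrier G" by (rule C_carrier[OF g])
  interpret I: induced_rep G M \<rho> by (rule induced[OF rep])
  interpret J: induced_rep G M \<rho>' by (rule induced[OF rep'])
  let ?n = "dgr \<rho>"
  have n: "I.n = ?n" by (simp add: I.n_def)
  note cd = conj_rep_over(2)[OF ov g]
  obtain P R where PRs: "P \<in> carrier_mat (rep_degree GM (conj_rep G g \<rho>)) (rep_degree GM (conj_rep G g \<rho>))" "R \<in> carrier_mat (rep_degree GM (conj_rep G g \<rho>)) (rep_degree GM (conj_rep G g \<rho>))"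
    "P * R = 1\<^sub>m (rep_degree GM (conj_rep G g \<rho>))" "R * P = 1\<^sub>m (rep_degree GM (conj_rep G g \<rho>))" "\<forall>m\<in>carrier GM. P * conj_rep G g \<rho> m = \<rho>' m * P"
    "is_rep GM (conj_rep G g \<rho>)" "is_rep GM (\<rho>')" "rep_degree GM (\<rho>') = rep_degree GM (conj_rep G g \<rho>)"
    using rep_equiv_vec[OF eq] by blast
  note P = PRs(1)[unfolded cd] and R = PRs(2)[unfolded cd] and RP = PRs(4)[unfolded cd] and int = PRs(5) and dd = PRs(8)[unfolded cd]
  have n': "J.n = ?n" by (simp add: J.n_def dd)
  have Pc: "P *\<^sub>v w \<in> carrier_vec J.n" if "w \<in> carrier_vec ?n" for w using P that n' by simp
  define L where "L w = Ind G M \<rho>' g *\<^sub>v J.emb (P *\<^sub>v w)" for w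
  have ui: "unit_vec ?n 0 \<in> carrier_vec ?n" by simp
  show ?thesis
  proof (rule I.Ind_equiv_if_intertwiner[where L = L and w = "unit_vec ?n 0"])
    show "irreducible_rep G (Ind G M \<rho>)" "irreducible_rep G (Ind G M \<rho>')"
      using Ind_irreducible ov ov' by auto
    fix w :: "complex Matrix.vec" assume "w \<in> carrier_vec I.n"
    then have w: "w \<in> carrier_vec ?n" by (simp add: n)
    note Pw = Pc[OF w]
    show "L w \<in> carrier_vec (rep_degree G (Ind G M \<rho>'))"
      unfolding J.Ind_degree L_def by (rule J.Ind_vec[OF J.emb(1)[OF Pw]])
    show "L (c \<cdot>\<^sub>v w) = c \<cdot>\<^sub>v L w" for c :: complex
      unfolding L_def mult_mat_vec[OF P w] J.emb_smult[OF Pw]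
      by (rule mult_mat_vec[OF J.Ind_mat J.emb(1)[OF Pw]])
    show "L (v + w) = L v + L w" if "v \<in> carrier_vec I.n" for v
    proof -
      have v: "v \<in> carrier_vec ?n" using that n by simp
      show ?thesis unfolding L_def mult_add_distrib_mat_vec[OF P v w] J.emb_add[OF Pc[OF v] Pw]
        by (rule mult_add_distrib_mat_vec[OF J.Ind_mat J.emb(1)[OF Pc[OF v]] J.emb(1)[OF Pw]])
    qed
    fix m assume m: "m \<in> M"
    let ?m = "inv g \<otimes> m \<otimes> g"
    have m': "?m \<in> M" by (rule M_conj'[OF g m])
    have mc: "m \<in> carrier G" using sub m by blast
    have "g \<otimes> ?m \<otimes> inv g = m" using gc mc by (simp add: m_assoc)
    then have e: "conj_rep G g \<rho> ?m = \<rho> m" by (simp add: conj_rep_def)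
    have "P *\<^sub>v (\<rho> m *\<^sub>v w) = (P * \<rho> m) *\<^sub>v w" using assoc_mult_mat_vec[OF P rep_GM_mat[OF rep m] w] by simp
    also have "\<dots> = (\<rho>' ?m * P) *\<^sub>v w" using bspec[OF int, of ?m] m' e by simp
    also have "\<dots> = \<rho>' ?m *\<^sub>v (P *\<^sub>v w)"
      using assoc_mult_mat_vec[of "\<rho>' ?m" ?n ?n P ?n w] rep_GM_mat[OF rep' m'] P w dd by simp
    finally have 1: "J.emb (P *\<^sub>v (\<rho> m *\<^sub>v w)) = Ind G M \<rho>' ?m *\<^sub>v J.emb (P *\<^sub>v w)"
      using J.emb_Ind[OF m' Pw] by simp
    have "L (\<rho> m *\<^sub>v w) = Ind G M \<rho>' (g \<otimes> ?m) *\<^sub>v J.emb (P *\<^sub>v w)"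
      unfolding L_def 1 using is_rep_mult_vec[OF J.Ind_is_rep gc sub(1)[OF m'], of "J.emb (P *\<^sub>v w)"] J.emb(1)[OF Pw] J.Ind_degree by simp
    also have "g \<otimes> ?m = m \<otimes> g" using gc mc by (simp add: m_assoc)
    finally show "L (\<rho> m *\<^sub>v w) = Ind G M \<rho>' m *\<^sub>v L w"
      unfolding L_def using is_rep_mult_vec[OF J.Ind_is_rep mc gc, of "J.emb (P *\<^sub>v w)"] J.emb(1)[OF Pw] J.Ind_degree by simp
  next
    show "unit_vec ?n 0 \<in> carrier_vec I.n" by (simp add: n)
    show "L (unit_vec ?n 0) \<noteq> 0\<^sub>v (rep_degree G (Ind G M \<rho>'))"
    proof
      assume L0: "L (unit_vec ?n 0) = 0\<^sub>v (rep_degree G (Ind G M \<rho>'))"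
      let ?v = "J.emb (P *\<^sub>v unit_vec ?n 0)"
      have vc: "?v \<in> carrier_vec J.N" by (rule J.emb(1)[OF Pc[OF ui]])
      have "Ind G M \<rho>' (inv g) *\<^sub>v L (unit_vec ?n 0) = Ind G M \<rho>' (inv g \<otimes> g) *\<^sub>v ?v"
        unfolding L_def using is_rep_mult_vec[OF J.Ind_is_rep inv_closed[OF gc] gc, of ?v] vc J.Ind_degree by simp
      also have "\<dots> = ?v" using is_rep_one_vec[OF J.Ind_is_rep, of ?v] vc J.Ind_degree gc by simp
      finally have "?v = 0\<^sub>v J.N" using L0 mult_mat_zero_vec[OF J.Ind_mat] J.Ind_degree by simp
      then have "P *\<^sub>v unit_vec ?n 0 = 0\<^sub>v ?n" using J.emb(2)[OF Pc[OF ui]] J.fn_zero[OF one_closed] n' by simp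
      then have "(0\<^sub>v ?n :: complex Matrix.vec) = unit_vec ?n 0"
        using left_inverse_cancel_vec[OF R P RP ui] mult_mat_zero_vec[OF R] by simp
      then have "(0\<^sub>v ?n :: complex Matrix.vec) $v 0 = unit_vec ?n 0 $v 0" by simp
      then show False using n0 by simp
    qed
  qed
qed

text \<open>An isomorphism of the induced representations, restricted to the copy of
  \<open>\<rho>\<close> and evaluated at a point x where it does not vanish, intertwines
  \<open>\<rho>\<close> with a conjugate of \<open>\<rho>'\<close>. The point lies in
  \<open>C\<close>, because that copy consists of \<open>f\<close>-eigenvectors of
  \<open>K\<close>.\<close>

lemma conj_of_Ind_equiv:
  assumes ov: "over \<rho>" and ov': "over \<rho>'" and eq: "rep_equiv G (Ind G M \<rho>) (Ind G M \<rho>')"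
  shows "\<exists>g\<in>C. rep_equiv GM \<rho> (conj_rep G g \<rho>')"
proof -
  have rep: "is_rep GM \<rho>" and rep': "is_rep GM \<rho>'" and irr: "irreducible_rep GM \<rho>" and n0: "dgr \<rho> > 0"
    using ov ov' by (auto simp: over_def irreducible_rep_def)
  interpret I: induced_rep G M \<rho> by (rule induced[OF rep])
  interpret J: induced_rep G M \<rho>' by (rule induced[OF rep'])
  let ?n = "dgr \<rho>"
  have n: "I.n = ?n" by (simp add: I.n_def)
  have n': "J.n = dgr \<rho>'" by (simp add: J.n_def)
  obtain P R where PRs: "P \<in> carrier_mat (rep_degree G (Ind G M \<rho>)) (rep_degree G (Ind G M \<rho>))" "R \<in> carrier_mat (rep_degree G (Ind G M \<rho>)) (rep_degree G (Ind G M \<rho>))"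
    "P * R = 1\<^sub>m (rep_degree G (Ind G M \<rho>))" "R * P = 1\<^sub>m (rep_degree G (Ind G M \<rho>))" "\<forall>g\<in>carrier G. P * Ind G M \<rho> g = Ind G M \<rho>' g * P"
    "is_rep G (Ind G M \<rho>)" "is_rep G (Ind G M \<rho>')" "rep_degree G (Ind G M \<rho>') = rep_degree G (Ind G M \<rho>)"
    using rep_equiv_vec[OF eq] by blast
  note P = PRs(1)[unfolded I.Ind_degree] and R = PRs(2)[unfolded I.Ind_degree] and RP = PRs(4)[unfolded I.Ind_degree]
    and int = PRs(5) and NN = PRs(8)[unfolded I.Ind_degree J.Ind_degree]
  have intv: "P *\<^sub>v (Ind G M \<rho> g *\<^sub>v v) = Ind G M \<rho>' g *\<^sub>v (P *\<^sub>v v)" if "g \<in> carrier G" "v \<in> carrier_vec I.N" for g v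
    using int that assoc_mult_mat_vec[OF P I.Ind_mat that(2), of g] assoc_mult_mat_vec[of "Ind G M \<rho>' g" I.N I.N P I.N v] P J.Ind_mat[of g] NN
    by simp
  let ?u = "unit_vec ?n 0 :: complex Matrix.vec"
  have u0: "?u \<noteq> 0\<^sub>v ?n"
  proof
    assume "?u = 0\<^sub>v ?n"
    then have "?u $v 0 = 0\<^sub>v ?n $v 0" by simp
    then show False using n0 by simp
  qed
  let ?e = "I.emb ?u"
  have ec: "?e \<in> carrier_vec I.N" and e0: "?e \<noteq> 0\<^sub>v I.N" using I.emb(1)[of ?u] I.emb_nonzero[of ?u] u0 n by auto
  have Pe0: "P *\<^sub>v ?e \<noteq> 0\<^sub>v J.N"
    using left_inverse_cancel_vec[OF R P RP ec] mult_mat_zero_vec[OF R] e0 NN by auto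
  have Pec: "P *\<^sub>v v \<in> carrier_vec J.N" if "v \<in> carrier_vec I.N" for v using P that NN by simp
  obtain x where x: "x \<in> carrier G" "J.fn (P *\<^sub>v ?e) x \<noteq> 0\<^sub>v (dgr \<rho>')"
  proof -
    have "\<exists>x\<in>carrier G. J.fn (P *\<^sub>v ?e) x \<noteq> 0\<^sub>v (dgr \<rho>')"
    proof (rule ccontr)
      assume "\<not> ?thesis"
      then have "P *\<^sub>v ?e = 0\<^sub>v J.N"
        by (rule_tac J.fn_eqI[OF Pec[OF ec] zero_carrier_vec]) (simp add: J.fn_zero n')
      with Pe0 show False by simp
    qed
    then show ?thesis using that by blast
  qed
  have xC: "x \<in> C"
  proof (rule fn_support_C[OF ov' Pec[OF ec] _ x])
    fix k assume k: "k \<in> K"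
    show "Ind G M \<rho>' k *\<^sub>v (P *\<^sub>v ?e) = f k \<cdot>\<^sub>v (P *\<^sub>v ?e)"
      using intv[OF sub(3)[OF k] ec] supported_K_eigen[OF ov unit_vec_carrier k, of 0] mult_mat_vec[OF P ec] by simp
  qed
  define L where "L w = J.fn (P *\<^sub>v I.emb w) x" for w
  have embc: "I.emb w \<in> carrier_vec I.N" if "w \<in> carrier_vec ?n" for w using I.emb(1) that n by simp
  have "\<exists>X\<in>carrier_mat (dgr \<rho>') ?n. \<forall>w\<in>carrier_vec ?n. X *\<^sub>v w = L w"
  proof (rule linear_map_mat)
    fix w :: "complex Matrix.vec" assume w: "w \<in> carrier_vec ?n"
    show "L w \<in> carrier_vec (dgr \<rho>')" using J.fn_carrier[OF x(1)] n' by (simp add: L_def)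
    show "L (c \<cdot>\<^sub>v w) = c \<cdot>\<^sub>v L w" for c :: complex
      using I.emb_smult[of w c] w n mult_mat_vec[OF P embc[OF w]] J.fn_smult[OF Pec[OF embc[OF w]] x(1)] by (simp add: L_def)
    show "L (w + v) = L w + L v" if v: "v \<in> carrier_vec ?n" for v
      using I.emb_add[of w v] w v n mult_add_distrib_mat_vec[OF P embc[OF w] embc[OF v]]
        J.fn_add[OF Pec[OF embc[OF w]] Pec[OF embc[OF v]] x(1)] by (simp add: L_def)
  qed
  then obtain X where X: "X \<in> carrier_mat (dgr \<rho>') ?n" and XL: "\<And>w. w \<in> carrier_vec ?n \<Longrightarrow> X *\<^sub>v w = L w" by blast
  have ixC: "inv x \<in> C" by (rule C_inv[OF xC])
  note cov = conj_rep_over[OF ov' ixC]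
  have "rep_equiv GM \<rho> (conj_rep G (inv x) \<rho>')"
  proof (rule rep_schur[OF irr, of _ X ?u])
    show "irreducible_rep GM (conj_rep G (inv x) \<rho>')" using cov(1) by (simp add: over_def)
    show "X \<in> carrier_mat (dgr (conj_rep G (inv x) \<rho>')) ?n" using X cov(2) by simp
    show "X *\<^sub>v ?u \<noteq> 0\<^sub>v (dgr (conj_rep G (inv x) \<rho>'))" using XL[of ?u] x(2) cov(2) by (simp add: L_def)
    fix m and w :: "complex Matrix.vec" assume m': "m \<in> carrier GM" and w: "w \<in> carrier_vec ?n"
    have m: "m \<in> M" using m' by simp
    have mc: "m \<in> carrier G" using sub m by blast
    have mx: "inv x \<otimes> m \<otimes> x \<in> M" by (rule M_conj'[OF xC m])
    have "X *\<^sub>v (\<rho> m *\<^sub>v w) = J.fn (P *\<^sub>v (Ind G M \<rho> m *\<^sub>v I.emb w)) x"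
      using XL[OF rep_GM_vec[OF rep m w]] I.emb_Ind[OF m, of w] w n by (simp add: L_def)
    also have "\<dots> = J.fn (P *\<^sub>v I.emb w) (inv m \<otimes> x)"
      unfolding intv[OF mc embc[OF w]] by (rule J.fn_Ind[OF mc Pec[OF embc[OF w]] x(1)])
    also have "inv m \<otimes> x = x \<otimes> inv (inv x \<otimes> m \<otimes> x)" using mc x(1) by (simp add: inv_mult_group m_assoc)
    also have "J.fn (P *\<^sub>v I.emb w) \<dots> = \<rho>' (inv x \<otimes> m \<otimes> x) *\<^sub>v L w"
      using J.fn_mult[OF x(1) clo(2)[OF mx], of "P *\<^sub>v I.emb w"] sub(1)[OF mx] by (simp add: L_def)
    finally show "conj_rep G (inv x) \<rho>' m *\<^sub>v (X *\<^sub>v w) = X *\<^sub>v (\<rho> m *\<^sub>v w)"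
      using XL[OF w] x(1) by (simp add: conj_rep_def)
  qed simp
  then show ?thesis using ixC by blast
qed

text \<open>The \<open>f\<close>-eigenvectors of \<open>K\<close> form an \<open>M\<close>-stable
  space. An irreducible subrepresentation there, with its inclusion \<open>Q\<close>, is the input
  for Frobenius reciprocity.\<close>

lemma equiv_Ind_of_overG:
  assumes ov: "overG \<sigma>"
  shows "\<exists>\<rho>. over \<rho> \<and> rep_equiv G (Ind G M \<rho>) \<sigma>"
proof -
  have irr: "irreducible_rep G \<sigma>" and rep: "is_rep G \<sigma>" using ov by (auto simp: overG_def irreducible_rep_def)
  let ?n = "rep_degree G \<sigma>"
  obtain v0 where v0: "v0 \<in> carrier_vec ?n" "v0 \<noteq> 0\<^sub>v ?n" "\<forall>k\<in>K. \<sigma> k *\<^sub>v v0 = f k \<cdot>\<^sub>v v0"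
    using ov by (auto simp: overG_def)
  define Y where "Y = {v \<in> carrier_vec ?n. \<forall>k\<in>K. \<sigma> k *\<^sub>v v = f k \<cdot>\<^sub>v v}"
  have Y: "lin_subspace ?n Y" unfolding Y_def
    by (rule eigenspace_subspace) (use is_rep_mat[OF rep] sub in blast)
  have repM: "is_rep GM \<sigma>" "rep_degree GM \<sigma> = ?n" using is_rep_restrict[OF rep, of M] sub by auto
  have st: "\<sigma> m *\<^sub>v w \<in> Y" if m': "m \<in> carrier GM" and w: "w \<in> Y" for m w
  proof -
    have m: "m \<in> M" using m' by simp
    have mc: "m \<in> carrier G" using m sub by blast
    have wc: "w \<in> carrier_vec ?n" using w by (simp add: Y_def)
    have "\<sigma> k *\<^sub>v (\<sigma> m *\<^sub>v w) = f k \<cdot>\<^sub>v (\<sigma> m *\<^sub>v w)" if k: "k \<in> K" for k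
    proof -
      have kc: "k \<in> carrier G" using k sub by blast
      have k': "inv m \<otimes> k \<otimes> m \<in> K" using K_norm' m k sub by blast
      have fk: "f (inv m \<otimes> k \<otimes> m) = f k" using f_C[OF C_inv[OF MC[OF m]] k] mc by simp
      have "\<sigma> k *\<^sub>v (\<sigma> m *\<^sub>v w) = \<sigma> (k \<otimes> m) *\<^sub>v w" using is_rep_mult_vec[OF rep kc mc wc] by simp
      also have "k \<otimes> m = m \<otimes> (inv m \<otimes> k \<otimes> m)" using mc kc by (simp add: m_assoc)
      also have "\<sigma> (m \<otimes> (inv m \<otimes> k \<otimes> m)) *\<^sub>v w = \<sigma> m *\<^sub>v (\<sigma> (inv m \<otimes> k \<otimes> m) *\<^sub>v w)"
        by (rule is_rep_mult_vec[OF rep mc sub(3)[OF k'] wc])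
      also have "\<dots> = \<sigma> m *\<^sub>v (f k \<cdot>\<^sub>v w)" using w k' fk by (simp add: Y_def)
      also have "\<dots> = f k \<cdot>\<^sub>v (\<sigma> m *\<^sub>v w)" by (rule mult_mat_vec[OF is_rep_mat[OF rep mc] wc])
      finally show ?thesis .
    qed
    then show ?thesis using mult_mat_vec_carrier[OF is_rep_mat[OF rep mc] wc] by (simp add: Y_def)
  qed
  interpret GM: group GM by (rule groups)
  have v0Y: "v0 \<in> Y" using v0 by (simp add: Y_def)
  obtain \<rho> d Q R where \<rho>: "irreducible_rep GM \<rho>" "rep_degree GM \<rho> = d" and Q: "Q \<in> carrier_mat ?n d"
    and R: "R \<in> carrier_mat d ?n" and RQ: "R * Q = 1\<^sub>m d" and QY: "\<forall>v\<in>carrier_vec d. Q *\<^sub>v v \<in> Y"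
    and int: "\<forall>m\<in>carrier GM. \<sigma> m * Q = Q * \<rho> m"
    using exists_irreducible_subrep[OF repM(1) repM(2)[symmetric] Y st v0Y v0(2) GM.one_closed GM.m_closed]
    by blast
  have rr: "is_rep GM \<rho>" and d0: "d > 0" using \<rho> by (auto simp: irreducible_rep_def)
  have intv: "\<sigma> m *\<^sub>v (Q *\<^sub>v v) = Q *\<^sub>v (\<rho> m *\<^sub>v v)" if m: "m \<in> M" and v: "v \<in> carrier_vec d" for m v
  proof -
    have "\<rho> m \<in> carrier_mat d d" using rep_GM_mat[OF rr m] \<rho>(2) by simp
    then show ?thesis
      using int m assoc_mult_mat_vec[OF is_rep_mat[OF rep sub(1)[OF m]] Q v] assoc_mult_mat_vec[OF Q _ v, of "\<rho> m"] by simp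
  qed
  let ?u = "unit_vec d 0 :: complex Matrix.vec"
  have u0: "?u \<noteq> 0\<^sub>v d"
  proof
    assume "?u = 0\<^sub>v d"
    then have "?u $v 0 = 0\<^sub>v d $v 0" by simp
    then show False using d0 by simp
  qed
  have "\<rho> k *\<^sub>v ?u = f k \<cdot>\<^sub>v ?u" if k: "k \<in> K" for k
  proof -
    have ru: "\<rho> k *\<^sub>v ?u \<in> carrier_vec d" using rep_GM_vec[OF rr sub'(3)[OF k], of ?u] \<rho>(2) by simp
    have "\<rho> k *\<^sub>v ?u = R *\<^sub>v (Q *\<^sub>v (\<rho> k *\<^sub>v ?u))" using left_inverse_cancel_vec[OF R Q RQ ru] by simp
    also have "\<dots> = R *\<^sub>v (\<sigma> k *\<^sub>v (Q *\<^sub>v ?u))" using intv[OF sub'(3)[OF k], of ?u] by simp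
    also have "\<dots> = R *\<^sub>v (f k \<cdot>\<^sub>v (Q *\<^sub>v ?u))" using QY k by (simp add: Y_def)
    also have "\<dots> = f k \<cdot>\<^sub>v ?u" using mult_mat_vec[OF R, of "Q *\<^sub>v ?u"] Q left_inverse_cancel_vec[OF R Q RQ, of ?u] by simp
    finally show ?thesis .
  qed
  then have ov\<rho>: "over \<rho>" using overI[OF \<rho>(1), of ?u] u0 \<rho>(2) by simp
  interpret I: induced_rep G M \<rho> by (rule induced[OF rr])
  have n: "I.n = d" using \<rho>(2) by (simp add: I.n_def)
  have "rep_equiv G (Ind G M \<rho>) \<sigma>"
  proof (rule I.Ind_equiv_if_intertwiner[where L = "\<lambda>w. Q *\<^sub>v w" and w = ?u])
    show "irreducible_rep G (Ind G M \<rho>)" by (rule Ind_irreducible[OF ov\<rho>])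
    show "Q *\<^sub>v ?u \<noteq> 0\<^sub>v ?n"
      using left_inverse_cancel_vec[OF R Q RQ, of ?u] mult_mat_zero_vec[OF R] u0 by auto
  qed (use irr Q n intv mult_add_distrib_mat_vec[OF Q] mult_mat_vec[OF Q] in auto)
  then show ?thesis using ov\<rho> by blast
qed

abbreviation "\<phi> \<equiv> lin_rep f"

lemma Irr_over_M_iff:
  "c \<in> Irr_over GM K \<phi> \<longleftrightarrow> (\<exists>\<rho>. over \<rho> \<and> c = {\<sigma>. rep_equiv GM \<rho> \<sigma>})"
proof -
  have inner: "rep_inner (GM\<lparr>carrier := K\<rparr>) \<rho> \<phi> \<noteq> 0 \<longleftrightarrow> over \<rho>" if irr: "irreducible_rep GM \<rho>" for \<rho>
  proof -
    have rep: "is_rep GM \<rho>" using irr by (simp add: irreducible_rep_def)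
    have KM: "K \<subseteq> M" using KA AM by blast
    note repK = is_rep_subset[OF rep KM]
    have finK: "finite (carrier GK)" using fin subgroup.subset[OF K] by (simp add: finite_subset)
    have "rep_inner GK \<rho> \<phi> \<noteq> 0 \<longleftrightarrow> (\<exists>v\<in>carrier_vec (dgr \<rho>). v \<noteq> 0\<^sub>v (dgr \<rho>) \<and> (\<forall>k\<in>K. \<rho> k *\<^sub>v v = f k \<cdot>\<^sub>v v))"
      using rep_inner_lin_rep_iff[OF groups(3) finK repK(1) f] by (simp add: repK(2))
    also have "\<dots> \<longleftrightarrow> over \<rho>"
    proof
      assume "over \<rho>"
      moreover have "unit_vec (dgr \<rho>) 0 \<noteq> (0\<^sub>v (dgr \<rho>) :: complex Matrix.vec)"
      proof
        assume "unit_vec (dgr \<rho>) 0 = (0\<^sub>v (dgr \<rho>) :: complex Matrix.vec)"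
        then have "unit_vec (dgr \<rho>) 0 $v 0 = (0\<^sub>v (dgr \<rho>) :: complex Matrix.vec) $v 0" by simp
        then show False using irr by (simp add: irreducible_rep_def)
      qed
      ultimately show "\<exists>v\<in>carrier_vec (dgr \<rho>). v \<noteq> 0\<^sub>v (dgr \<rho>) \<and> (\<forall>k\<in>K. \<rho> k *\<^sub>v v = f k \<cdot>\<^sub>v v)"
        by (intro bexI[of _ "unit_vec (dgr \<rho>) 0"]) (auto simp: over_K)
    qed (use overI[OF irr] in blast)
    finally show ?thesis by simp
  qed
  have eqr: "{(\<rho>, \<sigma>). rep_equiv GM \<rho> \<sigma>} `` {\<rho>} = {\<sigma>. rep_equiv GM \<rho> \<sigma>}" for \<rho> by auto
  show ?thesis
  proof
    assume "c \<in> Irr_over GM K \<phi>"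
    then obtain \<rho> \<sigma> where \<rho>: "irreducible_rep GM \<rho>" "c = {\<sigma>. rep_equiv GM \<rho> \<sigma>}" "\<sigma> \<in> c"
      "rep_inner (GM\<lparr>carrier := K\<rparr>) \<sigma> \<phi> \<noteq> 0"
      unfolding Irr_over_def Irr_def quotient_def eqr by auto
    then have "over \<sigma>" using inner[of \<sigma>] rep_equiv_irreducible[of GM \<rho> \<sigma>] by auto
    then have "over \<rho>" using over_equiv[of \<sigma> \<rho>] rep_equiv_sym \<rho> by auto
    then show "\<exists>\<rho>. over \<rho> \<and> c = {\<sigma>. rep_equiv GM \<rho> \<sigma>}" using \<rho> by blast
  next
    assume "\<exists>\<rho>. over \<rho> \<and> c = {\<sigma>. rep_equiv GM \<rho> \<sigma>}"
    then obtain \<rho> where \<rho>: "over \<rho>" "c = {\<sigma>. rep_equiv GM \<rho> \<sigma>}" by blast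
    then have irr: "irreducible_rep GM \<rho>" by (simp add: over_def)
    have "c \<in> Irr GM" unfolding Irr_def quotient_def eqr using irr \<rho> by auto
    moreover have "\<rho> \<in> c" using \<rho> rep_equiv_refl[OF over_is_rep[OF \<rho>(1)]] by simp
    ultimately show "c \<in> Irr_over GM K \<phi>" unfolding Irr_over_def using inner[OF irr] \<rho>(1) by blast
  qed
qed

lemma overG_equiv:
  assumes "overG \<rho>" "rep_equiv G \<rho> \<sigma>"
  shows "overG \<sigma>"
proof -
  let ?n = "rep_degree G \<rho>"
  have irr: "irreducible_rep G \<sigma>" using rep_equiv_irreducible assms by (auto simp: overG_def)
  obtain P R where PRs: "P \<in> carrier_mat (rep_degree G \<rho>) (rep_degree G \<rho>)" "R \<in> carrier_mat (rep_degree G \<rho>) (rep_degree G \<rho>)"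
    "P * R = 1\<^sub>m (rep_degree G \<rho>)" "R * P = 1\<^sub>m (rep_degree G \<rho>)" "\<forall>g\<in>carrier G. P * \<rho> g = \<sigma> g * P"
    "is_rep G (\<rho>)" "is_rep G (\<sigma>)" "rep_degree G (\<sigma>) = rep_degree G \<rho>"
    using rep_equiv_vec[OF assms(2)] by blast
  note P = PRs(1) and R = PRs(2) and RP = PRs(4) and int = PRs(5) and rr = PRs(6) and rs = PRs(7) and dg = PRs(8)
  obtain v where v: "v \<in> carrier_vec ?n" "v \<noteq> 0\<^sub>v ?n" "\<forall>k\<in>K. \<rho> k *\<^sub>v v = f k \<cdot>\<^sub>v v"
    using assms(1) by (auto simp: overG_def)
  have "\<sigma> k *\<^sub>v (P *\<^sub>v v) = f k \<cdot>\<^sub>v (P *\<^sub>v v)" if k: "k \<in> K" for k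
  proof -
    have kc: "k \<in> carrier G" using sub k by blast
    have sk: "\<sigma> k \<in> carrier_mat ?n ?n" using is_rep_mat[OF rs kc] dg by simp
    have "\<sigma> k *\<^sub>v (P *\<^sub>v v) = (P * \<rho> k) *\<^sub>v v" using int kc by (simp add: assoc_mult_mat_vec[OF sk P v(1)])
    also have "\<dots> = P *\<^sub>v (f k \<cdot>\<^sub>v v)" using v(3) k by (simp add: assoc_mult_mat_vec[OF P is_rep_mat[OF rr kc] v(1)])
    also have "\<dots> = f k \<cdot>\<^sub>v (P *\<^sub>v v)" by (rule mult_mat_vec[OF P v(1)])
    finally show ?thesis .
  qed
  moreover have "P *\<^sub>v v \<noteq> 0\<^sub>v ?n" using left_inverse_cancel_vec[OF R P RP v(1)] mult_mat_zero_vec[OF R] v(2) by auto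
  ultimately show ?thesis using irr mult_mat_vec_carrier[OF P v(1)] unfolding overG_def dg by blast
qed

lemma Irr_over_G_iff:
  "c \<in> Irr_over G K \<phi> \<longleftrightarrow> (\<exists>\<rho>. overG \<rho> \<and> c = {\<sigma>. rep_equiv G \<rho> \<sigma>})"
proof -
  have inner: "rep_inner GK \<rho> \<phi> \<noteq> 0 \<longleftrightarrow> overG \<rho>" if irr: "irreducible_rep G \<rho>" for \<rho>
  proof -
    have rep: "is_rep G \<rho>" using irr by (simp add: irreducible_rep_def)
    have repK: "is_rep GK \<rho>" "rep_degree GK \<rho> = rep_degree G \<rho>"
      using is_rep_restrict[OF rep, of K] sub by auto
    have finK: "finite (carrier GK)" using fin subgroup.subset[OF K] by (simp add: finite_subset)
    show ?thesis
      using rep_inner_lin_rep_iff[OF groups(3) finK repK(1) f] irr by (simp add: repK(2) overG_def)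
  qed
  have eqr: "{(\<rho>, \<sigma>). rep_equiv G \<rho> \<sigma>} `` {\<rho>} = {\<sigma>. rep_equiv G \<rho> \<sigma>}" for \<rho> by auto
  show ?thesis
  proof
    assume "c \<in> Irr_over G K \<phi>"
    then obtain \<rho> \<sigma> where \<rho>: "irreducible_rep G \<rho>" "c = {\<sigma>. rep_equiv G \<rho> \<sigma>}" "\<sigma> \<in> c" "rep_inner GK \<sigma> \<phi> \<noteq> 0"
      unfolding Irr_over_def Irr_def quotient_def eqr by auto
    then have "overG \<sigma>" using inner[of \<sigma>] rep_equiv_irreducible[of G \<rho> \<sigma>] by auto
    then have "overG \<rho>" using overG_equiv[of \<sigma> \<rho>] rep_equiv_sym \<rho> by auto
    then show "\<exists>\<rho>. overG \<rho> \<and> c = {\<sigma>. rep_equiv G \<rho> \<sigma>}" using \<rho> by blast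
  next
    assume "\<exists>\<rho>. overG \<rho> \<and> c = {\<sigma>. rep_equiv G \<rho> \<sigma>}"
    then obtain \<rho> where \<rho>: "overG \<rho>" "c = {\<sigma>. rep_equiv G \<rho> \<sigma>}" by blast
    then have irr: "irreducible_rep G \<rho>" by (simp add: overG_def)
    have "c \<in> Irr G" unfolding Irr_def quotient_def eqr using irr \<rho> by auto
    moreover have "\<rho> \<in> c" using \<rho> rep_equiv_refl[OF irreducible_rep_imp_is_rep[OF irr]] by simp
    ultimately show "c \<in> Irr_over G K \<phi>" unfolding Irr_over_def using inner[OF irr] \<rho>(1) by blast
  qed
qed

text \<open>Everything rests on \<open>E_iff\<close>: two classes are \<open>C\<close>-conjugate
  exactly if their members have equivalent inductions. Hence \<open>Ind_orbit\<close> of an orbit is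
  a single class, and different orbits have different images. Surjectivity is
  \<open>equiv_Ind_of_overG\<close>.\<close>

lemma clifford_bij:
  "bij_betw (Ind_orbit G M) (conj_orbits G C (Irr_over GM K \<phi>)) (Irr_over G K \<phi>)"
proof -
  let ?X = "Irr_over GM K \<phi>"
  define E where "E = {(c, d). c \<in> ?X \<and> d \<in> ?X \<and> (\<exists>g\<in>C. \<exists>\<rho>\<in>c. conj_rep G g \<rho> \<in> d)}"
  have ov: "over \<rho>" if "c \<in> ?X" "\<rho> \<in> c" for c \<rho>
    using that over_equiv unfolding Irr_over_M_iff by blast
  have class_eq: "c = {\<sigma>. rep_equiv GM \<rho> \<sigma>}" if "c \<in> ?X" "\<rho> \<in> c" for c \<rho>
    using that rep_equiv_sym rep_equiv_trans unfolding Irr_over_M_iff by blast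
  have nonempty: "\<exists>\<rho>. \<rho> \<in> c" if "c \<in> ?X" for c
    using that rep_equiv_refl[OF over_is_rep] unfolding Irr_over_M_iff by blast
  have E_iff: "(c, d) \<in> E \<longleftrightarrow> rep_equiv G (Ind G M \<rho>) (Ind G M \<rho>')"
    if c: "c \<in> ?X" "\<rho> \<in> c" and d: "d \<in> ?X" "\<rho>' \<in> d" for c d \<rho> \<rho>'
  proof
    assume "(c, d) \<in> E"
    then obtain g \<rho>1 where g: "g \<in> C" "\<rho>1 \<in> c" "conj_rep G g \<rho>1 \<in> d" by (auto simp: E_def)
    have 1: "rep_equiv GM (conj_rep G g \<rho>1) \<rho>'" using class_eq[OF d(1) g(3)] d(2) by blast
    have "rep_equiv G (Ind G M \<rho>1) (Ind G M \<rho>')"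
      by (rule Ind_equiv_of_conj[OF ov[OF c(1) g(2)] ov[OF d] g(1) 1])
    \<comment> \<open>Conjugation by 1 covers the change of member within a class.\<close>
    moreover have "rep_equiv G (Ind G M \<rho>) (Ind G M \<rho>1)"
    proof (rule Ind_equiv_of_conj[OF ov[OF c] ov[OF c(1) g(2)]])
      show oneC: "\<one> \<in> C" using MC clo(3) by blast
      have r: "rep_equiv GM \<rho> \<rho>1" using class_eq[OF c] g(2) by blast
      have "conj_rep G \<one> \<rho> m = \<rho> m" if "m \<in> M" for m using sub(1)[OF that] by (simp add: conj_rep_def)
      moreover have "rep_degree GM (conj_rep G \<one> \<rho>) = dgr \<rho>" by (rule conj_rep_over(2)[OF ov[OF c] oneC])
      moreover have "is_rep GM (conj_rep G \<one> \<rho>)" by (rule over_is_rep[OF conj_rep_over(1)[OF ov[OF c] oneC]])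
      ultimately show "rep_equiv GM (conj_rep G \<one> \<rho>) \<rho>1" using r unfolding rep_equiv_def by auto
    qed
    ultimately show "rep_equiv G (Ind G M \<rho>) (Ind G M \<rho>')" using rep_equiv_trans by blast
  next
    assume "rep_equiv G (Ind G M \<rho>) (Ind G M \<rho>')"
    then obtain g where g: "g \<in> C" "rep_equiv GM \<rho>' (conj_rep G g \<rho>)"
      using conj_of_Ind_equiv[OF ov[OF d] ov[OF c] rep_equiv_sym] by blast
    then have "conj_rep G g \<rho> \<in> d" using class_eq[OF d] by blast
    then show "(c, d) \<in> E" using g(1) c d by (auto simp: E_def)
  qed
  have orbit: "Ind_orbit G M (E `` {c}) = {\<sigma>. rep_equiv G (Ind G M \<rho>) \<sigma>}" if c: "c \<in> ?X" "\<rho> \<in> c" for c \<rho>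
  proof
    show "Ind_orbit G M (E `` {c}) \<subseteq> {\<sigma>. rep_equiv G (Ind G M \<rho>) \<sigma>}"
    proof
      fix \<sigma> assume "\<sigma> \<in> Ind_orbit G M (E `` {c})"
      then obtain d \<rho>' where d: "(c, d) \<in> E" "\<rho>' \<in> d" "rep_equiv G (Ind G M \<rho>') \<sigma>" by (auto simp: Ind_orbit_def)
      then have "rep_equiv G (Ind G M \<rho>) (Ind G M \<rho>')" using E_iff[OF c, of d \<rho>'] by (auto simp: E_def)
      then show "\<sigma> \<in> {\<sigma>. rep_equiv G (Ind G M \<rho>) \<sigma>}" using d(3) rep_equiv_trans by blast
    qed
    have "(c, c) \<in> E" using E_iff[OF c c] rep_equiv_refl induced_rep.Ind_is_rep[OF induced[OF over_is_rep[OF ov[OF c]]]] by blast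
    then show "{\<sigma>. rep_equiv G (Ind G M \<rho>) \<sigma>} \<subseteq> Ind_orbit G M (E `` {c})" using c by (auto simp: Ind_orbit_def)
  qed
  have orbits: "conj_orbits G C ?X = {E `` {c} | c. c \<in> ?X}"
    by (auto simp: conj_orbits_def quotient_def E_def)
  show ?thesis unfolding bij_betw_def
  proof
    show "inj_on (Ind_orbit G M) (conj_orbits G C ?X)"
    proof (rule inj_onI)
      fix Q Q' assume "Q \<in> conj_orbits G C ?X" "Q' \<in> conj_orbits G C ?X" and eq: "Ind_orbit G M Q = Ind_orbit G M Q'"
      then obtain c c' where c: "c \<in> ?X" "Q = E `` {c}" and c': "c' \<in> ?X" "Q' = E `` {c'}" unfolding orbits by blast
      obtain \<rho> \<rho>' where \<rho>: "\<rho> \<in> c" "\<rho>' \<in> c'" using nonempty c c' by blast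
      have "{\<sigma>. rep_equiv G (Ind G M \<rho>) \<sigma>} = {\<sigma>. rep_equiv G (Ind G M \<rho>') \<sigma>}"
        using eq orbit[OF c(1) \<rho>(1)] orbit[OF c'(1) \<rho>(2)] c c' by simp
      then have cc: "rep_equiv G (Ind G M \<rho>') (Ind G M \<rho>)"
        using rep_equiv_refl induced_rep.Ind_is_rep[OF induced[OF over_is_rep[OF ov[OF c(1) \<rho>(1)]]]] by blast
      have "(c, d) \<in> E \<longleftrightarrow> (c', d) \<in> E" for d
      proof (cases "d \<in> ?X")
        case True
        then obtain \<rho>2 where \<rho>2: "\<rho>2 \<in> d" using nonempty by blast
        show ?thesis unfolding E_iff[OF c(1) \<rho>(1) True \<rho>2] E_iff[OF c'(1) \<rho>(2) True \<rho>2]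
          using cc rep_equiv_trans rep_equiv_sym by blast
      qed (auto simp: E_def)
      then show "Q = Q'" using c c' by auto
    qed
    show "Ind_orbit G M ` conj_orbits G C ?X = Irr_over G K \<phi>"
    proof
      show "Ind_orbit G M ` conj_orbits G C ?X \<subseteq> Irr_over G K \<phi>"
      proof
        fix c' assume "c' \<in> Ind_orbit G M ` conj_orbits G C ?X"
        then obtain c where c: "c \<in> ?X" "c' = Ind_orbit G M (E `` {c})" unfolding orbits by blast
        obtain \<rho> where \<rho>: "\<rho> \<in> c" using nonempty c by blast
        show "c' \<in> Irr_over G K \<phi>" unfolding Irr_over_G_iff
          using orbit[OF c(1) \<rho>] c(2) Ind_overG[OF ov[OF c(1) \<rho>]] by blast
      qed
      show "Irr_over G K \<phi> \<subseteq> Ind_orbit G M ` conj_orbits G C ?X"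
      proof
        fix c' assume "c' \<in> Irr_over G K \<phi>"
        then obtain \<sigma> where \<sigma>: "overG \<sigma>" "c' = {\<tau>. rep_equiv G \<sigma> \<tau>}" unfolding Irr_over_G_iff by blast
        obtain \<rho> where \<rho>: "over \<rho>" "rep_equiv G (Ind G M \<rho>) \<sigma>" using equiv_Ind_of_overG[OF \<sigma>(1)] by blast
        define c where "c = {\<tau>. rep_equiv GM \<rho> \<tau>}"
        have c: "c \<in> ?X" "\<rho> \<in> c" using \<rho>(1) rep_equiv_refl[OF over_is_rep[OF \<rho>(1)]] unfolding Irr_over_M_iff c_def by auto
        have "Ind_orbit G M (E `` {c}) = c'"
          unfolding orbit[OF c] \<sigma>(2) using \<rho>(2) rep_equiv_trans rep_equiv_sym by blast
        then show "c' \<in> Ind_orbit G M ` conj_orbits G C ?X" unfolding orbits using c(1) by blast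
      qed
    qed
  qed
qed

end

section \<open>Extending linear characters\<close>

lemma complex_root_exists: "0 < m \<Longrightarrow> \<exists>c :: complex. c ^ m = z"
proof -
  assume m: "0 < m"
  obtain r a where z: "z = rcis r a" "0 \<le> r" using rcis_Ex[of z] by (metis norm_ge_zero rcis_cmod_Arg)
  have "rcis (root m r) (a / real m) ^ m = rcis (root m r ^ m) (real m * (a / real m))" by (rule DeMoivre2)
  also have "\<dots> = z" using m z by simp
  finally show ?thesis by blast
qed

lemma extends_one_dim_iff:
  "extends_one_dim G K H (lin_rep f) \<longleftrightarrow> (\<exists>\<theta>. lin_char (G\<lparr>carrier := H\<rparr>) \<theta> \<and> (\<forall>k\<in>K. \<theta> k = f k))"
proof
  assume "extends_one_dim G K H (lin_rep f)"
  then obtain \<rho> where \<rho>: "is_rep (G\<lparr>carrier := H\<rparr>) \<rho>" "rep_degree (G\<lparr>carrier := H\<rparr>) \<rho> = 1" "\<forall>k\<in>K. \<rho> k = lin_rep f k"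
    unfolding extends_one_dim_def by blast
  define \<theta> where "\<theta> g = \<rho> g $$ (0, 0)" for g
  have c: "\<rho> g \<in> carrier_mat 1 1" if "g \<in> H" for g using is_rep_mat[OF \<rho>(1), of g] that \<rho>(2) by simp
  have "lin_char (G\<lparr>carrier := H\<rparr>) \<theta>" unfolding lin_char_def
  proof (intro conjI ballI)
    show "\<theta> \<one>\<^bsub>G\<lparr>carrier := H\<rparr>\<^esub> = 1" using is_rep_one[OF \<rho>(1)] \<rho>(2) by (simp add: \<theta>_def)
    fix x y assume "x \<in> carrier (G\<lparr>carrier := H\<rparr>)" "y \<in> carrier (G\<lparr>carrier := H\<rparr>)"
    then have "\<rho> (x \<otimes>\<^bsub>G\<^esub> y) = \<rho> x * \<rho> y" "x \<in> H" "y \<in> H" using is_rep_mult[OF \<rho>(1), of x y] by auto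
    then show "\<theta> (x \<otimes>\<^bsub>G\<lparr>carrier := H\<rparr>\<^esub> y) = \<theta> x * \<theta> y"
      using c[of x] c[of y] by (simp add: \<theta>_def scalar_prod_def)
  qed
  moreover have "\<forall>k\<in>K. \<theta> k = f k" using \<rho>(3) by (simp add: \<theta>_def lin_rep_def)
  ultimately show "\<exists>\<theta>. lin_char (G\<lparr>carrier := H\<rparr>) \<theta> \<and> (\<forall>k\<in>K. \<theta> k = f k)" by blast
next
  assume "\<exists>\<theta>. lin_char (G\<lparr>carrier := H\<rparr>) \<theta> \<and> (\<forall>k\<in>K. \<theta> k = f k)"
  then obtain \<theta> where \<theta>: "lin_char (G\<lparr>carrier := H\<rparr>) \<theta>" "\<forall>k\<in>K. \<theta> k = f k" by blast
  have d: "rep_degree (G\<lparr>carrier := H\<rparr>) (lin_rep \<theta>) = 1" by (simp add: rep_degree_def lin_rep_def)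
  have "is_rep (G\<lparr>carrier := H\<rparr>) (lin_rep \<theta>)"
    unfolding is_rep_def d
  proof (intro conjI ballI)
    show "lin_rep \<theta> g \<in> carrier_mat 1 1" for g by (simp add: lin_rep_def)
    show "lin_rep \<theta> \<one>\<^bsub>G\<lparr>carrier := H\<rparr>\<^esub> = 1\<^sub>m 1"
      using \<theta>(1) by (intro eq_matI) (auto simp: lin_rep_def lin_char_def)
    fix g h assume "g \<in> carrier (G\<lparr>carrier := H\<rparr>)" "h \<in> carrier (G\<lparr>carrier := H\<rparr>)"
    then show "lin_rep \<theta> (g \<otimes>\<^bsub>G\<lparr>carrier := H\<rparr>\<^esub> h) = lin_rep \<theta> g * lin_rep \<theta> h"
      using \<theta>(1) by (intro eq_matI) (auto simp: lin_rep_def lin_char_def scalar_prod_def)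
  qed
  moreover have "\<forall>k\<in>K. lin_rep \<theta> k = lin_rep f k" using \<theta>(2) by (simp add: lin_rep_def)
  ultimately show "extends_one_dim G K H (lin_rep f)" unfolding extends_one_dim_def using d by blast
qed

section \<open>Extension of invariant characters\<close>

context group
begin

lemma set_mult_generate:
  assumes "finite (carrier G)" "e \<in> carrier G"
  shows "N <#> generate G {e} = {x \<otimes> e [^] k | x k. x \<in> N \<and> k \<in> (UNIV :: nat set)}"
  using generate_pow_on_finite_carrier[OF assms] by (auto simp: set_mult_def)

text \<open>As e normalizes \<open>N\<close> and fixes \<theta>, the rule x e^k -> \<theta>(x) c^k
  is multiplicative. It is well defined if c^m agrees with \<theta> at the first positive power e^m
  that lies in \<open>N\<close>, and the complex numbers contain such a root c.\<close>

lemma extend_lin_char_cyclic: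
  assumes fin: "finite (carrier G)" and N: "subgroup N G" and e: "e \<in> carrier G"
    and norm: "\<And>x. x \<in> N \<Longrightarrow> e \<otimes> x \<otimes> inv e \<in> N"
    and \<theta>: "lin_char (G\<lparr>carrier := N\<rparr>) \<theta>" and inv: "\<And>x. x \<in> N \<Longrightarrow> \<theta> (e \<otimes> x \<otimes> inv e) = \<theta> x"
  shows "subgroup (N <#> generate G {e}) G" (is "subgroup ?S G")
    "\<exists>\<eta>. lin_char (G\<lparr>carrier := N <#> generate G {e}\<rparr>) \<eta> \<and> (\<forall>x\<in>N. \<eta> x = \<theta> x)"
proof -
  interpret N: subgroup N G by (rule N)
  have mult: "\<theta> (x \<otimes> y) = \<theta> x * \<theta> y" if "x \<in> N" "y \<in> N" for x y using \<theta> that by (simp add: lin_char_def)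
  have one: "\<theta> \<one> = 1" using \<theta> by (simp add: lin_char_def)
  note S = set_mult_generate[OF fin e, of N]
  have conj: "e [^] k \<otimes> x \<otimes> inv (e [^] k) \<in> N \<and> \<theta> (e [^] k \<otimes> x \<otimes> inv (e [^] k)) = \<theta> x" if "x \<in> N" for k :: nat and x
    using that
  proof (induction k arbitrary: x)
    case 0
    then show ?case by simp
  next
    case (Suc k)
    have "e [^] Suc k \<otimes> x \<otimes> inv (e [^] Suc k) = e [^] k \<otimes> (e \<otimes> x \<otimes> inv e) \<otimes> inv (e [^] k)"
      using e Suc.prems by (simp add: m_assoc inv_mult_group)
    then show ?case using Suc.IH[OF norm[OF Suc.prems]] inv[OF Suc.prems] by simp
  qed
  have prod: "(x \<otimes> e [^] j) \<otimes> (y \<otimes> e [^] k) = (x \<otimes> (e [^] j \<otimes> y \<otimes> inv (e [^] j))) \<otimes> e [^] (j + k)"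
    if "x \<in> N" "y \<in> N" for x y and j k :: nat
    using that e by (simp add: m_assoc nat_pow_mult[symmetric])
  have Sc: "?S \<subseteq> carrier G" using e by (auto simp: S)
  have Sm: "a \<otimes> b \<in> ?S" if ab: "a \<in> ?S" "b \<in> ?S" for a b
  proof -
    obtain x j where a: "a = x \<otimes> e [^] (j::nat)" "x \<in> N" using ab(1) unfolding S by auto
    obtain y k where b: "b = y \<otimes> e [^] (k::nat)" "y \<in> N" using ab(2) unfolding S by auto
    have "x \<otimes> (e [^] j \<otimes> y \<otimes> inv (e [^] j)) \<in> N" using conj[OF b(2), of j] a(2) by simp
    then show ?thesis unfolding a b prod[OF a(2) b(2)] S by blast
  qed
  show sub: "subgroup ?S G"
  proof (rule subgroupI[OF Sc])
    have oneS: "\<one> \<in> ?S" unfolding S using N.one_closed by (auto intro!: exI[of _ \<one>] exI[of _ "0::nat"])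
    then show "?S \<noteq> {}" by blast
    fix a assume "a \<in> ?S"
    then obtain x j where a: "a = x \<otimes> e [^] (j::nat)" "x \<in> N" unfolding S by auto
    \<comment> \<open>By finiteness the inverse of a power of e is again a power with natural
      exponent.\<close>
    have "inv (e [^] j) \<in> generate G {e}"
    proof -
      have "e [^] j \<in> generate G {e}" using generate_pow_on_finite_carrier[OF fin e] by auto
      then show ?thesis using generate_is_subgroup[of "{e}"] e by (simp add: subgroup.m_inv_closed)
    qed
    then obtain k :: nat where k: "inv (e [^] j) = e [^] k" using generate_pow_on_finite_carrier[OF fin e] by auto
    have "inv a = (e [^] k \<otimes> inv x \<otimes> inv (e [^] k)) \<otimes> e [^] k"
      using a e k by (simp add: inv_mult_group m_assoc)
    moreover have "e [^] k \<otimes> inv x \<otimes> inv (e [^] k) \<in> N" using conj[of "inv x" k] a by simp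
    ultimately show "inv a \<in> ?S" unfolding S by blast
  qed (use Sm in auto)
  define m where "m = (LEAST m::nat. 0 < m \<and> e [^] m \<in> N)"
  have "0 < m \<and> e [^] m \<in> N" unfolding m_def
  proof (rule LeastI)
    show "0 < Coset.order G \<and> e [^] Coset.order G \<in> N"
      using fin e order_gt_0_iff_finite pow_order_eq_1 by simp
  qed
  then have m: "0 < m" "e [^] m \<in> N" by auto
  obtain c where c: "c ^ m = \<theta> (e [^] m)" using complex_root_exists[OF m(1)] by blast
  have c_pow: "\<theta> (e [^] k) = c ^ k" if k: "e [^] k \<in> N" for k :: nat
  proof -
    have emq: "e [^] (m * q) \<in> N \<and> \<theta> (e [^] (m * q)) = c ^ (m * q)" for q
    proof (induction q)
      case (Suc q)
      have "e [^] (m * Suc q) = e [^] m \<otimes> e [^] (m * q)" using e by (simp add: nat_pow_mult)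
      then show ?case using Suc m mult c by (simp add: power_add)
    qed (use one in simp)
    have "e [^] k = e [^] (m * (k div m)) \<otimes> e [^] (k mod m)" using e by (simp add: nat_pow_mult)
    then have "e [^] (k mod m) = inv (e [^] (m * (k div m))) \<otimes> e [^] k" using e by simp
    then have "e [^] (k mod m) \<in> N" using k emq by simp
    then have "k mod m = 0"
      using not_less_Least[of "k mod m" "\<lambda>m. 0 < m \<and> e [^] m \<in> N"] m(1) unfolding m_def[symmetric] by auto
    then have "k = m * (k div m)" using mult_div_mod_eq[of m k] by simp
    then show ?thesis using emq[of "k div m"] by simp
  qed
  have cancel: "\<theta> x * c ^ j = \<theta> y * c ^ k" if xy: "x \<in> N" "y \<in> N" and eq: "x \<otimes> e [^] j = y \<otimes> e [^] k" and jk: "j \<le> k"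
    for x y and j k :: nat
  proof -
    have "x \<otimes> e [^] j = (y \<otimes> e [^] (k - j)) \<otimes> e [^] j"
      using eq e xy jk by (simp add: m_assoc nat_pow_mult)
    then have x: "x = y \<otimes> e [^] (k - j)" using e xy by simp
    then have "e [^] (k - j) = inv y \<otimes> x" using e xy by simp
    then have p: "e [^] (k - j) \<in> N" using xy by simp
    have "\<theta> x = \<theta> y * c ^ (k - j)" using mult[OF xy(2) p] c_pow[OF p] x by simp
    then have "\<theta> x * c ^ j = \<theta> y * (c ^ (k - j) * c ^ j)" by simp
    then show ?thesis using jk by (simp add: power_add[symmetric])
  qed
  \<comment> \<open>The value is chosen over all ways to write g; \<open>cancel\<close> shows that
    they agree.\<close>
  define \<eta> where "\<eta> g = (SOME z. \<exists>x\<in>N. \<exists>k::nat. g = x \<otimes> e [^] k \<and> z = \<theta> x * c ^ k)" for g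
  have \<eta>: "\<eta> (x \<otimes> e [^] k) = \<theta> x * c ^ k" if x: "x \<in> N" for x and k :: nat
  proof -
    have "\<exists>y\<in>N. \<exists>j::nat. x \<otimes> e [^] k = y \<otimes> e [^] j \<and> \<eta> (x \<otimes> e [^] k) = \<theta> y * c ^ j"
      unfolding \<eta>_def by (rule someI_ex) (use x in blast)
    then obtain y j where y: "y \<in> N" "x \<otimes> e [^] k = y \<otimes> e [^] (j::nat)" "\<eta> (x \<otimes> e [^] k) = \<theta> y * c ^ j" by blast
    then show ?thesis using cancel[OF x y(1), of k j] cancel[OF y(1) x, of j k] by (cases "k \<le> j") auto
  qed
  have "lin_char (G\<lparr>carrier := ?S\<rparr>) \<eta>" unfolding lin_char_def
  proof (intro conjI ballI)
    show "\<eta> \<one>\<^bsub>G\<lparr>carrier := ?S\<rparr>\<^esub> = 1" using \<eta>[of \<one> 0] one by simp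
    fix a b assume "a \<in> carrier (G\<lparr>carrier := ?S\<rparr>)" "b \<in> carrier (G\<lparr>carrier := ?S\<rparr>)"
    then have ab: "a \<in> ?S" "b \<in> ?S" by simp_all
    obtain x j where a: "a = x \<otimes> e [^] (j::nat)" "x \<in> N" using ab(1) unfolding S by auto
    obtain y k where b: "b = y \<otimes> e [^] (k::nat)" "y \<in> N" using ab(2) unfolding S by auto
    have "\<eta> (a \<otimes> b) = \<theta> (x \<otimes> (e [^] j \<otimes> y \<otimes> inv (e [^] j))) * c ^ (j + k)"
      unfolding a b prod[OF a(2) b(2)] using conj[OF b(2), of j] a(2) by (intro \<eta>) simp
    also have "\<dots> = \<theta> x * \<theta> y * c ^ (j + k)" using conj[OF b(2), of j] mult[OF a(2)] by simp
    finally show "\<eta> (a \<otimes>\<^bsub>G\<lparr>carrier := ?S\<rparr>\<^esub> b) = \<eta> a * \<eta> b"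
      using \<eta>[OF a(2), of j] \<eta>[OF b(2), of k] a b by (simp add: power_add)
  qed
  moreover have "\<eta> x = \<theta> x" if "x \<in> N" for x using \<eta>[OF that, of 0] that by simp
  ultimately show "\<exists>\<eta>. lin_char (G\<lparr>carrier := ?S\<rparr>) \<eta> \<and> (\<forall>x\<in>N. \<eta> x = \<theta> x)" by blast
qed

text \<open>Take a largest subgroup that carries an extension. Any further x of \<open>X\<close>
  normalizes it and fixes the extension, because commutators with x lie in \<open>K\<close> and are
  killed by \<open>f\<close>; so one more cyclic step would be possible.\<close>

lemma extend_lin_char:
  assumes fin: "finite (carrier G)" and K: "subgroup K G" and X: "subgroup X G" and KX: "K \<subseteq> X"
    and f: "lin_char (G\<lparr>carrier := K\<rparr>) f"
    and comm: "\<And>x y. x \<in> X \<Longrightarrow> y \<in> X \<Longrightarrow> x \<otimes> y \<otimes> inv x \<otimes> inv y \<in> K \<and> f (x \<otimes> y \<otimes> inv x \<otimes> inv y) = 1"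
  shows "\<exists>\<theta>. lin_char (G\<lparr>carrier := X\<rparr>) \<theta> \<and> (\<forall>k\<in>K. \<theta> k = f k)"
proof -
  define S where "S = {H. subgroup H G \<and> K \<subseteq> H \<and> H \<subseteq> X \<and>
    (\<exists>\<theta>. lin_char (G\<lparr>carrier := H\<rparr>) \<theta> \<and> (\<forall>k\<in>K. \<theta> k = f k))}"
  have Xc: "X \<subseteq> carrier G" by (rule subgroup.subset[OF X])
  have finX: "finite X" by (rule finite_subset[OF Xc fin])
  have finS: "finite S" by (rule finite_subset[of _ "Pow X"]) (use finX in \<open>auto simp: S_def\<close>)
  have "K \<in> S" unfolding S_def using K KX f by blast
  then have Sne: "card ` S \<noteq> {}" by blast
  have "Max (card ` S) \<in> card ` S" by (rule Max_in[OF finite_imageI[OF finS] Sne])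
  then obtain H where H: "H \<in> S" "card H = Max (card ` S)" by auto
  have mx: "card H' \<le> card H" if "H' \<in> S" for H' using H(2) finS that by simp
  from H(1) obtain \<theta> where Hs: "subgroup H G" "K \<subseteq> H" "H \<subseteq> X" and \<theta>: "lin_char (G\<lparr>carrier := H\<rparr>) \<theta>" "\<forall>k\<in>K. \<theta> k = f k"
    unfolding S_def by blast
  interpret H: subgroup H G by (rule Hs)
  have "X \<subseteq> H"
  proof (rule ccontr)
    assume "\<not> X \<subseteq> H"
    then obtain x where x: "x \<in> X" "x \<notin> H" by blast
    have xc: "x \<in> carrier G" using x Xc by blast
    have e: "x \<otimes> h \<otimes> inv x = (x \<otimes> h \<otimes> inv x \<otimes> inv h) \<otimes> h" if "h \<in> H" for h using xc that by (simp add: m_assoc)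
    have n: "x \<otimes> h \<otimes> inv x \<in> H" "\<theta> (x \<otimes> h \<otimes> inv x) = \<theta> h" if h: "h \<in> H" for h
    proof -
      note c = comm[OF x(1) subsetD[OF Hs(3) h]]
      have cH: "x \<otimes> h \<otimes> inv x \<otimes> inv h \<in> H" using c Hs(2) by blast
      show "x \<otimes> h \<otimes> inv x \<in> H" using e[OF h] cH h by (metis H.m_closed)
      have "\<theta> ((x \<otimes> h \<otimes> inv x \<otimes> inv h) \<otimes> h) = \<theta> h"
        using \<theta> c cH h by (simp add: lin_char_def)
      then show "\<theta> (x \<otimes> h \<otimes> inv x) = \<theta> h" using e[OF h] by simp
    qed
    let ?H = "H <#> generate G {x}"
    note ext = extend_lin_char_cyclic[OF fin Hs(1) xc n(1) \<theta>(1) n(2)]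
    have HH: "?H = {h \<otimes> x [^] k | h k. h \<in> H \<and> k \<in> (UNIV :: nat set)}" by (rule set_mult_generate[OF fin xc])
    have sub: "H \<subseteq> ?H" unfolding HH
    proof
      fix h assume h: "h \<in> H"
      then have "h = h \<otimes> x [^] (0::nat)" by simp
      then show "h \<in> {h \<otimes> x [^] k | h k. h \<in> H \<and> k \<in> (UNIV :: nat set)}" using h by blast
    qed
    have xH: "x \<in> ?H" unfolding HH using xc by (auto intro!: exI[of _ \<one>] exI[of _ "1::nat"])
    have HX: "?H \<subseteq> X"
    proof -
      have "x [^] k \<in> X" for k :: nat by (induction k) (use x X in \<open>auto simp: subgroup.one_closed subgroup.m_closed\<close>)
      then show ?thesis unfolding HH using Hs(3) X by (auto simp: subgroup.m_closed)
    qed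
    obtain \<eta> where \<eta>: "lin_char (G\<lparr>carrier := ?H\<rparr>) \<eta>" "\<forall>h\<in>H. \<eta> h = \<theta> h" using ext(2) by blast
    have "\<forall>k\<in>K. \<eta> k = f k" using \<eta>(2) \<theta>(2) Hs(2) by auto
    then have HS: "?H \<in> S" unfolding S_def using ext(1) Hs(2) sub HX \<eta>(1) by blast
    have "H \<subset> ?H" using sub xH x(2) by blast
    then have "card H < card ?H" by (rule psubset_card_mono[OF finite_subset[OF HX finX]])
    with mx[OF HS] show False by simp
  qed
  then have "H = X" using Hs(3) by blast
  then show ?thesis using \<theta> by blast
qed

end

section \<open>Quotients by a subgroup containing commutators\<close>

lemma (in normal) comm_group_Mod:
  assumes "\<And>x y. x \<in> carrier G \<Longrightarrow> y \<in> carrier G \<Longrightarrow> x \<otimes> y \<otimes> inv x \<otimes> inv y \<in> H"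
  shows "comm_group (G Mod H)"
proof (rule group.group_comm_groupI[OF factorgroup_is_group])
  fix X Y assume "X \<in> carrier (G Mod H)" "Y \<in> carrier (G Mod H)"
  then obtain x y where x: "x \<in> carrier G" "X = H #> x" and y: "y \<in> carrier G" "Y = H #> y"
    by (auto simp: carrier_FactGroup)
  have "(x \<otimes> y) = (x \<otimes> y \<otimes> inv x \<otimes> inv y) \<otimes> (y \<otimes> x)" using x y by (simp add: m_assoc)
  then have "x \<otimes> y \<in> H #> (y \<otimes> x)" using assms[OF x(1) y(1)] unfolding r_coset_def by auto
  then have "H #> (y \<otimes> x) = H #> (x \<otimes> y)" using x y by (intro repr_independence) (auto simp: is_subgroup)
  then show "X \<otimes>\<^bsub>G Mod H\<^esub> Y = Y \<otimes>\<^bsub>G Mod H\<^esub> X" using x y by (simp add: rcos_sum)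
qed

text \<open>\<open>N\<close> has index two and e squares into \<open>H\<close>, so the coset of e
  generates a complement of order two.\<close>

lemma (in normal) abelian_semidirect_Mod:
  assumes N: "subgroup N G" and HN: "H \<subseteq> N"
    and comm: "\<And>x y. x \<in> N \<Longrightarrow> y \<in> N \<Longrightarrow> x \<otimes> y \<otimes> inv x \<otimes> inv y \<in> H"
    and e: "e \<in> carrier G" "e \<notin> N" "e \<otimes> e \<in> H"
    and norm: "\<And>x. x \<in> N \<Longrightarrow> e \<otimes> x \<otimes> inv e \<in> N"
    and all: "\<And>g. g \<in> carrier G \<Longrightarrow> g \<in> N \<or> (\<exists>x\<in>N. g = x \<otimes> e)"
  shows "abelian_semidirect_order_two (G Mod H)"
proof -
  interpret N: subgroup N G by (rule N)
  interpret Q: group "G Mod H" by (rule factorgroup_is_group)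
  have gh: "group_hom G (G Mod H) (\<lambda>a. H #> a)"
    by (simp add: group_hom_def group_hom_axioms_def r_coset_hom_Mod Q.is_group is_group)
  have surj: "(\<lambda>a. H #> a) ` carrier G = carrier (G Mod H)" by (simp add: carrier_FactGroup)
  have mult: "(H #> x) \<otimes>\<^bsub>G Mod H\<^esub> (H #> y) = H #> (x \<otimes> y)" if "x \<in> carrier G" "y \<in> carrier G" for x y
    using that by (simp add: rcos_sum)
  have eq: "H #> x = H #> y \<longleftrightarrow> x \<otimes> inv y \<in> H" if x: "x \<in> carrier G" and y: "y \<in> carrier G" for x y
  proof
    assume "H #> x = H #> y"
    then have "x \<in> H #> y" using rcos_self[OF x is_subgroup] by simp
    then obtain h where h: "h \<in> H" "x = h \<otimes> y" unfolding r_coset_def by auto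
    then show "x \<otimes> inv y \<in> H" using y by (simp add: m_assoc)
  next
    assume a: "x \<otimes> inv y \<in> H"
    have "x = (x \<otimes> inv y) \<otimes> y" using x y by (simp add: m_assoc)
    then have "x \<in> H #> y" using a unfolding r_coset_def by auto
    then show "H #> x = H #> y" using repr_independence[OF _ _ is_subgroup, of x y] y by simp
  qed
  have eq1: "H #> x = H \<longleftrightarrow> x \<in> H" if "x \<in> carrier G" for x
    using eq[OF that one_closed] that by (simp add: coset_mult_one subset)
  have NG: "N \<lhd> G"
  proof (rule normalI[OF N], intro ballI)
    have conj: "g \<otimes> n \<otimes> inv g \<in> N" if g: "g \<in> carrier G" and n: "n \<in> N" for g n
    proof (cases "g \<in> N")
      case False
      then obtain x where x: "x \<in> N" "g = x \<otimes> e" using all g by blast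
      have "g \<otimes> n \<otimes> inv g = x \<otimes> (e \<otimes> n \<otimes> inv e) \<otimes> inv x" using x e n by (simp add: m_assoc inv_mult_group)
      then show ?thesis using norm[OF n] x by simp
    qed (use n in simp)
    fix x assume x: "x \<in> carrier G"
    show "N #> x = x <# N"
    proof
      show "N #> x \<subseteq> x <# N"
      proof
        fix y assume "y \<in> N #> x"
        then obtain n where n: "n \<in> N" "y = n \<otimes> x" unfolding r_coset_def by auto
        have "inv x \<otimes> n \<otimes> inv (inv x) \<in> N" by (rule conj[OF inv_closed[OF x] n(1)])
        moreover have "y = x \<otimes> (inv x \<otimes> n \<otimes> inv (inv x))" using n x by (simp add: m_assoc)
        ultimately show "y \<in> x <# N" unfolding l_coset_def by auto
      qed
      show "x <# N \<subseteq> N #> x"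
      proof
        fix y assume "y \<in> x <# N"
        then obtain n where n: "n \<in> N" "y = x \<otimes> n" unfolding l_coset_def by auto
        have "y = (x \<otimes> n \<otimes> inv x) \<otimes> x" using n x by (simp add: m_assoc)
        then show "y \<in> N #> x" using conj[OF x n(1)] unfolding r_coset_def by auto
      qed
    qed
  qed
  define N' where "N' = (\<lambda>a. H #> a) ` N"
  define T where "T = {H, H #> e}"
  have N'n: "N' \<lhd> (G Mod H)" unfolding N'_def by (rule normal.surj_hom_normal_subgroup[OF NG gh surj])
  have N's: "subgroup N' (G Mod H)" by (rule normal_imp_subgroup[OF N'n])
  have "comm_group ((G Mod H)\<lparr>carrier := N'\<rparr>)"
  proof (rule group.group_comm_groupI[OF subgroup.subgroup_is_group[OF N's Q.is_group]])
    fix X Y assume "X \<in> carrier ((G Mod H)\<lparr>carrier := N'\<rparr>)" "Y \<in> carrier ((G Mod H)\<lparr>carrier := N'\<rparr>)"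
    then obtain x y where x: "x \<in> N" "X = H #> x" and y: "y \<in> N" "Y = H #> y" by (auto simp: N'_def)
    have "H #> (x \<otimes> y) = H #> (y \<otimes> x)"
      using comm[OF x(1) y(1)] x y by (subst eq) (auto simp: inv_mult_group m_assoc)
    then show "X \<otimes>\<^bsub>(G Mod H)\<lparr>carrier := N'\<rparr>\<^esub> Y = Y \<otimes>\<^bsub>(G Mod H)\<lparr>carrier := N'\<rparr>\<^esub> X"
      using x y mult[of x y] mult[of y x] by simp
  qed
  moreover have eH: "e \<notin> H" using e HN by blast
  have HeH: "H #> e \<noteq> H" using eq1[OF e(1)] eH by blast
  have one: "\<one>\<^bsub>G Mod H\<^esub> = H" by simp
  have ee: "(H #> e) \<otimes>\<^bsub>G Mod H\<^esub> (H #> e) = H" using mult[OF e(1) e(1)] eq1[of "e \<otimes> e"] e by simp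
  have Hc: "H \<in> carrier (G Mod H)" using Q.one_closed by simp
  have Hec: "H #> e \<in> carrier (G Mod H)" using e by (auto simp: carrier_FactGroup)
  have "subgroup T (G Mod H)"
  proof (rule Q.subgroupI)
    show "T \<subseteq> carrier (G Mod H)" using Hc Hec by (simp add: T_def)
    show "T \<noteq> {}" by (simp add: T_def)
    have "inv\<^bsub>G Mod H\<^esub> (H #> e) = H #> e" using Q.inv_equality[of "H #> e" "H #> e"] ee Hec by simp
    moreover have "inv\<^bsub>G Mod H\<^esub> H = H" using Q.inv_one by simp
    ultimately show "inv\<^bsub>G Mod H\<^esub> a \<in> T" if "a \<in> T" for a using that by (auto simp: T_def)
    show "a \<otimes>\<^bsub>G Mod H\<^esub> b \<in> T" if "a \<in> T" "b \<in> T" for a b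
      using that ee Q.l_one[OF Hec] Q.r_one[OF Hec] Q.l_one[OF Hc] unfolding T_def one by auto
  qed
  moreover have "card T = 2" using HeH by (simp add: T_def)
  moreover have "N' \<inter> T = {\<one>\<^bsub>G Mod H\<^esub>}"
  proof -
    have "H \<in> N'" using subgroup.one_closed[OF N's] by simp
    moreover have "H #> e \<notin> N'"
    proof
      assume "H #> e \<in> N'"
      then obtain x where x: "x \<in> N" "H #> e = H #> x" by (auto simp: N'_def)
      then have "e \<otimes> inv x \<in> N" using eq[of e x] e HN by auto
      then have "(e \<otimes> inv x) \<otimes> x \<in> N" using x by simp
      then show False using e x by (simp add: m_assoc)
    qed
    ultimately show ?thesis by (auto simp: T_def)
  qed
  moreover have "N' <#>\<^bsub>G Mod H\<^esub> T = carrier (G Mod H)"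
  proof
    show "N' <#>\<^bsub>G Mod H\<^esub> T \<subseteq> carrier (G Mod H)"
      using subgroup.subset[OF N's] Hc Hec Q.m_closed unfolding set_mult_def T_def by blast
    show "carrier (G Mod H) \<subseteq> N' <#>\<^bsub>G Mod H\<^esub> T"
    proof
      fix X assume "X \<in> carrier (G Mod H)"
      then obtain g where g: "g \<in> carrier G" "X = H #> g" by (auto simp: carrier_FactGroup)
      have "\<exists>x\<in>N. \<exists>t\<in>T. X = (H #> x) \<otimes>\<^bsub>G Mod H\<^esub> t"
      proof (cases "g \<in> N")
        case True
        have "X = (H #> g) \<otimes>\<^bsub>G Mod H\<^esub> H" using Q.r_one[of X] g unfolding one by (auto simp: carrier_FactGroup)
        then show ?thesis using True by (auto simp: T_def)
      next
        case False
        then obtain x where x: "x \<in> N" "g = x \<otimes> e" using all g by blast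
        then have "X = (H #> x) \<otimes>\<^bsub>G Mod H\<^esub> (H #> e)" using mult[of x e] e g by simp
        then show ?thesis using x(1) by (auto simp: T_def)
      qed
      then show "X \<in> N' <#>\<^bsub>G Mod H\<^esub> T" unfolding set_mult_def N'_def by blast
    qed
  qed
  ultimately show ?thesis unfolding abelian_semidirect_order_two_def using N'n by blast
qed

text \<open>Expressing the unit vectors by u and w factors the identity through a two-dimensional
  space.\<close>

lemma spanning_pair_degree:
  fixes u w :: "complex Matrix.vec"
  assumes u: "u \<in> carrier_vec n" and w: "w \<in> carrier_vec n"
    and sp: "\<And>v. v \<in> carrier_vec n \<Longrightarrow> \<exists>a b. v = a \<cdot>\<^sub>v u + b \<cdot>\<^sub>v w"
  shows "n \<le> 2"
proof -
  define Q where "Q = Matrix.mat n 2 (\<lambda>(i, j). if j = 0 then u $v i else w $v i)"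
  have Q: "Q \<in> carrier_mat n 2" by (simp add: Q_def)
  have "\<exists>a b. unit_vec n i = a \<cdot>\<^sub>v u + b \<cdot>\<^sub>v w" for i by (rule sp) simp
  then obtain a b where ab: "\<And>i. unit_vec n i = a i \<cdot>\<^sub>v u + b i \<cdot>\<^sub>v w" by metis
  define X where "X = Matrix.mat 2 n (\<lambda>(i, j). if i = 0 then a j else b j)"
  have X: "X \<in> carrier_mat 2 n" by (simp add: X_def)
  have "Q * X = 1\<^sub>m n"
  proof (rule eq_matI)
    fix i j assume ij: "i < dim_row (1\<^sub>m n)" "j < dim_col (1\<^sub>m n)"
    have "(Q * X) $$ (i, j) = (a j \<cdot>\<^sub>v u + b j \<cdot>\<^sub>v w) $v i"
      using ij u w by (simp add: Q_def X_def scalar_prod_def numeral_2_eq_2)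
    also have "\<dots> = 1\<^sub>m n $$ (i, j)" unfolding ab[symmetric] using ij by auto
    finally show "(Q * X) $$ (i, j) = 1\<^sub>m n $$ (i, j)" .
  qed (simp_all add: Q_def X_def)
  then show ?thesis by (rule left_inverse_dim_le[OF X Q])
qed

section \<open>Degrees of the representations of M\<close>

context clifford
begin

lemma degree_eq_1:
  assumes ov: "over \<rho>"
    and comm: "\<And>x y. x \<in> M \<Longrightarrow> y \<in> M \<Longrightarrow> x \<otimes> y \<otimes> inv x \<otimes> inv y \<in> K \<and> f (x \<otimes> y \<otimes> inv x \<otimes> inv y) = 1"
  shows "dgr \<rho> = 1"
proof (rule irreducible_commuting_degree_1)
  show irr: "irreducible_rep GM \<rho>" using ov by (simp add: over_def)
  note rep = over_is_rep[OF ov]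
  fix x y assume "x \<in> carrier GM" "y \<in> carrier GM"
  then have x: "x \<in> M" and y: "y \<in> M" by auto
  let ?c = "x \<otimes> y \<otimes> inv x \<otimes> inv y"
  have c: "?c \<in> K" "f ?c = 1" using comm[OF x y] by auto
  have yx: "y \<otimes> x \<in> M" by (rule clo(1)[OF y x])
  show "\<rho> x * \<rho> y = \<rho> y * \<rho> x"
  proof (rule mat_eq_by_vec[of _ "dgr \<rho>" "dgr \<rho>"])
    fix v :: "complex Matrix.vec" assume v: "v \<in> carrier_vec (dgr \<rho>)"
    have "x \<otimes> y = ?c \<otimes> (y \<otimes> x)" using sub(1)[OF x] sub(1)[OF y] by (simp add: m_assoc)
    then have "\<rho> (x \<otimes> y) *\<^sub>v v = \<rho> ?c *\<^sub>v (\<rho> (y \<otimes> x) *\<^sub>v v)"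
      using rep_GM_mult[OF rep sub'(3)[OF c(1)] yx v] by simp
    also have "\<dots> = \<rho> (y \<otimes> x) *\<^sub>v v" using over_K[OF ov c(1) rep_GM_vec[OF rep yx v]] c(2) by simp
    finally show "(\<rho> x * \<rho> y) *\<^sub>v v = (\<rho> y * \<rho> x) *\<^sub>v v"
      using is_rep_mult[OF rep, of x y] is_rep_mult[OF rep, of y x] x y by simp
  qed (use mult_carrier_mat[OF rep_GM_mat[OF rep x] rep_GM_mat[OF rep y]] mult_carrier_mat[OF rep_GM_mat[OF rep y] rep_GM_mat[OF rep x]] in auto)
qed

text \<open>A common eigenvector w of \<open>A\<close> and its image under e span an invariant
  space, since e normalizes \<open>A\<close> and squares into it.\<close>

lemma degree_le_2:
  assumes ov: "over \<rho>" and e: "e \<in> M" "e \<otimes> e \<in> A"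
    and all: "\<And>m. m \<in> M \<Longrightarrow> m \<in> A \<or> (\<exists>a\<in>A. m = a \<otimes> e)"
  shows "dgr \<rho> \<le> 2"
proof -
  let ?n = "dgr \<rho>"
  note rep = over_is_rep[OF ov]
  have irr: "irreducible_rep GM \<rho>" using ov by (simp add: over_def)
  obtain w \<theta> where w: "w \<in> carrier_vec ?n" "w \<noteq> 0\<^sub>v ?n" and ev: "\<And>a. a \<in> A \<Longrightarrow> \<rho> a *\<^sub>v w = \<theta> a \<cdot>\<^sub>v w"
    using exists_A_eigenvector[OF ov] by blast
  have ec: "e \<in> carrier G" using e sub by blast
  define u where "u = \<rho> e *\<^sub>v w"
  have u: "u \<in> carrier_vec ?n" unfolding u_def by (rule rep_GM_vec[OF rep e(1) w(1)])
  have evu: "\<rho> a *\<^sub>v u = \<theta> (inv e \<otimes> a \<otimes> e) \<cdot>\<^sub>v u" if a: "a \<in> A" for a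
  proof -
    have c: "inv e \<otimes> a \<otimes> e \<in> A" by (rule A_conj'[OF MC[OF e(1)] a])
    have ae: "a \<otimes> e = e \<otimes> (inv e \<otimes> a \<otimes> e)" using ec sub(2)[OF a] by (simp add: m_assoc)
    have "\<rho> a *\<^sub>v u = \<rho> (a \<otimes> e) *\<^sub>v w" unfolding u_def by (rule rep_GM_mult[OF rep sub'(1)[OF a] e(1) w(1), symmetric])
    also have "\<dots> = \<rho> e *\<^sub>v (\<rho> (inv e \<otimes> a \<otimes> e) *\<^sub>v w)" unfolding ae by (rule rep_GM_mult[OF rep e(1) sub'(1)[OF c] w(1)])
    also have "\<dots> = \<theta> (inv e \<otimes> a \<otimes> e) \<cdot>\<^sub>v u" unfolding ev[OF c] u_def by (rule mult_mat_vec[OF rep_GM_mat[OF rep e(1)] w(1)])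
    finally show ?thesis .
  qed
  have eu: "\<rho> e *\<^sub>v u = \<theta> (e \<otimes> e) \<cdot>\<^sub>v w"
    unfolding u_def rep_GM_mult[OF rep e(1) e(1) w(1), symmetric] by (rule ev[OF e(2)])
  define W where "W = {a \<cdot>\<^sub>v w + b \<cdot>\<^sub>v u | a b. True}"
  have WI: "a \<cdot>\<^sub>v w + b \<cdot>\<^sub>v u \<in> W" for a b unfolding W_def by blast
  have WE: "\<exists>a b. v = a \<cdot>\<^sub>v w + b \<cdot>\<^sub>v u" if "v \<in> W" for v using that unfolding W_def by blast
  have "W = carrier_vec ?n"
  proof (rule irreducible_rep_full[OF irr])
    show "lin_subspace ?n W" unfolding lin_subspace_def
    proof (intro conjI ballI allI)
      show "W \<subseteq> carrier_vec ?n" using w(1) u WE by fastforce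
      have "0\<^sub>v ?n = 0 \<cdot>\<^sub>v w + 0 \<cdot>\<^sub>v u" using w(1) u by (simp add: zero_smult_vec)
      then show "0\<^sub>v ?n \<in> W" using WI by metis
      fix v assume "v \<in> W"
      then obtain a b where v: "v = a \<cdot>\<^sub>v w + b \<cdot>\<^sub>v u" using WE by blast
      have "c \<cdot>\<^sub>v v = (c * a) \<cdot>\<^sub>v w + (c * b) \<cdot>\<^sub>v u" for c
        unfolding v using w(1) u by (simp add: smult_add_distrib_vec[of _ ?n] smult_smult_assoc)
      then show "c \<cdot>\<^sub>v v \<in> W" for c using WI by metis
      fix v' assume "v' \<in> W"
      then obtain a' b' where v': "v' = a' \<cdot>\<^sub>v w + b' \<cdot>\<^sub>v u" using WE by blast
      have "v + v' = (a + a') \<cdot>\<^sub>v w + (b + b') \<cdot>\<^sub>v u"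
        unfolding v v' using w(1) u by (intro eq_vecI) (auto simp: algebra_simps)
      then show "v + v' \<in> W" using WI by metis
    qed
    have stA: "\<rho> a *\<^sub>v v \<in> W" if a: "a \<in> A" and v: "v \<in> W" for a v
    proof -
      obtain c d where v: "v = c \<cdot>\<^sub>v w + d \<cdot>\<^sub>v u" using WE[OF v] by blast
      note ra = rep_GM_mat[OF rep sub'(1)[OF a]]
      have "\<rho> a *\<^sub>v v = c \<cdot>\<^sub>v (\<rho> a *\<^sub>v w) + d \<cdot>\<^sub>v (\<rho> a *\<^sub>v u)"
        unfolding v using w(1) u by (simp add: mult_add_distrib_mat_vec[OF ra] mult_mat_vec[OF ra])
      also have "\<dots> = (c * \<theta> a) \<cdot>\<^sub>v w + (d * \<theta> (inv e \<otimes> a \<otimes> e)) \<cdot>\<^sub>v u"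
        unfolding ev[OF a] evu[OF a] by (simp add: smult_smult_assoc)
      finally show ?thesis using WI by simp
    qed
    have ste: "\<rho> e *\<^sub>v v \<in> W" if v: "v \<in> W" for v
    proof -
      obtain c d where v: "v = c \<cdot>\<^sub>v w + d \<cdot>\<^sub>v u" using WE[OF v] by blast
      note re = rep_GM_mat[OF rep e(1)]
      have "\<rho> e *\<^sub>v v = c \<cdot>\<^sub>v u + d \<cdot>\<^sub>v (\<rho> e *\<^sub>v u)"
        unfolding v using w(1) u by (simp add: mult_add_distrib_mat_vec[OF re] mult_mat_vec[OF re] u_def[symmetric])
      also have "\<dots> = (d * \<theta> (e \<otimes> e)) \<cdot>\<^sub>v w + c \<cdot>\<^sub>v u"
        unfolding eu using w(1) u by (simp add: smult_smult_assoc comm_add_vec[of _ ?n])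
      finally show ?thesis using WI by simp
    qed
    fix m v assume "m \<in> carrier GM" and v: "v \<in> W"
    then have m: "m \<in> M" by simp
    have vc: "v \<in> carrier_vec ?n" using WE[OF v] w(1) u by auto
    show "\<rho> m *\<^sub>v v \<in> W"
    proof (cases "m \<in> A")
      case True
      then show ?thesis using stA v by blast
    next
      case False
      then obtain a where a: "a \<in> A" "m = a \<otimes> e" using all m by blast
      show ?thesis unfolding a(2) rep_GM_mult[OF rep sub'(1)[OF a(1)] e(1) vc] using stA[OF a(1)] ste[OF v] by blast
    qed
  next
    have "w = 1 \<cdot>\<^sub>v w + 0 \<cdot>\<^sub>v u" using w(1) u by (simp add: zero_smult_vec)
    then show "w \<in> W" using WI by metis
  qed (rule w(2))
  then show ?thesis using WE by (intro spanning_pair_degree[OF w(1) u]) simp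
qed

end

section \<open>The group generated by the one-dimensional extensions\<close>

text \<open>Abstracts from matrices: \<open>e\<close> is the family of transvections, as a
  homomorphism from an additive group, so that calculations with them modulo \<open>K\<close> become
  calculations in \<open>h\<close> modulo \<open>small\<close>. \<open>stab_decomp\<close> is the
  factorization of the stabilizer of \<open>f\<close> into \<open>A\<close> and the
  transvections.\<close>

locale extension_setting = group G for G (structure) +
  fixes K A :: "'a set" and f :: "'a \<Rightarrow> complex" and e :: "'t::ab_group_add \<Rightarrow> 'a" and h small :: "'t set"
  assumes fin: "finite (carrier G)" and K: "subgroup K G" and A: "subgroup A G" and KA: "K \<subseteq> A"
    and K_norm: "\<And>g k. g \<in> carrier G \<Longrightarrow> k \<in> K \<Longrightarrow> g \<otimes> k \<otimes> inv g \<in> K"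
    and f: "lin_char (G\<lparr>carrier := K\<rparr>) f"
    and f_A: "\<And>x k. x \<in> A \<Longrightarrow> k \<in> K \<Longrightarrow> f (x \<otimes> k \<otimes> inv x) = f k"
    and e_G: "\<And>t. e t \<in> carrier G" and e_add: "\<And>s t. e (s + t) = e s \<otimes> e t"
    and h_add: "\<And>s t. s \<in> h \<Longrightarrow> t \<in> h \<Longrightarrow> s + t \<in> h" and h_minus: "\<And>t. t \<in> h \<Longrightarrow> - t \<in> h"
    and small_0: "0 \<in> small" and small_add: "\<And>s t. s \<in> small \<Longrightarrow> t \<in> small \<Longrightarrow> s + t \<in> small"
    and small_minus: "\<And>t. t \<in> small \<Longrightarrow> - t \<in> small" and small_h: "small \<subseteq> h"
    and h_double: "\<And>t. t \<in> h \<Longrightarrow> t + t \<in> small"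
    and e_small: "\<And>t. t \<in> small \<Longrightarrow> e t \<in> K"
    and f_e: "\<And>t k. t \<in> h \<Longrightarrow> k \<in> K \<Longrightarrow> f (e t \<otimes> k \<otimes> inv (e t)) = f k"
    and stab_decomp: "\<And>g. g \<in> carrier G \<Longrightarrow> \<forall>k\<in>K. f (g \<otimes> k \<otimes> inv g) = f k \<Longrightarrow> \<exists>t\<in>h. g \<otimes> e t \<in> A"
    and A_e: "\<And>t x. t \<in> h \<Longrightarrow> x \<in> A \<Longrightarrow> e t \<otimes> x \<otimes> inv (e t) \<in> A"
    and commut: "\<And>x y. x \<in> A \<Longrightarrow> y \<in> A \<Longrightarrow> x \<otimes> y \<otimes> inv x \<otimes> inv y \<in> K \<and> f (x \<otimes> y \<otimes> inv x \<otimes> inv y) = 1"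
begin

abbreviation "GA \<equiv> G\<lparr>carrier := A\<rparr>"

definition ext :: "('a \<Rightarrow> complex) \<Rightarrow> bool" where
  "ext \<theta> \<longleftrightarrow> lin_char GA \<theta> \<and> (\<forall>k\<in>K. \<theta> k = f k)"

text \<open>By \<open>inE_iff\<close> this is membership of \<open>e t\<close> in the extendibility
  set. Stated through an invariant extension, it avoids the group generated by \<open>A\<close> and
  \<open>e t\<close>.\<close>

definition inE :: "'t \<Rightarrow> bool" where
  "inE t \<longleftrightarrow> t \<in> h \<and> (\<exists>\<theta>. ext \<theta> \<and> (\<forall>x\<in>A. \<theta> (e t \<otimes> x \<otimes> inv (e t)) = \<theta> x))"

definition MA :: "'a set" where
  "MA = {x \<otimes> e t | x t. x \<in> A \<and> inE t}"

lemma A_G: "x \<in> A \<Longrightarrow> x \<in> carrier G" using A subgroup.mem_carrier by metis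
lemma K_A: "k \<in> K \<Longrightarrow> k \<in> A" using KA by blast
lemma A_clo: "x \<in> A \<Longrightarrow> y \<in> A \<Longrightarrow> x \<otimes> y \<in> A" "x \<in> A \<Longrightarrow> inv x \<in> A" "\<one> \<in> A"
  using A by (auto simp: subgroup.m_closed subgroup.m_inv_closed subgroup.one_closed)

lemma e_0: "e 0 = \<one>"
proof -
  have "e 0 \<otimes> e 0 = e 0" using e_add[of 0 0] by simp
  then show ?thesis using e_G[of 0] by (metis l_cancel_one)
qed

lemma e_uminus: "e (- t) = inv (e t)"
  using inv_equality[of "e (- t)" "e t"] e_add[of "- t" t] e_0 e_G by simp

lemma ext_mult: "ext \<theta> \<Longrightarrow> x \<in> A \<Longrightarrow> y \<in> A \<Longrightarrow> \<theta> (x \<otimes> y) = \<theta> x * \<theta> y"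
  by (simp add: ext_def lin_char_def)

lemma ext_K: "ext \<theta> \<Longrightarrow> k \<in> K \<Longrightarrow> \<theta> k = f k"
  by (simp add: ext_def)

lemma group_GA: "group GA"
  using A subgroup.subgroup_is_group is_group by blast

lemma ext_nonzero: "ext \<theta> \<Longrightarrow> x \<in> A \<Longrightarrow> \<theta> x \<noteq> 0"
  using lin_char_inv(2)[OF group_GA, of \<theta> x] by (simp add: ext_def)

text \<open>Commutators of \<open>A\<close> are killed by \<open>f\<close>, so \<open>A\<close>
  fixes each of its extensions.\<close>

lemma ext_conj: "ext \<theta> \<Longrightarrow> x \<in> A \<Longrightarrow> y \<in> A \<Longrightarrow> \<theta> (x \<otimes> y \<otimes> inv x) = \<theta> y"
proof -
  assume t: "ext \<theta>" and x: "x \<in> A" and y: "y \<in> A"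
  have "x \<otimes> y \<otimes> inv x = (x \<otimes> y \<otimes> inv x \<otimes> inv y) \<otimes> y" using A_G x y by (simp add: m_assoc)
  then show ?thesis using ext_mult[OF t K_A[OF conjunct1[OF commut[OF x y]]] y] ext_K[OF t conjunct1[OF commut[OF x y]]] commut[OF x y] by simp
qed

lemma exists_ext: "\<exists>\<theta>. ext \<theta>"
  using extend_lin_char[OF fin K A KA f commut] by (simp add: ext_def)

lemma inE_h: "inE t \<Longrightarrow> t \<in> h" by (simp add: inE_def)

lemma inE_0: "inE 0"
proof -
  obtain \<theta> where "ext \<theta>" using exists_ext by blast
  moreover have "\<theta> (e 0 \<otimes> x \<otimes> inv (e 0)) = \<theta> x" if "x \<in> A" for x using A_G[OF that] by (simp add: e_0)
  ultimately show ?thesis unfolding inE_def using small_0 small_h by blast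
qed

lemma conj_conj: "x \<in> carrier G \<Longrightarrow> y \<in> carrier G \<Longrightarrow> z \<in> carrier G \<Longrightarrow>
    (x \<otimes> y) \<otimes> z \<otimes> inv (x \<otimes> y) = x \<otimes> (y \<otimes> z \<otimes> inv y) \<otimes> inv x"
  by (simp add: m_assoc inv_mult_group)

text \<open>\<open>K\<close> fixes every extension, so only the class of t modulo
  \<open>small\<close> matters. As doubling lands in \<open>small\<close>, t and -t have the same
  class.\<close>

lemma inE_cong:
  assumes t: "inE t" and s: "u - t \<in> small"
  shows "inE u"
proof -
  obtain \<theta> where \<theta>: "ext \<theta>" "\<And>x. x \<in> A \<Longrightarrow> \<theta> (e t \<otimes> x \<otimes> inv (e t)) = \<theta> x" using t by (auto simp: inE_def)
  have th: "t \<in> h" by (rule inE_h[OF t])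
  have eu: "e u = e (u - t) \<otimes> e t" using e_add[of "u - t" t] by simp
  have "u \<in> h" using h_add[of "u - t" t] s small_h th by auto
  moreover have "\<theta> (e u \<otimes> x \<otimes> inv (e u)) = \<theta> x" if x: "x \<in> A" for x
    unfolding eu conj_conj[OF e_G e_G A_G[OF x]] using ext_conj[OF \<theta>(1) K_A[OF e_small[OF s]] A_e[OF th x]] \<theta>(2)[OF x] by simp
  ultimately show ?thesis using \<theta>(1) unfolding inE_def by blast
qed

lemma inE_minus: "inE t \<Longrightarrow> inE (- t)"
proof -
  assume t: "inE t"
  have "- t - t \<in> small" using small_minus[OF h_double[OF inE_h[OF t]]] by simp
  then show ?thesis by (rule inE_cong[OF t])
qed

text \<open>An invariant extension is 1 on the commutator, and where the commutator lies in
  \<open>K\<close> the extension is \<open>f\<close>. This consequence mentions no extension, so it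
  can be computed.\<close>

lemma inE_commutator:
  assumes t: "inE t" and x: "x \<in> A" and c: "e t \<otimes> x \<otimes> inv (e t) \<otimes> inv x \<in> K"
  shows "f (e t \<otimes> x \<otimes> inv (e t) \<otimes> inv x) = 1"
proof -
  obtain \<theta> where \<theta>: "ext \<theta>" "\<And>x. x \<in> A \<Longrightarrow> \<theta> (e t \<otimes> x \<otimes> inv (e t)) = \<theta> x" using t by (auto simp: inE_def)
  let ?c = "e t \<otimes> x \<otimes> inv (e t) \<otimes> inv x"
  have "e t \<otimes> x \<otimes> inv (e t) = ?c \<otimes> x" using e_G[of t] A_G[OF x] by (simp add: m_assoc)
  then have "f ?c * \<theta> x = \<theta> x" using \<theta>(2)[OF x] ext_mult[OF \<theta>(1) K_A[OF c] x] ext_K[OF \<theta>(1) c] by simp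
  then show ?thesis using ext_nonzero[OF \<theta>(1) x] by simp
qed

text \<open>A character of the larger group takes values in a commutative group, so its restriction
  to \<open>A\<close> does not see conjugation by \<open>e t\<close>. The converse is the cyclic
  extension step.\<close>

lemma inE_iff: "inE t \<longleftrightarrow> t \<in> h \<and> extends_one_dim G K (A <#> generate G {e t}) (lin_rep f)"
proof
  assume t: "inE t"
  then obtain \<theta> where \<theta>: "ext \<theta>" "\<And>x. x \<in> A \<Longrightarrow> \<theta> (e t \<otimes> x \<otimes> inv (e t)) = \<theta> x" by (auto simp: inE_def)
  have th: "t \<in> h" by (rule inE_h[OF t])
  have lc: "lin_char GA \<theta>" using \<theta>(1) by (simp add: ext_def)
  obtain \<eta> where "lin_char (G\<lparr>carrier := A <#> generate G {e t}\<rparr>) \<eta>" "\<forall>x\<in>A. \<eta> x = \<theta> x"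
    using extend_lin_char_cyclic(2)[OF fin A e_G A_e[OF th] lc \<theta>(2)] by blast
  then show "t \<in> h \<and> extends_one_dim G K (A <#> generate G {e t}) (lin_rep f)"
    unfolding extends_one_dim_iff using th ext_K[OF \<theta>(1)] K_A by auto
next
  assume a: "t \<in> h \<and> extends_one_dim G K (A <#> generate G {e t}) (lin_rep f)"
  let ?S = "A <#> generate G {e t}"
  obtain \<eta> where \<eta>: "lin_char (G\<lparr>carrier := ?S\<rparr>) \<eta>" "\<forall>k\<in>K. \<eta> k = f k" using a unfolding extends_one_dim_iff by blast
  have mult: "\<eta> (x \<otimes> y) = \<eta> x * \<eta> y" if "x \<in> ?S" "y \<in> ?S" for x y using \<eta>(1) that by (simp add: lin_char_def)
  have S: "?S = {x \<otimes> e t [^] k | x k. x \<in> A \<and> k \<in> (UNIV :: nat set)}" by (rule set_mult_generate[OF fin e_G])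
  have AS: "x \<in> ?S" if "x \<in> A" for x
  proof -
    have "x = x \<otimes> e t [^] (0::nat)" using A_G[OF that] by simp
    then show ?thesis unfolding S using that by blast
  qed
  have eS: "e t \<in> ?S"
  proof -
    have "e t = \<one> \<otimes> e t [^] (1::nat)" using e_G[of t] by simp
    then show ?thesis unfolding S using A_clo(3) by blast
  qed
  have ieS: "inv (e t) \<in> ?S"
    unfolding set_mult_def using generate.inv[of "e t" "{e t}" G] A_clo(3) e_G[of t] by force
  have "\<eta> (inv (e t)) * \<eta> (e t) = \<eta> \<one>" using mult[OF ieS eS] e_G[of t] by simp
  also have "\<dots> = 1" using \<eta>(1) by (simp add: lin_char_def)
  finally have ne: "\<eta> (e t) \<noteq> 0" by auto
  have "lin_char GA \<eta>" using \<eta>(1) AS by (simp add: lin_char_def)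
  then have x: "ext \<eta>" using \<eta>(2) by (simp add: ext_def)
  have "\<eta> (e t \<otimes> x \<otimes> inv (e t)) = \<eta> x" if x: "x \<in> A" for x
  proof -
    have c: "e t \<otimes> x \<otimes> inv (e t) \<in> A" using A_e a x by blast
    have "(e t \<otimes> x \<otimes> inv (e t)) \<otimes> e t = e t \<otimes> x" using e_G[of t] A_G[OF x] by (simp add: m_assoc)
    then have "\<eta> (e t \<otimes> x \<otimes> inv (e t)) * \<eta> (e t) = \<eta> x * \<eta> (e t)"
      unfolding mult[OF AS[OF c] eS, symmetric] by (simp only: mult[OF eS AS[OF x]] mult.commute)
    then show ?thesis unfolding mult_right_cancel[OF ne] .
  qed
  then show "inE t" using a x unfolding inE_def by blast
qed

end

text \<open>The assumption \<open>dich\<close> is what the arithmetic of the ring has to supply; all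
  that follows in this locale is formal.\<close>

locale dichotomy_setting = extension_setting +
  assumes dich: "(\<forall>t. inE t \<longrightarrow> (\<forall>x\<in>A. e t \<otimes> x \<otimes> inv (e t) \<otimes> inv x \<in> K)) \<or>
    (\<exists>t. inE t \<and> (\<forall>u. inE u \<longrightarrow> u \<in> small \<or> u - t \<in> small))"
begin

definition central :: bool where
  "central \<longleftrightarrow> (\<forall>t. inE t \<longrightarrow> (\<forall>x\<in>A. e t \<otimes> x \<otimes> inv (e t) \<otimes> inv x \<in> K))"

lemma central_invariant:
  assumes c: central and \<theta>: "ext \<theta>" and t: "inE t" and x: "x \<in> A"
  shows "\<theta> (e t \<otimes> x \<otimes> inv (e t)) = \<theta> x"
proof -
  let ?c = "e t \<otimes> x \<otimes> inv (e t) \<otimes> inv x"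
  have k: "?c \<in> K" using c t x by (simp add: central_def)
  have "e t \<otimes> x \<otimes> inv (e t) = ?c \<otimes> x" using e_G[of t] A_G[OF x] by (simp add: m_assoc)
  then show ?thesis using ext_mult[OF \<theta> K_A[OF k] x] ext_K[OF \<theta> k] inE_commutator[OF t x k] by simp
qed

text \<open>Under the first alternative every extension is invariant under all admissible elements,
  so one serves for both t and u. Under the second, t and u lie in the classes of 0 and t0, and t0 +
  t0 is small.\<close>

lemma inE_add:
  assumes t: "inE t" and u: "inE u"
  shows "inE (t + u)"
proof (cases central)
  case True
  obtain \<theta> where \<theta>: "ext \<theta>" using exists_ext by blast
  have "\<theta> (e (t + u) \<otimes> x \<otimes> inv (e (t + u))) = \<theta> x" if x: "x \<in> A" for x
    unfolding e_add conj_conj[OF e_G e_G A_G[OF x]]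
    using central_invariant[OF True \<theta> t A_e[OF inE_h[OF u] x]] central_invariant[OF True \<theta> u x] by simp
  then show ?thesis unfolding inE_def using \<theta> h_add[OF inE_h[OF t] inE_h[OF u]] by blast
next
  case False
  then obtain t0 where t0: "inE t0" "\<And>u. inE u \<Longrightarrow> u \<in> small \<or> u - t0 \<in> small" using dich unfolding central_def by blast
  consider "t \<in> small" "u \<in> small" | "t \<in> small" "u - t0 \<in> small" | "t - t0 \<in> small" "u \<in> small" | "t - t0 \<in> small" "u - t0 \<in> small"
    using t0(2)[OF t] t0(2)[OF u] by blast
  then show ?thesis
  proof cases
    case 1
    then have "t + u - 0 \<in> small" using small_add by simp
    then show ?thesis by (rule inE_cong[OF inE_0])
  next
    case 2
    then have "t + u - t0 \<in> small" using small_add[of t "u - t0"] by (simp add: algebra_simps)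
    then show ?thesis by (rule inE_cong[OF t0(1)])
  next
    case 3
    then have "t + u - t0 \<in> small" using small_add[of "t - t0" u] by (simp add: algebra_simps)
    then show ?thesis by (rule inE_cong[OF t0(1)])
  next
    case 4
    have "(t - t0) + (u - t0) + (t0 + t0) \<in> small" using small_add[OF small_add[OF 4] h_double[OF inE_h[OF t0(1)]]] .
    then have "t + u - 0 \<in> small" by (simp add: algebra_simps)
    then show ?thesis by (rule inE_cong[OF inE_0])
  qed
qed

lemma MA_G: "m \<in> MA \<Longrightarrow> m \<in> carrier G"
  using A_G e_G by (auto simp: MA_def)

lemma MA_I: "x \<in> A \<Longrightarrow> inE t \<Longrightarrow> x \<otimes> e t \<in> MA"
  by (auto simp: MA_def)

lemma A_MA: "A \<subseteq> MA"
proof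
  fix x assume "x \<in> A"
  then show "x \<in> MA" using MA_I[of x 0] inE_0 e_0 A_G by simp
qed

lemma e_MA: "inE t \<Longrightarrow> e t \<in> MA"
  using MA_I[OF A_clo(3), of t] e_G by simp

lemma MA_subgroup: "subgroup MA G"
proof (rule subgroupI)
  show "MA \<subseteq> carrier G" using MA_G by blast
  show "MA \<noteq> {}" using A_MA A_clo(3) by blast
  fix m assume "m \<in> MA"
  then obtain x t where m: "m = x \<otimes> e t" "x \<in> A" "inE t" by (auto simp: MA_def)
  have "inv m = (e (- t) \<otimes> inv x \<otimes> inv (e (- t))) \<otimes> e (- t)"
    using m A_G[OF m(2)] e_G[of t] by (simp add: e_uminus inv_mult_group m_assoc)
  then show "inv m \<in> MA" using MA_I[OF A_e[OF inE_h[OF inE_minus[OF m(3)]] A_clo(2)[OF m(2)]] inE_minus[OF m(3)]] by simp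
  fix m' assume "m' \<in> MA"
  then obtain y u where m': "m' = y \<otimes> e u" "y \<in> A" "inE u" by (auto simp: MA_def)
  have "m \<otimes> m' = (x \<otimes> (e t \<otimes> y \<otimes> inv (e t))) \<otimes> e (t + u)"
    using m m' A_G[OF m(2)] A_G[OF m'(2)] e_G by (simp add: e_add m_assoc)
  then show "m \<otimes> m' \<in> MA" using MA_I[OF A_clo(1)[OF m(2) A_e[OF inE_h[OF m(3)] m'(2)]] inE_add[OF m(3) m'(3)]] by simp
qed

lemma f_mult_stable:
  assumes "x \<in> carrier G" "y \<in> carrier G" "\<And>k. k \<in> K \<Longrightarrow> f (x \<otimes> k \<otimes> inv x) = f k" "\<And>k. k \<in> K \<Longrightarrow> f (y \<otimes> k \<otimes> inv y) = f k" "k \<in> K"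
  shows "f (x \<otimes> y \<otimes> k \<otimes> inv (x \<otimes> y)) = f k"
proof -
  have kc: "k \<in> carrier G" using assms(5) A_G K_A by blast
  show ?thesis unfolding conj_conj[OF assms(1,2) kc] using assms(3)[OF K_norm[OF assms(2,5)]] assms(4,5) by simp
qed

lemma f_MA: "m \<in> MA \<Longrightarrow> k \<in> K \<Longrightarrow> f (m \<otimes> k \<otimes> inv m) = f k"
proof -
  assume "m \<in> MA" and k: "k \<in> K"
  then obtain x t where m: "m = x \<otimes> e t" "x \<in> A" "inE t" by (auto simp: MA_def)
  show ?thesis unfolding m(1) by (rule f_mult_stable[OF A_G[OF m(2)] e_G f_A[OF m(2)] f_e[OF inE_h[OF m(3)]] k])
qed

lemma stab_form:
  assumes g: "g \<in> carrier G" and st: "\<forall>k\<in>K. f (g \<otimes> k \<otimes> inv g) = f k"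
  obtains x t where "x \<in> A" "t \<in> h" "g = x \<otimes> e t"
proof -
  obtain t where t: "t \<in> h" "g \<otimes> e t \<in> A" using stab_decomp[OF g st] by blast
  have "g = (g \<otimes> e t) \<otimes> e (- t)" using g e_G[of t] by (simp add: e_uminus m_assoc)
  then show thesis using that[OF t(2) h_minus[OF t(1)]] by blast
qed

lemma A_stab_conj:
  assumes g: "g \<in> carrier G" "\<forall>k\<in>K. f (g \<otimes> k \<otimes> inv g) = f k" and y: "y \<in> A"
  shows "g \<otimes> y \<otimes> inv g \<in> A"
proof -
  obtain x t where x: "x \<in> A" "t \<in> h" "g = x \<otimes> e t" using stab_form[OF g] .
  show ?thesis unfolding x(3) conj_conj[OF A_G[OF x(1)] e_G A_G[OF y]] using A_clo x(1) A_e[OF x(2) y] by blast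
qed

lemma e_commute: "e s \<otimes> e t \<otimes> inv (e s) = e t"
proof -
  have "e s \<otimes> e t = e t \<otimes> e s" unfolding e_add[symmetric] by (simp add: add.commute)
  then show ?thesis using e_G by (simp add: m_assoc)
qed

lemma MA_stab_conj:
  assumes g: "g \<in> carrier G" "\<forall>k\<in>K. f (g \<otimes> k \<otimes> inv g) = f k" and m: "m \<in> MA"
  shows "g \<otimes> m \<otimes> inv g \<in> MA"
proof -
  obtain x t where x: "x \<in> A" "t \<in> h" "g = x \<otimes> e t" using stab_form[OF g] .
  obtain y u where y: "m = y \<otimes> e u" "y \<in> A" "inE u" using m by (auto simp: MA_def)
  have "e t \<otimes> m \<otimes> inv (e t) = (e t \<otimes> y \<otimes> inv (e t)) \<otimes> (e t \<otimes> e u \<otimes> inv (e t))"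
    unfolding y(1) using e_G A_G[OF y(2)] by (simp add: m_assoc)
  then have 1: "e t \<otimes> m \<otimes> inv (e t) \<in> MA" unfolding e_commute using MA_I[OF A_e[OF x(2) y(2)] y(3)] by simp
  have xM: "x \<in> MA" using A_MA x(1) by blast
  show ?thesis unfolding x(3) conj_conj[OF A_G[OF x(1)] e_G MA_G[OF m]]
    using subgroup.m_closed[OF MA_subgroup subgroup.m_closed[OF MA_subgroup xM 1] subgroup.m_inv_closed[OF MA_subgroup xM]] .
qed

text \<open>In g = x e_t with x in \<open>A\<close>, the factor x fixes every extension. So e_t
  alone must fix \<open>\<theta>\<close>, which makes t admissible.\<close>

lemma MA_stab_char:
  assumes \<theta>: "lin_char GA \<theta>" "\<forall>k\<in>K. \<theta> k = f k" and g: "g \<in> carrier G" "\<forall>k\<in>K. f (g \<otimes> k \<otimes> inv g) = f k"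
    and inv: "\<forall>x\<in>A. \<theta> (g \<otimes> x \<otimes> inv g) = \<theta> x"
  shows "g \<in> MA"
proof -
  obtain x t where x: "x \<in> A" "t \<in> h" "g = x \<otimes> e t" using stab_form[OF g] .
  have ex: "ext \<theta>" using \<theta> by (simp add: ext_def)
  have "\<theta> (e t \<otimes> y \<otimes> inv (e t)) = \<theta> y" if y: "y \<in> A" for y
    using bspec[OF inv y] ext_conj[OF ex x(1) A_e[OF x(2) y]] unfolding x(3) conj_conj[OF A_G[OF x(1)] e_G A_G[OF y]] by simp
  then have "inE t" unfolding inE_def using ex x(2) by blast
  then show ?thesis unfolding x(3) by (rule MA_I[OF x(1)])
qed

lemma clifford_MA: "clifford G K A MA f"
proof (intro clifford.intro clifford_axioms.intro)
  show "\<And>\<theta> g. lin_char GA \<theta> \<Longrightarrow> \<forall>k\<in>K. \<theta> k = f k \<Longrightarrow> g \<in> carrier G \<Longrightarrow>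
      \<forall>k\<in>K. f (g \<otimes> k \<otimes> inv g) = f k \<Longrightarrow> \<forall>x\<in>A. \<theta> (g \<otimes> x \<otimes> inv g) = \<theta> x \<Longrightarrow> g \<in> MA"
    by (rule MA_stab_char)
qed (fact is_group fin K A MA_subgroup KA A_MA K_norm f f_MA A_stab_conj MA_stab_conj commut)+

definition trivial_comm :: "'a \<Rightarrow> 'a \<Rightarrow> bool" where
  "trivial_comm x y \<longleftrightarrow> x \<otimes> y \<otimes> inv x \<otimes> inv y \<in> K \<and> f (x \<otimes> y \<otimes> inv x \<otimes> inv y) = 1"

lemma f_K: "k \<in> K \<Longrightarrow> k' \<in> K \<Longrightarrow> f (k \<otimes> k') = f k * f k'" "f \<one> = 1"
  using f by (simp_all add: lin_char_def)

lemma K_clo: "k \<in> K \<Longrightarrow> k' \<in> K \<Longrightarrow> k \<otimes> k' \<in> K" "k \<in> K \<Longrightarrow> inv k \<in> K" "\<one> \<in> K"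
  using K by (auto simp: subgroup.m_closed subgroup.m_inv_closed subgroup.one_closed)

lemma trivial_comm_swap:
  assumes "x \<in> carrier G" "y \<in> carrier G" "trivial_comm x y"
  shows "trivial_comm y x"
proof -
  let ?c = "x \<otimes> y \<otimes> inv x \<otimes> inv y"
  have c: "?c \<in> K" "f ?c = 1" using assms(3) by (auto simp: trivial_comm_def)
  have e: "y \<otimes> x \<otimes> inv y \<otimes> inv x = inv ?c" using assms(1,2) by (simp add: inv_mult_group m_assoc)
  have "f (inv ?c \<otimes> ?c) = f (inv ?c) * f ?c" by (rule f_K(1)[OF K_clo(2)[OF c(1)] c(1)])
  moreover have "inv ?c \<otimes> ?c = \<one>" using assms(1,2) by simp
  ultimately have "f (inv ?c) = 1" using c(2) f_K(2) by simp
  then show ?thesis unfolding trivial_comm_def e using K_clo(2)[OF c(1)] by blast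
qed

text \<open>The commutator of a product is a conjugated commutator times a commutator, and
  conjugation by \<open>MA\<close> fixes \<open>f\<close>.\<close>

lemma trivial_comm_mult:
  assumes x: "x \<in> MA" and y: "y \<in> MA" and z: "z \<in> carrier G" and xz: "trivial_comm x z" and yz: "trivial_comm y z"
  shows "trivial_comm (x \<otimes> y) z"
proof -
  let ?cx = "x \<otimes> z \<otimes> inv x \<otimes> inv z" and ?cy = "y \<otimes> z \<otimes> inv y \<otimes> inv z"
  note c = MA_G[OF x] MA_G[OF y] z
  have e: "x \<otimes> y \<otimes> z \<otimes> inv (x \<otimes> y) \<otimes> inv z = (x \<otimes> ?cy \<otimes> inv x) \<otimes> ?cx" using c by (simp add: m_assoc inv_mult_group)
  have k: "?cy \<in> K" "f ?cy = 1" "?cx \<in> K" "f ?cx = 1" using xz yz by (auto simp: trivial_comm_def)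
  have k2: "x \<otimes> ?cy \<otimes> inv x \<in> K" by (rule K_norm[OF c(1) k(1)])
  show ?thesis unfolding trivial_comm_def e using f_K(1)[OF k2 k(3)] K_clo(1)[OF k2 k(3)] f_MA[OF x k(1)] k by simp
qed

text \<open>By bilinearity it suffices to check pairs of factors: two elements of \<open>A\<close>,
  an \<open>e t\<close> with an element of \<open>A\<close>, and two transvections, which
  commute.\<close>

lemma central_commutators:
  assumes c: central and m: "m \<in> MA" and m': "m' \<in> MA"
  shows "trivial_comm m m'"
proof -
  have AA: "trivial_comm x y" if "x \<in> A" "y \<in> A" for x y using commut[OF that] by (simp add: trivial_comm_def)
  have eA: "trivial_comm (e t) x" if "inE t" "x \<in> A" for t x
    using c that inE_commutator[OF that] by (simp add: trivial_comm_def central_def)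
  have ee: "trivial_comm (e s) (e t)" for s t
    unfolding trivial_comm_def e_commute using e_G[of t] K_clo(3) f_K(2) by simp
  obtain x t where x: "m = x \<otimes> e t" "x \<in> A" "inE t" using m by (auto simp: MA_def)
  obtain y u where y: "m' = y \<otimes> e u" "y \<in> A" "inE u" using m' by (auto simp: MA_def)
  have M: "x \<in> MA" "y \<in> MA" "e t \<in> MA" "e u \<in> MA" using A_MA x y e_MA by auto
  have yA: "trivial_comm m y" unfolding x(1)
    by (rule trivial_comm_mult[OF M(1,3) A_G[OF y(2)] AA[OF x(2) y(2)] eA[OF x(3) y(2)]])
  have eu: "trivial_comm m (e u)" unfolding x(1)
    by (rule trivial_comm_mult[OF M(1,3) e_G trivial_comm_swap[OF e_G A_G[OF x(2)] eA[OF y(3) x(2)]] ee])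
  have "trivial_comm m' m" unfolding y(1)
    by (rule trivial_comm_mult[OF M(2,4) MA_G[OF m] trivial_comm_swap[OF MA_G[OF m] A_G[OF y(2)] yA] trivial_comm_swap[OF MA_G[OF m] e_G eu]])
  then show ?thesis by (rule trivial_comm_swap[OF MA_G[OF m'] MA_G[OF m]])
qed

lemma noncentral_MA:
  assumes "\<not> central"
  obtains t where "inE t" "\<And>m. m \<in> MA \<Longrightarrow> m \<in> A \<or> (\<exists>x\<in>A. m = x \<otimes> e t)" "e t \<otimes> e t \<in> K"
proof -
  obtain t where t: "inE t" "\<And>u. inE u \<Longrightarrow> u \<in> small \<or> u - t \<in> small" using assms dich unfolding central_def by blast
  have "m \<in> A \<or> (\<exists>x\<in>A. m = x \<otimes> e t)" if "m \<in> MA" for m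
  proof -
    obtain x u where x: "m = x \<otimes> e u" "x \<in> A" "inE u" using \<open>m \<in> MA\<close> by (auto simp: MA_def)
    show ?thesis
    proof (cases "u \<in> small")
      case True
      then show ?thesis unfolding x(1) using A_clo(1)[OF x(2) K_A[OF e_small]] by blast
    next
      case False
      then have s: "e (u - t) \<in> A" using t(2)[OF x(3)] e_small K_A by blast
      have "m = (x \<otimes> e (u - t)) \<otimes> e t" unfolding x(1) using e_add[of "u - t" t] A_G[OF x(2)] e_G by (simp add: m_assoc)
      then show ?thesis using A_clo(1)[OF x(2) s] by blast
    qed
  qed
  moreover have "e t \<otimes> e t \<in> K" using e_small[OF h_double[OF inE_h[OF t(1)]]] by (simp add: e_add)
  ultimately show thesis using that t(1) by blast
qed

text \<open>In the noncentral case \<open>MA\<close> is contained in \<open>A\<close> times the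
  powers of a single \<open>e t\<close>, and the admissibility of t means just that \<open>f\<close>
  extends to that product.\<close>

lemma MA_extends: "extends_one_dim G K MA (lin_rep f)"
proof (cases central)
  case True
  have KM: "K \<subseteq> MA" using KA A_MA by blast
  have "x \<otimes> y \<otimes> inv x \<otimes> inv y \<in> K \<and> f (x \<otimes> y \<otimes> inv x \<otimes> inv y) = 1" if "x \<in> MA" "y \<in> MA" for x y
    using central_commutators[OF True that] by (simp add: trivial_comm_def)
  then show ?thesis unfolding extends_one_dim_iff by (rule extend_lin_char[OF fin K MA_subgroup KM f])
next
  case False
  obtain t where t: "inE t" "\<And>m. m \<in> MA \<Longrightarrow> m \<in> A \<or> (\<exists>x\<in>A. m = x \<otimes> e t)" using noncentral_MA[OF False] by blast
  let ?S = "A <#> generate G {e t}"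
  obtain \<eta> where \<eta>: "lin_char (G\<lparr>carrier := ?S\<rparr>) \<eta>" "\<forall>k\<in>K. \<eta> k = f k"
    using t(1) unfolding inE_iff extends_one_dim_iff by blast
  have S: "?S = {x \<otimes> e t [^] k | x k. x \<in> A \<and> k \<in> (UNIV :: nat set)}" by (rule set_mult_generate[OF fin e_G])
  have "m \<in> ?S" if m: "m \<in> MA" for m
  proof (cases "m \<in> A")
    case True
    then have "m = m \<otimes> e t [^] (0::nat)" using A_G by simp
    then show ?thesis unfolding S using True by blast
  next
    case False
    then obtain x where "x \<in> A" "m = x \<otimes> e t [^] (1::nat)" using t(2)[OF m] e_G by auto
    then show ?thesis unfolding S by blast
  qed
  then have "lin_char (G\<lparr>carrier := MA\<rparr>) \<eta>" using \<eta>(1) by (simp add: lin_char_def)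
  then show ?thesis unfolding extends_one_dim_iff using \<eta>(2) by blast
qed

lemma K_normal_MA: "K \<lhd> (G\<lparr>carrier := MA\<rparr>)"
proof -
  have g: "group (G\<lparr>carrier := MA\<rparr>)" by (rule subgroup.subgroup_is_group[OF MA_subgroup is_group])
  have KM: "K \<subseteq> MA" using KA A_MA by blast
  have "subgroup K (G\<lparr>carrier := MA\<rparr>)" by (rule subgroup_incl[OF K MA_subgroup KM])
  moreover have "x \<otimes> k \<otimes> inv\<^bsub>G\<lparr>carrier := MA\<rparr>\<^esub> x \<in> K" if "x \<in> MA" "k \<in> K" for x k
    using K_norm[OF MA_G[OF that(1)] that(2)] m_inv_consistent[OF MA_subgroup that(1)] by simp
  ultimately show ?thesis unfolding group.normal_inv_iff[OF g] by simp
qed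

lemma MA_quotient:
  "comm_group (G\<lparr>carrier := MA\<rparr> Mod K) \<or> abelian_semidirect_order_two (G\<lparr>carrier := MA\<rparr> Mod K)"
proof -
  interpret Q: normal K "G\<lparr>carrier := MA\<rparr>" by (rule K_normal_MA)
  note ci = m_inv_consistent[OF MA_subgroup]
  have comm: ?thesis if "\<And>x y. x \<in> MA \<Longrightarrow> y \<in> MA \<Longrightarrow> x \<otimes> y \<otimes> inv x \<otimes> inv y \<in> K"
  proof -
    have "comm_group (G\<lparr>carrier := MA\<rparr> Mod K)" by (rule Q.comm_group_Mod) (simp add: ci that)
    then show ?thesis ..
  qed
  show ?thesis
  proof (cases central)
    case True
    then show ?thesis using central_commutators comm unfolding trivial_comm_def by blast
  next
    case False
    obtain t where t: "inE t" and all: "\<And>m. m \<in> MA \<Longrightarrow> m \<in> A \<or> (\<exists>x\<in>A. m = x \<otimes> e t)" and ee: "e t \<otimes> e t \<in> K"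
      using noncentral_MA[OF False] by blast
    show ?thesis
    \<comment> \<open>The distinguished class may be trivial, with \<open>MA\<close> equal to
      \<open>A\<close>; only otherwise does it supply a complement of order two.\<close>
    proof (cases "e t \<in> A")
      case True
      have "MA \<subseteq> A" using all A_clo(1) True by blast
      then show ?thesis using comm commut by blast
    next
      case eA: False
      have AM: "x \<in> MA" if "x \<in> A" for x using A_MA that by blast
      have "abelian_semidirect_order_two (G\<lparr>carrier := MA\<rparr> Mod K)"
      proof (rule Q.abelian_semidirect_Mod[of A "e t"])
        show "subgroup A (G\<lparr>carrier := MA\<rparr>)" by (rule subgroup_incl[OF A MA_subgroup A_MA])
        show "e t \<in> carrier (G\<lparr>carrier := MA\<rparr>)" using e_MA[OF t] by simp
        show "e t \<otimes>\<^bsub>G\<lparr>carrier := MA\<rparr>\<^esub> e t \<in> K" using ee by simp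
        show "g \<in> A \<or> (\<exists>x\<in>A. g = x \<otimes>\<^bsub>G\<lparr>carrier := MA\<rparr>\<^esub> e t)" if "g \<in> carrier (G\<lparr>carrier := MA\<rparr>)" for g
          using all that by simp
        show "e t \<otimes>\<^bsub>G\<lparr>carrier := MA\<rparr>\<^esub> x \<otimes>\<^bsub>G\<lparr>carrier := MA\<rparr>\<^esub> inv\<^bsub>G\<lparr>carrier := MA\<rparr>\<^esub> e t \<in> A" if "x \<in> A" for x
          using A_e[OF inE_h[OF t] that] by (simp add: ci[OF e_MA[OF t]])
        show "x \<otimes>\<^bsub>G\<lparr>carrier := MA\<rparr>\<^esub> y \<otimes>\<^bsub>G\<lparr>carrier := MA\<rparr>\<^esub> inv\<^bsub>G\<lparr>carrier := MA\<rparr>\<^esub> x \<otimes>\<^bsub>G\<lparr>carrier := MA\<rparr>\<^esub> inv\<^bsub>G\<lparr>carrier := MA\<rparr>\<^esub> y \<in> K"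
          if "x \<in> A" "y \<in> A" for x y using commut[OF that] by (simp add: ci[OF AM[OF that(1)]] ci[OF AM[OF that(2)]])
      qed (use KA eA in auto)
      then show ?thesis ..
    qed
  qed
qed

lemma MA_degree:
  assumes c: "c \<in> Irr_over (G\<lparr>carrier := MA\<rparr>) K (lin_rep f)" and \<rho>: "\<rho> \<in> c"
  shows "rep_degree (G\<lparr>carrier := MA\<rparr>) \<rho> = 1 \<or> rep_degree (G\<lparr>carrier := MA\<rparr>) \<rho> = 2"
proof -
  interpret Cl: clifford G K A MA f by (rule clifford_MA)
  have ov: "Cl.over \<rho>" using c \<rho> Cl.over_equiv unfolding Cl.Irr_over_M_iff by blast
  have pos: "rep_degree (G\<lparr>carrier := MA\<rparr>) \<rho> > 0" using ov by (simp add: Cl.over_def irreducible_rep_def)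
  show ?thesis
  proof (cases central)
    case True
    have "rep_degree (G\<lparr>carrier := MA\<rparr>) \<rho> = 1"
      by (rule Cl.degree_eq_1[OF ov]) (use central_commutators[OF True] in \<open>simp add: trivial_comm_def\<close>)
    then show ?thesis ..
  next
    case False
    obtain t where t: "inE t" and all: "\<And>m. m \<in> MA \<Longrightarrow> m \<in> A \<or> (\<exists>x\<in>A. m = x \<otimes> e t)" and ee: "e t \<otimes> e t \<in> K"
      using noncentral_MA[OF False] by blast
    have "rep_degree (G\<lparr>carrier := MA\<rparr>) \<rho> \<le> 2" by (rule Cl.degree_le_2[OF ov e_MA[OF t] K_A[OF ee] all])
    then show ?thesis using pos by linarith
  qed
qed

lemma MA_bij:
  assumes C: "C = {g \<in> carrier G. \<forall>k\<in>K. f (g \<otimes> k \<otimes> inv g) = f k}"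
  shows "bij_betw (Ind_orbit G MA) (conj_orbits G C (Irr_over (G\<lparr>carrier := MA\<rparr>) K (lin_rep f))) (Irr_over G K (lin_rep f))"
    and "\<And>g. g \<in> C \<Longrightarrow> (\<lambda>x. g \<otimes> x \<otimes> inv g) ` MA = MA"
proof -
  interpret Cl: clifford G K A MA f by (rule clifford_MA)
  have CC: "C = Cl.C" by (simp add: C Cl.C_def)
  show "bij_betw (Ind_orbit G MA) (conj_orbits G C (Irr_over (G\<lparr>carrier := MA\<rparr>) K (lin_rep f))) (Irr_over G K (lin_rep f))"
    unfolding CC by (rule Cl.clifford_bij)
  fix g assume g: "g \<in> C"
  have gc: "g \<in> carrier G" using g by (simp add: C)
  show "(\<lambda>x. g \<otimes> x \<otimes> inv g) ` MA = MA"
  proof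
    show "(\<lambda>x. g \<otimes> x \<otimes> inv g) ` MA \<subseteq> MA" using Cl.M_conj g unfolding CC by blast
    show "MA \<subseteq> (\<lambda>x. g \<otimes> x \<otimes> inv g) ` MA"
    proof
      fix m assume m: "m \<in> MA"
      have "m = g \<otimes> (inv g \<otimes> m \<otimes> g) \<otimes> inv g" using gc MA_G[OF m] by (simp add: m_assoc)
      then show "m \<in> (\<lambda>x. g \<otimes> x \<otimes> inv g) ` MA" using Cl.M_conj'[OF g[unfolded CC] m] by blast
    qed
  qed
qed

end

section \<open>Arithmetic in the truncated ring\<close>

text \<open>The quotient by the power 2 l of the maximal ideal, described as a chain ring.
  \<open>psi_top\<close> is nontriviality of the character on the smallest nonzero ideal.\<close>

locale truncated_dvr =
  fixes p :: "'r::comm_ring_1" and l :: nat and \<psi> :: "'r \<Rightarrow> complex"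
  assumes finR: "finite (UNIV :: 'r set)" and l1: "1 \<le> l"
    and unif: "\<exists>n u. n \<le> 2 * l \<and> u dvd 1 \<and> x = u * p ^ n"
    and p_nil: "p ^ (2 * l) = 0"
    and psi0: "\<psi> 0 = 1" and psi_add: "\<psi> (x + y) = \<psi> x * \<psi> y"
    and psi_top: "\<psi> (p ^ (2 * l - 1)) \<noteq> 1"
begin

text \<open>Lower powers of p are nonzero because \<open>\<psi>\<close> differs from 1 at
  p^(2l-1).\<close>

lemma p_pow_zero: "p ^ m = 0 \<longleftrightarrow> 2 * l \<le> m"
proof
  assume 0: "p ^ m = 0"
  show "2 * l \<le> m"
  proof (rule ccontr)
    assume "\<not> 2 * l \<le> m"
    then have "2 * l - 1 = m + (2 * l - 1 - m)" by simp
    then have "p ^ (2 * l - 1) = p ^ m * p ^ (2 * l - 1 - m)" by (metis power_add)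
    then show False using 0 psi_top psi0 by simp
  qed
next
  assume "2 * l \<le> m"
  then have "p ^ m = p ^ (2 * l) * p ^ (m - 2 * l)" by (simp flip: power_add)
  then show "p ^ m = 0" by (simp add: p_nil)
qed

lemma unit_mult_eq_0: "u dvd (1::'r) \<Longrightarrow> u * x = 0 \<longleftrightarrow> x = 0"
  by (metis dvdE mult.commute mult.left_commute mult_1_right mult_zero_right)

lemma unit_power_zero: "u dvd 1 \<Longrightarrow> u * p ^ m = 0 \<longleftrightarrow> 2 * l \<le> m"
  using unit_mult_eq_0[of u "p ^ m"] p_pow_zero by simp

text \<open>Multiplication by p^(2l-k) turns divisibility by p^k into vanishing.\<close>

lemma dvd_unit_power:
  assumes u: "u dvd 1" and k: "k \<le> 2 * l"
  shows "p ^ k dvd u * p ^ m \<longleftrightarrow> k \<le> m"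
proof
  assume "p ^ k dvd u * p ^ m"
  then have "p ^ (2 * l - k) * p ^ k dvd p ^ (2 * l - k) * (u * p ^ m)" by (rule mult_dvd_mono[OF dvd_refl])
  then have "p ^ (2 * l) dvd u * p ^ (2 * l - k + m)" using k by (simp add: power_add[symmetric] mult.left_commute)
  then have "u * p ^ (2 * l - k + m) = 0" by (simp add: p_nil)
  then show "k \<le> m" using unit_power_zero[OF u] k by simp
qed (simp add: dvd_mult le_imp_power_dvd)

lemma small_mult_zero: "p ^ l dvd x \<Longrightarrow> p ^ l dvd y \<Longrightarrow> x * y = 0"
proof -
  assume "p ^ l dvd x" "p ^ l dvd y"
  then have "p ^ l * p ^ l dvd x * y" by (rule mult_dvd_mono)
  then show ?thesis using p_nil by (simp flip: power_add mult_2)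
qed

text \<open>The annihilator of p^l is the ideal that p^l generates. This is how vanishing obtained
  from \<open>psi_primitive\<close> becomes a congruence modulo p^l.\<close>

lemma p_mult_zero_iff: "p ^ l * x = 0 \<longleftrightarrow> p ^ l dvd x"
proof -
  obtain n u where x: "u dvd 1" "x = u * p ^ n" using unif[of x] by blast
  have "p ^ l * x = u * p ^ (l + n)" using x by (simp add: power_add mult.left_commute)
  then show ?thesis using unit_power_zero[OF x(1), of "l + n"] dvd_unit_power[OF x(1), of l n] x(2) by auto
qed

lemma not_dvd_obtain:
  assumes "\<not> p ^ k dvd x"
  obtains n u where "n < k" "u dvd 1" "x = u * p ^ n"
proof -
  obtain n u where x: "u dvd 1" "x = u * p ^ n" using unif[of x] by blast
  have "n < k"
  proof (rule ccontr)
    assume "\<not> n < k"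
    then have "p ^ k dvd x" using x by (simp add: dvd_mult le_imp_power_dvd)
    with assms show False by simp
  qed
  with x that show thesis by blast
qed

lemma unit_iff: "x dvd 1 \<longleftrightarrow> \<not> p dvd x"
proof
  assume x: "x dvd 1"
  show "\<not> p dvd x" using dvd_unit_power[OF x, of 1 0] l1 by simp
next
  assume "\<not> p dvd x"
  then show "x dvd 1" using not_dvd_obtain[of 1 x] by auto
qed

lemma unit_plus: "p dvd y \<Longrightarrow> 1 + y dvd 1"
proof -
  assume y: "p dvd y"
  have "\<not> p dvd (1::'r)" using unit_iff[of 1] by simp
  then show ?thesis using y unit_iff dvd_add_left_iff by blast
qed

lemma unit_mult: "x dvd (1::'r) \<Longrightarrow> y dvd 1 \<Longrightarrow> x * y dvd 1"
  using mult_dvd_mono[of x 1 y 1] by simp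

lemma psi_uminus: "\<psi> (- x) = inverse (\<psi> x)"
  using psi_add[of x "- x"] psi0 by (simp add: inverse_unique)

lemma psi_nonzero: "\<psi> x \<noteq> 0"
  using psi_add[of x "- x"] psi0 by auto

text \<open>Every nonzero ideal contains p^(2l-1), where \<open>\<psi>\<close> is not 1.\<close>

lemma psi_primitive:
  assumes "\<And>t. \<psi> (x * t) = 1"
  shows "x = 0"
proof (rule ccontr)
  assume "x \<noteq> 0"
  then have "\<not> p ^ (2 * l) dvd x" by (simp add: p_nil)
  then obtain n u where n: "n < 2 * l" "u dvd 1" "x = u * p ^ n" by (rule not_dvd_obtain)
  from n(2) obtain v where v: "1 = u * v" by (rule dvdE)
  have "x * (v * p ^ (2 * l - 1 - n)) = (u * v) * p ^ (n + (2 * l - 1 - n))"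
    unfolding n(3) power_add by (simp add: algebra_simps)
  also have "\<dots> = p ^ (2 * l - 1)" using n(1) v by simp
  finally show False using assms[of "v * p ^ (2 * l - 1 - n)"] psi_top by simp
qed

text \<open>
  With \<open>u\<close> a unit, \<open>u p\<^sup>m \<tau> + B \<tau>\<^sup>2\<close> represents the socle generator if \<open>p\<^sup>m\<^sup>+\<^sup>1\<close> divides \<open>B\<close>:
  for the right \<open>\<tau>\<close> the quadratic term vanishes.
\<close>
lemma represents_top:
  assumes u: "u dvd 1" and m: "m < 2 * l" and B: "p ^ Suc m dvd B"
  shows "\<exists>\<tau>. u * p ^ m * \<tau> + B * \<tau>\<^sup>2 = p ^ (2 * l - 1)"
proof -
  obtain v where v: "1 = u * v" using u by (rule dvdE)
  let ?k = "2 * l - 1 - m"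
  obtain B' where B': "B = p ^ Suc m * B'" using B by (rule dvdE)
  have "u * p ^ m * (v * p ^ ?k) = (u * v) * p ^ (m + ?k)" by (simp add: power_add algebra_simps)
  then have 1: "u * p ^ m * (v * p ^ ?k) = p ^ (2 * l - 1)" using v m by simp
  have "B * (v * p ^ ?k)\<^sup>2 = B' * v\<^sup>2 * p ^ (Suc m + 2 * ?k)"
    unfolding B' power_add power_mult by (simp add: power_mult_distrib algebra_simps power2_eq_square)
  \<comment> \<open>The exponent is at least 2 l: m + 1 + 2 (2 l - 1 - m) = 2 l + (2 l - 1 -
    m).\<close>
  also have "p ^ (Suc m + 2 * ?k) = 0" unfolding p_pow_zero using m by simp
  finally show ?thesis using 1 by (intro exI[of _ "v * p ^ ?k"]) simp
qed

text \<open>Squaring is additive modulo p, so the order k of v modulo p is odd: for k = 2 h, p would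
  divide (v^h - 1)^2 and hence v^h - 1. Then v is congruent to the even power v^(k+1).\<close>

lemma residue_sqrt:
  assumes two: "p dvd 2" and v: "v dvd 1"
  shows "\<exists>t. p dvd t\<^sup>2 - v"
proof -
  have "\<not> inj (\<lambda>n::nat. v ^ n)" using finR finite_subset[OF subset_UNIV] range_inj_infinite by blast
  then obtain i j :: nat where ij: "i < j" "v ^ i = v ^ j" by (metis injI nat_neq_iff)
  have "v ^ j = v ^ i * v ^ (j - i)" using ij(1) by (simp flip: power_add)
  then have "v ^ i * (v ^ (j - i) - 1) = 0" using ij(2) by (simp add: right_diff_distrib)
  moreover have "v ^ i dvd 1" using v by (metis dvd_power_same power_one)
  ultimately have "v ^ (j - i) - 1 = 0" using unit_mult_eq_0 by blast
  then have ex: "0 < j - i \<and> p dvd v ^ (j - i) - 1" using ij by simp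
  define k where "k = (LEAST k. 0 < k \<and> p dvd v ^ k - 1)"
  have k: "0 < k \<and> p dvd v ^ k - 1" unfolding k_def by (rule LeastI, rule ex)
  have "odd k"
  proof
    assume "even k"
    then obtain h where h: "k = 2 * h" by (auto elim: evenE)
    have sq: "(v ^ h - 1)\<^sup>2 = (v ^ k - 1) - 2 * (v ^ h - 1)"
    proof -
      have "v ^ k = (v ^ h)\<^sup>2" unfolding h by (rule power_even_eq)
      then show ?thesis by (simp add: power2_diff algebra_simps)
    qed
    have "p dvd (v ^ h - 1)\<^sup>2" unfolding sq by (rule dvd_diff[OF conjunct2[OF k] dvd_mult2[OF two]])
    then have "\<not> (v ^ h - 1)\<^sup>2 dvd 1" using unit_iff by blast
    then have "p dvd v ^ h - 1" using unit_mult[of "v ^ h - 1" "v ^ h - 1"] unit_iff by (auto simp: power2_eq_square)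
    moreover have "0 < h" "h < k" using k h by auto
    ultimately show False using not_less_Least[of h "\<lambda>k. 0 < k \<and> p dvd v ^ k - 1"] unfolding k_def by blast
  qed
  then obtain h where h: "k = 2 * h + 1" by (auto elim: oddE)
  have "(v ^ (h + 1))\<^sup>2 = v ^ Suc k" unfolding h power_even_eq[symmetric] by simp
  then have "(v ^ (h + 1))\<^sup>2 - v = v * (v ^ k - 1)" by (simp add: right_diff_distrib)
  then show ?thesis using k by (metis dvd_mult)
qed

end

text \<open>The two alternatives are characteristic two and mixed characteristic; in the latter 2 e
  <= l is half of the bound 4 e <= 2 l.\<close>

locale truncated_quadratic = truncated_dvr p l \<psi> for p :: "'r::comm_ring_1" and l \<psi> +
  fixes \<alpha> \<beta> :: 'r
  assumes two: "(2::'r) = 0 \<or> (\<exists>e u. u dvd 1 \<and> 2 = u * p ^ e \<and> 1 \<le> e \<and> 2 * e \<le> l)"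
begin

text \<open>The norm equation modulo p^l: x^2 + \<beta> x y - \<alpha> y^2 is the determinant of x +
  y A for the companion matrix A. Elements of S reduce to such matrices, with first column (x, a
  y).\<close>

definition sol :: "'r \<Rightarrow> 'r \<Rightarrow> bool" where
  "sol x y \<longleftrightarrow> p ^ l dvd x\<^sup>2 + \<beta> * x * y - \<alpha> * y\<^sup>2 - 1"

text \<open>The value of \<open>\<psi>\<^sub>A\<close> on the commutator of \<open>e\<^sub>\<zeta>\<close> and an element with first column \<open>(x, a y)\<close> is \<open>\<psi> (comm_val \<zeta> x y)\<close>.\<close>
definition comm_val :: "'r \<Rightarrow> 'r \<Rightarrow> 'r \<Rightarrow> 'r" where
  "comm_val \<zeta> x y = \<zeta> * (1 - x\<^sup>2 - \<beta> * x * y + \<alpha> * y\<^sup>2) - \<zeta>\<^sup>2 * x * y"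

text \<open>A necessary condition for extendibility, see \<open>inE_good\<close>: y \<zeta> in p^l
  puts the commutator into \<open>K\<close>, where \<open>inE_commutator\<close> applies. With x a
  unit, the second column of a test element can be solved for.\<close>

definition good :: "'r \<Rightarrow> bool" where
  "good \<zeta> \<longleftrightarrow> (\<forall>x y. x dvd 1 \<and> sol x y \<and> p ^ l dvd y * \<zeta> \<longrightarrow> \<psi> (comm_val \<zeta> x y) = 1)"

text \<open>The test elements x = 1 + p^(l-e) t, y = 0 exclude everything but \<zeta> of valuation l
  - 1 with l = 2 e. There each parameter gives a condition on a linear plus a quadratic term in the
  residue of t, and combining two of them eliminates the linear terms.\<close>

lemma good_dichotomy_mixed:
  assumes e: "u dvd 1" "2 = u * p ^ e" "1 \<le> e" "2 * e \<le> l"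
    and L: "good \<zeta>" "\<not> p ^ l dvd \<zeta>" and M: "good \<mu>"
  shows "p ^ l dvd \<mu> \<or> p ^ l dvd \<mu> - \<zeta>"
proof (cases "p ^ l dvd \<mu>")
  case False
  have top: "\<exists>\<nu>'. \<nu>' dvd 1 \<and> \<nu> = \<nu>' * p ^ (l - 1) \<and> (\<forall>t. \<psi> (p ^ (2 * l - 1) * (\<nu>' * (u * t + t\<^sup>2))) = 1)"
    if g: "good \<nu>" and nd: "\<not> p ^ l dvd \<nu>" for \<nu>
  proof -
    obtain q \<nu>' where q: "q < l" "\<nu>' dvd 1" "\<nu> = \<nu>' * p ^ q" using nd by (rule not_dvd_obtain)
    have le: "l = (l - e) + e" "2 * l - 2 * e = l + (l - 2 * e)" using e by auto
    have val: "\<psi> (\<nu> * (p ^ l * (u * t + p ^ (l - 2 * e) * t\<^sup>2))) = 1" for t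
    proof -
      let ?x = "1 + p ^ (l - e) * t"
      have "?x\<^sup>2 - 1 = 2 * p ^ (l - e) * t + (p ^ (l - e))\<^sup>2 * t\<^sup>2"
        by (simp add: power2_sum power_mult_distrib)
      also have "(p ^ (l - e))\<^sup>2 = p ^ (2 * l - 2 * e)"
        by (simp only: power_even_eq[symmetric] diff_mult_distrib2)
      finally have "?x\<^sup>2 - 1 = 2 * p ^ (l - e) * t + p ^ (2 * l - 2 * e) * t\<^sup>2" .
      also have "2 * p ^ (l - e) * t + p ^ (2 * l - 2 * e) * t\<^sup>2 = u * p ^ (l - e + e) * t + p ^ (l + (l - 2 * e)) * t\<^sup>2"
        unfolding e(2) le(2)[symmetric] power_add by (simp add: algebra_simps)
      also have "\<dots> = p ^ l * (u * t + p ^ (l - 2 * e) * t\<^sup>2)"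
        unfolding le(1)[symmetric] power_add by (simp add: algebra_simps)
      finally have x: "?x\<^sup>2 - 1 = p ^ l * (u * t + p ^ (l - 2 * e) * t\<^sup>2)" .
      have "p dvd p ^ (l - e) * t" using e l1 by (intro dvd_mult2 dvd_power) auto
      then have "?x dvd 1" by (rule unit_plus)
      moreover have "sol ?x 0" unfolding sol_def using x by simp
      ultimately have "\<psi> (comm_val \<nu> ?x 0) = 1" using g unfolding good_def by simp
      moreover have "comm_val \<nu> ?x 0 = - (\<nu> * (?x\<^sup>2 - 1))" by (simp add: comm_val_def algebra_simps)
      ultimately have "\<psi> (- (\<nu> * (?x\<^sup>2 - 1))) = 1" by simp
      then show ?thesis unfolding psi_uminus x by simp
    qed
    \<comment> \<open>Otherwise t = p^(l-1-q) \<tau> kills the quadratic term and turns the linear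
      one into p^(2l-1) times an arbitrary ring element.\<close>
    have "q = l - 1 \<and> l = 2 * e"
    proof (rule ccontr)
      assume n: "\<not> (q = l - 1 \<and> l = 2 * e)"
      let ?k = "l - 1 - q"
      have *: "\<nu> * (p ^ l * (u * (p ^ ?k * \<tau>) + p ^ (l - 2 * e) * (p ^ ?k * \<tau>)\<^sup>2)) = p ^ (2 * l - 1) * (\<nu>' * u * \<tau>)" for \<tau>
      proof -
        have "\<nu> * (p ^ l * (u * (p ^ ?k * \<tau>) + p ^ (l - 2 * e) * (p ^ ?k * \<tau>)\<^sup>2))
          = p ^ (q + l + ?k) * (\<nu>' * u * \<tau>) + p ^ (q + l + (l - 2 * e) + 2 * ?k) * (\<nu>' * \<tau>\<^sup>2)"
          unfolding q(3) power_add power_mult by (simp add: algebra_simps power_mult_distrib power2_eq_square)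
        also have "q + l + ?k = 2 * l - 1" using q(1) by simp
        also have "p ^ (q + l + (l - 2 * e) + 2 * ?k) = 0" unfolding p_pow_zero using q(1) n e by auto
        finally show ?thesis by simp
      qed
      have "\<nu>' * u dvd 1" using unit_mult[OF q(2) e(1)] .
      then obtain w where w: "1 = (\<nu>' * u) * w" by (rule dvdE)
      show False using val[of "p ^ ?k * w"] psi_top unfolding * w[symmetric] by simp
    qed
    then have ql: "q = l - 1" "l - 2 * e = 0" by auto
    have "\<nu> * (p ^ l * (u * t + p ^ (l - 2 * e) * t\<^sup>2)) = p ^ (2 * l - 1) * (\<nu>' * (u * t + t\<^sup>2))" for t
    proof -
      have "\<nu> * (p ^ l * (u * t + p ^ (l - 2 * e) * t\<^sup>2)) = p ^ (l - 1 + l) * (\<nu>' * (u * t + t\<^sup>2))"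
        unfolding q(3) ql power_add by (simp add: algebra_simps)
      then show ?thesis using l1 by (simp add: mult_2)
    qed
    then show ?thesis using val q ql by metis
  qed
  obtain \<zeta>' where \<zeta>': "\<zeta>' dvd 1" "\<zeta> = \<zeta>' * p ^ (l - 1)" "\<And>t. \<psi> (p ^ (2 * l - 1) * (\<zeta>' * (u * t + t\<^sup>2))) = 1"
    using top[OF L] by blast
  obtain \<mu>' where \<mu>': "\<mu>' dvd 1" "\<mu> = \<mu>' * p ^ (l - 1)" "\<And>t. \<psi> (p ^ (2 * l - 1) * (\<mu>' * (u * t + t\<^sup>2))) = 1"
    using top[OF M False] by blast
  have "p dvd \<mu>' - \<zeta>'"
  proof (rule ccontr)
    assume "\<not> p dvd \<mu>' - \<zeta>'"
    then have "\<mu>' - \<zeta>' dvd 1" using unit_iff by blast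
    then have \<kappa>: "\<zeta>' * \<mu>' * (\<mu>' - \<zeta>') dvd 1" using unit_mult \<zeta>' \<mu>' by blast
    \<comment> \<open>Substituting \<mu>' t in the condition for \<zeta>' and \<zeta>' t in the one
      for \<mu>' gives equal linear parts. The quadratic parts differ by ?\<kappa> t^2, and t^2 can
      be any unit modulo p.\<close>
    let ?\<kappa> = "\<zeta>' * \<mu>' * (\<mu>' - \<zeta>')"
    obtain v where v: "1 = ?\<kappa> * v" using \<kappa> by (rule dvdE)
    then have vu: "v dvd 1" by (metis dvd_triv_right)
    have "p dvd 2" unfolding e(2) using e(3) by (simp add: dvd_mult dvd_power)
    then obtain t where t: "p dvd t\<^sup>2 - v" using residue_sqrt[OF _ vu] by blast
    then obtain z where z: "t\<^sup>2 = v + p * z" by (metis add.commute diff_add_cancel dvdE)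
    let ?P = "p ^ (2 * l - 1)"
    have "?P * (?\<kappa> * t\<^sup>2) = ?P * (\<zeta>' * (u * (\<mu>' * t) + (\<mu>' * t)\<^sup>2)) - ?P * (\<mu>' * (u * (\<zeta>' * t) + (\<zeta>' * t)\<^sup>2))"
      by (simp add: algebra_simps power_mult_distrib power2_eq_square)
    then have "\<psi> (?P * (?\<kappa> * t\<^sup>2)) = 1"
      using psi_add[of _ "- _"] \<zeta>'(3)[of "\<mu>' * t"] \<mu>'(3)[of "\<zeta>' * t"] by (simp add: psi_uminus)
    moreover have "?P * (?\<kappa> * t\<^sup>2) = ?P"
    proof -
      have "?P * (?\<kappa> * t\<^sup>2) = ?P * (?\<kappa> * v) + p ^ (2 * l - 1 + 1) * (?\<kappa> * z)"
        unfolding z power_add by (simp add: algebra_simps)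
      also have "p ^ (2 * l - 1 + 1) = 0" unfolding p_pow_zero by simp
      finally show ?thesis using v by simp
    qed
    ultimately show False using psi_top by simp
  qed
  then obtain z where "\<mu>' - \<zeta>' = p * z" by (rule dvdE)
  then have "\<mu> - \<zeta> = p ^ (1 + (l - 1)) * z" unfolding \<mu>' \<zeta>' power_add by (simp add: algebra_simps flip: left_diff_distrib)
  then show ?thesis using l1 by simp
qed simp

text \<open>The test elements are \<open>x = 1 + (x\<^sub>0 + 1) t\<close>, \<open>y = y\<^sub>0 t\<close> with \<open>t = p\<^sup>n \<tau>\<close>.\<close>
lemma comm_val_represents_top:
  assumes two0: "(2::'r) = 0" and s0: "sol x0 y0" and y0: "y0 = \<eta> * p ^ i" "\<eta> dvd 1"
    and \<nu>: "\<nu> = u * p ^ q" "u dvd 1" "q < l" and \<nu>\<beta>: "\<nu> + \<beta> = u' * p ^ m" "u' dvd 1"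
    and n: "i + n + m = l" "1 \<le> n" and b: "p ^ l dvd p ^ n * \<beta> * y0" and y\<nu>: "p ^ l dvd p ^ n * y0 * \<nu>"
  shows "\<exists>x z. x dvd 1 \<and> sol x (p ^ n * y0 * z) \<and> comm_val \<nu> x (p ^ n * y0 * z) = p ^ (2 * l - 1)"
proof -
  have neg: "- z = z" for z :: 'r using two0 by (metis add_eq_0_iff mult_2 mult_zero_left)
  have minus: "w - z = w + z" for w z :: 'r using neg[of z] by (metis diff_conv_add_uminus)
  have dbl: "z + z = 0" for z :: 'r using neg[of z] by (metis add.right_inverse)
  obtain c where c: "x0\<^sup>2 + \<beta> * x0 * y0 + \<alpha> * y0\<^sup>2 + 1 = p ^ l * c"
    using s0 unfolding sol_def minus by (rule dvdE)
  obtain d where d: "p ^ n * \<beta> * y0 = p ^ l * d" using b by (rule dvdE)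
  obtain d' where d': "p ^ n * y0 * \<nu> = p ^ l * d'" using y\<nu> by (rule dvdE)
  let ?x = "\<lambda>\<tau>. 1 + (x0 + 1) * (p ^ n * \<tau>)"
  let ?y = "\<lambda>\<tau>. p ^ n * y0 * \<tau>"
  have sq: "(w + z)\<^sup>2 = w\<^sup>2 + z\<^sup>2" for w z :: 'r
  proof -
    have "(w + z)\<^sup>2 = w\<^sup>2 + z\<^sup>2 + (w * z + w * z)" by (simp add: power2_eq_square algebra_simps)
    then show ?thesis by (simp only: dbl) simp
  qed
  \<comment> \<open>When 2 = 0, moving from (1, 0) towards (x0, y0) by the parameter t = p^n \<tau>
    multiplies the defect of the norm equation at (x0, y0) by t^2 and adds \<beta> y0 t (1 + t),
    which is small by assumption. So one solution yields a family.\<close>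
  have Q: "1 + (?x \<tau>)\<^sup>2 + \<beta> * ?x \<tau> * ?y \<tau> + \<alpha> * (?y \<tau>)\<^sup>2 = p ^ l * ((p ^ n * \<tau>)\<^sup>2 * c + d * \<tau> * (1 + p ^ n * \<tau>))" for \<tau>
  proof -
    let ?t = "p ^ n * \<tau>"
    have "1 + (?x \<tau>)\<^sup>2 + \<beta> * ?x \<tau> * ?y \<tau> + \<alpha> * (?y \<tau>)\<^sup>2
      = (1 + 1) + ?t\<^sup>2 * (x0\<^sup>2 + \<beta> * x0 * y0 + \<alpha> * y0\<^sup>2 + 1) + (p ^ n * \<beta> * y0) * \<tau> * (1 + ?t)"
      unfolding sq power_mult_distrib by (simp add: algebra_simps power2_eq_square)
    then show ?thesis unfolding c d dbl by (simp add: algebra_simps)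
  qed
  have sol: "sol (?x \<tau>) (?y \<tau>)" for \<tau>
  proof -
    have "(?x \<tau>)\<^sup>2 + \<beta> * ?x \<tau> * ?y \<tau> - \<alpha> * (?y \<tau>)\<^sup>2 - 1 = p ^ l * ((p ^ n * \<tau>)\<^sup>2 * c + d * \<tau> * (1 + p ^ n * \<tau>))"
      unfolding minus Q[symmetric] by (simp only: ac_simps)
    then show ?thesis unfolding sol_def by simp
  qed
  \<comment> \<open>Collects the terms quadratic in \<tau>. They carry p^(l+q+n) against p^(l+q) in
    the linear term, and n >= 1 is what \<open>represents_top\<close> requires.\<close>
  define B where "B = p ^ (n + q + l) * (u * (p ^ n * c + d + d' * (x0 + 1)))"
  \<comment> \<open>The linear coefficient: the contribution of \<nu> beta y0 from the norm defect
    joins that of \<nu>^2 y0 to form the factor \<nu> (\<nu> + \<beta>).\<close>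
  have A: "u * \<eta> * u' * p ^ (l + q) = p ^ n * y0 * \<nu> * (\<nu> + \<beta>)"
  proof -
    have "p ^ n * y0 * \<nu> * (\<nu> + \<beta>) = p ^ n * (\<eta> * p ^ i) * (u * p ^ q) * (u' * p ^ m)"
      using \<nu>\<beta>(1) y0(1) \<nu>(1) by simp
    also have "\<dots> = u * \<eta> * u' * p ^ (i + n + m + q)"
      unfolding power_add by (simp add: algebra_simps)
    finally have "p ^ n * y0 * \<nu> * (\<nu> + \<beta>) = u * \<eta> * u' * p ^ (i + n + m + q)" .
    then show ?thesis using n by simp
  qed
  have V: "comm_val \<nu> (?x \<tau>) (?y \<tau>) = u * \<eta> * u' * p ^ (l + q) * \<tau> + B * \<tau>\<^sup>2" for \<tau>
  proof -
    let ?t = "p ^ n * \<tau>"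
    have 1: "comm_val \<nu> (?x \<tau>) (?y \<tau>) = \<nu> * (1 + (?x \<tau>)\<^sup>2 + \<beta> * ?x \<tau> * ?y \<tau> + \<alpha> * (?y \<tau>)\<^sup>2) + \<nu>\<^sup>2 * ?x \<tau> * ?y \<tau>"
      unfolding comm_val_def minus ..
    have 2: "\<nu>\<^sup>2 * ?x \<tau> * ?y \<tau> = (p ^ n * y0 * \<nu>) * \<nu> * \<tau> + (p ^ n * y0 * \<nu>) * \<nu> * \<tau> * (x0 + 1) * ?t"
      by (simp add: algebra_simps power2_eq_square)
    have 3: "(p ^ n * y0 * \<nu>) * \<beta> * \<tau> = \<nu> * (p ^ l * (d * \<tau>))"
    proof -
      have "(p ^ n * y0 * \<nu>) * \<beta> * \<tau> = \<nu> * ((p ^ n * \<beta> * y0) * \<tau>)" by (simp add: algebra_simps)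
      then show ?thesis unfolding d by (simp add: algebra_simps)
    qed
    have "comm_val \<nu> (?x \<tau>) (?y \<tau>) = \<nu> * (p ^ l * (?t\<^sup>2 * c + d * \<tau> * (1 + ?t))) + ((p ^ n * y0 * \<nu>) * \<nu> * \<tau> + p ^ l * d' * \<nu> * \<tau> * (x0 + 1) * ?t)"
      unfolding 1 Q 2 d' ..
    also have "\<dots> = (p ^ n * y0 * \<nu>) * \<nu> * \<tau> + (p ^ n * y0 * \<nu>) * \<beta> * \<tau> + \<nu> * p ^ l * p ^ n * (p ^ n * c + d + d' * (x0 + 1)) * \<tau>\<^sup>2"
      unfolding 3 by (simp add: algebra_simps power2_eq_square)
    also have "\<nu> * p ^ l * p ^ n * (p ^ n * c + d + d' * (x0 + 1)) = B"
      unfolding B_def \<nu> power_add by (simp add: algebra_simps)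
    also have "(p ^ n * y0 * \<nu>) * \<nu> * \<tau> + (p ^ n * y0 * \<nu>) * \<beta> * \<tau> = u * \<eta> * u' * p ^ (l + q) * \<tau>"
      unfolding A by (simp add: algebra_simps)
    finally show ?thesis .
  qed
  have "u * \<eta> * u' dvd 1" using unit_mult \<nu> y0 \<nu>\<beta> by blast
  moreover have "p ^ Suc (l + q) dvd B" unfolding B_def using n by (intro dvd_mult2 le_imp_power_dvd) simp
  moreover have "l + q < 2 * l" using \<nu> by simp
  ultimately obtain \<tau> where \<tau>: "u * \<eta> * u' * p ^ (l + q) * \<tau> + B * \<tau>\<^sup>2 = p ^ (2 * l - 1)"
    using represents_top[of "u * \<eta> * u'" "l + q" B] by blast
  have "p dvd (x0 + 1) * (p ^ n * \<tau>)" using n by (intro dvd_mult dvd_mult2 dvd_power) simp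
  then have "?x \<tau> dvd 1" by (rule unit_plus)
  then show ?thesis using sol[of \<tau>] V[of \<tau>] \<tau> by (intro exI[of _ "?x \<tau>"] exI[of _ \<tau>]) simp
qed

lemma sum_unit_power:
  assumes "u dvd 1" "v dvd 1" "q < m"
  shows "\<exists>w. w dvd 1 \<and> u * p ^ q + v * p ^ m = w * p ^ q"
proof -
  obtain u' where u': "1 = u * u'" using assms(1) by (rule dvdE)
  let ?w = "u * (1 + u' * v * p ^ (m - q))"
  have "p dvd u' * v * p ^ (m - q)" using assms(3) by (intro dvd_mult dvd_power) simp
  then have "?w dvd 1" using unit_plus unit_mult[OF assms(1)] by blast
  moreover have "u * p ^ q + v * p ^ m = ?w * p ^ q"
  proof -
    have "?w * p ^ q = u * p ^ q + (u * u') * v * p ^ (m - q + q)" unfolding power_add by (simp add: algebra_simps)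
    then show ?thesis using u' assms(3) by simp
  qed
  ultimately show ?thesis by blast
qed

text \<open>Let i, b, q be the valuations of y0, \<beta>, \<nu>. If \<nu> + \<beta> has valuation m
  with m <= b and m <= q and i + m < l, the test family with n = l - m - i reaches p^(2l-1). So a
  good \<nu> with y0 \<nu> not small must cancel the leading term of \<beta>. Two such parameters
  differ by an element of higher valuation, to which the same test applies, because
  \<open>comm_val\<close> is additive in its first argument when 2 = 0.\<close>

lemma good_dichotomy_equal:
  assumes two0: "(2::'r) = 0" and L: "good \<zeta>" and M: "good \<mu>"
    and s0: "sol x0 y0" and act: "\<not> p ^ l dvd y0 * \<zeta>"
  shows "p ^ l dvd \<mu> \<or> p ^ l dvd \<mu> - \<zeta>"
proof -
  have neg: "- z = z" for z :: 'r using two0 by (metis add_eq_0_iff mult_2 mult_zero_left)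
  obtain b \<beta>' where b: "\<beta>' dvd 1" "\<beta> = \<beta>' * p ^ b" using unif[of \<beta>] by blast
  have "\<not> p ^ l dvd y0" using act by (metis dvd_mult2)
  then obtain i \<eta> where y0: "\<eta> dvd 1" "y0 = \<eta> * p ^ i" by (rule not_dvd_obtain)
  have dvdY: "p ^ l dvd p ^ n * y0 * (u * p ^ q) \<longleftrightarrow> l \<le> n + i + q" if "u dvd 1" for n u q
  proof -
    have "p ^ n * y0 * (u * p ^ q) = (\<eta> * u) * p ^ (n + i + q)" unfolding y0 power_add by (simp add: algebra_simps)
    then show ?thesis using dvd_unit_power[OF unit_mult[OF y0(1) that], of l "n + i + q"] by simp
  qed
  have contra: False if C: "good \<nu>" "\<nu> = u * p ^ q" "u dvd 1" "q < l" "\<nu> + \<beta> = u' * p ^ m" "u' dvd 1"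
    "i + n + m = l" "1 \<le> n" "l \<le> n + i + b" "l \<le> n + i + q" for \<nu> u q u' m n
  proof -
    have 1: "p ^ l dvd p ^ n * \<beta> * y0" using dvdY[OF b(1), of n b] C(9) b(2) by (simp add: mult.assoc mult.commute mult.left_commute)
    have 2: "p ^ l dvd p ^ n * y0 * \<nu>" using dvdY[OF C(3), of n q] C(2,10) by simp
    obtain x z where xz: "x dvd 1" "sol x (p ^ n * y0 * z)" "comm_val \<nu> x (p ^ n * y0 * z) = p ^ (2 * l - 1)"
      using comm_val_represents_top[OF two0 s0 y0(2,1) C(2-8) 1 2] by blast
    have "p ^ l dvd (p ^ n * y0 * \<nu>) * z" using 2 by (rule dvd_mult2)
    then have "p ^ l dvd (p ^ n * y0 * z) * \<nu>" by (simp add: ac_simps)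
    then have "\<psi> (p ^ (2 * l - 1)) = 1" using C(1) xz unfolding good_def by metis
    then show False using psi_top by simp
  qed
  have nontrivial: "\<exists>u. u dvd 1 \<and> \<nu> = u * p ^ b \<and> i + b < l \<and> p ^ Suc b dvd \<nu> + \<beta>" if g: "good \<nu>" and nd: "\<not> p ^ l dvd y0 * \<nu>" for \<nu>
  proof -
    have "\<not> p ^ l dvd \<nu>" using nd by (metis dvd_mult)
    then obtain q u where q: "q < l" "u dvd 1" "\<nu> = u * p ^ q" by (rule not_dvd_obtain)
    have iq: "i + q < l" using nd dvdY[OF q(2), of 0 q] q(3) by simp
    have qb: "q = b"
    proof (rule ccontr)
      assume "q \<noteq> b"
      then have "\<exists>w. w dvd 1 \<and> \<nu> + \<beta> = w * p ^ min q b"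
        using sum_unit_power[OF q(2) b(1), of q b] sum_unit_power[OF b(1) q(2), of b q] q(3) b(2)
        by (cases "q < b") (auto simp: add.commute min_def)
      then obtain w where w: "w dvd 1" "\<nu> + \<beta> = w * p ^ min q b" by blast
      show False
        by (rule contra[OF g q(3,2,1) w(2,1), of "l - min q b - i"]) (use iq in auto)
    qed
    have "p ^ Suc b dvd \<nu> + \<beta>"
    proof (rule ccontr)
      assume nd: "\<not> p ^ Suc b dvd \<nu> + \<beta>"
      have s: "\<nu> + \<beta> = (u + \<beta>') * p ^ b" using q(3) qb b(2) by (simp add: algebra_simps)
      have "u + \<beta>' dvd 1"
      proof (rule ccontr)
        assume "\<not> u + \<beta>' dvd 1"
        then have "p dvd u + \<beta>'" using unit_iff by blast
        then have "p * p ^ b dvd (u + \<beta>') * p ^ b" by (rule mult_dvd_mono) simp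
        then show False using nd s by simp
      qed
      then show False by (rule contra[OF g q(3,2,1) s, of "l - b - i"]) (use iq qb in auto)
    qed
    then show ?thesis using q iq qb by blast
  qed
  obtain u where u: "u dvd 1" "\<zeta> = u * p ^ b" "i + b < l" "p ^ Suc b dvd \<zeta> + \<beta>" using nontrivial[OF L act] by blast
  \<comment> \<open>For \<nu> divisible by p^(b+1) no cancellation with \<beta> is possible: \<nu> +
    \<beta> has valuation exactly b, so the test excludes every such \<nu> that is not
    small.\<close>
  have fin: "p ^ l dvd \<nu>" if \<nu>: "p ^ Suc b dvd \<nu>"
    and ok: "\<And>x z. x dvd 1 \<Longrightarrow> sol x (p ^ (l - b - i) * y0 * z) \<Longrightarrow> \<psi> (comm_val \<nu> x (p ^ (l - b - i) * y0 * z)) = 1" for \<nu>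
  proof (rule ccontr)
    assume nd: "\<not> p ^ l dvd \<nu>"
    then obtain q v where q: "q < l" "v dvd 1" "\<nu> = v * p ^ q" by (rule not_dvd_obtain)
    have bq: "b < q" using \<nu> dvd_unit_power[OF q(2), of "Suc b" q] q(3) u(3) l1 by simp
    obtain w where w: "w dvd 1" "\<nu> + \<beta> = w * p ^ b"
      using sum_unit_power[OF b(1) q(2) bq] q(3) b(2) by (auto simp: add.commute)
    have 1: "p ^ l dvd p ^ (l - b - i) * \<beta> * y0" using dvdY[OF b(1), of "l - b - i" b] u(3) b(2) by (simp add: mult.assoc mult.commute mult.left_commute)
    have 2: "p ^ l dvd p ^ (l - b - i) * y0 * \<nu>" using dvdY[OF q(2), of "l - b - i" q] u(3) bq q(3) by simp
    have 3: "i + (l - b - i) + b = l" "1 \<le> l - b - i" using u(3) by auto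
    obtain x z where "x dvd 1" "sol x (p ^ (l - b - i) * y0 * z)" "comm_val \<nu> x (p ^ (l - b - i) * y0 * z) = p ^ (2 * l - 1)"
      using comm_val_represents_top[OF two0 s0 y0(2,1) q(3,2,1) w(2,1) 3 1 2] by blast
    then show False using ok[of x z] psi_top by simp
  qed
  have okL: "\<psi> (comm_val \<zeta> x (p ^ (l - b - i) * y0 * z)) = 1" if "x dvd 1" "sol x (p ^ (l - b - i) * y0 * z)" for x z
  proof -
    have "p ^ l dvd p ^ (l - b - i) * y0 * \<zeta>" using dvdY[OF u(1), of "l - b - i" b] u(2,3) by simp
    then have "p ^ l dvd (p ^ (l - b - i) * y0 * \<zeta>) * z" by (rule dvd_mult2)
    then have "p ^ l dvd (p ^ (l - b - i) * y0 * z) * \<zeta>" by (simp add: ac_simps)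
    then show ?thesis using L that unfolding good_def by blast
  qed
  show ?thesis
  proof (cases "p ^ l dvd y0 * \<mu>")
    case False
    obtain v where v: "v dvd 1" "\<mu> = v * p ^ b" "p ^ Suc b dvd \<mu> + \<beta>" using nontrivial[OF M False] by blast
    have eq: "\<mu> - \<zeta> = (\<mu> + \<beta>) - (\<zeta> + \<beta>)" by simp
    have "p ^ l dvd \<mu> - \<zeta>"
    proof (rule fin)
      show "p ^ Suc b dvd \<mu> - \<zeta>" unfolding eq by (rule dvd_diff[OF v(3) u(4)])
      fix x z assume x: "x dvd 1" "sol x (p ^ (l - b - i) * y0 * z)"
      let ?y = "p ^ (l - b - i) * y0 * z"
      have "p ^ l dvd p ^ (l - b - i) * y0 * \<mu>" using dvdY[OF v(1), of "l - b - i" b] v(2) u(3) by simp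
      then have "p ^ l dvd (p ^ (l - b - i) * y0 * \<mu>) * z" by (rule dvd_mult2)
      then have "p ^ l dvd ?y * \<mu>" by (simp add: ac_simps)
      then have m: "\<psi> (comm_val \<mu> x ?y) = 1" using M x unfolding good_def by blast
      have "comm_val (\<mu> - \<zeta>) x ?y = comm_val \<mu> x ?y - comm_val \<zeta> x ?y - 2 * (\<zeta>\<^sup>2 * x * ?y - \<mu> * \<zeta> * x * ?y)"
        unfolding comm_val_def by (simp add: algebra_simps power2_eq_square)
      then have "comm_val (\<mu> - \<zeta>) x ?y = comm_val \<mu> x ?y + - comm_val \<zeta> x ?y" using two0 by simp
      then have "\<psi> (comm_val (\<mu> - \<zeta>) x ?y) = \<psi> (comm_val \<mu> x ?y) * inverse (\<psi> (comm_val \<zeta> x ?y))"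
        by (simp only: psi_add psi_uminus)
      then show "\<psi> (comm_val (\<mu> - \<zeta>) x ?y) = 1" using m okL[OF x] by simp
    qed
    then show ?thesis ..
  next
    case True
    obtain q v where q: "v dvd 1" "\<mu> = v * p ^ q" using unif[of \<mu>] by blast
    \<comment> \<open>Since i + b < l, this already places \<mu> in p^(b+1), within reach of
      \<open>fin\<close>.\<close>
    have "l \<le> i + q" using True dvdY[OF q(1), of 0 q] q(2) by simp
    then have bq: "Suc b \<le> q" using u(3) by simp
    have "p ^ l dvd \<mu>"
    proof (rule fin)
      show "p ^ Suc b dvd \<mu>" unfolding q(2) by (rule dvd_mult[OF le_imp_power_dvd[OF bq]])
      fix x z assume x: "x dvd 1" "sol x (p ^ (l - b - i) * y0 * z)"
      have "p ^ l dvd (y0 * \<mu>) * (p ^ (l - b - i) * z)" using True by (rule dvd_mult2)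
      then have "p ^ l dvd (p ^ (l - b - i) * y0 * z) * \<mu>" by (simp add: ac_simps)
      then show "\<psi> (comm_val \<mu> x (p ^ (l - b - i) * y0 * z)) = 1" using M x unfolding good_def by blast
    qed
    then show ?thesis ..
  qed
qed

lemma good_dichotomy:
  assumes "good \<zeta>" "good \<mu>" "sol x0 y0" "\<not> p ^ l dvd y0 * \<zeta>"
  shows "p ^ l dvd \<mu> \<or> p ^ l dvd \<mu> - \<zeta>"
proof (cases "(2::'r) = 0")
  case True
  then show ?thesis using good_dichotomy_equal assms by blast
next
  case False
  then obtain e u where "u dvd 1" "2 = u * p ^ e" "1 \<le> e" "2 * e \<le> l" using two by blast
  moreover have "\<not> p ^ l dvd \<zeta>" using assms(4) by (metis dvd_mult)
  ultimately show ?thesis using good_dichotomy_mixed assms by blast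
qed

end

section \<open>Two by two matrices\<close>

lemma mat2_nth [simp]:
  "mat2 a b c d $ 1 $ 1 = a" "mat2 a b c d $ 1 $ 2 = b" "mat2 a b c d $ 2 $ 1 = c" "mat2 a b c d $ 2 $ 2 = d"
  by (simp_all add: mat2_def)

lemma mat2_collapse: "mat2 (g $ 1 $ 1) (g $ 1 $ 2) (g $ 2 $ 1) (g $ 2 $ 2) = g"
  by (simp add: Finite_Cartesian_Product.vec_eq_iff forall_2)

lemma mat2_eq_iff [simp]: "mat2 a b c d = mat2 a' b' c' d' \<longleftrightarrow> a = a' \<and> b = b' \<and> c = c' \<and> d = d'"
  by (auto simp: Finite_Cartesian_Product.vec_eq_iff forall_2)

lemma mat2_mult [simp]:
  "mat2 a b c d ** mat2 a' b' c' d' = mat2 (a * a' + b * c') (a * b' + b * d') (c * a' + d * c') (c * b' + d * d')"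
  by (simp add: Finite_Cartesian_Product.vec_eq_iff forall_2 matrix_matrix_mult_def sum_2)

lemma mat_1_eq: "mat 1 = mat2 1 0 0 1"
  by (simp add: Finite_Cartesian_Product.vec_eq_iff forall_2 Finite_Cartesian_Product.mat_def)

lemma det_mat2 [simp]: "det (mat2 a b c d) = a * d - b * c"
  by (simp add: det_2)

lemma trace_mat2: "trace (mat2 a b c d) = a + d"
  by (simp add: trace_def sum_2)

lemma mat2_diff: "mat2 a b c d - mat2 a' b' c' d' = mat2 (a - a') (b - b') (c - c') (d - d')"
  by (simp add: Finite_Cartesian_Product.vec_eq_iff forall_2)

lemma mat2_inverse:
  fixes a b c d :: "'a::comm_ring_1"
  assumes "(a * d - b * c) * u = 1"
  shows "mat2 a b c d ** mat2 (u * d) (- u * b) (- u * c) (u * a) = mat 1"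
    "mat2 (u * d) (- u * b) (- u * c) (u * a) ** mat2 a b c d = mat 1"
  using assms by (simp_all add: mat_1_eq algebra_simps)

lemma GL2_simps [simp]: "carrier GL2 = {g. invertible g}" "monoid.mult GL2 = (**)" "one GL2 = mat 1"
  by (simp_all add: GL2_def)

lemma invertible_det_1: "det g = (1::'a::comm_ring_1) \<Longrightarrow> invertible (g :: 'a^2^2)"
proof -
  assume "det g = 1"
  then have "(g $ 1 $ 1 * g $ 2 $ 2 - g $ 1 $ 2 * g $ 2 $ 1) * 1 = 1" by (simp add: det_2)
  from mat2_inverse[OF this] show "invertible g" unfolding mat2_collapse invertible_def by blast
qed

lemma SL2_simps [simp]: "carrier SL2 = {g. det g = 1}" "monoid.mult SL2 = (**)" "one SL2 = mat 1"
  using invertible_det_1 by (auto simp: SL2_def)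

lemma group_GL2: "Group.group GL2"
proof (rule groupI)
  fix x :: "'a^2^2" assume "x \<in> carrier GL2"
  then obtain y where "x ** y = mat 1" "y ** x = mat 1" by (auto simp: invertible_def)
  then show "\<exists>y\<in>carrier GL2. y \<otimes>\<^bsub>GL2\<^esub> x = \<one>\<^bsub>GL2\<^esub>" by (auto simp: invertible_def intro!: bexI[of _ y])
qed (auto simp: matrix_mul_assoc invertible_mult, simp add: invertible_def exI[of _ "mat 1"])

lemma group_SL2: "Group.group (SL2 :: ('a::comm_ring_1^2^2) monoid)"
proof (rule groupI)
  fix g :: "'a^2^2" assume "g \<in> carrier SL2"
  then have "(g $ 1 $ 1 * g $ 2 $ 2 - g $ 1 $ 2 * g $ 2 $ 1) * 1 = 1" by (simp add: det_2)
  from mat2_inverse(2)[OF this] this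
  show "\<exists>y\<in>carrier SL2. y \<otimes>\<^bsub>SL2\<^esub> g = \<one>\<^bsub>SL2\<^esub>"
    unfolding mat2_collapse
    by (intro bexI[of _ "mat2 (1 * g $ 2 $ 2) (- 1 * g $ 1 $ 2) (- 1 * g $ 2 $ 1) (1 * g $ 1 $ 1)"]) (auto simp: algebra_simps)
qed (auto simp: matrix_mul_assoc det_mul)

lemma inv_SL2: "x * w - s * y = 1 \<Longrightarrow> inv\<^bsub>SL2\<^esub> (mat2 x s y w) = mat2 w (- s) (- y) x"
  using group.inv_equality[OF group_SL2, of "mat2 w (- s) (- y) x" "mat2 x s y w"]
  by (simp add: mat_1_eq algebra_simps)

lemma inv_GL2: "x * w - s * y = 1 \<Longrightarrow> inv\<^bsub>GL2\<^esub> (mat2 x s y w) = mat2 w (- s) (- y) x"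
  using group.inv_equality[OF group_GL2, of "mat2 w (- s) (- y) x" "mat2 x s y w"]
    invertible_det_1[of "mat2 w (- s) (- y) x"] invertible_det_1[of "mat2 x s y w"]
  by (simp add: mat_1_eq algebra_simps)

lemma SL2_cases:
  assumes "g \<in> carrier SL2"
  obtains x s y w where "g = mat2 x s y w" "x * w - s * y = 1"
  using that[of "g $ 1 $ 1" "g $ 1 $ 2" "g $ 2 $ 1" "g $ 2 $ 2"] assms by (simp add: mat2_collapse det_2)

lemma finite_matrices:
  assumes "finite (UNIV :: 'a::zero set)"
  shows "finite (UNIV :: ('a^2^2) set)"
proof (rule finite_subset)
  show "(UNIV :: ('a^2^2) set) \<subseteq> (\<lambda>(a, b, c, d). mat2 a b c d) ` (UNIV \<times> UNIV \<times> UNIV \<times> UNIV)"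
  proof
    fix g :: "'a^2^2"
    show "g \<in> (\<lambda>(a, b, c, d). mat2 a b c d) ` (UNIV \<times> UNIV \<times> UNIV \<times> UNIV)"
      using mat2_collapse[of g] by (auto intro!: image_eqI[of _ _ "(g $ 1 $ 1, g $ 1 $ 2, g $ 2 $ 1, g $ 2 $ 2)"])
  qed
  have "finite ((UNIV :: 'a set) \<times> (UNIV :: 'a set) \<times> (UNIV :: 'a set) \<times> (UNIV :: 'a set))"
    using assms by (intro finite_cartesian_product)
  then show "finite ((\<lambda>(a, b, c, d). mat2 a b c d) ` (UNIV \<times> UNIV \<times> UNIV \<times> (UNIV :: 'a set)))" by (rule finite_imageI)
qed

lemma lin_char_is_rep:
  assumes "lin_char H \<theta>"
  shows "is_rep H (lin_rep \<theta>)" "rep_degree H (lin_rep \<theta>) = 1"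
proof -
  show d: "rep_degree H (lin_rep \<theta>) = 1" by (simp add: rep_degree_def lin_rep_def)
  show "is_rep H (lin_rep \<theta>)" unfolding is_rep_def d
    using assms by (auto simp: lin_rep_def lin_char_def scalar_prod_def intro!: eq_matI)
qed

text \<open>In degree 1 the intertwining matrix is a nonzero scalar and cancels.\<close>

lemma rep_equiv_lin_rep:
  assumes "lin_char H \<theta>"
  shows "rep_equiv H (lin_rep \<eta>) (lin_rep \<theta>) \<longleftrightarrow> lin_char H \<eta> \<and> (\<forall>x\<in>carrier H. \<eta> x = \<theta> x)"
proof
  assume eq: "rep_equiv H (lin_rep \<eta>) (lin_rep \<theta>)"
  have d: "rep_degree H (lin_rep \<eta>) = 1" by (simp add: rep_degree_def lin_rep_def)
  obtain P R where P: "P \<in> carrier_mat 1 1" "R \<in> carrier_mat 1 1" "P * R = 1\<^sub>m 1" "R * P = 1\<^sub>m 1"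
    "\<forall>x\<in>carrier H. P * lin_rep \<eta> x = lin_rep \<theta> x * P" "is_rep H (lin_rep \<eta>)" "is_rep H (lin_rep \<theta>)"
    "rep_degree H (lin_rep \<theta>) = 1"
    using rep_equiv_vec[OF eq, unfolded d] by blast
  have "(P * R) $$ (0, 0) = P $$ (0, 0) * R $$ (0, 0)" using P(1,2) by (simp add: scalar_prod_def)
  then have P0: "P $$ (0, 0) \<noteq> 0" using P(3) by auto
  have e: "\<eta> x = \<theta> x" if "x \<in> carrier H" for x
  proof -
    have "(P * lin_rep \<eta> x) $$ (0, 0) = (lin_rep \<theta> x * P) $$ (0, 0)" using P(5) that by simp
    then have "P $$ (0, 0) * \<eta> x = \<theta> x * P $$ (0, 0)" using P(1) by (simp add: lin_rep_def scalar_prod_def)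
    then show ?thesis using P0 by simp
  qed
  have "lin_char H \<eta>" unfolding lin_char_def
  proof (intro conjI ballI)
    have "lin_rep \<eta> \<one>\<^bsub>H\<^esub> $$ (0, 0) = 1\<^sub>m 1 $$ (0, 0)" using is_rep_one[OF P(6)] d by simp
    then show "\<eta> \<one>\<^bsub>H\<^esub> = 1" by (simp add: lin_rep_def)
    fix x y assume "x \<in> carrier H" "y \<in> carrier H"
    then have "lin_rep \<eta> (x \<otimes>\<^bsub>H\<^esub> y) $$ (0, 0) = (lin_rep \<eta> x * lin_rep \<eta> y) $$ (0, 0)" using is_rep_mult[OF P(6)] by simp
    then show "\<eta> (x \<otimes>\<^bsub>H\<^esub> y) = \<eta> x * \<eta> y" by (simp add: lin_rep_def scalar_prod_def)
  qed
  then show "lin_char H \<eta> \<and> (\<forall>x\<in>carrier H. \<eta> x = \<theta> x)" using e by blast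
next
  assume a: "lin_char H \<eta> \<and> (\<forall>x\<in>carrier H. \<eta> x = \<theta> x)"
  then have "lin_rep \<eta> x = lin_rep \<theta> x" if "x \<in> carrier H" for x using that by (simp add: lin_rep_def)
  then show "rep_equiv H (lin_rep \<eta>) (lin_rep \<theta>)"
    using rep_equiv_refl[OF lin_char_is_rep(1)[OF conjunct1[OF a]]] lin_char_is_rep[OF assms] lin_char_is_rep(2)[OF conjunct1[OF a]]
    unfolding rep_equiv_def by simp
qed

lemma conj_rep_lin_rep: "conj_rep G g (lin_rep f) = lin_rep (\<lambda>x. f (g \<otimes>\<^bsub>G\<^esub> x \<otimes>\<^bsub>G\<^esub> inv\<^bsub>G\<^esub> g))"
  by (simp add: conj_rep_def lin_rep_def fun_eq_iff)

section \<open>Stabilizers\<close>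

locale sl2_setting = truncated_quadratic p l \<psi> \<alpha> \<beta> for p :: "'r::comm_ring_1" and l \<psi> \<alpha> \<beta> +
  fixes red :: "'r \<Rightarrow> 'l::comm_ring_1" and a :: 'r
  assumes red_hom: "comm_ring_hom red" and red_zero: "red x = 0 \<longleftrightarrow> p ^ l dvd x" and a_unit: "a dvd 1"
begin

sublocale red: comm_ring_hom red by (rule red_hom)

definition b where "b = unit_inverse a"
definition k where "k = b * \<alpha>"
abbreviation "At \<equiv> comp_mat a \<alpha> \<beta>"
abbreviation "f \<equiv> psi_A \<psi> At"
abbreviation "K \<equiv> K_grp red"
abbreviation "CS \<equiv> C_S red At"
abbreviation small :: "'r \<Rightarrow> bool" where "small x \<equiv> p ^ l dvd x"
definition redm :: "'r^2^2 \<Rightarrow> 'l^2^2" where "redm g = (\<chi> i j. red (g $ i $ j))"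

lemma ab: "a * b = 1"
proof -
  obtain c where c: "a * c = 1" using a_unit by (metis dvdE)
  have "(THE d. a * d = 1) = c"
  proof (rule the_equality[where P = "\<lambda>d. a * d = 1"])
    fix d assume "a * d = 1"
    then have "c * (a * d) = c" by simp
    then show "d = c" using c by (simp add: mult.left_commute flip: mult.assoc)
  qed (rule c)
  then show ?thesis using c by (simp add: b_def unit_inverse_def)
qed

lemma ab_cancel: "b * (a * t) = t" "a * (b * t) = t"
  using ab by (simp_all add: mult.commute flip: mult.assoc)

lemma ak: "a * k = \<alpha>"
  using ab by (simp add: k_def flip: mult.assoc)

lemma At_eq: "At = mat2 0 k a \<beta>"
  by (simp add: comp_mat_def k_def b_def)

lemma e_mat_eq: "e_mat a t = mat2 1 (b * t) 0 1"
  by (simp add: e_mat_def b_def)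

lemma redm_mat2 [simp]: "redm (mat2 x s y w) = mat2 (red x) (red s) (red y) (red w)"
  by (simp add: redm_def Finite_Cartesian_Product.vec_eq_iff forall_2)

lemma redm_one: "redm (mat 1) = mat 1"
  by (simp add: mat_1_eq)

lemma redm_mult: "redm (g ** h) = redm g ** redm h"
proof -
  have "redm (mat2 (g $ 1 $ 1) (g $ 1 $ 2) (g $ 2 $ 1) (g $ 2 $ 2) ** mat2 (h $ 1 $ 1) (h $ 1 $ 2) (h $ 2 $ 1) (h $ 2 $ 2))
    = redm (mat2 (g $ 1 $ 1) (g $ 1 $ 2) (g $ 2 $ 1) (g $ 2 $ 2)) ** redm (mat2 (h $ 1 $ 1) (h $ 1 $ 2) (h $ 2 $ 1) (h $ 2 $ 2))"
    by (simp add: red.hom_add red.hom_mult)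
  then show ?thesis by (simp only: mat2_collapse)
qed

lemma red_eq_iff: "red x = red y \<longleftrightarrow> small (x - y)"
  using red_zero[of "x - y"] by (simp add: red.hom_minus)

lemma small_add: "small x \<Longrightarrow> small y \<Longrightarrow> small (x + y)" by (rule dvd_add)
lemma unit_near_1: "small (x - 1) \<Longrightarrow> x dvd 1"
proof -
  assume s: "small (x - 1)"
  have "p dvd p ^ l" using l1 by (intro dvd_power) simp
  then show "x dvd 1" using unit_plus[of "x - 1"] s by (metis add_diff_cancel_left' diff_add_eq dvd_trans diff_add_cancel add.commute)
qed

lemma M_grp_eq: "M_grp red = {g. invertible g \<and> redm g = mat 1}"
  by (simp add: M_grp_def kernel_def redm_def)

lemma K_eq: "K = {g \<in> carrier SL2. redm g = mat 1}"
  using invertible_det_1 by (auto simp: K_grp_def M_grp_eq)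

lemma mat2_in_K: "mat2 x s y w \<in> K \<longleftrightarrow> x * w - s * y = 1 \<and> small (x - 1) \<and> small s \<and> small y \<and> small (w - 1)"
  using red_eq_iff[of x 1] red_eq_iff[of w 1] red_zero[of s] red_zero[of y]
  by (auto simp: K_eq mat_1_eq red.hom_one)

lemma f_mat2: "f (mat2 x s y w) = \<psi> (k * y + a * s + \<beta> * (w - 1))"
  by (simp add: psi_A_def At_eq mat_1_eq mat2_diff trace_mat2 algebra_simps)

text \<open>g h - 1 differs from (g - 1) + (h - 1) by (g - 1) (h - 1), whose entries lie in p^(2l) =
  0.\<close>

lemma f_mult:
  assumes "redm g = mat 1" "redm h = mat 1"
  shows "f (g ** h) = f g * f h"
proof -
  obtain x s y w where g: "g = mat2 x s y w" by (metis mat2_collapse)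
  obtain x' s' y' w' where h: "h = mat2 x' s' y' w'" by (metis mat2_collapse)
  have sm: "small (x - 1)" "small s" "small y" "small (w - 1)" "small (x' - 1)" "small s'" "small y'" "small (w' - 1)"
    using assms red_eq_iff[of x 1] red_eq_iff[of w 1] red_eq_iff[of x' 1] red_eq_iff[of w' 1]
    by (auto simp: g h mat_1_eq red.hom_one red_zero)
  have "y * x' + w * y' = y + y' + (y * (x' - 1) + (w - 1) * y')" by (simp add: algebra_simps)
  then have 1: "y * x' + w * y' = y + y'" using small_mult_zero sm by simp
  have "x * s' + s * w' = s + s' + ((x - 1) * s' + s * (w' - 1))" by (simp add: algebra_simps)
  then have 2: "x * s' + s * w' = s + s'" using small_mult_zero sm by simp
  have "y * s' + w * w' - 1 = (w - 1) + (w' - 1) + (y * s' + (w - 1) * (w' - 1))" by (simp add: algebra_simps)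
  then have 3: "y * s' + w * w' - 1 = (w - 1) + (w' - 1)" using small_mult_zero sm by simp
  show ?thesis unfolding g h mat2_mult f_mat2 1 2 3 psi_add[symmetric] by (simp add: algebra_simps)
qed

lemma f_one: "f (mat 1) = 1"
  by (simp add: mat_1_eq f_mat2 psi0)

definition c1 where "c1 x s y w = k * y * w - a * x * s - \<beta> * s * y"
definition c2 where "c2 x s y w = a * x\<^sup>2 + \<beta> * x * y - k * y\<^sup>2 - a"
definition c3 where "c3 x s y w = k * w\<^sup>2 - a * s\<^sup>2 - \<beta> * s * w - k"

text \<open>\<open>c1\<close>, \<open>c2\<close>, \<open>c3\<close> are the entries of \<open>g\<inverse> At g - At\<close>, which has trace \<open>0\<close>.\<close>
lemma conj_At:
  assumes "x * w - s * y = 1"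
  shows "mat2 w (- s) (- y) x ** At ** mat2 x s y w = mat2 (c1 x s y w) (k + c3 x s y w) (a + c2 x s y w) (\<beta> - c1 x s y w)"
proof -
  have "x * w = 1 + s * y" using assms by (simp add: algebra_simps)
  then have "\<beta> * (x * w) = \<beta> * (1 + s * y)" by simp
  then show ?thesis unfolding At_eq by (simp add: c1_def c2_def c3_def algebra_simps power2_eq_square)
qed

text \<open>By cyclicity of the trace, the extra factor is \<open>\<psi>\<close> at the trace of
  (g^-1 At g - At) (m - 1).\<close>

lemma f_conj:
  assumes d: "x * w - s * y = 1"
  shows "f (mat2 x s y w ** mat2 m1 m2 m3 m4 ** mat2 w (- s) (- y) x)
    = f (mat2 m1 m2 m3 m4) * \<psi> (c1 x s y w * (m1 - m4) + c2 x s y w * m2 + c3 x s y w * m3)"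
proof -
  have xw: "x * w = 1 + s * y" using d by (simp add: algebra_simps)
  have 1: "k * ((y * m1 + w * m3) * w + (y * m2 + w * m4) * - y) + a * ((x * m1 + s * m3) * - s + (x * m2 + s * m4) * x)
      + \<beta> * ((y * m1 + w * m3) * - s + (y * m2 + w * m4) * x - 1)
    = (k * m3 + a * m2 + \<beta> * (m4 - 1)) + (c1 x s y w * (m1 - m4) + c2 x s y w * m2 + c3 x s y w * m3) + \<beta> * m4 * (x * w - (1 + s * y))"
    by (simp add: c1_def c2_def c3_def algebra_simps power2_eq_square)
  show ?thesis unfolding mat2_mult f_mat2 1 psi_add[symmetric] by (simp add: xw)
qed

text \<open>Up to sign, \<open>?P\<close> and \<open>?R\<close> form the first column of At g - g
  At, which is g times g^-1 At g - At. Its other entries are - \<open>?P\<close> and, as a is a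
  unit, a combination of \<open>?P\<close> and \<open>?R\<close>.\<close>

lemma CS_small_iff:
  assumes d: "x * w - s * y = 1"
  shows "small (k * y - a * s) \<and> small (a * w - a * x - \<beta> * y) \<longleftrightarrow>
    small (c1 x s y w) \<and> small (c2 x s y w) \<and> small (c3 x s y w)"
proof -
  let ?P = "k * y - a * s" and ?R = "a * w - a * x - \<beta> * y"
  have xw: "x * w = 1 + s * y" using d by (simp add: algebra_simps)
  have kxw: "k * (x * w) = k * (1 + s * y)" "a * (x * w) = a * (1 + s * y)" using xw by simp_all
  have e1: "c1 x s y w = w * ?P + s * ?R" by (simp add: c1_def algebra_simps)
  have e2: "c2 x s y w = - (y * ?P) - x * ?R" using kxw by (simp add: c2_def algebra_simps power2_eq_square)
  have e3: "a * c3 x s y w = a * (s * ?P) + w * (k * ?R + \<beta> * ?P)"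
  proof -
    have "a * (k * (x * w)) = a * (k * (1 + s * y))" using kxw(1) by simp
    then show ?thesis by (simp add: c3_def algebra_simps power2_eq_square)
  qed
  have e3': "c3 x s y w = b * (a * (s * ?P) + w * (k * ?R + \<beta> * ?P))"
    unfolding e3[symmetric] ab_cancel ..
  have r1: "?P = x * c1 x s y w + s * c2 x s y w"
  proof -
    have "k * y * (x * w) = k * y * (1 + s * y)" "a * s * x * (x * w) = a * s * x * (1 + s * y)" using xw by simp_all
    then show ?thesis by (simp add: c1_def c2_def algebra_simps power2_eq_square)
  qed
  have r2: "?R = - (y * c1 x s y w) - w * c2 x s y w"
  proof -
    have "a * x * (x * w) = a * x * (1 + s * y)" "\<beta> * y * (x * w) = \<beta> * y * (1 + s * y)" using xw by simp_all
    then show ?thesis by (simp add: c1_def c2_def algebra_simps power2_eq_square)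
  qed
  show ?thesis
  proof
    assume "small ?P \<and> small ?R"
    then show "small (c1 x s y w) \<and> small (c2 x s y w) \<and> small (c3 x s y w)"
      unfolding e1 e2 e3' by (metis dvd_add dvd_diff dvd_minus_iff dvd_mult)
  next
    assume "small (c1 x s y w) \<and> small (c2 x s y w) \<and> small (c3 x s y w)"
    then show "small ?P \<and> small ?R" unfolding r1 r2 by (metis dvd_add dvd_diff dvd_minus_iff dvd_mult)
  qed
qed

text \<open>A matrix of determinant 1 that commutes with At modulo p^l is congruent to
  \<open>?h\<close> = x + b y At. This one commutes with At exactly and has a determinant near 1, so
  the quotient lies in the kernel of reduction.\<close>

lemma mat2_in_CS:
  "mat2 x s y w \<in> CS \<longleftrightarrow> x * w - s * y = 1 \<and> small (k * y - a * s) \<and> small (a * w - a * x - \<beta> * y)"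
proof
  assume "mat2 x s y w \<in> CS"
  then obtain h m where h: "h ** At = At ** h" and m: "redm m = mat 1" and g: "mat2 x s y w = h ** m" and d: "x * w - s * y = 1"
    by (auto simp: C_S_def set_mult_def M_grp_eq)
  obtain h1 h2 h3 h4 where hh: "h = mat2 h1 h2 h3 h4" by (metis mat2_collapse)
  have "redm (mat2 x s y w) = redm h" unfolding g redm_mult m by simp
  then have r: "red x = red h1" "red s = red h2" "red y = red h3" "red w = red h4" by (simp_all add: hh)
  have e: "h2 * a = k * h3" "h4 * a = a * h1 + \<beta> * h3" using h by (simp_all add: hh At_eq)
  have "red (k * y - a * s) = red (k * h3 - h2 * a)" by (simp add: red.hom_minus red.hom_mult r mult.commute)
  moreover have "red (a * w - a * x - \<beta> * y) = red (h4 * a - (a * h1 + \<beta> * h3))"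
    by (simp add: red.hom_minus red.hom_add red.hom_mult r mult.commute)
  ultimately show "x * w - s * y = 1 \<and> small (k * y - a * s) \<and> small (a * w - a * x - \<beta> * y)"
    using d e red_zero by (simp add: red.hom_zero)
next
  assume a: "x * w - s * y = 1 \<and> small (k * y - a * s) \<and> small (a * w - a * x - \<beta> * y)"
  let ?h2 = "b * k * y" and ?h4 = "x + b * \<beta> * y"
  let ?h = "mat2 x ?h2 y ?h4"
  have s2: "small (s - ?h2)"
  proof -
    have "s - ?h2 = - (b * (k * y - a * s))" by (simp add: right_diff_distrib ab_cancel mult.assoc)
    then show ?thesis using a by simp
  qed
  have s4: "small (w - ?h4)"
  proof -
    have "w - ?h4 = b * (a * w - a * x - \<beta> * y)"
      by (simp add: right_diff_distrib ab_cancel mult.assoc)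
    then show ?thesis using a by simp
  qed
  have com: "?h ** At = At ** ?h"
  proof -
    have "a * (b * (\<beta> * y)) = \<beta> * y" "a * (b * (k * y)) = k * y" by (rule ab_cancel)+
    then show ?thesis unfolding At_eq by (simp add: algebra_simps)
  qed
  have "det ?h - 1 = - (x * (w - ?h4)) + (s - ?h2) * y" using a by (simp add: algebra_simps)
  then have "small (det ?h - 1)" using s2 s4 by (simp only:) (intro dvd_add, simp_all)
  then obtain u where u: "det ?h * u = 1" using unit_near_1 by (metis dvdE)
  define hi where "hi = mat2 (u * ?h4) (- u * ?h2) (- u * y) (u * x)"
  have hi: "?h ** hi = mat 1" "hi ** ?h = mat 1" unfolding hi_def using mat2_inverse[of x ?h4 ?h2 y u] u by simp_all
  define m where "m = hi ** mat2 x s y w"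
  have "redm (mat2 x s y w) = redm ?h"
    using s2 s4 red_eq_iff[of s ?h2] red_eq_iff[of w ?h4] by (simp del: red.hom_mult red.hom_add)
  then have "redm m = redm (hi ** ?h)" unfolding m_def redm_mult by simp
  then have m1: "redm m = mat 1" by (simp only: hi redm_one)
  have inv: "invertible hi" "invertible ?h" using hi by (auto simp: invertible_def)
  have "invertible m" unfolding m_def using a by (intro invertible_mult inv invertible_det_1) simp
  moreover have "mat2 x s y w = ?h ** m" unfolding m_def matrix_mul_assoc hi by simp
  ultimately have "\<exists>h\<in>{g \<in> carrier GL2. g ** At = At ** g}. \<exists>m\<in>M_grp red. mat2 x s y w = h ** m"
    using com inv(2) m1 by (intro bexI[of _ ?h] bexI[of _ m]) (simp_all add: M_grp_eq del: mat2_mult mat2_eq_iff)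
  moreover have "mat2 x s y w \<in> carrier SL2" using a by simp
  ultimately show "mat2 x s y w \<in> CS" unfolding C_S_def set_mult_def by simp
qed

lemma K_sub_CS: "K \<subseteq> CS"
proof
  fix g assume g: "g \<in> K"
  obtain x s y w where e: "g = mat2 x s y w" by (metis mat2_collapse)
  have "small (a * w - a * x - \<beta> * y)"
  proof -
    have "a * w - a * x - \<beta> * y = a * (w - 1) - a * (x - 1) - \<beta> * y" by (simp add: algebra_simps)
    then show ?thesis using g unfolding e mat2_in_K by (simp only:) (intro dvd_diff, simp_all)
  qed
  then show "g \<in> CS" using g unfolding e mat2_in_K mat2_in_CS by (auto intro!: dvd_diff)
qed

text \<open>The unipotent matrices and diag(1 + p^l t, 1) are enough test elements: each isolates
  one of \<open>c1\<close>, \<open>c2\<close>, \<open>c3\<close>, and primitivity of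
  \<open>\<psi>\<close> makes it small.\<close>

lemma stabilizer_M: "rep_stabilizer GL2 (carrier SL2) (M_grp red) (lin_rep f) = CS"
proof -
  let ?M = "GL2\<lparr>carrier := M_grp red\<rparr>"
  have lc: "lin_char ?M f" unfolding lin_char_def using f_one f_mult by (auto simp: M_grp_eq)
  have "g \<in> rep_stabilizer GL2 (carrier SL2) (M_grp red) (lin_rep f) \<longleftrightarrow> g \<in> CS" for g :: "'r^2^2"
  proof (cases "g \<in> carrier SL2")
    case True
    then obtain x s y w where g: "g = mat2 x s y w" and d: "x * w - s * y = 1" by (rule SL2_cases)
    have "g \<in> rep_stabilizer GL2 (carrier SL2) (M_grp red) (lin_rep f) \<longleftrightarrow>
      lin_char ?M (\<lambda>m. f (g ** m ** inv\<^bsub>GL2\<^esub> g)) \<and> (\<forall>m\<in>M_grp red. f (g ** m ** inv\<^bsub>GL2\<^esub> g) = f m)"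
      using True by (simp add: rep_stabilizer_def conj_rep_lin_rep rep_equiv_lin_rep[OF lc])
    also have "\<dots> \<longleftrightarrow> (\<forall>m\<in>M_grp red. f (g ** m ** inv\<^bsub>GL2\<^esub> g) = f m)"
    proof -
      have "lin_char ?M (\<lambda>m. f (g ** m ** inv\<^bsub>GL2\<^esub> g))" if "\<forall>m\<in>M_grp red. f (g ** m ** inv\<^bsub>GL2\<^esub> g) = f m"
      proof -
        have one: "mat 1 \<in> M_grp red" and "\<And>m m'. m \<in> M_grp red \<Longrightarrow> m' \<in> M_grp red \<Longrightarrow> m ** m' \<in> M_grp red"
          by (auto simp: M_grp_eq redm_one redm_mult invertible_mult invertible_det_1)
        then show ?thesis using lc that bspec[OF that one] unfolding lin_char_def by simp
      qed
      then show ?thesis by blast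
    qed
    also have "\<dots> \<longleftrightarrow> small (c1 x s y w) \<and> small (c2 x s y w) \<and> small (c3 x s y w)"
    proof
      assume st: "\<forall>m\<in>M_grp red. f (g ** m ** inv\<^bsub>GL2\<^esub> g) = f m"
      have test: "\<psi> (c1 x s y w * (m1 - m4) + c2 x s y w * m2 + c3 x s y w * m3) = 1"
        if "mat2 m1 m2 m3 m4 \<in> M_grp red" for m1 m2 m3 m4
      proof -
        have "f (mat2 m1 m2 m3 m4) * \<psi> (c1 x s y w * (m1 - m4) + c2 x s y w * m2 + c3 x s y w * m3) = f (mat2 m1 m2 m3 m4)"
          using bspec[OF st that] unfolding g inv_GL2[OF d] f_conj[OF d] .
        moreover have "f (mat2 m1 m2 m3 m4) \<noteq> 0" unfolding f_mat2 by (rule psi_nonzero)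
        ultimately show ?thesis by simp
      qed
      have dM: "mat2 m1 m2 m3 m4 \<in> M_grp red" if D: "small (m1 - 1)" "small m2" "small m3" "m2 * m3 = 0" "m4 = 1" for m1 m2 m3 m4
      proof -
        obtain u where u: "m1 * u = 1" using unit_near_1[OF D(1)] by (metis dvdE)
        have "invertible (mat2 m1 m2 m3 m4)"
          using mat2_inverse[of m1 m4 m2 m3 u] D u unfolding invertible_def by (auto simp del: mat2_mult)
        then show ?thesis using D red_eq_iff[of m1 1] red_zero by (auto simp: M_grp_eq mat_1_eq red.hom_one)
      qed
      have "\<psi> (c1 x s y w * p ^ l * t) = 1" for t using test[OF dM[of "1 + p ^ l * t" 0 0 1]] by (simp add: mult.assoc)
      then have "c1 x s y w * p ^ l = 0" by (rule psi_primitive)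
      moreover have "\<psi> (c2 x s y w * p ^ l * t) = 1" for t using test[OF dM[of 1 "p ^ l * t" 0 1]] by (simp add: mult.assoc)
      then have "c2 x s y w * p ^ l = 0" by (rule psi_primitive)
      moreover have "\<psi> (c3 x s y w * p ^ l * t) = 1" for t using test[OF dM[of 1 0 "p ^ l * t" 1]] by (simp add: mult.assoc)
      then have "c3 x s y w * p ^ l = 0" by (rule psi_primitive)
      ultimately show "small (c1 x s y w) \<and> small (c2 x s y w) \<and> small (c3 x s y w)"
        using p_mult_zero_iff by (metis mult.commute)
    next
      assume c: "small (c1 x s y w) \<and> small (c2 x s y w) \<and> small (c3 x s y w)"
      show "\<forall>m\<in>M_grp red. f (g ** m ** inv\<^bsub>GL2\<^esub> g) = f m"
      proof
        fix m :: "'r^2^2" assume m: "m \<in> M_grp red"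
        obtain m1 m2 m3 m4 where e: "m = mat2 m1 m2 m3 m4" by (metis mat2_collapse)
        have sm: "small (m1 - 1)" "small m2" "small m3" "small (m4 - 1)"
          using m red_eq_iff[of m1 1] red_eq_iff[of m4 1] red_zero by (auto simp: M_grp_eq e mat_1_eq red.hom_one)
        have "small (m1 - m4)" using dvd_diff[OF sm(1,4)] by simp
        then show "f (g ** m ** inv\<^bsub>GL2\<^esub> g) = f m"
          unfolding g inv_GL2[OF d] e f_conj[OF d] using c sm by (simp add: small_mult_zero psi0)
      qed
    qed
    also have "\<dots> \<longleftrightarrow> g \<in> CS" unfolding g mat2_in_CS using CS_small_iff[OF d] d by blast
    finally show ?thesis .
  next
    case False
    then show ?thesis by (simp add: rep_stabilizer_def C_S_def)
  qed
  then show ?thesis by blast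
qed

lemma group_G: "Group.group (SL2 :: ('r^2^2) monoid)" by (rule group_SL2)

lemma fin_G: "finite (carrier (SL2 :: ('r^2^2) monoid))"
  by (rule finite_subset[OF subset_UNIV finite_matrices[OF finR]])

lemma K_subgroup: "subgroup K SL2"
proof (rule group.subgroupI[OF group_G])
  show "K \<subseteq> carrier SL2" by (auto simp: K_eq)
  have "mat 1 \<in> K" by (simp add: K_eq redm_one)
  then show "K \<noteq> {}" by blast
  fix g assume g: "g \<in> K"
  obtain x s y w where e: "g = mat2 x s y w" by (metis mat2_collapse)
  have d: "x * w - s * y = 1" using g unfolding e mat2_in_K by simp
  then show "inv\<^bsub>SL2\<^esub> g \<in> K" using g unfolding e inv_SL2[OF d] mat2_in_K by (simp add: mult.commute)
  fix h assume "h \<in> K"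
  then show "g \<otimes>\<^bsub>SL2\<^esub> h \<in> K" using g by (auto simp: K_eq redm_mult det_mul)
qed

lemma K_norm: "g \<in> carrier SL2 \<Longrightarrow> h \<in> K \<Longrightarrow> g \<otimes>\<^bsub>SL2\<^esub> h \<otimes>\<^bsub>SL2\<^esub> inv\<^bsub>SL2\<^esub> g \<in> K"
proof -
  assume g: "g \<in> carrier SL2" and h: "h \<in> K"
  interpret G: Group.group "SL2 :: ('r^2^2) monoid" by (rule group_G)
  have "redm (g ** h ** inv\<^bsub>SL2\<^esub> g) = redm (g ** inv\<^bsub>SL2\<^esub> g)" using h unfolding redm_mult by (simp add: K_eq)
  also have "g ** inv\<^bsub>SL2\<^esub> g = mat 1" using G.r_inv[OF g] by simp
  finally have "redm (g ** h ** inv\<^bsub>SL2\<^esub> g) = mat 1" by (simp only: redm_one)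
  moreover have "g \<otimes>\<^bsub>SL2\<^esub> h \<otimes>\<^bsub>SL2\<^esub> inv\<^bsub>SL2\<^esub> g \<in> carrier SL2" using g h G.inv_closed[OF g] by (simp add: K_eq det_mul)
  ultimately show ?thesis by (simp add: K_eq)
qed

lemma f_char: "lin_char (SL2\<lparr>carrier := K\<rparr>) f"
  unfolding lin_char_def using f_one f_mult by (auto simp: K_eq)

definition C where "C = {g \<in> carrier SL2. \<forall>h\<in>K. f (g \<otimes>\<^bsub>SL2\<^esub> h \<otimes>\<^bsub>SL2\<^esub> inv\<^bsub>SL2\<^esub> g) = f h}"

lemma stabilizer_K: "rep_stabilizer SL2 (carrier SL2) K (lin_rep f) = C"
proof -
  have "lin_char (SL2\<lparr>carrier := K\<rparr>) (\<lambda>h. f (g ** h ** inv\<^bsub>SL2\<^esub> g))" if "\<forall>h\<in>K. f (g ** h ** inv\<^bsub>SL2\<^esub> g) = f h" for g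
    using f_char that bspec[OF that subgroup.one_closed[OF K_subgroup]] subgroup.one_closed[OF K_subgroup] subgroup.m_closed[OF K_subgroup]
    unfolding lin_char_def by simp
  then show ?thesis
    by (auto simp: rep_stabilizer_def conj_rep_lin_rep rep_equiv_lin_rep[OF f_char] C_def)
qed

text \<open>On \<open>K\<close>, determinant 1 forces m1 - m4 = 2 (m1 - 1), so only 2 c1 is
  detected. This is how the stabilizer of the restriction can exceed that of
  \<open>psi_A\<close>.\<close>

lemma mat2_in_C:
  assumes d: "x * w - s * y = 1"
  shows "mat2 x s y w \<in> C \<longleftrightarrow> small (2 * c1 x s y w) \<and> small (c2 x s y w) \<and> small (c3 x s y w)"
proof
  assume "mat2 x s y w \<in> C"
  then have st: "f (mat2 x s y w ** m ** mat2 w (- s) (- y) x) = f m" if "m \<in> K" for m using that by (simp add: C_def inv_SL2[OF d])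
  have test: "\<psi> (c1 x s y w * (m1 - m4) + c2 x s y w * m2 + c3 x s y w * m3) = 1"
    if m: "mat2 m1 m2 m3 m4 \<in> K" for m1 m2 m3 m4
  proof -
    have "f (mat2 m1 m2 m3 m4) * \<psi> (c1 x s y w * (m1 - m4) + c2 x s y w * m2 + c3 x s y w * m3) = f (mat2 m1 m2 m3 m4)"
      using st[OF m] unfolding f_conj[OF d] .
    moreover have "f (mat2 m1 m2 m3 m4) \<noteq> 0" unfolding f_mat2 by (rule psi_nonzero)
    ultimately show ?thesis by simp
  qed
  have "\<psi> (2 * c1 x s y w * p ^ l * t) = 1" for t
  proof -
    have "(p ^ l * t) * (p ^ l * t) = 0" by (rule small_mult_zero) simp_all
    then have "mat2 (1 + p ^ l * t) 0 0 (1 - p ^ l * t) \<in> K" unfolding mat2_in_K by (simp add: algebra_simps)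
    from test[OF this] show ?thesis by (simp add: algebra_simps)
  qed
  then have "2 * c1 x s y w * p ^ l = 0" by (rule psi_primitive)
  moreover have "\<psi> (c2 x s y w * p ^ l * t) = 1" for t using test[of 1 "p ^ l * t" 0 1] unfolding mat2_in_K by (simp add: mult.assoc)
  then have "c2 x s y w * p ^ l = 0" by (rule psi_primitive)
  moreover have "\<psi> (c3 x s y w * p ^ l * t) = 1" for t using test[of 1 0 "p ^ l * t" 1] unfolding mat2_in_K by (simp add: mult.assoc)
  then have "c3 x s y w * p ^ l = 0" by (rule psi_primitive)
  ultimately show "small (2 * c1 x s y w) \<and> small (c2 x s y w) \<and> small (c3 x s y w)"
    using p_mult_zero_iff by (metis mult.commute)
next
  assume c: "small (2 * c1 x s y w) \<and> small (c2 x s y w) \<and> small (c3 x s y w)"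
  have "f (mat2 x s y w ** m ** mat2 w (- s) (- y) x) = f m" if m: "m \<in> K" for m
  proof -
    obtain m1 m2 m3 m4 where e: "m = mat2 m1 m2 m3 m4" by (metis mat2_collapse)
    have sm: "small (m1 - 1)" "small m2" "small m3" "small (m4 - 1)" "m1 * m4 - m2 * m3 = 1"
      using m unfolding e mat2_in_K by auto
    have "m1 - m4 = 2 * (m1 - 1) - (m1 * m4 - m2 * m3 - 1) + ((m1 - 1) * (m4 - 1) - m2 * m3)" by (simp add: algebra_simps)
    then have e14: "m1 - m4 = 2 * (m1 - 1)" using sm by (simp add: small_mult_zero)
    have "c1 x s y w * (m1 - m4) = (2 * c1 x s y w) * (m1 - 1)" unfolding e14 by (simp only: ac_simps)
    then have "c1 x s y w * (m1 - m4) = 0" using c sm(1) by (simp only: small_mult_zero)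
    then show ?thesis unfolding e f_conj[OF d] using c sm by (simp add: small_mult_zero psi0)
  qed
  then show "mat2 x s y w \<in> C" using d by (simp add: C_def inv_SL2[OF d])
qed

end

section \<open>The extension setting for \<open>SL\<^sub>2\<close>\<close>

lemma conj_transvection:
  "mat2 1 c 0 1 ** mat2 x s y w ** mat2 1 (- c) 0 1 =
    mat2 (x + c * y) (s + c * w - c * x - c * c * y) y (w - c * y)" for c :: "'a::comm_ring_1"
  by (simp add: algebra_simps)

lemma commutator_transvection:
  fixes c :: "'a::comm_ring_1"
  assumes d: "x * w - s * y = 1"
  shows "mat2 1 c 0 1 ** mat2 x s y w ** mat2 1 (- c) 0 1 ** mat2 w (- s) (- y) x =
    mat2 (1 + c * x * y + c * c * y * y) (c * (1 - x * x) - c * c * x * y) (c * y * y) (1 - c * x * y)"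
proof -
  have xw: "x * w = 1 + s * y" using d by (simp add: algebra_simps)
  have 1: "(x + c * y) * w + (s + c * w - c * x - c * c * y) * (- y) = 1 + c * x * y + c * c * y * y"
    using xw by (simp add: algebra_simps)
  have "(x + c * y) * - s + (s + c * w - c * x - c * c * y) * x = c * (x * w - s * y) - c * x * x - c * c * x * y"
    by (simp add: algebra_simps)
  then have 2: "(x + c * y) * - s + (s + c * w - c * x - c * c * y) * x = c * (1 - x * x) - c * c * x * y"
    unfolding d by (simp add: algebra_simps)
  have 3: "y * w + (w - c * y) * - y = c * y * y" by (simp add: algebra_simps)
  have "y * - s + (w - c * y) * x = (x * w - s * y) - c * x * y" by (simp add: algebra_simps)
  then have 4: "y * - s + (w - c * y) * x = 1 - c * x * y" unfolding d .
  show ?thesis unfolding conj_transvection unfolding mat2_mult 1 2 3 4 ..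
qed

context sl2_setting
begin

abbreviation "\<epsilon> t \<equiv> mat2 1 (b * t) 0 1"
abbreviation "h \<equiv> h_set p l \<beta>"

lemma h_iff: "t \<in> h \<longleftrightarrow> small (2 * t) \<and> small (t * (t + \<beta>))"
  by (simp add: h_set_def)

lemma small_dbl: "small (2 * t) \<Longrightarrow> small (2 * t * u)" by (rule dvd_mult2)

text \<open>The condition quadratic in t is additive up to the cross term 2 s t, which the other
  condition makes small.\<close>

lemma h_add: "s \<in> h \<Longrightarrow> t \<in> h \<Longrightarrow> s + t \<in> h"
proof -
  assume s: "s \<in> h" and t: "t \<in> h"
  have 1: "2 * (s + t) = 2 * s + 2 * t" by (simp add: algebra_simps)
  have 2: "(s + t) * (s + t + \<beta>) = s * (s + \<beta>) + t * (t + \<beta>) + 2 * s * t" by (simp add: algebra_simps)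
  show ?thesis using s t small_dbl[of s t] unfolding h_iff 1 2 by (blast intro: small_add)
qed

lemma h_minus: "t \<in> h \<Longrightarrow> - t \<in> h"
proof -
  assume t: "t \<in> h"
  have 2: "- t * (- t + \<beta>) = t * (t + \<beta>) - 2 * t * \<beta>" by (simp add: algebra_simps)
  show ?thesis using t small_dbl[of t \<beta>] unfolding h_iff 2 by (simp add: dvd_diff)
qed

lemma inv_e: "inv\<^bsub>SL2\<^esub> (\<epsilon> t) = mat2 1 (- (b * t)) 0 1"
  using inv_SL2[of 1 1 "b * t" 0] by simp

lemma CS_SL2: "g \<in> CS \<Longrightarrow> g \<in> carrier SL2" by (simp add: C_S_def)

lemma CS_cases:
  assumes "g \<in> CS"
  obtains x s y w where "g = mat2 x s y w" "x * w - s * y = 1" "small (k * y - a * s)" "small (a * w - a * x - \<beta> * y)"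
proof -
  obtain x s y w where g: "g = mat2 x s y w" by (metis mat2_collapse)
  show thesis by (rule that[OF g]) (use assms in \<open>simp_all add: g mat2_in_CS\<close>)
qed

lemma CS_subset_C: "CS \<subseteq> C"
proof
  fix g assume "g \<in> CS"
  then obtain x s y w where g: "g = mat2 x s y w" and d: "x * w - s * y = 1" and s: "small (k * y - a * s)" "small (a * w - a * x - \<beta> * y)"
    by (rule CS_cases)
  show "g \<in> C" unfolding g mat2_in_C[OF d] using CS_small_iff[OF d] s by (simp add: dvd_mult)
qed

text \<open>Commuting with At modulo p^l is visibly closed under products and inverses, unlike the
  product of two sets by which \<open>C_S\<close> is defined.\<close>

lemma CS_eq: "CS = {g \<in> carrier SL2. redm g ** redm At = redm At ** redm g}"
proof
  have rz: "red (k * y - a * s) = 0 \<longleftrightarrow> red k * red y = red a * red s" for y s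
    by (simp add: red.hom_minus red.hom_mult)
  have rz2: "red (a * w - a * x - \<beta> * y) = 0 \<longleftrightarrow> red a * red w = red a * red x + red \<beta> * red y" for w x y
    by (simp add: red.hom_minus red.hom_mult red.hom_add algebra_simps)
  show "{g \<in> carrier SL2. redm g ** redm At = redm At ** redm g} \<subseteq> CS"
  proof
    fix g assume g: "g \<in> {g \<in> carrier SL2. redm g ** redm At = redm At ** redm g}"
    obtain x s y w where e: "g = mat2 x s y w" and d: "x * w - s * y = 1" by (rule SL2_cases[of g]) (use g in auto)
    have "redm g ** redm At = redm At ** redm g" using g by blast
    then have "red s * red a = red k * red y" "red w * red a = red a * red x + red \<beta> * red y"
      unfolding e At_eq redm_mat2 mat2_mult mat2_eq_iff red.hom_zero mult_zero_left mult_zero_right add_0_left add_0_right by blast+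
    then have "red k * red y = red a * red s \<and> red a * red w = red a * red x + red \<beta> * red y"
      by (simp only: mult.commute)
    then show "g \<in> CS" unfolding e mat2_in_CS red_zero[symmetric] rz rz2 using d by simp
  qed
  show "CS \<subseteq> {g \<in> carrier SL2. redm g ** redm At = redm At ** redm g}"
  proof
    fix g assume g: "g \<in> CS"
    then obtain x s y w where e: "g = mat2 x s y w" and d: "x * w - s * y = 1" and s: "small (k * y - a * s)" "small (a * w - a * x - \<beta> * y)"
      by (rule CS_cases)
    have 1: "red k * red y = red a * red s" "red a * red w = red a * red x + red \<beta> * red y"
      using s unfolding red_zero[symmetric] rz rz2 by simp_all
    have ba: "red b * (red a * z) = z" for z
    proof -
      have "red b * red a = 1" using ab by (metis red.hom_mult red.hom_one mult.commute)
      then show ?thesis by (simp flip: mult.assoc)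
    qed
    have 2: "red s = red b * (red k * red y)" unfolding 1(1) ba ..
    have "red w = red b * (red a * red x + red \<beta> * red y)" unfolding 1(2)[symmetric] ba ..
    then have 3: "red w = red x + red b * (red \<beta> * red y)" unfolding distrib_left ba .
    have "red x * red k + red s * red \<beta> = red k * red w" unfolding 2 3 by (simp only: distrib_left ac_simps)
    moreover have "red s * red a = red k * red y" "red w * red a = red a * red x + red \<beta> * red y"
      unfolding 1 using 1(2) by (simp_all only: mult.commute)
    moreover have "red y * red k + red w * red \<beta> = red a * red s + red \<beta> * red w"
      unfolding 1(1)[symmetric] by (simp only: mult.commute)
    ultimately have "redm g ** redm At = redm At ** redm g"
      unfolding e At_eq redm_mat2 mat2_mult mat2_eq_iff red.hom_zero mult_zero_left mult_zero_right add_0_left add_0_right by blast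
    then show "g \<in> {g \<in> carrier SL2. redm g ** redm At = redm At ** redm g}" using CS_SL2[OF g] by blast
  qed
qed

lemma CS_subgroup: "subgroup CS SL2"
proof (rule group.subgroupI[OF group_G])
  interpret G: Group.group "SL2 :: ('r^2^2) monoid" by (rule group_G)
  show "CS \<subseteq> carrier SL2" using CS_SL2 by blast
  show "CS \<noteq> {}" using K_sub_CS subgroup.one_closed[OF K_subgroup] by blast
  fix g assume g: "g \<in> CS"
  then have gc: "g \<in> carrier SL2" and gA: "redm g ** redm At = redm At ** redm g" unfolding CS_eq by blast+
  let ?i = "inv\<^bsub>SL2\<^esub> g"
  have i: "g ** ?i = mat 1" "?i ** g = mat 1" using G.r_inv[OF gc] G.l_inv[OF gc] by simp_all
  have ri: "redm ?i ** redm g = mat 1" "redm g ** redm ?i = mat 1" unfolding redm_mult[symmetric] i redm_one by simp_all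
  have "redm ?i ** redm At = redm ?i ** (redm At ** redm g) ** redm ?i"
    using ri(2) by (simp flip: matrix_mul_assoc)
  also have "\<dots> = redm ?i ** redm g ** redm At ** redm ?i" unfolding gA[symmetric] by (simp add: matrix_mul_assoc)
  finally have "redm ?i ** redm At = redm At ** redm ?i" unfolding ri by simp
  then show "?i \<in> CS" unfolding CS_eq using G.inv_closed[OF gc] by blast
  fix g' assume "g' \<in> CS"
  then have gc': "g' \<in> carrier SL2" and gA': "redm g' ** redm At = redm At ** redm g'" unfolding CS_eq by blast+
  have "redm (g ** g') ** redm At = redm g ** (redm g' ** redm At)" unfolding redm_mult by (simp add: matrix_mul_assoc)
  also have "\<dots> = (redm g ** redm At) ** redm g'" unfolding gA' by (simp add: matrix_mul_assoc)
  also have "\<dots> = redm At ** redm (g ** g')" unfolding gA redm_mult by (simp add: matrix_mul_assoc)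
  finally show "g \<otimes>\<^bsub>SL2\<^esub> g' \<in> CS" unfolding CS_eq using G.m_closed[OF gc gc'] by simp
qed

lemma e_in_C: "t \<in> h \<Longrightarrow> \<epsilon> t \<in> C"
proof -
  assume t: "t \<in> h"
  have d: "1 * 1 - (b * t) * 0 = (1::'r)" by simp
  have 1: "c1 1 (b * t) 0 1 = - t" "c2 1 (b * t) 0 1 = 0" by (simp_all add: c1_def c2_def ab_cancel)
  have "a * (b * t)\<^sup>2 = a * (b * t) * (b * t)" by (simp add: power2_eq_square ac_simps)
  then have 3: "c3 1 (b * t) 0 1 = - (b * (t * (t + \<beta>)))" unfolding ab_cancel by (simp add: c3_def algebra_simps)
  show ?thesis unfolding mat2_in_C[OF d] 1 3 using t by (simp add: h_iff)
qed

text \<open>Conjugation by the transvection changes the two congruences by multiples of themselves,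
  of t (t + \<beta>) and of 2 t, and the last two are small for t in \<open>h\<close>.\<close>

lemma e_conj_CS:
  assumes t: "t \<in> h" and g: "g \<in> CS"
  shows "\<epsilon> t \<otimes>\<^bsub>SL2\<^esub> g \<otimes>\<^bsub>SL2\<^esub> inv\<^bsub>SL2\<^esub> (\<epsilon> t) \<in> CS"
proof -
  obtain x s y w where e: "g = mat2 x s y w" and d: "x * w - s * y = 1" and s: "small (k * y - a * s)" "small (a * w - a * x - \<beta> * y)"
    using g by (rule CS_cases)
  let ?c = "b * t"
  let ?R = "a * w - a * x - \<beta> * y"
  have ac: "a * (?c * z) = t * z" for z using ab_cancel(2)[of t] by (simp flip: mult.assoc)
  have P: "k * y - a * (s + ?c * w - ?c * x - ?c * ?c * y) = (k * y - a * s) - t * b * ?R + b * y * (t * (t + \<beta>)) - (2 * t) * (b * y * \<beta>)"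
  proof -
    have 1: "a * (s + ?c * w - ?c * x - ?c * ?c * y) = a * s + t * w - t * x - t * (b * t * y)"
      using ac[of w] ac[of x] ac[of "?c * y"] by (simp add: algebra_simps)
    have "b * (a * (t * w)) = t * w" "b * (a * (t * x)) = t * x" by (rule ab_cancel)+
    then have 2: "t * b * ?R = t * w - t * x - t * b * \<beta> * y" by (simp add: algebra_simps)
    show ?thesis unfolding 1 2 by (simp add: algebra_simps)
  qed
  have R: "a * (w - ?c * y) - a * (x + ?c * y) - \<beta> * y = ?R - 2 * t * y"
    using ac[of y] by (simp add: algebra_simps)
  have sP: "small (k * y - a * (s + ?c * w - ?c * x - ?c * ?c * y))"
    unfolding P using t unfolding h_iff
    by (intro dvd_diff[OF dvd_add[OF dvd_diff[OF s(1) dvd_mult[OF s(2)]] dvd_mult] dvd_mult2]) auto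
  have sR: "small (a * (w - ?c * y) - a * (x + ?c * y) - \<beta> * y)"
    unfolding R using s t small_dbl[of t y] by (simp add: h_iff dvd_diff)
  have "(x + ?c * y) * (w - ?c * y) - (s + ?c * w - ?c * x - ?c * ?c * y) * y = x * w - s * y" by (simp add: algebra_simps)
  then have "(x + ?c * y) * (w - ?c * y) - (s + ?c * w - ?c * x - ?c * ?c * y) * y = 1" using d by simp
  then show ?thesis unfolding e inv_e SL2_simps conj_transvection mat2_in_CS using sP sR by blast
qed

text \<open>For t = c1, conjugating At by g gives modulo p^l the companion matrix with t added to
  one diagonal entry and subtracted from the other. Comparing determinants yields t (t + \<beta>) =
  2 t^2 modulo p^l, so t lies in \<open>h\<close>, and the transvection by t, whose own c1 is -t,
  undoes the change.\<close>

lemma e_mult_C: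
  assumes g: "g \<in> C"
  shows "\<exists>t\<in>h. g \<otimes>\<^bsub>SL2\<^esub> \<epsilon> t \<in> CS"
proof -
  have "g \<in> carrier SL2" using g by (simp add: C_def)
  then obtain x s y w where e: "g = mat2 x s y w" and d: "x * w - s * y = 1" by (rule SL2_cases)
  have c: "small (2 * c1 x s y w)" "small (c2 x s y w)" "small (c3 x s y w)" using g unfolding e mat2_in_C[OF d] by auto
  define t where "t = c1 x s y w"
  have xw: "x * w = 1 + s * y" using d by (simp add: algebra_simps)
  have "det (mat2 w (- s) (- y) x ** At ** mat2 x s y w) = det At"
    using d unfolding det_mul det_mat2 by (simp add: algebra_simps)
  then have "t * (\<beta> - t) - (k + c3 x s y w) * (a + c2 x s y w) = - (k * a)"
    unfolding conj_At[OF d] by (simp add: t_def At_eq)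
  then have "t * (t + \<beta>) = 2 * t * t + (k + c3 x s y w) * (a + c2 x s y w) - k * a" by (simp add: algebra_simps)
  also have "\<dots> = 2 * t * t + k * c2 x s y w + c3 x s y w * (a + c2 x s y w)" by (simp add: algebra_simps)
  finally have q: "t * (t + \<beta>) = 2 * t * t + k * c2 x s y w + c3 x s y w * (a + c2 x s y w)" .
  have "small (2 * t * t)" using c(1) unfolding t_def by (rule dvd_mult2)
  then have th: "t \<in> h" unfolding h_iff q using c by (auto simp: t_def intro!: dvd_add)
  have act: "a * (b * t * z) = t * z" for z using ab_cancel(2)[of t] by (simp flip: mult.assoc)
  have P: "k * y - a * (x * (b * t) + s) = s * c2 x s y w"
  proof -
    have "k * y * (x * w) = k * y * (1 + s * y)" "a * s * x * (x * w) = a * s * x * (1 + s * y)" using xw by simp_all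
    then have "k * y - a * s = x * t + s * c2 x s y w" by (simp add: t_def c1_def c2_def algebra_simps power2_eq_square)
    then show ?thesis using act[of x] by (simp add: algebra_simps)
  qed
  have R: "a * (y * (b * t) + w) - a * x - \<beta> * y = - w * c2 x s y w"
  proof -
    have "a * x * (x * w) = a * x * (1 + s * y)" "\<beta> * y * (x * w) = \<beta> * y * (1 + s * y)" using xw by simp_all
    then have "a * w - a * x - \<beta> * y = - (y * t) - w * c2 x s y w" by (simp add: t_def c1_def c2_def algebra_simps power2_eq_square)
    then show ?thesis using act[of y] by (simp add: algebra_simps)
  qed
  have "g \<otimes>\<^bsub>SL2\<^esub> \<epsilon> t = mat2 x (x * (b * t) + s) y (y * (b * t) + w)" by (simp add: e)
  moreover have "x * (y * (b * t) + w) - (x * (b * t) + s) * y = 1" using d by (simp add: algebra_simps)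
  ultimately have "g \<otimes>\<^bsub>SL2\<^esub> \<epsilon> t \<in> CS" unfolding mat2_in_CS using P R c(2) by (simp only: mat2_in_CS) (simp add: dvd_mult)
  then show ?thesis using th by blast
qed

end

section \<open>Commutators and the values of the character on them\<close>

context sl2_setting
begin

text \<open>Let g = z + X and g' = z' + X' with z, z' polynomials in At and X, X' small. As X X' =
  0, the difference D = g g' - g' g is [z, X'] + [X, z']. The character sees the trace of At D (g'
  g)^-1, which vanishes by cyclicity, since modulo p^l the inverse of g' g is again a polynomial in
  At. The proof carries this out entry by entry.\<close>

lemma CS_commutator:
  assumes g: "g \<in> CS" and g': "g' \<in> CS"
  shows "g \<otimes>\<^bsub>SL2\<^esub> g' \<otimes>\<^bsub>SL2\<^esub> inv\<^bsub>SL2\<^esub> g \<otimes>\<^bsub>SL2\<^esub> inv\<^bsub>SL2\<^esub> g' \<in> K \<and>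
    f (g \<otimes>\<^bsub>SL2\<^esub> g' \<otimes>\<^bsub>SL2\<^esub> inv\<^bsub>SL2\<^esub> g \<otimes>\<^bsub>SL2\<^esub> inv\<^bsub>SL2\<^esub> g') = 1"
proof -
  interpret G: Group.group "SL2 :: ('r^2^2) monoid" by (rule group_G)
  obtain x s y w where e: "g = mat2 x s y w" and d: "x * w - s * y = 1" and sm: "small (k * y - a * s)" "small (a * w - a * x - \<beta> * y)"
    using g by (rule CS_cases)
  obtain x' s' y' w' where e': "g' = mat2 x' s' y' w'" and d': "x' * w' - s' * y' = 1"
    and sm': "small (k * y' - a * s')" "small (a * w' - a * x' - \<beta> * y')"
    using g' by (rule CS_cases)
  have cg: "g \<in> carrier SL2" "g' \<in> carrier SL2" using CS_SL2 g g' by blast+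
  let ?P = "k * y - a * s" and ?P' = "k * y' - a * s'" and ?R = "a * w - a * x - \<beta> * y" and ?R' = "a * w' - a * x' - \<beta> * y'"
  define q1 q2 q3 q4 where q: "q1 = x' * x + s' * y" "q2 = x' * s + s' * w" "q3 = y' * x + w' * y" "q4 = y' * s + w' * w"
  have Q: "g' ** g = mat2 q1 q2 q3 q4" by (simp add: e e' q)
  have "g' \<otimes>\<^bsub>SL2\<^esub> g \<in> CS" by (rule subgroup.m_closed[OF CS_subgroup g' g])
  then have Qs: "q1 * q4 - q2 * q3 = 1" "small (k * q3 - a * q2)" "small (a * q4 - a * q1 - \<beta> * q3)"
    using mat2_in_CS[of q1 q2 q3 q4] Q by simp_all
  \<comment> \<open>The entries of g g' - g' g are D1, D2, D3, -D1.\<close>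
  define D1 where "D1 = s * y' - s' * y"
  define D2 where "D2 = s * (w' - x') - s' * (w - x)"
  define D3 where "D3 = y' * (w - x) - y * (w' - x')"
  have PQ: "g ** g' = mat2 (q1 + D1) (q2 + D2) (q3 + D3) (q4 - D1)"
    by (simp add: e e' q D1_def D2_def D3_def algebra_simps)
  have D1: "D1 = b * (?P' * y - ?P * y')"
  proof -
    have "?P' * y - ?P * y' = a * D1" by (simp add: D1_def algebra_simps)
    then show ?thesis by (simp add: ab_cancel)
  qed
  have D3: "D3 = b * (y' * ?R - y * ?R')"
  proof -
    have "y' * ?R - y * ?R' = a * D3" by (simp add: D3_def algebra_simps)
    then show ?thesis by (simp add: ab_cancel)
  qed
  \<comment> \<open>This says that At D has trace zero; it holds exactly, not only modulo p^l, since
    products of two small entries vanish.\<close>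
  have D2: "a * D2 = \<beta> * D1 - k * D3"
  proof -
    have z: "?P * ?R' = 0" "?P' * ?R = 0" using small_mult_zero sm sm' by blast+
    have "a * (a * D2) = a * (\<beta> * D1 - k * D3) + (?P' * ?R - ?P * ?R')"
      by (simp add: D1_def D2_def D3_def algebra_simps)
    then have "b * (a * (a * D2)) = b * (a * (\<beta> * D1 - k * D3))" using z by simp
    then show ?thesis unfolding ab_cancel .
  qed
  have sD: "small D1" "small D3" unfolding D1 D3 using sm sm' by (blast intro: dvd_mult dvd_mult2 dvd_diff)+
  have "D2 = b * (\<beta> * D1 - k * D3)" unfolding D2[symmetric] ab_cancel ..
  then have sD2: "small D2" using sD by (blast intro: dvd_mult dvd_diff)
  have c: "g \<otimes>\<^bsub>SL2\<^esub> g' \<otimes>\<^bsub>SL2\<^esub> inv\<^bsub>SL2\<^esub> g \<otimes>\<^bsub>SL2\<^esub> inv\<^bsub>SL2\<^esub> g' = (g \<otimes>\<^bsub>SL2\<^esub> g') \<otimes>\<^bsub>SL2\<^esub> inv\<^bsub>SL2\<^esub> (g' \<otimes>\<^bsub>SL2\<^esub> g)"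
    unfolding G.inv_mult_group[OF cg(2,1)] using cg G.inv_closed G.m_closed by (simp only: G.m_assoc)
  have c2: "(g \<otimes>\<^bsub>SL2\<^esub> g') \<otimes>\<^bsub>SL2\<^esub> inv\<^bsub>SL2\<^esub> (g' \<otimes>\<^bsub>SL2\<^esub> g) =
    mat2 (1 + (D1 * q4 - D2 * q3)) (D2 * q1 - D1 * q2) (D3 * q4 + D1 * q3) (1 + (- D1 * q1 - D3 * q2))"
  proof -
    have 1: "(q1 + D1) * q4 + (q2 + D2) * - q3 = (q1 * q4 - q2 * q3) + (D1 * q4 - D2 * q3)"
      "(q1 + D1) * - q2 + (q2 + D2) * q1 = D2 * q1 - D1 * q2"
      "(q3 + D3) * q4 + (q4 - D1) * - q3 = D3 * q4 + D1 * q3"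
      "(q3 + D3) * - q2 + (q4 - D1) * q1 = (q1 * q4 - q2 * q3) + (- D1 * q1 - D3 * q2)"
      by (simp_all add: algebra_simps)
    show ?thesis unfolding SL2_simps PQ Q inv_SL2[OF Qs(1)] mat2_mult 1 Qs(1) ..
  qed
  have cl: "(g \<otimes>\<^bsub>SL2\<^esub> g') \<otimes>\<^bsub>SL2\<^esub> inv\<^bsub>SL2\<^esub> (g' \<otimes>\<^bsub>SL2\<^esub> g) \<in> carrier SL2"
    by (intro G.m_closed G.inv_closed cg)
  have inK: "mat2 (1 + (D1 * q4 - D2 * q3)) (D2 * q1 - D1 * q2) (D3 * q4 + D1 * q3) (1 + (- D1 * q1 - D3 * q2)) \<in> K"
    unfolding mat2_in_K
  proof (intro conjI)
    show "(1 + (D1 * q4 - D2 * q3)) * (1 + (- D1 * q1 - D3 * q2)) - (D2 * q1 - D1 * q2) * (D3 * q4 + D1 * q3) = 1"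
      using cl unfolding c2 by simp
    show "small (1 + (D1 * q4 - D2 * q3) - 1)" using sD sD2 by (simp add: dvd_diff dvd_mult2)
    show "small (D2 * q1 - D1 * q2)" using sD sD2 by (simp add: dvd_diff dvd_mult2)
    show "small (D3 * q4 + D1 * q3)" using sD by (simp add: dvd_add dvd_mult2)
    have "small (- D1 * q1 - D3 * q2)" using sD by (intro dvd_diff dvd_mult2) simp_all
    then show "small (1 + (- D1 * q1 - D3 * q2) - 1)" by simp
  qed
  have "small (k * (q4 - q1) - \<beta> * q2)"
  proof -
    have "a * (k * (q4 - q1) - \<beta> * q2) = k * (a * q4 - a * q1 - \<beta> * q3) + \<beta> * (k * q3 - a * q2)" by (simp add: algebra_simps)
    then have "b * (a * (k * (q4 - q1) - \<beta> * q2)) = b * (k * (a * q4 - a * q1 - \<beta> * q3) + \<beta> * (k * q3 - a * q2))" by simp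
    then show ?thesis unfolding ab_cancel using Qs(2,3) by (simp only:) (intro dvd_mult dvd_add)
  qed
  then have z: "D3 * (k * (q4 - q1) - \<beta> * q2) = 0" "D1 * (k * q3 - a * q2) = 0" using small_mult_zero sD Qs(2) by blast+
  \<comment> \<open>The argument of \<open>\<psi>\<close> is the trace of At D times q1, up to two
    products of small elements.\<close>
  have "k * (D3 * q4 + D1 * q3) + a * (D2 * q1 - D1 * q2) + \<beta> * (1 + (- D1 * q1 - D3 * q2) - 1)
    = D3 * (k * (q4 - q1) - \<beta> * q2) + D1 * (k * q3 - a * q2) + (a * D2 - (\<beta> * D1 - k * D3)) * q1" by (simp add: algebra_simps)
  then have "k * (D3 * q4 + D1 * q3) + a * (D2 * q1 - D1 * q2) + \<beta> * (1 + (- D1 * q1 - D3 * q2) - 1) = 0"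
    unfolding z D2 by simp
  then have "f (mat2 (1 + (D1 * q4 - D2 * q3)) (D2 * q1 - D1 * q2) (D3 * q4 + D1 * q3) (1 + (- D1 * q1 - D3 * q2))) = 1"
    unfolding f_mat2 by (simp only: psi0)
  then show ?thesis unfolding c c2 using inK by blast
qed

text \<open>Modulo p^l, 1 - x^2 is a multiple of y for elements of S. So once t y is small, every
  entry of the commutator agrees with the identity matrix modulo p^l.\<close>

lemma e_commutator:
  assumes g: "mat2 x s y w \<in> CS" and ty: "small (t * y)"
  defines "g' \<equiv> \<epsilon> t \<otimes>\<^bsub>SL2\<^esub> mat2 x s y w \<otimes>\<^bsub>SL2\<^esub> inv\<^bsub>SL2\<^esub> (\<epsilon> t) \<otimes>\<^bsub>SL2\<^esub> inv\<^bsub>SL2\<^esub> (mat2 x s y w)"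
  shows "g' \<in> K" and "f g' = \<psi> (comm_val t x (b * y))"
proof -
  interpret G: Group.group "SL2 :: ('r^2^2) monoid" by (rule group_G)
  have d: "x * w - s * y = 1" and R: "small (a * w - a * x - \<beta> * y)" using g unfolding mat2_in_CS by blast+
  let ?c = "b * t"
  have e: "g' = mat2 (1 + ?c * x * y + ?c * ?c * y * y) (?c * (1 - x * x) - ?c * ?c * x * y) (?c * y * y) (1 - ?c * x * y)"
    unfolding g'_def inv_SL2[OF d] inv_e SL2_simps by (rule commutator_transvection[OF d])
  have gc: "mat2 x s y w \<in> carrier SL2" "\<epsilon> t \<in> carrier SL2" using d by simp_all
  have "g' \<in> carrier SL2" unfolding g'_def by (intro G.m_closed G.inv_closed gc)
  then have dt: "(1 + ?c * x * y + ?c * ?c * y * y) * (1 - ?c * x * y) - (?c * (1 - x * x) - ?c * ?c * x * y) * (?c * y * y) = 1"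
    unfolding e by simp
  have s1: "small (?c * z * y)" for z
  proof -
    have "?c * z * y = (b * z) * (t * y)" by (simp only: ac_simps)
    then show ?thesis using ty by (simp only: dvd_mult)
  qed
  have s2: "small (?c * (1 - x * x))"
  proof -
    let ?R = "a * w - a * x - \<beta> * y"
    have "w - x = b * (a * (w - x))" by (simp only: ab_cancel)
    also have "a * (w - x) = ?R + \<beta> * y" by (simp add: algebra_simps)
    finally have wx: "w - x = b * (?R + \<beta> * y)" .
    have "1 - x * x = x * (w - x) - s * y" using d by (simp add: algebra_simps)
    then have "?c * (1 - x * x) = ?c * (x * (b * (?R + \<beta> * y)) - s * y)" unfolding wx by simp
    also have "\<dots> = (?c * x * b) * ?R + ((b * x * b * \<beta>) * (t * y) - (b * s) * (t * y))" by (simp add: algebra_simps)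
    finally show ?thesis by (simp only: dvd_add[OF dvd_mult[OF R] dvd_diff[OF dvd_mult[OF ty] dvd_mult[OF ty]]])
  qed
  show "g' \<in> K" unfolding e mat2_in_K
  proof (intro conjI dt)
    have "1 + ?c * x * y + ?c * ?c * y * y - 1 = ?c * x * y + ?c * (?c * y) * y" by (simp add: algebra_simps)
    then show "small (1 + ?c * x * y + ?c * ?c * y * y - 1)" using s1[of x] s1[of "?c * y"] by (simp only: dvd_add)
    have "?c * (1 - x * x) - ?c * ?c * x * y = ?c * (1 - x * x) - ?c * (?c * x) * y" by (simp only: ac_simps)
    then show "small (?c * (1 - x * x) - ?c * ?c * x * y)" using s2 s1[of "?c * x"] by (simp only: dvd_diff)
    show "small (?c * y * y)" by (rule s1)
    show "small (1 - ?c * x * y - 1)" using s1[of x] by simp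
  qed
  have ac: "a * (?c * z) = t * z" for z using ab_cancel(2)[of t] by (simp flip: mult.assoc)
  have 1: "a * (?c * (1 - x * x) - ?c * ?c * x * y) = t * (1 - x * x) - t * (b * t * x * y)"
    using ac[of "1 - x * x"] ac[of "?c * x * y"] by (simp only: right_diff_distrib mult.assoc)
  have "k * (?c * y * y) = t * (\<alpha> * (b * y)\<^sup>2)" by (simp only: k_def power2_eq_square ac_simps)
  then have "k * (?c * y * y) + a * (?c * (1 - x * x) - ?c * ?c * x * y) + \<beta> * ((1 - ?c * x * y) - 1) = comm_val t x (b * y)"
    unfolding 1 comm_val_def by (simp add: algebra_simps power2_eq_square)
  then show "f g' = \<psi> (comm_val t x (b * y))" unfolding e f_mat2 by simp
qed

text \<open>Modulo p^l the first column determines the second, and determinant 1 becomes the norm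
  equation.\<close>

lemma CS_sol:
  assumes g: "mat2 x s y w \<in> CS"
  shows "sol x (b * y)"
proof -
  have d: "x * w = 1 + s * y" and s: "small (k * y - a * s)" "small (a * w - a * x - \<beta> * y)"
    using g unfolding mat2_in_CS by (auto simp: algebra_simps)
  have 1: "b * a * z = z" for z using ab by (simp add: mult.commute)
  have "x * b * (a * w - a * x - \<beta> * y) = b * a * (x * w) - b * a * (x * x) - \<beta> * x * (b * y)"
    by (simp only: right_diff_distrib ac_simps)
  then have 2: "x * b * (a * w - a * x - \<beta> * y) = 1 + s * y - x * x - \<beta> * x * (b * y)" unfolding 1 d .
  have "b * y * (k * y - a * s) = \<alpha> * (b * y)\<^sup>2 - b * a * (s * y)"
    by (simp only: k_def right_diff_distrib power2_eq_square ac_simps)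
  then have 3: "b * y * (k * y - a * s) = \<alpha> * (b * y)\<^sup>2 - s * y" unfolding 1 .
  have "x\<^sup>2 + \<beta> * x * (b * y) - \<alpha> * (b * y)\<^sup>2 - 1 = - (x * b * (a * w - a * x - \<beta> * y)) - b * y * (k * y - a * s)"
    unfolding 2 3 by (simp add: power2_eq_square algebra_simps)
  then show ?thesis unfolding sol_def by (simp only: dvd_diff[OF iffD2[OF dvd_minus_iff dvd_mult[OF s(2)]] dvd_mult[OF s(1)]])
qed

lemma extension_setting: "extension_setting SL2 K CS f \<epsilon> h {t. small t}"
proof (intro extension_setting.intro extension_setting_axioms.intro)
  show "\<And>x j. x \<in> CS \<Longrightarrow> j \<in> K \<Longrightarrow> f (x \<otimes>\<^bsub>SL2\<^esub> j \<otimes>\<^bsub>SL2\<^esub> inv\<^bsub>SL2\<^esub> x) = f j"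
    using CS_subset_C unfolding C_def by blast
  show "\<And>t j. t \<in> h \<Longrightarrow> j \<in> K \<Longrightarrow> f (\<epsilon> t \<otimes>\<^bsub>SL2\<^esub> j \<otimes>\<^bsub>SL2\<^esub> inv\<^bsub>SL2\<^esub> \<epsilon> t) = f j"
    using e_in_C unfolding C_def by blast
  show "\<And>t. \<epsilon> t \<in> carrier SL2" by simp
  show "\<And>s t. \<epsilon> (s + t) = \<epsilon> s \<otimes>\<^bsub>SL2\<^esub> \<epsilon> t" by (simp add: distrib_left add.commute)
  show "{t. small t} \<subseteq> h" by (auto simp: h_iff dvd_mult2)
  show "\<And>t. t \<in> h \<Longrightarrow> t + t \<in> {t. small t}" by (simp only: h_iff mem_Collect_eq mult_2[symmetric])
  show "\<And>t. t \<in> {t. small t} \<Longrightarrow> \<epsilon> t \<in> K" by (simp add: mat2_in_K dvd_mult)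
  show "\<And>g. g \<in> carrier SL2 \<Longrightarrow> \<forall>j\<in>K. f (g \<otimes>\<^bsub>SL2\<^esub> j \<otimes>\<^bsub>SL2\<^esub> inv\<^bsub>SL2\<^esub> g) = f j \<Longrightarrow> \<exists>t\<in>h. g \<otimes>\<^bsub>SL2\<^esub> \<epsilon> t \<in> CS"
    using e_mult_C unfolding C_def by blast
  show "\<And>s t. s \<in> {t. small t} \<Longrightarrow> t \<in> {t. small t} \<Longrightarrow> s + t \<in> {t. small t}" by simp
qed (fact group_G fin_G K_subgroup CS_subgroup K_sub_CS K_norm f_char h_add h_minus e_conj_CS CS_commutator | simp)+

sublocale ES: extension_setting SL2 K CS f \<epsilon> h "{t. small t}" by (rule extension_setting)

text \<open>A unit x allows any solution (x, Y) to be completed, by solving for w, to an element of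
  S with first column (x, a Y). Its commutator with the transvection lies in \<open>K\<close>, where
  \<open>inE_commutator\<close> evaluates it.\<close>

lemma inE_good: "ES.inE t \<Longrightarrow> good t"
  unfolding good_def
proof (intro allI impI, elim conjE)
  fix x Y assume t: "ES.inE t" and u: "x dvd 1" and s: "sol x Y" and Yt: "small (Y * t)"
  obtain x' where x': "x * x' = 1" using u by (metis dvdE)
  let ?w = "x' * (1 + \<alpha> * Y * Y)"
  have xx: "x * x' * z = z" for z using x' by simp
  have d: "x * ?w - k * Y * (a * Y) = 1"
  proof -
    have "x * ?w - k * Y * (a * Y) = x * x' * (1 + \<alpha> * Y * Y) - (a * k) * (Y * Y)" by (simp only: ac_simps)
    then show ?thesis unfolding xx ak by (simp add: mult.assoc)
  qed
  have P: "k * (a * Y) - a * (k * Y) = 0" by (simp add: mult.left_commute)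
  have R: "a * ?w - a * x - \<beta> * (a * Y) = - (a * x' * (x\<^sup>2 + \<beta> * x * Y - \<alpha> * Y\<^sup>2 - 1))"
  proof -
    have "a * x' * (x\<^sup>2 + \<beta> * x * Y - \<alpha> * Y\<^sup>2 - 1) = x * x' * (a * x) + x * x' * (\<beta> * (a * Y)) - a * (x' * (\<alpha> * Y * Y)) - a * x'"
      by (simp only: power2_eq_square right_diff_distrib distrib_left mult_1_right mult_1_left ac_simps)
    then show ?thesis unfolding xx by (simp add: algebra_simps)
  qed
  have sR: "small (a * ?w - a * x - \<beta> * (a * Y))" unfolding R using s unfolding sol_def by (simp add: dvd_mult)
  have g: "mat2 x (k * Y) (a * Y) ?w \<in> CS" unfolding mat2_in_CS P using d sR by simp
  have "t * (a * Y) = a * (Y * t)" by (simp only: ac_simps)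
  then have ty: "small (t * (a * Y))" using Yt by (simp only: dvd_mult)
  show "\<psi> (comm_val t x Y) = 1"
    using ES.inE_commutator[OF t g e_commutator(1)[OF g ty]] unfolding e_commutator(2)[OF g ty] ab_cancel .
qed

text \<open>If no single class exhausts the admissible parameters, each admissible t has an
  admissible u outside the classes of 0 and t. Then the contrapositive of
  \<open>good_dichotomy\<close> makes y t small for every element of S, and all commutators with the
  transvection lie in \<open>K\<close>.\<close>

sublocale DS: dichotomy_setting SL2 K CS f \<epsilon> h "{t. small t}"
proof (unfold_locales, rule disjCI)
  assume "\<not> (\<exists>t. ES.inE t \<and> (\<forall>u. ES.inE u \<longrightarrow> u \<in> {t. small t} \<or> u - t \<in> {t. small t}))"
  then have no: "\<exists>u. ES.inE u \<and> \<not> small u \<and> \<not> small (u - t)" if "ES.inE t" for t using that by blast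
  show "\<forall>t. ES.inE t \<longrightarrow> (\<forall>x\<in>CS. \<epsilon> t \<otimes>\<^bsub>SL2\<^esub> x \<otimes>\<^bsub>SL2\<^esub> inv\<^bsub>SL2\<^esub> \<epsilon> t \<otimes>\<^bsub>SL2\<^esub> inv\<^bsub>SL2\<^esub> x \<in> K)"
  proof (intro allI impI ballI)
    fix t g assume t: "ES.inE t" and g: "g \<in> CS"
    obtain x s y w where e: "g = mat2 x s y w" by (metis mat2_collapse)
    obtain u where u: "ES.inE u" "\<not> small u" "\<not> small (u - t)" using no[OF t] by blast
    have "small (b * y * t)"
      using good_dichotomy[OF inE_good[OF t] inE_good[OF u(1)] CS_sol] g u unfolding e by blast
    then have "small (a * (b * (t * y)))" by (simp add: ac_simps)
    then have "small (t * y)" unfolding ab_cancel .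
    then show "\<epsilon> t \<otimes>\<^bsub>SL2\<^esub> g \<otimes>\<^bsub>SL2\<^esub> inv\<^bsub>SL2\<^esub> \<epsilon> t \<otimes>\<^bsub>SL2\<^esub> inv\<^bsub>SL2\<^esub> g \<in> K"
      using e_commutator(1) g unfolding e by blast
  qed
qed

lemma M_A_eq: "M_A p l red \<psi> a \<alpha> \<beta> = ES.MA"
proof -
  have "E_set p l red \<psi> a \<alpha> \<beta> = \<epsilon> ` {t. ES.inE t}"
    unfolding E_set_def H_grp_def e_mat_eq[abs_def] by (auto simp: ES.inE_iff)
  then show ?thesis unfolding M_A_def stabilizer_M ES.MA_def set_mult_def by auto
qed

end

section \<open>Quotients of a compact discrete valuation ring\<close>

text \<open>Expansion in powers of \<pi> with digits from a finite set of representatives of the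
  residue ring.\<close>

lemma finite_residue_digits:
  fixes \<pi> :: "'o::comm_ring_1"
  assumes "finite_residue_ring \<pi>"
  shows "\<exists>D. finite D \<and> (\<forall>x. \<exists>d\<in>D. \<pi> ^ m dvd x - d)"
proof (induction m)
  case 0
  show ?case by (rule exI[of _ "{0}"]) simp
next
  case (Suc m)
  then obtain D where D: "finite D" "\<And>x. \<exists>d\<in>D. \<pi> ^ m dvd x - d" by blast
  let ?Q = "(UNIV :: 'o set) // {(x, y). \<pi> dvd x - y}"
  define E where "E = (\<lambda>c. SOME x. x \<in> c) ` ?Q"
  have E: "\<exists>d\<in>E. \<pi> dvd x - d" for x
  proof -
    let ?c = "{(x, y). \<pi> dvd x - y} `` {x}"
    have "x \<in> ?c" by simp
    then have "(SOME z. z \<in> ?c) \<in> ?c" by (rule someI)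
    moreover have "(SOME z. z \<in> ?c) \<in> E" unfolding E_def by (rule imageI) (rule quotientI, rule UNIV_I)
    ultimately show ?thesis by blast
  qed
  have "finite E" using assms by (simp add: E_def finite_residue_ring_def)
  then have "finite ((\<lambda>(d, d'). d + \<pi> ^ m * d') ` (D \<times> E))" using D(1) by blast
  moreover have "\<exists>d\<in>(\<lambda>(d, d'). d + \<pi> ^ m * d') ` (D \<times> E). \<pi> ^ Suc m dvd x - d" for x
  proof -
    obtain d where d: "d \<in> D" "\<pi> ^ m dvd x - d" using D(2) by blast
    then obtain z where z: "x - d = \<pi> ^ m * z" by (blast elim: dvdE)
    obtain d' where d': "d' \<in> E" "\<pi> dvd z - d'" using E by blast
    then obtain z' where z': "z - d' = \<pi> * z'" by (blast elim: dvdE)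
    have "x - (d + \<pi> ^ m * d') = \<pi> ^ m * (z - d')" using z by (simp add: algebra_simps)
    then have "x - (d + \<pi> ^ m * d') = \<pi> ^ Suc m * z'" unfolding z' by (simp add: ac_simps)
    then have "\<pi> ^ Suc m dvd x - (d + \<pi> ^ m * d')" by (rule dvdI)
    then show ?thesis using d(1) d'(1) by (intro bexI[of _ "d + \<pi> ^ m * d'"]) auto
  qed
  ultimately show ?case by blast
qed

lemma quotient_map_mod_simps:
  assumes "quotient_map_mod \<pi> m q"
  shows "q 0 = 0" "q 1 = 1" "q (x + y) = q x + q y" "q (x * y) = q x * q y" "q (x ^ n) = q x ^ n" "q (x - y) = q x - q y"
    "q x = 0 \<longleftrightarrow> \<pi> ^ m dvd x" "\<exists>x. q x = z"
proof -
  interpret comm_ring_hom q using assms by (simp add: quotient_map_mod_def)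
  show "q 0 = 0" "q 1 = 1" "q (x + y) = q x + q y" "q (x * y) = q x * q y" "q (x ^ n) = q x ^ n" "q (x - y) = q x - q y"
    by (simp_all add: hom_add hom_mult hom_power hom_minus)
  show "q x = 0 \<longleftrightarrow> \<pi> ^ m dvd x" "\<exists>x. q x = z" using assms unfolding quotient_map_mod_def surj_def by metis+
qed

lemma finite_quotient:
  fixes q :: "'o::comm_ring_1 \<Rightarrow> 'r::comm_ring_1"
  assumes "finite_residue_ring \<pi>" and q: "quotient_map_mod \<pi> m q"
  shows "finite (UNIV :: 'r set)"
proof -
  obtain D where D: "finite D" "\<And>x. \<exists>d\<in>D. \<pi> ^ m dvd x - d" using finite_residue_digits[OF assms(1)] by blast
  have "UNIV \<subseteq> q ` D"
  proof
    fix z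
    obtain x where x: "q x = z" using quotient_map_mod_simps(8)[OF q] by blast
    obtain d where d: "d \<in> D" "\<pi> ^ m dvd x - d" using D(2) by blast
    then have "q (x - d) = 0" using quotient_map_mod_simps(7)[OF q] by blast
    then have "q x = q d" using quotient_map_mod_simps(6)[OF q] by simp
    then show "z \<in> q ` D" using x d(1) by blast
  qed
  then show ?thesis using D(1) by (rule finite_subset[OF _ finite_imageI])
qed

lemma uniformizer_quotient:
  assumes \<pi>: "dvr_uniformizer \<pi>" and q: "quotient_map_mod \<pi> m q"
  shows "\<exists>n u. n \<le> m \<and> u dvd 1 \<and> z = u * q \<pi> ^ n"
proof -
  note s = quotient_map_mod_simps[OF q]
  have pm: "q \<pi> ^ m = 0" unfolding s(5)[symmetric] s(7) by simp
  have zero: ?thesis if "z = 0" using that pm by (intro exI[of _ m] exI[of _ 1]) simp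
  obtain x where x: "q x = z" using s(8) by blast
  show ?thesis
  proof (cases "x = 0")
    case True
    then show ?thesis using zero x s(1) by simp
  next
    case False
    then obtain n u where u: "u dvd 1" "x = u * \<pi> ^ n" using \<pi> unfolding dvr_uniformizer_def by blast
    obtain v where "1 = u * v" using u(1) by (rule dvdE)
    then have "1 = q u * q v" using s(2,4) by metis
    then have qu: "q u dvd 1" by (rule dvdI)
    have z: "z = q u * q \<pi> ^ n" unfolding x[symmetric] u(2) s(4,5) ..
    show ?thesis
    proof (cases "n \<le> m")
      case True
      then show ?thesis using qu z by blast
    next
      case False
      then have "q \<pi> ^ n = q \<pi> ^ m * q \<pi> ^ (n - m)" by (simp flip: power_add)
      then show ?thesis using zero z pm by simp
    qed
  qed
qed

text \<open>Distinct powers of \<pi> generate distinct ideals, which makes the definite description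
  unique.\<close>

lemma ramification_index_eqI:
  assumes \<pi>: "dvr_uniformizer \<pi>" and u: "u dvd 1" "2 = u * \<pi> ^ e"
  shows "ramification_index \<pi> = e"
proof -
  have 0: "\<pi> \<noteq> 0" and nu: "\<not> \<pi> dvd 1" using \<pi> by (auto simp: dvr_uniformizer_def)
  obtain v where v: "1 = u * v" using u(1) by (rule dvdE)
  have le: "i \<le> j" if "\<pi> ^ i dvd \<pi> ^ j" for i j
  proof (rule ccontr)
    assume "\<not> i \<le> j"
    then have "i = j + Suc (i - j - 1)" by simp
    then have "\<pi> ^ i = \<pi> ^ j * (\<pi> * \<pi> ^ (i - j - 1))" by (metis power_add power_Suc)
    then have "\<pi> ^ j * (\<pi> * \<pi> ^ (i - j - 1)) dvd \<pi> ^ j * 1" using that by simp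
    then have "\<pi> * \<pi> ^ (i - j - 1) dvd 1" using 0 by (simp only: dvd_mult_cancel_left) simp
    then show False using nu dvd_mult_left by blast
  qed
  have r: "range ((*) 2) = range ((*) (\<pi> ^ e))"
  proof
    show "range ((*) 2) \<subseteq> range ((*) (\<pi> ^ e))" unfolding u(2) by (auto simp: mult.assoc mult.commute mult.left_commute)
    show "range ((*) (\<pi> ^ e)) \<subseteq> range ((*) 2)"
    proof
      fix x assume "x \<in> range ((*) (\<pi> ^ e))"
      then obtain y where "x = \<pi> ^ e * y" by blast
      then have "x = u * v * (\<pi> ^ e * y)" using v by simp
      then have "x = 2 * (v * y)" unfolding u(2) by (simp only: ac_simps)
      then show "x \<in> range ((*) 2)" by blast
    qed
  qed
  show ?thesis unfolding ramification_index_def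
  proof (rule the_equality[where P = "\<lambda>e. range ((*) 2) = range ((*) (\<pi> ^ e))", OF r])
    fix e' assume "range ((*) 2) = range ((*) (\<pi> ^ e'))"
    then have eq: "range ((*) (\<pi> ^ e)) = range ((*) (\<pi> ^ e'))" using r by simp
    have "\<pi> ^ e \<in> range ((*) (\<pi> ^ e))" "\<pi> ^ e' \<in> range ((*) (\<pi> ^ e'))" by (rule range_eqI[of _ _ 1], simp)+
    then have "\<pi> ^ e \<in> range ((*) (\<pi> ^ e'))" "\<pi> ^ e' \<in> range ((*) (\<pi> ^ e))" unfolding eq by simp_all
    then have "\<pi> ^ e' dvd \<pi> ^ e" "\<pi> ^ e dvd \<pi> ^ e'" by (auto elim!: rangeE intro: dvdI)
    then show "e' = e" using le by (metis le_antisym)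
  qed
qed

text \<open>An odd characteristic would make 2 a unit. An even one 2 m leaves only 2 = 0 in a
  domain, as the smaller number m is nonzero there.\<close>

lemma two_eq_0_or_CHAR_0:
  fixes \<pi> :: "'o::idom"
  assumes "\<pi> dvd 2" "\<not> \<pi> dvd 1"
  shows "(2::'o) = 0 \<or> CHAR('o) = 0"
proof (rule disjCI)
  assume c: "CHAR('o) \<noteq> 0"
  show "(2::'o) = 0"
  proof (cases "even CHAR('o)")
    case True
    then obtain m where m: "CHAR('o) = 2 * m" by blast
    have "(2::'o) * of_nat m = of_nat CHAR('o)" unfolding m by simp
    also have "\<dots> = 0" by simp
    finally have "(2::'o) = 0 \<or> (of_nat m :: 'o) = 0" by simp
    moreover have "(of_nat m :: 'o) \<noteq> 0" using c m unfolding of_nat_eq_0_iff_char_dvd by (auto dest: dvd_imp_le)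
    ultimately show ?thesis by blast
  next
    case False
    then obtain m where m: "CHAR('o) = 2 * m + 1" by (blast elim: oddE)
    have "(2::'o) * of_nat m + 1 = of_nat CHAR('o)" unfolding m by simp
    also have "\<dots> = 0" by simp
    finally have "2 * of_nat m + (1::'o) = 0" .
    then have "(1::'o) = 2 * (- of_nat m)" by (simp add: eq_neg_iff_add_eq_0 add.commute)
    then have "(2::'o) dvd 1" by (rule dvdI)
    then show ?thesis using assms dvd_trans by blast
  qed
qed

theorem theorem2p4:
  fixes \<pi> :: "'o::idom"
    and proj_r :: "'o \<Rightarrow> 'r::comm_ring_1"
    and proj_l :: "'o \<Rightarrow> 'l::comm_ring_1"
    and red :: "'r \<Rightarrow> 'l"
    and \<psi> :: "'r \<Rightarrow> complex"
    and A :: "'l^2^2" and a \<alpha> \<beta> :: 'l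
    and a' \<alpha>' \<beta>' :: 'r
    and l r :: nat
  assumes "dvr_uniformizer \<pi>" and "compact_space (adic_topology \<pi>)"
    and "finite_residue_ring \<pi>" and "\<pi> dvd 2"
    and "l \<ge> 1" and "2 * l \<ge> R_o \<pi>" and "r = 2 * l"
    and "quotient_map_mod \<pi> r proj_r" and "quotient_map_mod \<pi> l proj_l"
    and "\<And>x. red (proj_r x) = proj_l x"
    and "additive_character UNIV \<psi>" and "\<psi> (proj_r \<pi> ^ (r - 1)) \<noteq> 1"
    and "CHAR('o) = 2 \<Longrightarrow> top_digit_character r (proj_r \<pi>) \<psi>"
    and "A = comp_mat a \<alpha> \<beta>" and "a dvd 1" and "cyclic_matrix A"
    and "red a' = a" and "red \<alpha>' = \<alpha>" and "red \<beta>' = \<beta>"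
  shows "let K = K_grp red;
             MA = M_A (proj_r \<pi>) l red \<psi> a' \<alpha>' \<beta>';
             G = SL2\<lparr>carrier := MA\<rparr>;
             \<phi> = lin_rep (psi_A \<psi> (comp_mat a' \<alpha>' \<beta>'));
             C = rep_stabilizer SL2 (carrier SL2) K \<phi>
         in subgroup MA SL2 \<and>
            extends_one_dim SL2 K MA \<phi> \<and>
            K \<lhd> G \<and>
            (comm_group (G Mod K) \<or> abelian_semidirect_order_two (G Mod K)) \<and>
            (\<forall>c \<in> Irr_over G K \<phi>. \<forall>\<rho> \<in> c. rep_degree G \<rho> = 1 \<or> rep_degree G \<rho> = 2) \<and>
            (\<forall>g \<in> C. (\<lambda>x. g \<otimes>\<^bsub>SL2\<^esub> x \<otimes>\<^bsub>SL2\<^esub> inv\<^bsub>SL2\<^esub> g) ` MA = MA) \<and>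
            bij_betw (Ind_orbit SL2 MA)
              (conj_orbits SL2 C (Irr_over G K \<phi>))
              (Irr_over SL2 K \<phi>)"
proof -
  note \<pi> = assms(1) and q = assms(8) and ql = assms(9)
  note s = quotient_map_mod_simps[OF q] and sl = quotient_map_mod_simps[OF ql]
  let ?p = "proj_r \<pi>"
  have nu: "\<not> \<pi> dvd 1" using \<pi> by (simp add: dvr_uniformizer_def)
  interpret T: truncated_dvr ?p l \<psi>
  proof
    show "finite (UNIV :: 'r set)" by (rule finite_quotient[OF assms(3) q])
    show "1 \<le> l" by (rule assms(5))
    show "\<exists>n u. n \<le> 2 * l \<and> u dvd 1 \<and> x = u * ?p ^ n" for x
      using uniformizer_quotient[OF \<pi> q] by (simp add: assms(7))
    show "?p ^ (2 * l) = 0" unfolding s(5)[symmetric] s(7) assms(7) by simp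
    show "\<psi> 0 = 1" "\<psi> (x + y) = \<psi> x * \<psi> y" for x y using assms(11) by (auto simp: additive_character_def)
    show "\<psi> (?p ^ (2 * l - 1)) \<noteq> 1" using assms(12) by (simp add: assms(7))
  qed
  have hom: "red 0 = 0" "red 1 = 1" using assms(10)[of 0] assms(10)[of 1] by (simp_all add: s(1,2) sl(1,2))
  have hom2: "red (x + y) = red x + red y" "red (x * y) = red x * red y" for x y
  proof -
    obtain X Y where X: "x = proj_r X" "y = proj_r Y" using s(8) by metis
    show "red (x + y) = red x + red y" "red (x * y) = red x * red y"
      unfolding X s(3)[symmetric] s(4)[symmetric] assms(10) sl(3,4) by (rule refl)+
  qed
  have rh: "comm_ring_hom red" by unfold_locales (rule hom hom2)+
  have rz: "red x = 0 \<longleftrightarrow> ?p ^ l dvd x" for x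
  proof -
    obtain X where X: "x = proj_r X" using s(8) by metis
    have "red x = 0 \<longleftrightarrow> \<pi> ^ l dvd X" unfolding X assms(10) sl(7) ..
    also have "\<dots> \<longleftrightarrow> ?p ^ l dvd x"
    proof
      assume "\<pi> ^ l dvd X"
      then obtain Y where "X = \<pi> ^ l * Y" by (rule dvdE)
      then have "x = ?p ^ l * proj_r Y" unfolding X by (simp only: s(4,5))
      then show "?p ^ l dvd x" by (rule dvdI)
    next
      assume "?p ^ l dvd x"
      then obtain y where y: "x = ?p ^ l * y" by (rule dvdE)
      obtain Y where Y: "y = proj_r Y" using s(8) by metis
      \<comment> \<open>The lift X is known only modulo \<pi>^r; this is harmless as l <= r.\<close>
      have "proj_r (X - \<pi> ^ l * Y) = 0" unfolding s(6) s(4) s(5) using X y Y by simp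
      then have "\<pi> ^ r dvd X - \<pi> ^ l * Y" unfolding s(7) .
      moreover have "\<pi> ^ l dvd \<pi> ^ r" unfolding assms(7) by (rule le_imp_power_dvd) simp
      ultimately have "\<pi> ^ l dvd (X - \<pi> ^ l * Y) + \<pi> ^ l * Y" using dvd_trans by (blast intro: dvd_add dvd_triv_left)
      then show "\<pi> ^ l dvd X" by simp
    qed
    finally show ?thesis .
  qed
  have au: "a' dvd 1"
  proof -
    obtain c where c: "1 = a * c" using assms(15) by (rule dvdE)
    obtain c' where c': "c = red c'"
    proof -
      obtain X where "proj_l X = c" using sl(8) by blast
      then show thesis using that[of "proj_r X"] assms(10) by simp
    qed
    \<comment> \<open>An inverse after reduction is enough, because an element congruent to 1 modulo
      p^l is a unit.\<close>
    have "red (a' * c') = 1" unfolding hom2 c'[symmetric] assms(17) c[symmetric] ..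
    then have "red (a' * c' - 1) = 0" using hom2(1)[of "a' * c' - 1" 1] hom(2) by simp
    then have "?p ^ l dvd a' * c' - 1" unfolding rz .
    moreover have "?p dvd ?p ^ l" using assms(5) by (intro dvd_power) simp
    ultimately have "1 + (a' * c' - 1) dvd 1" using T.unit_plus dvd_trans by blast
    then show ?thesis by (auto intro: dvd_mult_left)
  qed
  have two: "(2::'r) = 0 \<or> (\<exists>e u. u dvd 1 \<and> 2 = u * ?p ^ e \<and> 1 \<le> e \<and> 2 * e \<le> l)"
  proof (cases "(2::'o) = 0")
    case True
    have "(2::'r) = proj_r (1 + 1)" unfolding s(3) s(2) by simp
    then show ?thesis using True s(1) by simp
  next
    case False
    then have ch: "CHAR('o) = 0" using two_eq_0_or_CHAR_0[OF assms(4) nu] by blast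
    obtain e u where u: "u dvd 1" "2 = u * \<pi> ^ e" using \<pi> False unfolding dvr_uniformizer_def by blast
    \<comment> \<open>\<pi> divides 2, so 2 is not a unit; halving 4 e <= 2 l then gives the bound
      that \<open>truncated_quadratic\<close> asks for.\<close>
    have "e \<noteq> 0" using u assms(4) nu dvd_trans by (metis mult_1_right power_0)
    moreover have "4 * e \<le> 2 * l" using assms(6) by (simp add: R_o_def ch ramification_index_eqI[OF \<pi> u])
    moreover have "proj_r u dvd 1"
    proof -
      obtain v where "1 = u * v" using u(1) by (rule dvdE)
      then have "1 = proj_r u * proj_r v" using s(2,4) by metis
      then show ?thesis by (rule dvdI)
    qed
    moreover have "(2::'r) = proj_r u * ?p ^ e"
    proof -
      have "(2::'r) = proj_r (1 + 1)" unfolding s(3) s(2) by simp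
      also have "\<dots> = proj_r u * ?p ^ e" using arg_cong[OF u(2), of proj_r] by (simp add: s(4,5))
      finally show ?thesis .
    qed
    ultimately have "\<exists>e u. u dvd 1 \<and> 2 = u * ?p ^ e \<and> 1 \<le> e \<and> 2 * e \<le> l" by (intro exI[of _ e] exI[of _ "proj_r u"]) auto
    then show ?thesis ..
  qed
  interpret S: sl2_setting ?p l \<psi> \<alpha>' \<beta>' red a'
    by (intro sl2_setting.intro truncated_quadratic.intro truncated_quadratic_axioms.intro sl2_setting_axioms.intro T.truncated_dvr_axioms)
      (fact two rh rz au)+
  show ?thesis unfolding Let_def S.M_A_eq S.stabilizer_K
    using S.DS.MA_subgroup S.DS.MA_extends S.DS.K_normal_MA S.DS.MA_quotient S.DS.MA_degree S.DS.MA_bij[OF S.C_def] by blast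
qed

end
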